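(* There is a randomized algorithm which, given parameters $\epsilon>0$, a junta arity $k$, a smoothness parameter $s$, and oracle access to $f:\mathbb{R}^n\to[-1,1]$, outputs an estimate $\hat\rho$ which with probability at least $2/3$ satisfies $|\hat\rho-\rho_{\mathbb{R}^n,k,s}(f)|\le\epsilon$, where $\rho_{\mathbb{R}^n,k,s}(f)=\sup_{\phi}\mathbf{E}_{x\sim\gamma_n}[\phi(x)f(x)]$, the supremum being over all $s$-smooth linear $k$-juntas $\phi:\mathbb{R}^n\to[-1,1]$. The query complexity of the algorithm is $k^{\mathrm{poly}(s/\epsilon)}$.
   Context: $\gamma_n$ is the standard Gaussian measure on $\mathbb{R}^n$. For $t\ge0$ and $f\in L^2(\gamma_n)$, $P_tf(x)=\mathbf{E}_{y\sim\gamma_n}[f(e^{-t}x+\sqrt{1-e^{-2t}}\,y)]$. A function $f:\mathbb{R}^n\to[-1,1]$ is $s$-smooth if $\mathbf{E}_{x\sim\gamma_n}[|f(x)-P_tf(x)|]\le s\sqrt t$ for all $t>0$. A function $\phi:\mathbb{R}^n\to[-1,1]$ is an $s$-smooth linear $k$-junta if it is $s$-smooth and there is a $k$-dimensional subspace $E'\subseteq\mathbb{R}^n$ such that $\phi(x)=\phi(z)$ whenever $\Pi_{E'}x=\Pi_{E'}z$ ($\Pi_{E'}$ the orthogonal projection onto $E'$).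
   Formalization: The query bound is max(2,k)^{p(max(1,s)/ε)} for one fixed polynomial p, because k^{poly(s/ε)} fails for k ≤ 1 and for s = ε → 0; k ≤ n, s ≥ 0 and f measurable are assumed, and the algorithm is taken in the query model (unlimited computation). *)

theory Defs
  imports "HOL-Probability.Probability" "HOL-Computational_Algebra.Polynomial"
begin

text \<open>
  The complexity bound must not depend on the dimension \<open>n\<close>, so \<open>n\<close> has to be quantified inside the
  statement. Hence \<open>\<real>\<^sup>n\<close> is the carrier set of extensional functions on \<open>{..<n}\<close>, which is also the
  space of the product measure \<open>gaussian n\<close>.
\<close>

type_synonym rvec = "nat \<Rightarrow> real"

definition Rn :: "nat \<Rightarrow> rvec set" where
  "Rn n = {..<n} \<rightarrow>\<^sub>E UNIV"

definition std_gaussian :: "real measure" where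
  "std_gaussian = density lborel (\<lambda>x. ennreal (std_normal_density x))"

definition gaussian :: "nat \<Rightarrow> rvec measure" where
  "gaussian n = (\<Pi>\<^sub>M i\<in>{..<n}. std_gaussian)"

definition noise :: "nat \<Rightarrow> real \<Rightarrow> (rvec \<Rightarrow> real) \<Rightarrow> rvec \<Rightarrow> real" where
  "noise n t f x =
     (\<integral>y. f (\<lambda>i\<in>{..<n}. exp (- t) * x i + sqrt (1 - exp (- 2 * t)) * y i) \<partial>gaussian n)"

definition bounded_fun :: "nat \<Rightarrow> (rvec \<Rightarrow> real) \<Rightarrow> bool" where
  "bounded_fun n f \<longleftrightarrow> f \<in> borel_measurable (gaussian n) \<and> f ` Rn n \<subseteq> {-1..1}"

definition smooth_fun :: "nat \<Rightarrow> real \<Rightarrow> (rvec \<Rightarrow> real) \<Rightarrow> bool" where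
  "smooth_fun n s f \<longleftrightarrow> bounded_fun n f \<and>
     (\<forall>t>0. (\<integral>x. \<bar>f x - noise n t f x\<bar> \<partial>gaussian n) \<le> s * sqrt t)"

definition lin_comb :: "nat \<Rightarrow> nat \<Rightarrow> (nat \<Rightarrow> rvec) \<Rightarrow> (nat \<Rightarrow> real) \<Rightarrow> rvec" where
  "lin_comb n k b c = (\<lambda>i\<in>{..<n}. \<Sum>j<k. c j * b j i)"

text \<open>\<open>E\<close> is the span of \<open>k\<close> linearly independent vectors of \<open>\<real>\<^sup>n\<close>.\<close>

definition subspace_of_dim :: "nat \<Rightarrow> nat \<Rightarrow> rvec set \<Rightarrow> bool" where
  "subspace_of_dim n k E \<longleftrightarrow> (\<exists>b. (\<forall>j<k. b j \<in> Rn n) \<and>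
     (\<forall>c. lin_comb n k b c = (\<lambda>i\<in>{..<n}. 0) \<longrightarrow> (\<forall>j<k. c j = 0)) \<and>
     E = range (lin_comb n k b))"

definition orth_proj :: "nat \<Rightarrow> rvec set \<Rightarrow> rvec \<Rightarrow> rvec" where
  "orth_proj n E x = (THE p. p \<in> E \<and> (\<forall>e\<in>E. (\<Sum>i<n. (x i - p i) * e i) = 0))"

definition smooth_linear_junta :: "nat \<Rightarrow> nat \<Rightarrow> real \<Rightarrow> (rvec \<Rightarrow> real) \<Rightarrow> bool" where
  "smooth_linear_junta n k s \<phi> \<longleftrightarrow> smooth_fun n s \<phi> \<and>
     (\<exists>E. subspace_of_dim n k E \<and>
       (\<forall>x\<in>Rn n. \<forall>z\<in>Rn n. orth_proj n E x = orth_proj n E z \<longrightarrow> \<phi> x = \<phi> z))"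

definition junta_corr :: "nat \<Rightarrow> nat \<Rightarrow> real \<Rightarrow> (rvec \<Rightarrow> real) \<Rightarrow> real" where
  "junta_corr n k s f =
     (SUP \<phi>\<in>Collect (smooth_linear_junta n k s). \<integral>x. \<phi> x * f x \<partial>gaussian n)"

text \<open>
  Randomized adaptive query algorithms. The internal randomness is an infinite sequence of independent
  standard Gaussians. The \<open>j\<close>-th query point is a function of the random sequence and the answers to
  queries \<open>0, \<dots>, j - 1\<close>; the output is a function of the random sequence and all answers. On every run
  exactly \<open>num_queries\<close> queries are made; an algorithm that may stop earlier is covered by padding with
  dummy queries, so \<open>num_queries\<close> is the worst-case query complexity.
\<close>

definition random_source :: "(nat \<Rightarrow> real) measure" where
  "random_source = (\<Pi>\<^sub>M i\<in>UNIV. std_gaussian)"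

record query_alg =
  num_queries :: nat
  next_query :: "nat \<Rightarrow> (nat \<Rightarrow> real) \<times> (nat \<Rightarrow> real) \<Rightarrow> rvec"
  estimate :: "(nat \<Rightarrow> real) \<times> (nat \<Rightarrow> real) \<Rightarrow> real"

definition randomized_query_alg :: "nat \<Rightarrow> query_alg \<Rightarrow> bool" where
  "randomized_query_alg n A \<longleftrightarrow>
     (\<forall>j<num_queries A. next_query A j \<in>
        random_source \<Otimes>\<^sub>M (\<Pi>\<^sub>M i\<in>{..<j}. borel) \<rightarrow>\<^sub>M (\<Pi>\<^sub>M i\<in>{..<n}. borel)) \<and>
     estimate A \<in> random_source \<Otimes>\<^sub>M (\<Pi>\<^sub>M i\<in>{..<num_queries A}. borel) \<rightarrow>\<^sub>M borel"

primrec answers :: "query_alg \<Rightarrow> (rvec \<Rightarrow> real) \<Rightarrow> (nat \<Rightarrow> real) \<Rightarrow> nat \<Rightarrow> (nat \<Rightarrow> real)" where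
  "answers A f \<omega> 0 = (\<lambda>_. undefined)"
| "answers A f \<omega> (Suc j) =
     (answers A f \<omega> j)(j := f (next_query A j (\<omega>, answers A f \<omega> j)))"

definition run_alg :: "query_alg \<Rightarrow> (rvec \<Rightarrow> real) \<Rightarrow> (nat \<Rightarrow> real) \<Rightarrow> real" where
  "run_alg A f \<omega> = estimate A (\<omega>, answers A f \<omega> (num_queries A))"

text \<open>
  The bound \<open>k\<close> to the power \<open>poly (s / \<epsilon>)\<close> is read with base \<open>max 2 k\<close>, since powers of \<open>0\<close> and \<open>1\<close> do not
  grow, and with \<open>max 1 s\<close> for \<open>s\<close> in the exponent: constants are smooth for every \<open>s \<ge> 0\<close>, so of the
  order of \<open>1 / \<epsilon>\<^sup>2\<close> queries are needed even when \<open>s / \<epsilon>\<close> stays bounded. For \<open>k \<ge> 2\<close> and \<open>s \<ge> 1\<close> nothing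
  changes. The supremum \<open>junta_corr n k s f\<close> ranges over a nonempty set iff \<open>k \<le> n\<close> and \<open>s \<ge> 0\<close>.
\<close>

end

theory Submission
 imports Defs
begin

text \<open>
  Let \<open>q\<close> be \<open>s\<close>-smooth on \<open>\<real>\<^sup>k\<close>, \<open>B\<close> a \<open>k \<times> n\<close> contraction and \<open>w\<close> Gaussian noise completing the covariance of \<open>B x\<close> to
  the identity. The correlation of \<open>q (B x + w)\<close> with \<open>f\<close> is an average of correlations with smooth linear juntas, so
  it is at most the supremum; conversely smoothness allows an optimal orthonormal frame to be damped by \<open>exp (- t)\<close> at
  cost \<open>s * sqrt t\<close>. The damped correlation changes little when the frame moves almost orthogonally to the gradients
  \<open>gz z\<close> of the smoothed \<open>f\<close> at random points \<open>z\<close>; Landweber iteration moves the frame into the span of \<open>N\<close> sampled gradients, with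
  \<open>N\<close> independent of \<open>n\<close>.

  The functionals \<open>x \<mapsto> \<langle>gz z, x\<rangle>\<close> are read off from differences of values of \<open>f\<close>: for bounded \<open>H\<close> the noise operator with
  small parameter \<open>r\<close> maps \<open>H\<close> to its affine part up to \<open>2 * r\<^sup>2\<close> in \<open>L\<^sup>2\<close>, in every dimension, because the power series
  \<open>r \<mapsto> E (H * NO r H)\<close> has nonnegative coefficients. The same positivity shows that a polynomial in the noise operator
  is almost the identity on smooth functions; sampling its kernel gives a finite net of the smooth functions on \<open>\<real>\<^sup>k\<close>.

  The algorithm maximises the empirical correlation over all \<open>q\<close> in the net and all coefficient matrices in a grid for which
  the empirical covariance of the estimated functionals is admissible. Hoeffding's inequality and a union bound control
  the estimates, and Lipschitz continuity of the Gaussian smoothing of \<open>q\<close> absorbs the errors.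
\<close>

text \<open>Since \<open>f\<close> is only measurable, gradients exist only after Gaussian
  smoothing, and estimating all their coordinates would cost queries growing with \<open>n\<close>.
  What a candidate needs is just the scalar \<open>dot {..<n} (gz n c f z) x\<close> at sampled
  \<open>x\<close>. Noise of small correlation \<open>ka\<close> multiplies Hermite level
  \<open>j\<close> by \<open>ka^j\<close>, so after removing the mean and dividing by
  \<open>ka\<close> only the linear level is left to leading order. Hermite expansions are never
  formed: all that is used of them are linear inequalities between values of \<open>FF\<close>,
  which reduce to inequalities between monomials. The inner products of the gradients are unknown as
  well, but the joint law of finitely many Gaussian linear forms depends only on their Gram matrix,
  so an estimated Gram matrix suffices to decide which candidates are admissible. The net has about
  \<open>2^M\<close> members, where \<open>M\<close> itself is \<open>k\<close> to a polynomial
  power. The union bound charges only its logarithm. A kernel correlation of order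
  \<open>1 / sqrt k\<close> keeps the \<open>k\<close>-th power of \<open>1/(1 - ka^2)\<close>
  bounded, while \<open>1 / ka\<close> stays a power of \<open>k\<close>.\<close>

notation pair_measure (infixr "><" 80)

section \<open>Rotation invariance of Gaussian product measures\<close>

lemma sets_std_gaussian [measurable_cong, simp]: "sets std_gaussian = sets borel"
 by (simp add: std_gaussian_def)

lemma space_std_gaussian [simp]: "space std_gaussian = UNIV"
 by (simp add: std_gaussian_def)

lemma prob_space_std_gaussian: "prob_space std_gaussian"
 unfolding std_gaussian_def by (rule prob_space_normal_density) simp

lemma emeasure_std_gaussian_UNIV: "emeasure std_gaussian UNIV = 1"
 using prob_space.emeasure_space_1[OF prob_space_std_gaussian] by simp

lemma measurable_std_gaussian [simp]: "measurable M std_gaussian = borel_measurable M"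
 by (rule measurable_cong_sets) auto

lemma measurable_std_gaussian_dom [simp]: "measurable std_gaussian M = measurable borel M"
 by (rule measurable_cong_sets) auto

text \<open>The index type is arbitrary because blocks of coordinates are later glued together over
  disjoint sums of index sets.\<close>

abbreviation GI :: "'a set => ('a => real) measure" where
 "GI I == PiM I (%_. std_gaussian)"

interpretation SG: product_prob_space "%_::'a. std_gaussian" UNIV
 by (intro product_prob_spaceI prob_space_std_gaussian)

interpretation SG1: prob_space std_gaussian
 by (rule prob_space_std_gaussian)

interpretation GI: prob_space "GI (I :: 'a set)" for I
 by (intro prob_space_PiM prob_space_std_gaussian)

interpretation gaussian: prob_space "gaussian n" for n
 unfolding gaussian_def by (rule GI.prob_space_axioms)

lemma space_GI: "space (GI I) = (I \<rightarrow>\<^sub>E UNIV)"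
 by (simp add: space_PiM)

lemma measurable_GI_component [measurable (raw)]:
 "i \<in> I ==> (%x. x i) \<in> borel_measurable (GI I)"
 using measurable_component_singleton[of i I "%_. std_gaussian"] by simp

lemma measurable_GI_restrict:
 assumes "!!i. i \<in> I ==> f i \<in> borel_measurable M"
 shows "(%x. \<lambda>i\<in>I. f i x) \<in> measurable M (GI I)"
 using assms by (intro measurable_restrict) simp

lemma nn_integral_std_gaussian:
 assumes "f \<in> borel_measurable borel"
 shows "(\<integral>\<^sup>+x. f x \<partial>std_gaussian) = (\<integral>\<^sup>+x. ennreal (std_normal_density x)*f x \<partial>lborel)"
 unfolding std_gaussian_def using assms by (subst nn_integral_density) auto

lemma std_gaussian_Fubini:
 assumes "case_prod f \<in> borel_measurable (borel >< borel)"
 shows "(\<integral>\<^sup>+y. \<integral>\<^sup>+x. f x y \<partial>std_gaussian \<partial>std_gaussian) = (\<integral>\<^sup>+x. \<integral>\<^sup>+y. f x y \<partial>std_gaussian \<partial>std_gaussian)"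
proof (rule pair_sigma_finite.Fubini')
 show "pair_sigma_finite std_gaussian std_gaussian"
  by (intro pair_sigma_finite.intro prob_space_imp_sigma_finite prob_space_std_gaussian)
 show "case_prod f \<in> borel_measurable (std_gaussian >< std_gaussian)"
  using assms by (simp cong: measurable_cong_sets)
qed

lemma std_normal_density_rotate:
 assumes "c^2 + s^2 = (1::real)"
 shows "std_normal_density (c*x + s*y) * std_normal_density (- s*x+c*y)
    = std_normal_density x * std_normal_density y"
proof -
 have "(c*x + s*y)^2+(- s*x+c*y)^2 = (c^2 + s^2)*(x^2+y^2)"
  by (simp add: power2_eq_square algebra_simps)
 then have e: "- (c*x + s*y)\<^sup>2/2 + - (- s*x+c*y)\<^sup>2/2 = - x\<^sup>2/2 + - y\<^sup>2/2"
  using assms by (simp add: field_simps)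
 have "exp (- (c*x + s*y)\<^sup>2/2)*exp (- (- s*x+c*y)\<^sup>2/2) = exp (- x\<^sup>2/2)*exp (- y\<^sup>2/2)"
  unfolding exp_add[symmetric] using e by simp
 then show ?thesis
  unfolding std_normal_density_def by (simp add: field_simps)
qed

text \<open>Two one-dimensional affine substitutions, first \<open>u = c*x + s*y\<close> at fixed
  \<open>x\<close> and then \<open>v = (c*u - x) / s\<close> at fixed \<open>u\<close>, replace a
  planar change of variables. They divide by \<open>s\<close>; for \<open>s = 0\<close> the rotation
  is a reflection through the origin or the identity.\<close>

lemma lborel_rotate:
 fixes H :: "real \<times> real => ennreal"
 assumes [measurable]: "H \<in> borel_measurable (borel >< borel)" and cs: "c^2 + s^2 = 1"
 shows "(\<integral>\<^sup>+x. \<integral>\<^sup>+y. H (c*x + s*y, - s*x+c*y) \<partial>lborel \<partial>lborel) = (\<integral>\<^sup>+x. \<integral>\<^sup>+y. H (x, y) \<partial>lborel \<partial>lborel)"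
proof (cases "s = 0")
 case True
 then have c: "c ~= 0" "\<bar>c\<bar> = 1" using cs by (auto simp: power2_eq_1_iff)
 have 1: "(\<integral>\<^sup>+y. K (c*y) \<partial>lborel) = (\<integral>\<^sup>+y. K y \<partial>lborel)" if [measurable]: "K \<in> borel_measurable borel" for K :: "real => ennreal"
  by (subst (2) nn_integral_real_affine[where c = c and t = 0]) (use c in auto)
 have "(\<integral>\<^sup>+x. \<integral>\<^sup>+y. H (c*x, c*y) \<partial>lborel \<partial>lborel) = (\<integral>\<^sup>+x. \<integral>\<^sup>+y. H (c*x, y) \<partial>lborel \<partial>lborel)"
  by (intro nn_integral_cong 1) simp
 also have "... = (\<integral>\<^sup>+x. \<integral>\<^sup>+y. H (x, y) \<partial>lborel \<partial>lborel)"
  by (rule 1[of "%x. \<integral>\<^sup>+y. H (x, y) \<partial>lborel"]) simp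
 finally show ?thesis using True by simp
next
 case False
 have a: "(\<integral>\<^sup>+y. H (c*x + s*y, - s*x+c*y) \<partial>lborel)
   = ennreal \<bar>1/s\<bar> * (\<integral>\<^sup>+u. H (u, (c*u - x) / s) \<partial>lborel)" for x
 proof -
  have "- s*x+c*(- c*x / s+1 / s*u) = (c*u - x) / s" for u
  proof -
   have "c*c = 1 - s * s" using cs by (simp add: power2_eq_square)
   then have "c*(c*x) = x - s*(s*x)" by (metis left_diff_distrib mult.assoc mult_1)
   then show ?thesis using False by (simp add: field_simps)
  qed
  then show ?thesis
   using False by (subst nn_integral_real_affine[where c = "1/s" and t = "- c*x / s"])
    (auto simp: algebra_simps)
 qed
 have b: "(\<integral>\<^sup>+x. H (u, (c*u - x) / s) \<partial>lborel) = ennreal \<bar>s\<bar> * (\<integral>\<^sup>+v. H (u, v) \<partial>lborel)" for u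
  using False by (subst nn_integral_real_affine[where c = "-s" and t = "c*u"]) auto
 have "(\<integral>\<^sup>+x. \<integral>\<^sup>+y. H (c*x + s*y, - s*x+c*y) \<partial>lborel \<partial>lborel)
   = ennreal \<bar>1/s\<bar> * (\<integral>\<^sup>+x. \<integral>\<^sup>+u. H (u, (c*u - x) / s) \<partial>lborel \<partial>lborel)"
  unfolding a by (rule nn_integral_cmult) measurable
 also have "(\<integral>\<^sup>+x. \<integral>\<^sup>+u. H (u, (c*u - x) / s) \<partial>lborel \<partial>lborel) = (\<integral>\<^sup>+u. \<integral>\<^sup>+x. H (u, (c*u - x) / s) \<partial>lborel \<partial>lborel)"
  by (rule lborel_pair.Fubini'[of "%u x. H (u, (c*u - x) / s)"]) measurable
 also have "... = ennreal \<bar>s\<bar> * (\<integral>\<^sup>+u. \<integral>\<^sup>+v. H (u, v) \<partial>lborel \<partial>lborel)"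
  unfolding b by (rule nn_integral_cmult) measurable
 also have "ennreal \<bar>1/s\<bar> * (ennreal \<bar>s\<bar> * (\<integral>\<^sup>+u. \<integral>\<^sup>+v. H (u, v) \<partial>lborel \<partial>lborel)) = (\<integral>\<^sup>+u. \<integral>\<^sup>+v. H (u, v) \<partial>lborel \<partial>lborel)"
  using False by (simp add: mult.assoc[symmetric] ennreal_mult[symmetric])
 finally show ?thesis .
qed

lemma std_gaussian_rotate:
 fixes G :: "real \<times> real => ennreal"
 assumes [measurable]: "G \<in> borel_measurable (borel >< borel)" and cs: "c^2 + s^2 = 1"
 shows "(\<integral>\<^sup>+x. \<integral>\<^sup>+y. G (c*x + s*y, - s*x+c*y) \<partial>std_gaussian \<partial>std_gaussian)
    = (\<integral>\<^sup>+x. \<integral>\<^sup>+y. G (x, y) \<partial>std_gaussian \<partial>std_gaussian)"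
proof -
 define ph where "ph = std_normal_density"
 have m[measurable]: "ph \<in> borel_measurable borel" unfolding ph_def by simp
 define H where "H = (%p. ennreal (ph (fst p)*ph (snd p))*G p)"
 have [measurable]: "H \<in> borel_measurable (borel >< borel)" unfolding H_def by measurable
 have nn: "ph x >= 0" for x unfolding ph_def by simp
 have *: "(\<integral>\<^sup>+x. \<integral>\<^sup>+y. K (x, y) \<partial>std_gaussian \<partial>std_gaussian) = (\<integral>\<^sup>+x. \<integral>\<^sup>+y. ennreal (ph x*ph y)*K (x, y) \<partial>lborel \<partial>lborel)"
  if [measurable]: "K \<in> borel_measurable (borel >< borel)" for K
 proof -
  have "(\<integral>\<^sup>+y. K (x, y) \<partial>std_gaussian) = (\<integral>\<^sup>+y. ennreal (ph y)*K (x, y) \<partial>lborel)" for x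
   unfolding ph_def by (rule nn_integral_std_gaussian) measurable
  then have "(\<integral>\<^sup>+x. \<integral>\<^sup>+y. K (x, y) \<partial>std_gaussian \<partial>std_gaussian) = (\<integral>\<^sup>+x. \<integral>\<^sup>+y. ennreal (ph y)*K (x, y) \<partial>lborel \<partial>std_gaussian)"
   by simp
  also have "... = (\<integral>\<^sup>+x. ennreal (ph x)*(\<integral>\<^sup>+y. ennreal (ph y)*K (x, y) \<partial>lborel) \<partial>lborel)"
   unfolding ph_def by (rule nn_integral_std_gaussian) measurable
  also have "... = (\<integral>\<^sup>+x. \<integral>\<^sup>+y. ennreal (ph x*ph y)*K (x, y) \<partial>lborel \<partial>lborel)"
  proof -
   have "ennreal (ph x)*(\<integral>\<^sup>+y. ennreal (ph y)*K (x, y) \<partial>lborel) = (\<integral>\<^sup>+y. ennreal (ph x)*(ennreal (ph y)*K (x, y)) \<partial>lborel)" for x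
    by (rule nn_integral_cmult[symmetric]) measurable
   then show ?thesis by (simp add: ennreal_mult nn mult.assoc)
  qed
  finally show ?thesis .
 qed
 have r: "H (c*x + s*y, - s*x+c*y) = ennreal (ph x*ph y)*G (c*x + s*y, - s*x+c*y)" for x y
  unfolding H_def ph_def fst_conv snd_conv std_normal_density_rotate[OF cs] ..
 have "(\<integral>\<^sup>+x. \<integral>\<^sup>+y. G (c*x + s*y, - s*x+c*y) \<partial>std_gaussian \<partial>std_gaussian)
   = (\<integral>\<^sup>+x. \<integral>\<^sup>+y. H (c*x + s*y, - s*x+c*y) \<partial>lborel \<partial>lborel)"
 proof -
  have "(%p. G (c*fst p + s * snd p, - s*fst p+c * snd p)) \<in> borel_measurable (borel >< borel)"
   by measurable
  from *[OF this] show ?thesis unfolding r by (simp only: fst_conv snd_conv)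
 qed
 also have "... = (\<integral>\<^sup>+x. \<integral>\<^sup>+y. H (x, y) \<partial>lborel \<partial>lborel)"
  by (rule lborel_rotate[OF _ cs]) measurable
 also have "... = (\<integral>\<^sup>+x. \<integral>\<^sup>+y. G (x, y) \<partial>std_gaussian \<partial>std_gaussian)"
  unfolding H_def fst_conv snd_conv by (rule *[OF assms(1), symmetric])
 finally show ?thesis .
qed

lemma std_gaussian_rotate_swapped:
 fixes G :: "real \<times> real => ennreal"
 assumes m[measurable]: "G \<in> borel_measurable (borel >< borel)" and cs: "c^2 + s^2 = 1"
 shows "(\<integral>\<^sup>+y. \<integral>\<^sup>+x. G (c*x + s*y, - s*x+c*y) \<partial>std_gaussian \<partial>std_gaussian)
    = (\<integral>\<^sup>+y. \<integral>\<^sup>+x. G (x, y) \<partial>std_gaussian \<partial>std_gaussian)"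
proof -
 have "(\<integral>\<^sup>+y. \<integral>\<^sup>+x. G (c*x + s*y, - s*x+c*y) \<partial>std_gaussian \<partial>std_gaussian)
   = (\<integral>\<^sup>+x. \<integral>\<^sup>+y. G (c*x + s*y, - s*x+c*y) \<partial>std_gaussian \<partial>std_gaussian)"
  by (rule std_gaussian_Fubini) measurable
 also have "... = (\<integral>\<^sup>+x. \<integral>\<^sup>+y. G (x, y) \<partial>std_gaussian \<partial>std_gaussian)"
  by (rule std_gaussian_rotate[OF m cs])
 also have "... = (\<integral>\<^sup>+y. \<integral>\<^sup>+x. G (x, y) \<partial>std_gaussian \<partial>std_gaussian)"
  by (rule std_gaussian_Fubini[symmetric]) simp
 finally show ?thesis .
qed

text \<open>Linear forms with coefficient rows indexed by \<open>R\<close>. Under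
  \<open>GI J\<close> they form a centered Gaussian vector whose covariance is the Gram matrix of
  the rows.\<close>

definition lf :: "'b set => 'a set => ('b => 'a => real) => ('a => real) => ('b => real)" where
 "lf R J A w = (\<lambda>i\<in>R. \<Sum>j\<in>J. A i j*w j)"

lemma lf_measurable [measurable]: "lf R J A \<in> measurable (GI J) (GI R)"
 unfolding lf_def by (intro measurable_GI_restrict) measurable

lemma lf_in: "i \<in> R ==> lf R J A w i = (\<Sum>j\<in>J. A i j*w j)"
 by (simp add: lf_def)

lemma lf_space [simp]: "lf R J A w \<in> R \<rightarrow>\<^sub>E UNIV"
 by (simp add: lf_def)

lemma nn_integral_GI_insert:
 assumes "finite L" "a \<notin> L" "f \<in> borel_measurable (GI (insert a L))"
 shows "(\<integral>\<^sup>+w. f w \<partial>GI (insert a L)) = (\<integral>\<^sup>+w. \<integral>\<^sup>+x. f (w(a := x)) \<partial>std_gaussian \<partial>GI L)"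
 using assms by (rule SG.product_nn_integral_insert)

lemma measurable_nn_integral_upd:
 assumes f: "f \<in> borel_measurable (GI (insert a L))"
 shows "(%w. \<integral>\<^sup>+x. f (w(a := x)) \<partial>std_gaussian) \<in> borel_measurable (GI L)"
proof -
 have "(%p. (fst p)(a := snd p)) \<in> measurable (GI L >< std_gaussian) (GI (insert a L))"
  by (rule measurable_fun_upd[where J = L]) auto
 from measurable_compose[OF this f] show ?thesis
  by (intro sigma_finite_measure.borel_measurable_nn_integral[OF prob_space_imp_sigma_finite[OF prob_space_std_gaussian]])
    (simp add: split_beta')
qed

text \<open>Rotating two columns of the matrix amounts to rotating two independent Gaussian
  coordinates, and all other coordinates can be frozen meanwhile.\<close>

lemma givens:
 fixes A :: "'b => 'a => real"
 assumes J: "finite J" "a \<in> J" "b \<in> J" "a ~= b" and cs: "c^2 + s^2 = 1"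
  and F[measurable]: "F \<in> borel_measurable (GI R)"
 shows "(\<integral>\<^sup>+w. F (lf R J (%i. (A i)(a := A i a*c - A i b * s, b := A i a * s+A i b*c)) w) \<partial>GI J)
    = (\<integral>\<^sup>+w. F (lf R J A w) \<partial>GI J)"
proof -
 define L where "L = J - {a, b}"
 have L: "finite L" "a \<notin> insert b L" "b \<notin> L" "J = insert a (insert b L)"
  using J by (auto simp: L_def)
 let ?S = "%w i. \<Sum>j\<in>L. A i j*w j"
 define K where "K = (%w p. F (\<lambda>i\<in>R. A i a*fst p+A i b * snd p+?S w i))"
 have m: "(%w. F (lf R J B w)) \<in> borel_measurable (GI J)" for B
  by measurable
 have *: "(\<integral>\<^sup>+w. F (lf R J B w) \<partial>GI J) = (\<integral>\<^sup>+w. \<integral>\<^sup>+y. \<integral>\<^sup>+x. F (\<lambda>i\<in>R. B i a*x+B i b*y+(\<Sum>j\<in>L. B i j*w j)) \<partial>std_gaussian \<partial>std_gaussian \<partial>GI L)" for B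
 proof -
  have "(\<integral>\<^sup>+w. F (lf R J B w) \<partial>GI J) = (\<integral>\<^sup>+w. \<integral>\<^sup>+x. F (lf R J B (w(a := x))) \<partial>std_gaussian \<partial>GI (insert b L))"
   unfolding L(4) using L(1,2) m[of B] by (intro nn_integral_GI_insert) (simp_all add: L(4))
  also have "... = (\<integral>\<^sup>+w. \<integral>\<^sup>+y. \<integral>\<^sup>+x. F (lf R J B (w(b := y, a := x))) \<partial>std_gaussian \<partial>std_gaussian \<partial>GI L)"
   using L(1,3) measurable_nn_integral_upd[OF m[of B, unfolded L(4)], folded L(4)]
   by (rule nn_integral_GI_insert)
  also have "... = (\<integral>\<^sup>+w. \<integral>\<^sup>+y. \<integral>\<^sup>+x. F (\<lambda>i\<in>R. B i a*x+B i b*y+(\<Sum>j\<in>L. B i j*w j)) \<partial>std_gaussian \<partial>std_gaussian \<partial>GI L)"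
  proof -
   have u: "(\<Sum>j\<in>L. B i j*(w(b := y, a := x)) j) = (\<Sum>j\<in>L. B i j*w j)" for i w x y
    using L by (intro sum.cong) auto
   have "lf R J B (w(b := y, a := x)) = (\<lambda>i\<in>R. B i a*x+B i b*y+(\<Sum>j\<in>L. B i j*w j))" for w x y
    unfolding lf_def L(4) using L(1-3) u[of _ w y x] by (intro restrict_ext) (auto simp: add.assoc)
   then show ?thesis by (simp only:)
  qed
  finally show ?thesis .
 qed
 have Km: "K w \<in> borel_measurable (borel >< borel)" for w
  unfolding K_def by (rule measurable_compose[OF measurable_GI_restrict F]) measurable
 let ?B = "%i. (A i)(a := A i a*c - A i b * s, b := A i a * s+A i b*c)"
 have "(\<integral>\<^sup>+w. F (lf R J ?B w) \<partial>GI J) = (\<integral>\<^sup>+w. \<integral>\<^sup>+y. \<integral>\<^sup>+x. K w (c*x + s*y, - s*x+c*y) \<partial>std_gaussian \<partial>std_gaussian \<partial>GI L)"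
 proof -
  have s: "(\<Sum>j\<in>L. ?B i j*w j) = ?S w i" for w i
   using L by (intro sum.cong) auto
  have e: "F (\<lambda>i\<in>R. ?B i a*x+?B i b*y+(\<Sum>j\<in>L. ?B i j*w j)) = K w (c*x + s*y, - s*x+c*y)" for w x y
   unfolding K_def s using J(4) by (simp add: algebra_simps)
  show ?thesis
   by (rule *[of ?B, unfolded e])
 qed
 also have "... = (\<integral>\<^sup>+w. \<integral>\<^sup>+y. \<integral>\<^sup>+x. K w (x, y) \<partial>std_gaussian \<partial>std_gaussian \<partial>GI L)"
  by (rule nn_integral_cong) (rule std_gaussian_rotate_swapped[OF Km cs])
 also have "... = (\<integral>\<^sup>+w. F (lf R J A w) \<partial>GI J)"
  by (simp add: *[of A] K_def)
 finally show ?thesis .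
qed


lemma givens_gram:
 fixes A :: "'b => 'a => real"
 assumes J: "finite J" "a \<in> J" "b \<in> J" "a ~= b" and cs: "c^2 + s^2 = 1"
  and B: "B = (%i. (A i)(a := A i a*c - A i b * s, b := A i a * s+A i b*c))"
 shows "(\<Sum>l\<in>J. B i l*B i' l) = (\<Sum>l\<in>J. A i l*A i' l)"
proof -
 define L where "L = J - {a, b}"
 have L: "finite L" "a \<notin> insert b L" "b \<notin> L" "J = insert a (insert b L)"
  using J by (auto simp: L_def)
 have 1: "(\<Sum>l\<in>J. C l) = C a+C b+(\<Sum>l\<in>L. C l)" for C :: "'a => real"
  unfolding L(4) using L(1-3) J(4) by (simp add: add.assoc)
 have 2: "(\<Sum>l\<in>L. B i l*B i' l) = (\<Sum>l\<in>L. A i l*A i' l)"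
  using L by (intro sum.cong) (auto simp: B)
 have "B i a*B i' a+B i b*B i' b = (c^2 + s^2)*(A i a*A i' a+A i b*A i' b)"
  using J(4) by (simp add: B algebra_simps power2_eq_square)
 then show ?thesis unfolding 1 2 cs by simp
qed

text \<open>Rotating the coordinate pairs \<open>(j0, j)\<close> one after the other moves row \<open>k\<close> onto the axis \<open>j0\<close>.\<close>

lemma row_to_axis:
 fixes A :: "'b => 'a => real"
 assumes "finite L" "finite K" "j0 \<in> K" "L \<subseteq> K - {j0}" "A k j0 >= 0"
 shows "EX B. (ALL i i'. (\<Sum>l\<in>K. B i l*B i' l) = (\<Sum>l\<in>K. A i l*A i' l)) \<and> (ALL j:L. B k j = 0) \<and> B k j0 >= 0 \<and>
  (ALL F:borel_measurable (GI R). (\<integral>\<^sup>+w. F (lf R K B w) \<partial>GI K) = (\<integral>\<^sup>+w. F (lf R K A w) \<partial>GI K))"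
 using assms
proof (induction L rule: finite_induct)
 case empty
 then show ?case by (intro exI[of _ A]) auto
next
 case (insert j L)
 then obtain B where B: "ALL i i'. (\<Sum>l\<in>K. B i l*B i' l) = (\<Sum>l\<in>K. A i l*A i' l)" "ALL j:L. B k j = 0" "B k j0 >= 0"
  "ALL F:borel_measurable (GI R). (\<integral>\<^sup>+w. F (lf R K B w) \<partial>GI K) = (\<integral>\<^sup>+w. F (lf R K A w) \<partial>GI K)"
  by blast
 note B = B(1)[rule_format] B(2)[rule_format] B(3) B(4)[rule_format]
 have j: "j \<in> K" "j0 ~= j" "j0 \<notin> L" using insert by auto
 define rh where "rh = sqrt ((B k j0)^2+(B k j)^2)"
 define c s where "c = (if rh = 0 then 1 else B k j0/rh)" and "s = (if rh = 0 then 0 else - B k j/rh)"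
 have rh: "rh^2 = (B k j0)^2+(B k j)^2" "rh >= 0" by (simp_all add: rh_def)
 have cs: "c^2 + s^2 = 1"
 proof (cases "rh = 0")
  case False
  have "c^2 + s^2 = ((B k j0)^2+(B k j)^2)/rh^2"
   using False by (simp add: c_def s_def power_divide add_divide_distrib)
  moreover have "rh^2 ~= 0" using False by simp
  ultimately show ?thesis unfolding rh(1) by (metis divide_self)
 qed (simp add: c_def s_def)
 have z: "B k j0 * s+B k j*c = 0"
  using rh(1) by (auto simp: c_def s_def)
 have p: "B k j0*c - B k j * s >= 0"
 proof (cases "rh = 0")
  case False
  have "B k j0*c - B k j * s = (B k j0*B k j0+B k j*B k j)/rh"
   using False by (simp add: c_def s_def add_divide_distrib)
  then show ?thesis using rh(2) by simp
 qed (use B(3) in \<open>simp add: c_def s_def\<close>)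
 define C where "C = (%i. (B i)(j0 := B i j0*c - B i j * s, j := B i j0 * s+B i j*c))"
 show ?case
 proof (intro exI[of _ C] conjI allI ballI)
  show "(\<Sum>l\<in>K. C i l*C i' l) = (\<Sum>l\<in>K. A i l*A i' l)" for i i'
   using givens_gram[OF insert.prems(1,2) j(1,2) cs C_def] B(1) by simp
  show "C k l = 0" if "l \<in> insert j L" for l
   using that z B(2) j insert.hyps by (auto simp: C_def)
  show "C k j0 >= 0" using p j by (simp add: C_def)
  show "(\<integral>\<^sup>+w. F (lf R K C w) \<partial>GI K) = (\<integral>\<^sup>+w. F (lf R K A w) \<partial>GI K)" if F: "F \<in> borel_measurable (GI R)" for F
   unfolding C_def using givens[OF insert.prems(1,2) j(1,2) cs F, of B] B(4)[OF F] by simp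
 qed
qed

text \<open>Conditioning a Gaussian vector on its component \<open>x\<close>: every other row is a
  multiple of that component plus an independent residual whose Gram matrix is the Schur complement.
  Row \<open>x\<close> is rotated onto a fresh coordinate \<open>j0\<close> whose column was zero,
  so the residual lives on the old index set \<open>J\<close>.\<close>

lemma row_split:
 fixes A :: "'b => nat => real"
 assumes J: "finite J" and x: "x \<notin> R" and g: "g = (%i i'. \<Sum>l\<in>J. A i l*A i' l)" and r: "g x x ~= 0"
 shows "EX B. (ALL i i'. (\<Sum>l\<in>J. B i l*B i' l) = g i i' - g i x*g i' x/g x x) \<and>
  (ALL F:borel_measurable (GI (insert x R)). (\<integral>\<^sup>+w. F (lf (insert x R) J A w) \<partial>GI J) =
   (\<integral>\<^sup>+y. \<integral>\<^sup>+w. F (\<lambda>i\<in>insert x R. if i = x then sqrt (g x x)*y else g i x / sqrt (g x x)*y+lf R J B w i) \<partial>GI J \<partial>std_gaussian))"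
proof -
 \<comment> \<open>The column indices are natural numbers so that a fresh index exists.\<close>
 obtain j0 where j0: "j0 \<notin> J" using J ex_new_if_finite[of J] by auto
 define K where "K = insert j0 J"
 define A0 where "A0 = (%i. (A i)(j0 := 0))"
 have K: "finite K" "j0 \<in> K" "J \<subseteq> K - {j0}" using J j0 by (auto simp: K_def)
 have sK: "(\<Sum>l\<in>K. C l) = C j0+(\<Sum>l\<in>J. C l)" for C :: "nat => real"
  using J j0 by (simp add: K_def)
 have A0J: "(\<Sum>l\<in>J. A0 i l*f l) = (\<Sum>l\<in>J. A i l*f l)" for i f
  using j0 by (intro sum.cong) (auto simp: A0_def)
 have A0J2: "(\<Sum>l\<in>J. A0 i l*A0 i' l) = g i i'" for i i'
  unfolding g using j0 by (intro sum.cong) (auto simp: A0_def)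
 have A00: "A0 i j0 = 0" for i by (simp add: A0_def)
 have "A0 x j0 >= 0" using A00 by simp
 then obtain B where B: "ALL i i'. (\<Sum>l\<in>K. B i l*B i' l) = (\<Sum>l\<in>K. A0 i l*A0 i' l)" "ALL j:J. B x j = 0" "B x j0 >= 0"
  "ALL F:borel_measurable (GI (insert x R)). (\<integral>\<^sup>+w. F (lf (insert x R) K B w) \<partial>GI K) = (\<integral>\<^sup>+w. F (lf (insert x R) K A0 w) \<partial>GI K)"
  using row_to_axis[OF J K(1) K(2) K(3), of A0 x "insert x R"] by blast
 note B = B(1)[rule_format] B(2)[rule_format] B(3) B(4)[rule_format]
 have gB: "B i j0*B i' j0+(\<Sum>l\<in>J. B i l*B i' l) = g i i'" for i i'
  using B(1)[of i i'] unfolding sK A00 A0J2 by simp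
 have bx: "B x j0 = sqrt (g x x)"
  using gB[of x x] B(2,3) by (intro real_sqrt_unique[symmetric]) (simp_all add: power2_eq_square)
 have bi: "B i j0 = g i x / sqrt (g x x)" for i
  using gB[of i x] B(2) bx r by (simp add: field_simps)
 have gx: "g x x >= 0" unfolding g by (simp add: sum_nonneg)
 show ?thesis
 proof (intro exI[of _ B] conjI allI ballI)
  show "(\<Sum>l\<in>J. B i l*B i' l) = g i i' - g i x*g i' x/g x x" for i i'
   using gB[of i i'] gx unfolding bi[of i] bi[of i'] by simp
  fix F :: "('b => real) => ennreal" assume F[measurable]: "F \<in> borel_measurable (GI (insert x R))"
  have m: "(%w. F (lf (insert x R) K C w)) \<in> borel_measurable (GI (insert j0 J))" for C
   using measurable_compose[OF lf_measurable F] by (simp add: K_def)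
  have ins: "(\<integral>\<^sup>+w. F (lf (insert x R) K C w) \<partial>GI K) = (\<integral>\<^sup>+w. \<integral>\<^sup>+y. F (lf (insert x R) K C (w(j0 := y))) \<partial>std_gaussian \<partial>GI J)" for C
   using nn_integral_GI_insert[OF J j0 m[of C]] by (simp add: K_def)
  have sj: "(\<Sum>l\<in>J. C l*(w(j0 := y)) l) = (\<Sum>l\<in>J. C l*w l)" for C w and y :: real
   using j0 by (intro sum.cong) auto
  have e1: "lf (insert x R) K A0 (w(j0 := y)) = lf (insert x R) J A w" for w y
   unfolding lf_def sK A00 sj A0J by simp
  have e2: "lf (insert x R) K B (w(j0 := y)) = (\<lambda>i\<in>insert x R. if i = x then sqrt (g x x)*y else g i x / sqrt (g x x)*y+lf R J B w i)" for w y
  proof (rule ext)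
   fix i
   consider "i = x" | "i \<in> R" "i ~= x" | "i \<notin> insert x R" by auto
   then show "lf (insert x R) K B (w(j0 := y)) i = (\<lambda>i\<in>insert x R. if i = x then sqrt (g x x)*y else g i x / sqrt (g x x)*y+lf R J B w i) i"
   proof cases
    case 1
    have "g x x / sqrt (g x x) = sqrt (g x x)" using gx by (rule real_div_sqrt)
    then show ?thesis using 1 by (simp add: lf_def sK sj B(2) bx)
   next
    case 2
    then show ?thesis unfolding lf_def sK sj bi by simp
   next
    case 3
    then show ?thesis by (simp add: lf_def)
   qed
  qed
  define H where "H = (%w y. F (\<lambda>i\<in>insert x R. if i = x then sqrt (g x x)*y else g i x / sqrt (g x x)*y+lf R J B w i))"
  have Hm: "case_prod H \<in> borel_measurable (GI J >< std_gaussian)"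
  proof -
   have "(%p. \<lambda>i\<in>insert x R. if i = x then sqrt (g x x) * snd p else g i x / sqrt (g x x) * snd p+lf R J B (fst p) i)
     \<in> measurable (GI J >< std_gaussian) (GI (insert x R))"
   proof (rule measurable_GI_restrict)
    fix i assume i: "i \<in> insert x R"
    show "(%p. if i = x then sqrt (g x x) * snd p else g i x / sqrt (g x x) * snd p+lf R J B (fst p) i) \<in> borel_measurable (GI J >< std_gaussian)"
    proof (cases "i = x")
     case False
     then have "i \<in> R" using i by simp
     then show ?thesis using False unfolding lf_def by simp
    qed simp
   qed
   from measurable_compose[OF this F] show ?thesis
    by (simp add: H_def split_beta')
  qed
  have ps: "pair_sigma_finite (GI J) std_gaussian"
   by (intro pair_sigma_finite.intro prob_space_imp_sigma_finite prob_space_std_gaussian GI.prob_space_axioms)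
  have a: "(\<integral>\<^sup>+w. F (lf (insert x R) J A w) \<partial>GI J) = (\<integral>\<^sup>+w. F (lf (insert x R) K A0 w) \<partial>GI K)"
   unfolding ins e1 by (simp add: emeasure_std_gaussian_UNIV)
  show "(\<integral>\<^sup>+w. F (lf (insert x R) J A w) \<partial>GI J) =
   (\<integral>\<^sup>+y. \<integral>\<^sup>+w. F (\<lambda>i\<in>insert x R. if i = x then sqrt (g x x)*y else g i x / sqrt (g x x)*y+lf R J B w i) \<partial>GI J \<partial>std_gaussian)"
  proof -
   have "(\<integral>\<^sup>+w. F (lf (insert x R) J A w) \<partial>GI J) = (\<integral>\<^sup>+w. \<integral>\<^sup>+y. H w y \<partial>std_gaussian \<partial>GI J)"
    using a unfolding B(4)[OF F, symmetric] ins e2 H_def .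
   also have "... = (\<integral>\<^sup>+y. \<integral>\<^sup>+w. H w y \<partial>GI J \<partial>std_gaussian)"
    by (rule pair_sigma_finite.Fubini'[OF ps Hm, symmetric])
   finally show ?thesis by (simp add: H_def)
  qed
 qed
qed

text \<open>Induction on the rows. A row of norm zero vanishes identically; any other row is split
  off on both sides. The residual Gram matrices are Schur complements of equal matrices, hence
  equal, although the coefficient matrices and index sets differ; this is why these are
  generalized.\<close>

lemma law_core:
 fixes A A' :: "'b => nat => real"
 assumes "finite R" "finite J" "finite J'"
  "!!i i'. i \<in> R ==> i' \<in> R ==> (\<Sum>l\<in>J. A i l*A i' l) = (\<Sum>l\<in>J'. A' i l*A' i' l)"
  "F \<in> borel_measurable (GI R)"
 shows "(\<integral>\<^sup>+w. F (lf R J A w) \<partial>GI J) = (\<integral>\<^sup>+w. F (lf R J' A' w) \<partial>GI J')"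
 using assms
proof (induction R arbitrary: J J' A A' F rule: finite_induct)
 case empty
 have "lf {} J A w = (%_. undefined)" "lf {} J' A' w = (%_. undefined)" for w by (auto simp: lf_def)
 then show ?case by (simp add: GI.emeasure_space_1)
next
 case (insert x R)
 define g where "g = (%i i'. \<Sum>l\<in>J. A i l*A i' l)"
 define g' where "g' = (%i i'. \<Sum>l\<in>J'. A' i l*A' i' l)"
 have gg: "g i i' = g' i i'" if "i \<in> insert x R" "i' \<in> insert x R" for i i'
  unfolding g_def g'_def by (rule insert.prems(3)[OF that])
 note F[measurable] = insert.prems(4)
 show ?case
 proof (cases "g x x = 0")
  case True
  then have z: "!!j. j \<in> J ==> A x j = 0" unfolding g_def using insert.prems(1) by (simp add: sum_nonneg_eq_0_iff)
  have "g' x x = 0" using gg[of x x] True by simp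
  then have z': "!!j. j \<in> J' ==> A' x j = 0" unfolding g'_def using insert.prems(2) by (simp add: sum_nonneg_eq_0_iff)
  define G where "G = (%u. F (\<lambda>i\<in>insert x R. if i = x then 0 else u i))"
  have "(%u. \<lambda>i\<in>insert x R. if i = x then 0 else u i) \<in> measurable (GI R) (GI (insert x R))"
  proof (rule measurable_GI_restrict)
   fix i assume "i \<in> insert x R"
   then show "(%u. if i = x then 0 else u i) \<in> borel_measurable (GI R)"
    by (cases "i = x") (auto intro: measurable_GI_component)
  qed
  then have G: "G \<in> borel_measurable (GI R)" unfolding G_def by (rule measurable_compose[OF _ F])
  have e: "lf (insert x R) J A w = (\<lambda>i\<in>insert x R. if i = x then 0 else lf R J A w i)" for w
   using insert.hyps z by (auto simp: lf_def fun_eq_iff)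
  have e': "lf (insert x R) J' A' w = (\<lambda>i\<in>insert x R. if i = x then 0 else lf R J' A' w i)" for w
   using insert.hyps z' by (auto simp: lf_def fun_eq_iff)
  have "(\<integral>\<^sup>+w. G (lf R J A w) \<partial>GI J) = (\<integral>\<^sup>+w. G (lf R J' A' w) \<partial>GI J')"
   using insert.prems(3) by (intro insert.IH[OF insert.prems(1,2) _ G]) auto
  then show ?thesis unfolding e e' G_def .
 next
  case False
  then have False': "g' x x ~= 0" using gg[of x x] by simp
  obtain B where B: "!!i i'. (\<Sum>l\<in>J. B i l*B i' l) = g i i' - g i x*g i' x/g x x"
   "(\<integral>\<^sup>+w. F (lf (insert x R) J A w) \<partial>GI J) =
   (\<integral>\<^sup>+y. \<integral>\<^sup>+w. F (\<lambda>i\<in>insert x R. if i = x then sqrt (g x x)*y else g i x / sqrt (g x x)*y+lf R J B w i) \<partial>GI J \<partial>std_gaussian)"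
   using row_split[OF insert.prems(1) insert.hyps(2) g_def False] F by blast
  obtain B' where B': "!!i i'. (\<Sum>l\<in>J'. B' i l*B' i' l) = g' i i' - g' i x*g' i' x/g' x x"
   "(\<integral>\<^sup>+w. F (lf (insert x R) J' A' w) \<partial>GI J') =
   (\<integral>\<^sup>+y. \<integral>\<^sup>+w. F (\<lambda>i\<in>insert x R. if i = x then sqrt (g' x x)*y else g' i x / sqrt (g' x x)*y+lf R J' B' w i) \<partial>GI J' \<partial>std_gaussian)"
   using row_split[OF insert.prems(2) insert.hyps(2) g'_def False'] F by blast
  define G where "G = (%y u. F (\<lambda>i\<in>insert x R. if i = x then sqrt (g x x)*y else g i x / sqrt (g x x)*y+u i))"
  have G: "G y \<in> borel_measurable (GI R)" for y
  proof -
   have "(%u. \<lambda>i\<in>insert x R. if i = x then sqrt (g x x)*y else g i x / sqrt (g x x)*y+u i) \<in> measurable (GI R) (GI (insert x R))"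
   proof (rule measurable_GI_restrict)
    fix i assume "i \<in> insert x R"
    then show "(%u. if i = x then sqrt (g x x)*y else g i x / sqrt (g x x)*y+u i) \<in> borel_measurable (GI R)"
     by (cases "i = x") (auto intro!: borel_measurable_add measurable_GI_component)
   qed
   then show ?thesis unfolding G_def by (rule measurable_compose[OF _ F])
  qed
  have gram: "(\<Sum>l\<in>J. B i l*B i' l) = (\<Sum>l\<in>J'. B' i l*B' i' l)" if "i \<in> R" "i' \<in> R" for i i'
   unfolding B(1) B'(1) using that by (simp add: gg)
  have "(\<integral>\<^sup>+w. G y (lf R J B w) \<partial>GI J) = (\<integral>\<^sup>+w. G y (lf R J' B' w) \<partial>GI J')" for y
   by (rule insert.IH[OF insert.prems(1,2) gram G])
  moreover have "(\<lambda>i\<in>insert x R. if i = x then sqrt (g' x x)*y else g' i x / sqrt (g' x x)*y+u i) =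
    (\<lambda>i\<in>insert x R. if i = x then sqrt (g x x)*y else g i x / sqrt (g x x)*y+u i)" for y u
  proof (rule restrict_ext)
   fix i assume "i \<in> insert x R"
   then have "g' i x = g i x" "g' x x = g x x" using gg[of i x] gg[of x x] by auto
   then show "(if i = x then sqrt (g' x x)*y else g' i x / sqrt (g' x x)*y+u i) =
    (if i = x then sqrt (g x x)*y else g i x / sqrt (g x x)*y+u i)" by simp
  qed
  ultimately show ?thesis unfolding B(2) B'(2) G_def by presburger
 qed
qed

lemma GI_reindex:
 assumes "inj_on h J"
 shows "distr (GI (h ` J)) (GI J) (%w. \<lambda>j\<in>J. w (h j)) = GI J"
 using assms by (subst distr_PiM_reindex) (auto intro!: prob_space_std_gaussian)

text \<open>Finite index sets are transported into the natural numbers, where splitting finds its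
  fresh coordinate. Later changes of Gaussian variables all reduce to comparing inner products of
  rows.\<close>

theorem nn_integral_gram:
 fixes A :: "'b => 'a => real" and A' :: "'b => 'c => real"
 assumes fin: "finite R" "finite J" "finite J'"
  and gram: "!!i i'. i \<in> R ==> i' \<in> R ==> (\<Sum>l\<in>J. A i l*A i' l) = (\<Sum>l\<in>J'. A' i l*A' i' l)"
  and F: "F \<in> borel_measurable (GI R)"
 shows "(\<integral>\<^sup>+w. F (lf R J A w) \<partial>GI J) = (\<integral>\<^sup>+w. F (lf R J' A' w) \<partial>GI J')"
proof -
 have *: "EX L B. finite L \<and> (ALL i i'. (\<Sum>l\<in>L. B i l*B i' l) = (\<Sum>l\<in>J. A i l*A i' l)) \<and>
   (\<integral>\<^sup>+w. F (lf R J A w) \<partial>GI J) = (\<integral>\<^sup>+w. F (lf R L B w) \<partial>GI (L :: nat set))" if J: "finite J" for J :: "'d set" and A :: "'b => 'd => real"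
 proof -
  obtain h :: "'d => nat" where h: "inj_on h J" using J finite_imp_inj_to_nat_seg by blast
  define B where "B = (%i l. A i (inv_into J h l))"
  have Bh: "B i (h j) = A i j" if "j \<in> J" for i j using h that by (simp add: B_def)
  have hm: "(%w. \<lambda>j\<in>J. w (h j)) \<in> measurable (GI (h ` J)) (GI J)"
   by (rule measurable_GI_restrict) simp
  have e: "lf R J A (\<lambda>j\<in>J. w (h j)) = lf R (h ` J) B w" for w
   unfolding lf_def by (intro restrict_ext) (simp add: sum.reindex[OF h] Bh)
  have "(\<integral>\<^sup>+w. F (lf R J A w) \<partial>GI J) = (\<integral>\<^sup>+w. F (lf R J A w) \<partial>distr (GI (h ` J)) (GI J) (%w. \<lambda>j\<in>J. w (h j)))"
   by (simp add: GI_reindex[OF h])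
  also have "... = (\<integral>\<^sup>+w. F (lf R (h ` J) B w) \<partial>GI (h ` J))"
   using measurable_compose[OF lf_measurable F] hm by (subst nn_integral_distr) (simp_all add: e)
  finally show ?thesis
   using J by (intro exI[of _ "h ` J"] exI[of _ B]) (simp add: sum.reindex[OF h] Bh)
 qed
 obtain L B where 1: "finite L" "!!i i'. (\<Sum>l\<in>L. B i l*B i' l) = (\<Sum>l\<in>J. A i l*A i' l)"
   "(\<integral>\<^sup>+w. F (lf R J A w) \<partial>GI J) = (\<integral>\<^sup>+w. F (lf R L B w) \<partial>GI (L :: nat set))" using *[OF fin(2), of A] by blast
 obtain L' B' where 2: "finite L'" "!!i i'. (\<Sum>l\<in>L'. B' i l*B' i' l) = (\<Sum>l\<in>J'. A' i l*A' i' l)"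
   "(\<integral>\<^sup>+w. F (lf R J' A' w) \<partial>GI J') = (\<integral>\<^sup>+w. F (lf R L' B' w) \<partial>GI (L' :: nat set))" using *[OF fin(3), of A'] by blast
 show ?thesis unfolding 1(3) 2(3)
  by (rule law_core[OF fin(1) 1(1) 2(1) _ F]) (simp add: 1(2) 2(2) gram)
qed

corollary distr_gram:
 fixes A :: "'b => 'a => real" and A' :: "'b => 'c => real"
 assumes fin: "finite R" "finite J" "finite J'"
  and gram: "!!i i'. i \<in> R ==> i' \<in> R ==> (\<Sum>l\<in>J. A i l*A i' l) = (\<Sum>l\<in>J'. A' i l*A' i' l)"
 shows "distr (GI J) (GI R) (lf R J A) = distr (GI J') (GI R) (lf R J' A')"
proof (rule measure_eqI)
 fix X assume "X \<in> sets (distr (GI J) (GI R) (lf R J A))"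
 then have X: "X \<in> sets (GI R)" by simp
 have *: "emeasure (distr (GI K) (GI R) (lf R K C)) X = (\<integral>\<^sup>+w. indicator X (lf R K C w) \<partial>GI K)" for K :: "'d set" and C
 proof -
  have "emeasure (distr (GI K) (GI R) (lf R K C)) X = (\<integral>\<^sup>+u. indicator X u \<partial>distr (GI K) (GI R) (lf R K C))"
   using X by simp
  also have "... = (\<integral>\<^sup>+w. indicator X (lf R K C w) \<partial>GI K)"
   using X by (intro nn_integral_distr) auto
  finally show ?thesis .
 qed
 have "(indicator X :: _ => ennreal) \<in> borel_measurable (GI R)" using X by simp
 from nn_integral_gram[OF fin gram this] show "emeasure (distr (GI J) (GI R) (lf R J A)) X = emeasure (distr (GI J') (GI R) (lf R J' A')) X"
  unfolding * .
qed simp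

definition csum :: "'a set => 'b set => ('a => real) => ('b => real) => 'a + 'b => real" where
 "csum I J x y = (\<lambda>k\<in>I <+> J. case_sum x y k)"

lemma csum_measurable: "(%(x, y). csum I J x y) \<in> measurable (GI I >< GI J) (GI (I <+> J))"
 unfolding csum_def split_beta'
proof (rule measurable_GI_restrict)
 fix k assume "k \<in> I <+> J"
 then show "(%p. case_sum (fst p) (snd p) k) \<in> borel_measurable (GI I >< GI J)"
  by (cases k) auto
qed

text \<open>Two independent Gaussian vectors are a single one over the disjoint sum, so that
  integrals over pairs also fall under the Gram criterion.\<close>

lemma GI_Plus:
 assumes "finite I" "finite J"
 shows "distr (GI I >< GI J) (GI (I <+> J)) (%(x, y). csum I J x y) = GI (I <+> J)"
proof (rule SG.PiM_eqI)
 show "finite (I <+> J)" using assms by simp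
 fix A :: "'a + 'b => real set" assume A: "!!k. k \<in> I <+> J ==> A k \<in> sets std_gaussian"
 have [simp]: "sets std_gaussian = sets borel" by simp
 have P: "(%(x, y). csum I J x y) -` (Pi\<^sub>E (I <+> J) A) \<inter> space (GI I >< GI J)
   = Pi\<^sub>E I (%i. A (Inl i)) \<times> Pi\<^sub>E J (%j. A (Inr j))"
  (is "?L = ?R")
 proof (intro set_eqI iffI)
  fix p assume p: "p \<in> ?L"
  obtain x y where xy: "p = (x, y)" by (cases p)
  have "csum I J x y k \<in> A k" if "k \<in> I <+> J" for k using p xy that by (auto simp: PiE_iff)
  from this[of "Inl _"] this[of "Inr _"] show "p \<in> ?R"
   using p xy by (auto simp: csum_def space_pair_measure space_PiM PiE_iff)
 next
  fix p assume "p \<in> ?R"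
  then show "p \<in> ?L"
   by (auto simp: csum_def space_pair_measure space_PiM PiE_iff Plus_def)
 qed
 have sf: "sigma_finite_measure (GI J)" by (rule prob_space_imp_sigma_finite) (rule GI.prob_space_axioms)
 have "emeasure (distr (GI I >< GI J) (GI (I <+> J)) (%(x, y). csum I J x y)) (Pi\<^sub>E (I <+> J) A)
   = emeasure (GI I >< GI J) (Pi\<^sub>E I (%i. A (Inl i)) \<times> Pi\<^sub>E J (%j. A (Inr j)))"
  using A assms by (subst emeasure_distr[OF csum_measurable]) (auto simp: P intro!: sets_PiM_I_finite)
 also have "... = emeasure (GI I) (Pi\<^sub>E I (%i. A (Inl i)))*emeasure (GI J) (Pi\<^sub>E J (%j. A (Inr j)))"
  using A assms by (intro sigma_finite_measure.emeasure_pair_measure_Times[OF sf] sets_PiM_I_finite) auto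
 also have "... = (\<Prod>k\<in>I <+> J. emeasure std_gaussian (A k))"
  using A assms by (subst (1 2) SG.emeasure_PiM) (auto simp: prod.Plus)
 finally show "emeasure (distr (GI I >< GI J) (GI (I <+> J)) (%(x, y). csum I J x y)) (Pi\<^sub>E (I <+> J) A)
   = (\<Prod>k\<in>I <+> J. emeasure std_gaussian (A k))" .
qed simp

section \<open>Bounded functions, Fubini and square integrability\<close>

text \<open>The bound holds at every point of the space, not just almost everywhere, so that it
  survives composition with any measurable map and restriction to sections.\<close>

definition bdd :: "'a measure => real => ('a => real) => bool" where
 "bdd M b f \<longleftrightarrow> f \<in> borel_measurable M \<and> (ALL x:space M. \<bar>f x\<bar> <= b)"

lemma bddI: "f \<in> borel_measurable M ==> (!!x. x \<in> space M ==> \<bar>f x\<bar> <= b) ==> bdd M b f"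
 by (simp add: bdd_def)

lemma bddD: "bdd M b f ==> f \<in> borel_measurable M" "bdd M b f ==> x \<in> space M ==> \<bar>f x\<bar> <= b"
 by (auto simp: bdd_def)

lemma bdd_compose: "bdd N b f ==> g \<in> measurable M N ==> bdd M b (%x. f (g x))"
 by (auto simp: bdd_def measurable_space intro: measurable_compose)

lemma bdd_mono: "bdd M b f ==> b <= c ==> bdd M c f"
 by (force simp: bdd_def)

lemma bdd_mult: "bdd M b f ==> bdd M c g ==> bdd M (b*c) (%x. f x*g x)"
 unfolding bdd_def by (auto simp: abs_mult intro!: mult_mono')

lemma bdd_mult1: "bdd M 1 f ==> bdd M 1 g ==> bdd M 1 (%x. f x*g x)"
 using bdd_mult[of M 1 f 1 g] by simp

lemma bdd_diff: "bdd M b f ==> bdd M c g ==> bdd M (b+c) (%x. f x - g x)"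
 by (force simp: bdd_def)

lemma bdd_cmult: "bdd M b f ==> bdd M (\<bar>c\<bar> * b) (%x. c*f x)"
 by (auto simp: bdd_def abs_mult mult_left_mono)

lemma bdd_power2: "bdd M b f ==> bdd M (b^2) (%x. (f x)^2)"
 using bdd_mult[of M b f b f] by (simp add: power2_eq_square)

lemma bdd_abs: "bdd M b f ==> bdd M b (%x. \<bar>f x\<bar>)"
 by (auto simp: bdd_def)

lemma (in prob_space) bdd_integrable: "bdd M b f ==> integrable M f"
 by (rule integrable_const_bound[where B = b]) (auto simp: bdd_def)

lemma (in prob_space) bdd_integral_le:
 assumes "bdd M b f" shows "\<bar>(LINT x|M. f x)\<bar> <= b"
proof -
 have "\<bar>(LINT x|M. f x)\<bar> <= (LINT x|M. \<bar>f x\<bar>)" by simp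
 also have "... <= (LINT x|M. b)"
  using assms bdd_integrable[OF assms] by (intro integral_mono) (auto simp: bdd_def)
 finally show ?thesis by (simp add: prob_space)
qed

lemma (in prob_space) power2_integral_le:
 fixes f :: "'a => real"
 assumes "integrable M f" "integrable M (%x. (f x)^2)"
 shows "(LINT x|M. f x)^2 <= (LINT x|M. (f x)^2)"
proof -
 have "0 <= (LINT x|M. (f x - (LINT x|M. f x))^2)" by simp
 then show ?thesis unfolding variance_eq[OF assms] by simp
qed

lemma (in prob_space) abs_integral_power2_le:
 fixes f :: "'a => real"
 assumes "f \<in> borel_measurable M" "integrable M (%x. (f x)^2)"
 shows "integrable M f" "(LINT x|M. \<bar>f x\<bar>)^2 <= (LINT x|M. (f x)^2)"
proof -
 show "integrable M f"
  using square_integrable_imp_integrable[OF assms] .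
 then have "integrable M (%x. \<bar>f x\<bar>)" by simp
 then show "(LINT x|M. \<bar>f x\<bar>)^2 <= (LINT x|M. (f x)^2)"
  using power2_integral_le[of "%x. \<bar>f x\<bar>"] assms(2) by simp
qed

text \<open>The quadratic form in \<open>(s, t)\<close> given by the integral of
  \<open>(s*f - t*g)^2\<close> is nonnegative; the point \<open>(c, b)\<close> yields the inequality
  up to the factor \<open>c\<close>.\<close>

lemma cauchy_schwarz_integral:
 fixes f g :: "'a => real"
 assumes [measurable]: "f \<in> borel_measurable M" "g \<in> borel_measurable M"
  and f: "integrable M (%x. (f x)^2)" and g: "integrable M (%x. (g x)^2)"
 shows "integrable M (%x. f x*g x)"
  "(LINT x|M. f x*g x)^2 <= (LINT x|M. (f x)^2)*(LINT x|M. (g x)^2)"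
proof -
 have b: "\<bar>a*b\<bar> <= a^2+b^2" for a b :: real
 proof -
  have "2*(\<bar>a\<bar> * \<bar>b\<bar>) <= a^2+b^2" using sum_squares_bound[of "\<bar>a\<bar>" "\<bar>b\<bar>"] by simp
  then show ?thesis using abs_ge_zero[of "a*b"] unfolding abs_mult by linarith
 qed
 have i: "integrable M (%x. (f x)^2+(g x)^2)" using f g by simp
 show fg: "integrable M (%x. f x*g x)"
  using b by (intro Bochner_Integration.integrable_bound[OF i]) auto
 define a b c where "a = (LINT x|M. (f x)^2)" and "b = (LINT x|M. f x*g x)" and "c = (LINT x|M. (g x)^2)"
 have *: "0 <= s^2*a - 2 * s*t*b+t^2*c" for s t
 proof -
  have "0 <= (LINT x|M. (s*f x - t*g x)^2)" by simp
  also have "... = (LINT x|M. s^2*(f x)^2 - (2 * s*t)*(f x*g x)+t^2*(g x)^2)"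
   by (intro Bochner_Integration.integral_cong) (auto simp: power2_eq_square algebra_simps)
  also have "... = s^2*a - 2 * s*t*b+t^2*c"
   using f g fg by (simp add: a_def b_def c_def)
  finally show ?thesis .
 qed
 have nn: "a >= 0" "c >= 0" by (simp_all add: a_def c_def)
 have "b^2 <= a*c"
 proof (cases "c = 0")
  case True
  have "b = 0"
  proof (rule ccontr)
   assume "b ~= 0"
   \<comment> \<open>For \<open>c = 0\<close> the form is affine in \<open>t\<close>; at this point
     its value is \<open>- a - 2\<close>.\<close>
   then show False using *[of 1 "(a+1)/b"] True nn by (simp add: power2_eq_square)
  qed
  then show ?thesis using True by simp
 next
  case False
  have "0 <= c*(a*c - b^2)" using *[of c b] by (simp add: power2_eq_square algebra_simps)
  then show ?thesis using False nn by (simp add: zero_le_mult_iff)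
 qed
 then show "(LINT x|M. f x*g x)^2 <= (LINT x|M. (f x)^2)*(LINT x|M. (g x)^2)" by (simp add: a_def b_def c_def)
qed

lemma pair_prob_spaceI: "prob_space M ==> prob_space N ==> pair_prob_space M N"
 by (simp add: pair_prob_space_def pair_sigma_finite_def prob_space_imp_sigma_finite)

lemma prob_space_pairI: "prob_space M ==> prob_space N ==> prob_space (M >< N)"
 by (intro prob_space_pair)

lemma bdd_fubini:
 assumes M: "prob_space M" and N: "prob_space N" and f: "bdd (M >< N) b (%(x, y). f x y)"
 shows "(LINT x|M. LINT y|N. f x y) = (LINT p|(M >< N). f (fst p) (snd p))"
  "(LINT x|M. LINT y|N. f x y) = (LINT y|N. LINT x|M. f x y)"
  "bdd M b (%x. (LINT y|N. f x y))" "bdd N b (%y. (LINT x|M. f x y))"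
  "!!x. x \<in> space M ==> bdd N b (f x)" "!!y. y \<in> space N ==> bdd M b (%x. f x y)"
proof -
 interpret P: pair_prob_space M N using M N by (rule pair_prob_spaceI)
 note m[measurable] = bddD(1)[OF f]
 have i: "integrable (M >< N) (case_prod f)"
  using f by (rule P.bdd_integrable)
 show "(LINT x|M. LINT y|N. f x y) = (LINT p|(M >< N). f (fst p) (snd p))"
  using P.integral_fst'[OF i] by (simp add: split_beta')
 show "(LINT x|M. LINT y|N. f x y) = (LINT y|N. LINT x|M. f x y)"
  using P.Fubini_integral[OF i] by simp
 show 1: "bdd N b (f x)" if "x \<in> space M" for x
  using that f by (auto simp: bdd_def space_pair_measure)
 show 2: "bdd M b (%x. f x y)" if "y \<in> space N" for y
  using that f by (auto simp: bdd_def space_pair_measure)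
 show "bdd M b (%x. (LINT y|N. f x y))"
  using prob_space.bdd_integral_le[OF N 1] by (intro bddI) auto
 show "bdd N b (%y. (LINT x|M. f x y))"
  using prob_space.bdd_integral_le[OF M 2] by (intro bddI) auto
qed

section \<open>Joint laws of combinations of independent Gaussian vectors\<close>

lemma prob_GI: "prob_space (GI I)"
 by (rule GI.prob_space_axioms)

lemma gaussian_GI: "gaussian n = GI {..<n}"
 by (simp add: gaussian_def)

lemma pair_law:
 assumes fin: "finite I" "finite J" and h: "h \<in> measurable (GI (I <+> J)) N"
  and T: "!!x y. x \<in> space (GI I) ==> y \<in> space (GI J) ==> T (x, y) = h (csum I J x y)"
 shows "distr (GI I >< GI J) N T = distr (GI (I <+> J)) N h"
proof -
 have "distr (GI (I <+> J)) N h = distr (distr (GI I >< GI J) (GI (I <+> J)) (%(x, y). csum I J x y)) N h"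
  unfolding GI_Plus[OF fin] ..
 also have "... = distr (GI I >< GI J) N (h \<circ> (%(x, y). csum I J x y))"
  using h csum_measurable by (rule distr_distr)
 also have "... = distr (GI I >< GI J) N T"
  using T by (intro distr_cong) (auto simp: space_pair_measure)
 finally show ?thesis ..
qed

lemma csum_simps: "i \<in> I ==> csum I J x y (Inl i) = x i" "j \<in> J ==> csum I J x y (Inr j) = y j"
 by (auto simp: csum_def)

lemma lf_Plus:
 assumes "finite I" "finite J"
 shows "lf R (I <+> J) A (csum I J x y) = (\<lambda>i\<in>R. (\<Sum>j\<in>I. A i (Inl j)*x j)+(\<Sum>j\<in>J. A i (Inr j)*y j))"
 unfolding lf_def
proof (intro restrict_ext)
 fix i
 show "(\<Sum>j\<in>I <+> J. A i j*csum I J x y j) = (\<Sum>j\<in>I. A i (Inl j)*x j)+(\<Sum>j\<in>J. A i (Inr j)*y j)"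
  using assms by (simp add: sum.Plus csum_def cong: sum.cong)
qed

text \<open>The two row systems are stacked over the disjoint sum of their row sets; the three
  hypotheses are the blocks of the common Gram matrix.\<close>

lemma distr_gram2:
 fixes A C :: "'b => _ => real" and B D :: "'e => _ => real"
 assumes fin: "finite R" "finite S" "finite J" "finite J'"
  and 1: "!!i i'. i \<in> R ==> i' \<in> R ==> (\<Sum>l\<in>J. A i l*A i' l) = (\<Sum>l\<in>J'. C i l*C i' l)"
  and 2: "!!i i'. i \<in> R ==> i' \<in> S ==> (\<Sum>l\<in>J. A i l*B i' l) = (\<Sum>l\<in>J'. C i l*D i' l)"
  and 3: "!!i i'. i \<in> S ==> i' \<in> S ==> (\<Sum>l\<in>J. B i l*B i' l) = (\<Sum>l\<in>J'. D i l*D i' l)"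
 shows "distr (GI J) (GI R >< GI S) (%w. (lf R J A w, lf S J B w)) = distr (GI J') (GI R >< GI S) (%w. (lf R J' C w, lf S J' D w))"
proof -
 define sp where "sp = (%v :: 'b + 'e => real. (\<lambda>i\<in>R. v (Inl i), \<lambda>i\<in>S. v (Inr i)))"
 have sp: "sp \<in> measurable (GI (R <+> S)) (GI R >< GI S)"
  unfolding sp_def by (intro measurable_Pair measurable_GI_restrict measurable_GI_component) auto
 have e: "(%w. (lf R K E w, lf S K F w)) = sp \<circ> lf (R <+> S) K (case_sum E F)" for K :: "'k set" and E F
  by (auto simp: sp_def lf_def fun_eq_iff)
 have d: "distr (GI K) (GI R >< GI S) (%w. (lf R K E w, lf S K F w)) = distr (distr (GI K) (GI (R <+> S)) (lf (R <+> S) K (case_sum E F))) (GI R >< GI S) sp" for K :: "'k set" and E F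
  unfolding e by (rule distr_distr[symmetric]) (use sp in auto)
 have "distr (GI J) (GI (R <+> S)) (lf (R <+> S) J (case_sum A B)) = distr (GI J') (GI (R <+> S)) (lf (R <+> S) J' (case_sum C D))"
 proof (rule distr_gram)
  fix i i' assume "i \<in> R <+> S" "i' \<in> R <+> S"
  then show "(\<Sum>l\<in>J. case_sum A B i l*case_sum A B i' l) = (\<Sum>l\<in>J'. case_sum C D i l*case_sum C D i' l)"
   using 1 2 3 2[of "case_sum id undefined i'" "case_sum undefined id i"] by (auto simp: mult.commute)
 qed (use fin in auto)
 then show ?thesis unfolding d by simp
qed

text \<open>Entries of a scalar multiple of the identity matrix. It turns vector operations such as
  \<open>mix\<close> into matrices to which the Gram criterion applies.\<close>

definition sc :: "real => 'a => 'a => real" where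
 "sc c i j = (if i = j then c else 0)"

lemma sum_sc: "finite I ==> i \<in> I ==> (\<Sum>j\<in>I. sc c i j*f j) = c*f i"
 "finite I ==> i \<in> I ==> (\<Sum>j\<in>I. f j * sc c i j) = f i*c"
 by (auto simp: sc_def if_distrib[of "%u. u * _"] if_distrib[of "%u. _ * u"] sum.delta' cong: if_cong)

lemma sum_sc1: "finite I ==> i \<in> I ==> (\<Sum>j\<in>I. sc c i j) = c"
 using sum_sc(1)[of I i c "%_. 1"] by simp

lemma sc_mult: "sc c i j * sc d i' j = (if i = i' then sc (c*d) i j else 0)"
 by (auto simp: sc_def)

definition mix :: "'a set => real => real => ('a => real) => ('a => real) => 'a => real" where
 "mix I a b x y = (\<lambda>i\<in>I. a*x i+b*y i)"

lemma mix_space [simp]: "mix I a b x y \<in> space (GI I)"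
 by (simp add: mix_def space_GI)

lemma measurable_mix [measurable (raw)]:
 assumes [measurable]: "f \<in> measurable M (GI I)" "g \<in> measurable M (GI I)"
 shows "(%p. mix I a b (f p) (g p)) \<in> measurable M (GI I)"
 unfolding mix_def
proof (rule measurable_GI_restrict)
 fix i assume i: "i \<in> I"
 have [measurable]: "(%p. f p i) \<in> borel_measurable M" "(%p. g p i) \<in> borel_measurable M"
  using measurable_compose[OF assms(1) measurable_GI_component[OF i]] measurable_compose[OF assms(2) measurable_GI_component[OF i]] by auto
 show "(%p. a*f p i+b*g p i) \<in> borel_measurable M" by measurable
qed

lemma mix_1_0: "x \<in> space (GI I) ==> mix I 1 0 x y = x" "y \<in> space (GI I) ==> mix I 0 1 x y = y"
 by (auto simp: mix_def fun_eq_iff space_GI PiE_def extensional_def)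

lemma mix_law:
 assumes I: "finite I" and e: "a^2+b^2 = a'^2+b'^2" "a*c+b*d = a'*c'+b'*d'" "c^2+d^2 = c'^2+d'^2"
 shows "distr (GI I >< GI I) (GI I >< GI I) (%(x, y). (mix I a b x y, mix I c d x y))
    = distr (GI I >< GI I) (GI I >< GI I) (%(x, y). (mix I a' b' x y, mix I c' d' x y))"
proof -
 let ?A = "%a b i. case_sum (sc a i) (sc b i)"
 have *: "distr (GI I >< GI I) (GI I >< GI I) (%(x, y). (mix I a b x y, mix I c d x y))
  = distr (GI (I <+> I)) (GI I >< GI I) (%w. (lf I (I <+> I) (?A a b) w, lf I (I <+> I) (?A c d) w))" for a b c d
  using I by (intro pair_law) (auto simp: lf_Plus sum_sc mix_def fun_eq_iff)
 have g: "(\<Sum>l\<in>I <+> I. ?A a b i l*?A c d i' l) = (if i = i' then a*c+b*d else 0)" if "i \<in> I" for a b c d i i'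
  using I that by (auto simp: sum.Plus sc_mult sum_sc1)
 show ?thesis unfolding *
  using I e by (intro distr_gram2) (simp_all add: g power2_eq_square)
qed

text \<open>A third independent vector is required because the increment formula for
  \<open>FF\<close> freezes a component shared by two correlated points.\<close>

lemma mix_law3:
 assumes I: "finite I" and e: "a^2+b^2+e^2 = a'^2+b'^2" "a*c+b*d+e*g = a'*c'+b'*d'" "c^2+d^2+g^2 = c'^2+d'^2"
 shows "distr (GI I >< (GI I >< GI I)) (GI I >< GI I) (%(x, (y, z)). (mix I 1 e (mix I a b x y) z, mix I 1 g (mix I c d x y) z))
    = distr (GI I >< GI I) (GI I >< GI I) (%(x, y). (mix I a' b' x y, mix I c' d' x y))"
proof -
 have ps: "prob_space (GI I)" by (rule prob_GI)
 let ?A = "%a b i. case_sum (sc a i) (sc b i)"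
 let ?B = "%a b e i. case_sum (sc a i) (case_sum (sc b i) (sc e i))"
 have 1: "distr (GI I >< GI I) (GI I >< GI I) (%(x, y). (mix I a b x y, mix I c d x y))
  = distr (GI (I <+> I)) (GI I >< GI I) (%w. (lf I (I <+> I) (?A a b) w, lf I (I <+> I) (?A c d) w))" for a b c d
  using I by (intro pair_law) (auto simp: lf_Plus sum_sc mix_def fun_eq_iff)
 have g1: "(\<Sum>l\<in>I <+> I. ?A a b i l*?A c d i' l) = (if i = i' then a*c+b*d else 0)" if "i \<in> I" for a b c d i i'
  using I that by (auto simp: sum.Plus sc_mult sum_sc1)
 have g2: "(\<Sum>l\<in>I <+> (I <+> I). ?B a b e i l*?B c d g i' l) = (if i = i' then a*c+b*d+e*g else 0)" if "i \<in> I" for a b c d e g i i'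
  using I that by (auto simp: sum.Plus sc_mult sum_sc1)
 let ?T = "%(x, w). (lf I (I <+> (I <+> I)) (?B a b e) (csum I (I <+> I) x w), lf I (I <+> (I <+> I)) (?B c d g) (csum I (I <+> I) x w))"
 have T: "?T \<in> measurable (GI I >< GI (I <+> I)) (GI I >< GI I)"
  using measurable_compose[OF csum_measurable lf_measurable] by (auto simp: split_beta' intro!: measurable_Pair)
 have P: "distr (GI I >< (GI I >< GI I)) (GI I >< GI (I <+> I)) (%(x, (y, z)). (x, csum I I y z)) = GI I >< GI (I <+> I)"
 proof -
  have "distr (GI I) (GI I) (%x. x) >< distr (GI I >< GI I) (GI (I <+> I)) (%(y, z). csum I I y z)
   = distr (GI I >< (GI I >< GI I)) (GI I >< GI (I <+> I)) (%(x, p). (x, (%(y, z). csum I I y z) p))"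
   using csum_measurable[of I I] by (intro pair_measure_distr) (auto simp: GI_Plus[OF I I] intro!: prob_space_imp_sigma_finite prob_GI)
  then show ?thesis unfolding GI_Plus[OF I I] by (simp add: distr_id split_beta')
 qed
 have m1: "(%(x, (y, z)). (x, csum I I y z)) \<in> measurable (GI I >< (GI I >< GI I)) (GI I >< GI (I <+> I))"
  using csum_measurable[of I I] by (auto simp: split_beta' intro!: measurable_Pair measurable_compose[OF measurable_snd csum_measurable[unfolded split_beta']])
 have "distr (GI I >< (GI I >< GI I)) (GI I >< GI I) (%(x, (y, z)). (mix I 1 e (mix I a b x y) z, mix I 1 g (mix I c d x y) z))
   = distr (GI I >< (GI I >< GI I)) (GI I >< GI I) (?T \<circ> (%(x, (y, z)). (x, csum I I y z)))"
  using I by (intro distr_cong) (auto simp: lf_Plus sum_sc sum.Plus mix_def fun_eq_iff csum_simps cong: sum.cong)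
 also have "... = distr (GI I >< GI (I <+> I)) (GI I >< GI I) ?T"
  by (subst distr_distr[symmetric, OF T m1]) (simp only: P)
 also have "... = distr (GI (I <+> (I <+> I))) (GI I >< GI I) (%w. (lf I (I <+> (I <+> I)) (?B a b e) w, lf I (I <+> (I <+> I)) (?B c d g) w))"
  using I by (intro pair_law) auto
 also have "... = distr (GI (I <+> I)) (GI I >< GI I) (%w. (lf I (I <+> I) (?A a' b') w, lf I (I <+> I) (?A c' d') w))"
  using I e by (intro distr_gram2) (simp_all add: g1 g2 power2_eq_square)
 finally show ?thesis unfolding 1 .
qed

lemma mix_integral2:
 assumes I: "finite I" and e: "a^2+b^2 = a'^2+b'^2" "a*c+b*d = a'*c'+b'*d'" "c^2+d^2 = c'^2+d'^2"
  and G: "bdd (GI I >< GI I) B (%(u, v). G u v)"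
 shows "(LINT x|GI I. LINT y|GI I. G (mix I a b x y) (mix I c d x y)) = (LINT x|GI I. LINT y|GI I. G (mix I a' b' x y) (mix I c' d' x y))"
proof -
 have m: "(%(x, y). (mix I a b x y, mix I c d x y)) \<in> measurable (GI I >< GI I) (GI I >< GI I)" for a b c d
  by measurable
 have "bdd (GI I >< GI I) B (%(x, y). G (mix I a b x y) (mix I c d x y))" for a b c d
  using bdd_compose[OF G m] by (simp add: split_beta')
 note f = bdd_fubini(1)[OF prob_GI prob_GI this]
 have "(LINT p|(GI I >< GI I). (%(u, v). G u v) ((%(x, y). (mix I a b x y, mix I c d x y)) p)) = (LINT p|(distr (GI I >< GI I) (GI I >< GI I) (%(x, y). (mix I a b x y, mix I c d x y))). (%(u, v). G u v) p)" for a b c d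
  using m bddD(1)[OF G] by (rule integral_distr[symmetric])
 from this[of a b c d] this[of a' b' c' d'] show ?thesis unfolding f mix_law[OF I e] by (simp add: split_beta')
qed

lemma mix_integral1:
 assumes I: "finite I" and e: "a^2+b^2 = 1" and G: "bdd (GI I) B G"
 shows "(LINT x|GI I. LINT y|GI I. G (mix I a b x y)) = (LINT x|GI I. G x)"
proof -
 have "bdd (GI I >< GI I) B (%(u, v). G u)" using bdd_compose[OF G measurable_fst] by (simp add: split_beta')
 from mix_integral2[OF I _ _ _ this, of a b 1 0 1 0 1 0] e I
 have "(LINT x|GI I. LINT y|GI I. G (mix I a b x y)) = (LINT x|GI I. LINT y|GI I. G (mix I 1 0 x y))"
  using mix_integral2[OF I _ _ _ \<open>bdd _ B (%(u, v). G u)\<close>, of a b 1 0 0 0 0 0] by simp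
 also have "... = (LINT x|GI I. G x)"
  by (intro Bochner_Integration.integral_cong) (auto simp: mix_1_0 GI.prob_space)
 finally show ?thesis .
qed

section \<open>The noise operator and noise stability\<close>

text \<open>The Ornstein-Uhlenbeck operator, parametrized by the correlation
  \<open>r = exp (- t)\<close> instead of the time, so that composition multiplies
  parameters.\<close>

definition NO :: "'a set => real => (('a => real) => real) => ('a => real) => real" where
 "NO I r f x = (LINT y|GI I. f (mix I r (sqrt (1 - r^2)) x y))"

lemma noise_NO: "noise n t f x = NO {..<n} (exp (- t)) f x"
 by (simp add: noise_def NO_def gaussian_GI mix_def exp_double[symmetric] power2_eq_square flip: exp_add)

lemma bdd_mix2:
 assumes "bdd (GI I) b f"
 shows "bdd (GI I >< GI I) b (%(x, y). f (mix I a c x y))"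
proof -
 have "(%p. mix I a c (fst p) (snd p)) \<in> measurable (GI I >< GI I) (GI I)" by measurable
 from bdd_compose[OF assms this] show ?thesis by (simp add: split_beta')
qed

lemma bdd_fst: "bdd M b f ==> bdd (M >< N) b (%(x, y). f x)"
 using bdd_compose[OF _ measurable_fst, of M b f N] by (simp add: split_beta')

lemma bdd_snd: "bdd N b f ==> bdd (M >< N) b (%(x, y). f y)"
 using bdd_compose[OF _ measurable_snd, of N b f M] by (simp add: split_beta')

lemma bdd_mult2: "bdd M b (%(x, y). f x y) ==> bdd M c (%(x, y). g x y) ==> bdd M (b*c) (%(x, y). f x y*g x y)"
 using bdd_mult[of M b "%(x, y). f x y" c "%(x, y). g x y"] by (simp add: split_beta')

lemma bdd_NO: "bdd (GI I) b f ==> bdd (GI I) b (NO I r f)"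
 unfolding NO_def by (intro bdd_fubini(3)[OF prob_GI prob_GI] bdd_mix2)

lemma bdd_NO_integrand:
 assumes "bdd (GI I) b f" "x \<in> space (GI I)"
 shows "bdd (GI I) b (%y. f (mix I r c x y))"
 by (rule bdd_fubini(5)[OF prob_GI prob_GI bdd_mix2[OF assms(1)] assms(2)])

lemma integral_mult_NO:
 assumes "bdd (GI I) b f" "bdd (GI I) c g"
 shows "(LINT x|GI I. f x*NO I r g x) = (LINT x|GI I. LINT y|GI I. f x*g (mix I r (sqrt (1 - r^2)) x y))"
 unfolding NO_def by (intro Bochner_Integration.integral_cong) auto

text \<open>A pair of standard Gaussian vectors with correlation \<open>r\<close> is
  exchangeable.\<close>

lemma NO_sym:
 assumes I: "finite I" and f: "bdd (GI I) b f" and g: "bdd (GI I) c g" and r: "\<bar>r\<bar> <= 1"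
 shows "(LINT x|GI I. f x*NO I r g x) = (LINT x|GI I. NO I r f x*g x)"
proof -
 let ?s = "sqrt (1 - r^2)"
 have s: "?s^2 = 1 - r^2" using r by (simp add: abs_square_le_1)
 have B: "bdd (GI I >< GI I) (b*c) (%(u, v). f u*g v)"
  using bdd_mult2[OF bdd_fst[OF f] bdd_snd[OF g]] .
 have "(LINT x|GI I. f x*NO I r g x) = (LINT x|GI I. LINT y|GI I. f (mix I 1 0 x y)*g (mix I r ?s x y))"
  unfolding integral_mult_NO[OF f g] by (intro Bochner_Integration.integral_cong) (auto simp: mix_1_0)
 also have "... = (LINT x|GI I. LINT y|GI I. f (mix I r ?s x y)*g (mix I 1 0 x y))"
  using s by (intro mix_integral2[OF I _ _ _ B]) auto
 also have "... = (LINT x|GI I. NO I r f x*g x)"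
  unfolding NO_def by (intro Bochner_Integration.integral_cong) (auto simp: mix_1_0)
 finally show ?thesis .
qed

lemma NO_NO:
 assumes I: "finite I" and f: "bdd (GI I) b f" and r: "0 <= r" "r <= 1" "0 <= q" "q <= 1" and x: "x \<in> space (GI I)"
 shows "NO I r (NO I q f) x = NO I (r*q) f x"
proof -
 let ?s = "sqrt (1 - r^2)" and ?u = "sqrt (1 - q^2)" and ?t = "sqrt (1 - (r*q)^2)"
 have s: "?s^2 = 1 - r^2" "?u^2 = 1 - q^2" "?t^2 = 1 - (r*q)^2"
  using r mult_mono[of r 1 q 1] by (auto simp: abs_square_le_1)
 have e: "(q*?s)^2+?u^2 = ?t^2"
 proof -
  have "(q*?s)^2 = q^2*(1 - r^2)" by (simp only: power_mult_distrib s(1))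
  then show ?thesis unfolding s(2,3) by (simp add: power_mult_distrib algebra_simps)
 qed
 show ?thesis
 proof (cases "?t = 0")
  case True
  then have z: "(q*?s)^2+?u^2 = 0" using e by simp
  then have "q*?s = 0" "?u = 0" by (simp_all only: sum_power2_eq_zero_iff)
  then have "mix I q ?u (mix I r ?s x y) z = mix I (r*q) ?t x y" for y z
   using True by (auto simp: mix_def fun_eq_iff)
  then show ?thesis by (simp add: NO_def GI.prob_space)
 next
  case False
  \<comment> \<open>The two independent noises, of sizes \<open>q*?s\<close> and \<open>?u\<close>,
    are merged into one standard vector. This divides by the total size \<open>?t\<close>, so the
    noiseless case was treated before.\<close>
  define al be where "al = q*?s/?t" and "be = ?u/?t"
  have ab: "al^2+be^2 = 1" using e False unfolding al_def be_def power_divide by (simp add: add_divide_distrib[symmetric])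
  have "mix I q ?u (mix I r ?s x y) z = mix I (r*q) ?t x (mix I al be y z)" for y z
   using False by (auto simp: mix_def fun_eq_iff al_def be_def algebra_simps)
  then have "NO I r (NO I q f) x = (LINT y|GI I. LINT z|GI I. f (mix I (r*q) ?t x (mix I al be y z)))"
   by (simp add: NO_def)
  also have "... = (LINT y|GI I. f (mix I (r*q) ?t x y))"
   by (rule mix_integral1[OF I ab bdd_NO_integrand[OF f x]])
  finally show ?thesis by (simp add: NO_def)
 qed
qed

lemma NO_integral:
 assumes I: "finite I" and f: "bdd (GI I) b f" and r: "\<bar>r\<bar> <= 1"
 shows "(LINT x|GI I. NO I r f x) = (LINT x|GI I. f x)"
 unfolding NO_def using r by (intro mix_integral1[OF I _ f]) (simp add: abs_square_le_1)

text \<open>The noise stability of \<open>f\<close>: the correlation between the values of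
  \<open>f\<close> at two \<open>r\<close>-correlated points.\<close>

definition FF :: "'a set => (('a => real) => real) => real => real" where
 "FF I f r = (LINT x|GI I. f x*NO I r f x)"

lemma FF_NO:
 assumes I: "finite I" and f: "bdd (GI I) b f" and q: "0 <= q" "q <= 1" and r: "0 <= r" "r <= 1"
 shows "FF I (NO I q f) r = FF I f (q^2*r)"
proof -
 have qr: "q*r <= 1" "0 <= q*r" "r*q <= 1" using q r mult_mono[of q 1 r 1] by (auto simp: mult.commute)
 have "FF I (NO I q f) r = (LINT x|GI I. NO I q f x*NO I (r*q) f x)"
  unfolding FF_def using q r by (intro Bochner_Integration.integral_cong) (auto simp: NO_NO[OF I f])
 also have "... = (LINT x|GI I. f x*NO I q (NO I (r*q) f) x)"
  using q by (intro NO_sym[OF I f bdd_NO[OF f], symmetric]) auto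
 also have "... = FF I f (q^2*r)"
  unfolding FF_def using q qr by (intro Bochner_Integration.integral_cong) (auto simp: NO_NO[OF I f] power2_eq_square mult_ac)
 finally show ?thesis .
qed

lemma FF_1:
 assumes "bdd (GI I) b f"
 shows "FF I f 1 = (LINT x|GI I. (f x)^2)"
 unfolding FF_def NO_def power2_eq_square
 by (intro Bochner_Integration.integral_cong) (auto simp: mix_1_0 GI.prob_space)

lemma FF_0: "finite I ==> bdd (GI I) b f ==> FF I f 0 = (LINT x|GI I. f x)^2"
proof -
 have "NO I 0 f x = (LINT x|GI I. f x)" for x
  unfolding NO_def by (intro Bochner_Integration.integral_cong) (auto simp: mix_1_0)
 then show "FF I f 0 = (LINT x|GI I. f x)^2" by (simp add: FF_def power2_eq_square)
qed

lemma NO_L2: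
 assumes I: "finite I" and f: "bdd (GI I) b f" and q: "0 <= q" "q <= 1"
 shows "(LINT x|GI I. (NO I q f x)^2) = FF I f (q^2)"
 using FF_NO[OF I f q, of 1] FF_1[OF bdd_NO[OF f]] by simp

lemma FF_nonneg:
 assumes I: "finite I" and f: "bdd (GI I) b f" and r: "0 <= r" "r <= 1"
 shows "0 <= FF I f r"
proof -
 have "0 <= (LINT x|GI I. (NO I (sqrt r) f x)^2)" by simp
 then show ?thesis using NO_L2[OF I f, of "sqrt r"] r by simp
qed

lemma FF_le_1:
 assumes I: "finite I" and f: "bdd (GI I) b f" and r: "0 <= r" "r <= 1"
 shows "FF I f r <= FF I f 1"
proof -
 let ?q = "sqrt r" let ?s = "sqrt (1 - ?q^2)"
 have f2: "bdd (GI I) (b^2) (%x. (f x)^2)" by (rule bdd_power2[OF f])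
 have "(NO I ?q f x)^2 <= NO I ?q (%x. (f x)^2) x" if "x \<in> space (GI I)" for x
  unfolding NO_def
  by (intro GI.power2_integral_le GI.bdd_integrable[OF bdd_NO_integrand[OF f that]] GI.bdd_integrable[OF bdd_NO_integrand[OF f2 that]])
 then have "(LINT x|GI I. (NO I ?q f x)^2) <= (LINT x|GI I. NO I ?q (%x. (f x)^2) x)"
  by (intro integral_mono GI.bdd_integrable[OF bdd_power2[OF bdd_NO[OF f]]] GI.bdd_integrable[OF bdd_NO[OF f2]])
 also have "... = FF I f 1" unfolding FF_1[OF f] using r by (intro NO_integral[OF I f2]) auto
 finally show ?thesis using NO_L2[OF I f, of ?q] r by simp
qed

lemma FF_bilinear:
 assumes I: "finite I" and f: "bdd (GI I) b f" and g: "bdd (GI I) c g" and r: "\<bar>r\<bar> <= 1"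
 shows "FF I (%x. f x - g x) r = FF I f r - 2*(LINT x|GI I. f x*NO I r g x)+FF I g r"
proof -
 have 1: "NO I r (%x. f x - g x) x = NO I r f x - NO I r g x" if "x \<in> space (GI I)" for x
  unfolding NO_def using GI.bdd_integrable[OF bdd_NO_integrand[OF f that]] GI.bdd_integrable[OF bdd_NO_integrand[OF g that]]
  by simp
 note i = GI.bdd_integrable[OF bdd_mult[OF f bdd_NO[OF f]]] GI.bdd_integrable[OF bdd_mult[OF f bdd_NO[OF g]]]
  GI.bdd_integrable[OF bdd_mult[OF g bdd_NO[OF f]]] GI.bdd_integrable[OF bdd_mult[OF g bdd_NO[OF g]]]
 have "FF I (%x. f x - g x) r = (LINT x|GI I. f x*NO I r f x - f x*NO I r g x - (g x*NO I r f x - g x*NO I r g x))"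
  unfolding FF_def by (intro Bochner_Integration.integral_cong) (auto simp: 1 algebra_simps)
 also have "... = FF I f r - (LINT x|GI I. f x*NO I r g x) - ((LINT x|GI I. g x*NO I r f x) - FF I g r)"
  using i by (simp add: FF_def)
 also have "(LINT x|GI I. g x*NO I r f x) = (LINT x|GI I. f x*NO I r g x)"
  using NO_sym[OF I f g r] by (simp add: mult.commute)
 finally show ?thesis by simp
qed

lemma mix_integral3:
 assumes I: "finite I" and e: "a^2+b^2+e^2 = a'^2+b'^2" "a*c+b*d+e*g = a'*c'+b'*d'" "c^2+d^2+g^2 = c'^2+d'^2"
  and G: "bdd (GI I >< GI I) B (%(u, v). G u v)"
 shows "(LINT x|GI I. LINT y|GI I. LINT z|GI I. G (mix I 1 e (mix I a b x y) z) (mix I 1 g (mix I c d x y) z))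
    = (LINT x|GI I. LINT y|GI I. G (mix I a' b' x y) (mix I c' d' x y))"
proof -
 let ?P = "GI I >< GI I"
 have pp: "prob_space ?P" by (intro prob_space_pairI prob_GI)
 let ?T = "%(x, (y, z)). (mix I 1 e (mix I a b x y) z, mix I 1 g (mix I c d x y) z)"
 let ?S = "%(x, y). (mix I a' b' x y, mix I c' d' x y)"
 have T: "?T \<in> measurable (GI I >< ?P) ?P" by measurable
 have S: "?S \<in> measurable ?P ?P" by measurable
 have bT: "bdd (GI I >< ?P) B (%(x, p). G (mix I 1 e (mix I a b x (fst p)) (snd p)) (mix I 1 g (mix I c d x (fst p)) (snd p)))"
  using bdd_compose[OF G T] by (simp add: split_beta')
 have bS: "bdd ?P B (%(x, y). G (mix I a' b' x y) (mix I c' d' x y))"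
  using bdd_compose[OF G S] by (simp add: split_beta')
 have in1: "(LINT y|GI I. LINT z|GI I. G (mix I 1 e (mix I a b x y) z) (mix I 1 g (mix I c d x y) z))
   = (LINT p|?P. G (mix I 1 e (mix I a b x (fst p)) (snd p)) (mix I 1 g (mix I c d x (fst p)) (snd p)))" if x: "x \<in> space (GI I)" for x
  using bdd_fubini(5)[OF prob_GI pp bT x]
  by (intro bdd_fubini(1)[OF prob_GI prob_GI, where b = B]) (simp add: split_beta')
 have "(LINT x|GI I. LINT y|GI I. LINT z|GI I. G (mix I 1 e (mix I a b x y) z) (mix I 1 g (mix I c d x y) z))
  = (LINT p|(GI I >< ?P). (%(u, v). G u v) (?T p))"
  using bdd_fubini(1)[OF prob_GI pp bT] by (simp add: in1 split_beta' cong: Bochner_Integration.integral_cong)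
 also have "... = (LINT p|distr (GI I >< ?P) ?P ?T. (%(u, v). G u v) p)"
  using T bddD(1)[OF G] by (rule integral_distr[symmetric])
 also have "... = (LINT p|distr ?P ?P ?S. (%(u, v). G u v) p)"
  unfolding mix_law3[OF I e] ..
 also have "... = (LINT p|?P. (%(u, v). G u v) (?S p))"
  using S bddD(1)[OF G] by (rule integral_distr)
 also have "... = (LINT x|GI I. LINT y|GI I. G (mix I a' b' x y) (mix I c' d' x y))"
  using bdd_fubini(1)[OF prob_GI prob_GI bS] by (simp add: split_beta')
 finally show ?thesis .
qed

lemma mix_swap: "mix I a b x y = mix I b a y x"
 by (auto simp: mix_def)

text \<open>An increment of \<open>FF\<close> is an average of values of \<open>FF\<close> for
  centered functions. Two points sharing the component \<open>sqrt a * z\<close>, with correlation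
  \<open>s/(1 - a)\<close> in the remaining part, have total correlation
  \<open>a + (1 - a)*(s/(1 - a)) = s + a\<close>; subtracting the mean over \<open>z\<close> removes
  exactly the value at \<open>s\<close>.\<close>

lemma FF_increment:
 assumes I: "finite I" and f: "bdd (GI I) b f" and s: "0 <= s" and a: "0 <= a" "a < 1" "s+a <= 1"
 defines "K == %z y. f (mix I (sqrt a) (sqrt (1 - a)) z y) - NO I (sqrt (1 - a)) f y"
 shows "FF I f (s+a) - FF I f s = (LINT z|GI I. FF I (K z) (s/(1 - a)))"
  "z \<in> space (GI I) ==> bdd (GI I) (b+b) (K z)"
  "0 <= r ==> r <= 1 ==> integrable (GI I) (%z. FF I (K z) r)"
proof -
 define q where "q = sqrt (1 - a)"
 define p where "p = sqrt a"
 have q: "0 <= q" "q <= 1" "q^2 = 1 - a" using a by (auto simp: q_def)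
 have p: "0 <= p" "p^2 = a" "sqrt (1 - q^2) = p" using a q by (auto simp: p_def)
 define H where "H = (%z y. f (mix I p q z y))"
 define N where "N = NO I q f"
 have N: "bdd (GI I) b N" unfolding N_def by (rule bdd_NO[OF f])
 have KH: "K = (%z y. H z y - N y)" by (simp add: K_def H_def N_def p_def q_def)
 have H2: "bdd (GI I >< GI I) b (%(z, y). H z y)" unfolding H_def by (rule bdd_mix2[OF f])
 have H: "bdd (GI I) b (H z)" if "z \<in> space (GI I)" for z
  using bdd_fubini(5)[OF prob_GI prob_GI H2 that] .
 show K: "bdd (GI I) (b+b) (K z)" if "z \<in> space (GI I)" for z
  unfolding KH using bdd_diff[OF H[OF that] N] .
 have HN: "(LINT z|GI I. H z y) = N y" for y
  unfolding H_def N_def NO_def p(3) by (simp add: mix_swap[of I q p])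
 have iN: "integrable (GI I) (%z. (LINT x|GI I. H z x*NO I r N x))"
  and eN: "(LINT z|GI I. LINT x|GI I. H z x*NO I r N x) = FF I N r" for r
 proof -
  have B: "bdd (GI I >< GI I) (b*b) (%(z, x). H z x*NO I r N x)"
   by (rule bdd_mult2[OF H2 bdd_snd[OF bdd_NO[OF N]]])
  show "integrable (GI I) (%z. (LINT x|GI I. H z x*NO I r N x))"
   using bdd_fubini(3)[OF prob_GI prob_GI B] by (rule GI.bdd_integrable)
  have "(LINT z|GI I. LINT x|GI I. H z x*NO I r N x) = (LINT x|GI I. LINT z|GI I. H z x*NO I r N x)"
   by (rule bdd_fubini(2)[OF prob_GI prob_GI B])
  also have "... = FF I N r" by (simp add: HN FF_def)
  finally show "(LINT z|GI I. LINT x|GI I. H z x*NO I r N x) = FF I N r" .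
 qed
 have P3: "prob_space (GI I >< GI I)" by (intro prob_space_pairI prob_GI)
 have HHm: "bdd (GI I >< (GI I >< GI I)) (b*b) (%(z, w). H z (fst w)*H z (mix I r (sqrt (1 - r^2)) (fst w) (snd w)))" for r
 proof -
  have m1: "(%p. mix I p' q (fst p) (fst (snd p))) \<in> measurable (GI I >< (GI I >< GI I)) (GI I)" for p' by measurable
  have m2: "(%p. mix I p' q (fst p) (mix I r (sqrt (1 - r^2)) (fst (snd p)) (snd (snd p)))) \<in> measurable (GI I >< (GI I >< GI I)) (GI I)" for p' by measurable
  show ?thesis
   using bdd_mult[OF bdd_compose[OF f m1[of p]] bdd_compose[OF f m2[of p]]] by (simp add: H_def split_beta')
 qed
 have FH: "FF I (H z) r = (LINT w|(GI I >< GI I). H z (fst w)*H z (mix I r (sqrt (1 - r^2)) (fst w) (snd w)))" if z: "z \<in> space (GI I)" for z r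
  unfolding FF_def integral_mult_NO[OF H[OF z] H[OF z]]
  using bdd_fubini(5)[OF prob_GI P3 HHm z]
  by (intro bdd_fubini(1)[OF prob_GI prob_GI, where b = "b*b"]) (simp add: split_beta')
 have iH: "integrable (GI I) (%z. FF I (H z) r)" for r
 proof -
  have "integrable (GI I) (%z. (LINT w|(GI I >< GI I). H z (fst w)*H z (mix I r (sqrt (1 - r^2)) (fst w) (snd w))))"
   using bdd_fubini(3)[OF prob_GI P3 HHm] by (rule GI.bdd_integrable)
  then show ?thesis by (rule Bochner_Integration.integrable_cong[THEN iffD1, rotated -1]) (auto simp: FH)
 qed
 have bil: "FF I (K z) r = FF I (H z) r - 2*(LINT x|GI I. H z x*NO I r N x)+FF I N r" if "z \<in> space (GI I)" "0 <= r" "r <= 1" for z r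
  unfolding KH using that by (intro FF_bilinear[OF I H N]) auto
 have ik: "integrable (GI I) (%z. FF I (H z) r - 2*(LINT x|GI I. H z x*NO I r N x)+FF I N r)" for r
  using iH iN by (intro Bochner_Integration.integrable_add Bochner_Integration.integrable_diff integrable_mult_right integrable_const) auto
 show "integrable (GI I) (%z. FF I (K z) r)" if "0 <= r" "r <= 1"
  using ik[of r] that by (rule_tac Bochner_Integration.integrable_cong[THEN iffD1, rotated -1]) (auto simp: bil)
 let ?r = "s/(1 - a)" let ?rh = "sqrt (1 - ?r^2)"
 have r: "0 <= ?r" "?r <= 1" using s a by (auto simp: field_simps)
 have sa: "(1 - a)*?r = s" using a by simp
 have "?r^2 <= 1" using r by (intro power_le_one) auto
 then have r2: "?rh^2 = 1 - ?r^2" by simp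
 have sa2: "(sqrt (1 - (s+a)^2))^2 = 1 - (s+a)^2" using s a by (simp add: abs_square_le_1)
 have "(LINT z|GI I. FF I (K z) ?r) = (LINT z|GI I. FF I (H z) ?r - 2*(LINT x|GI I. H z x*NO I ?r N x)+FF I N ?r)"
  using r by (intro Bochner_Integration.integral_cong) (auto simp: bil)
 \<comment> \<open>The mean of \<open>H z\<close> over \<open>z\<close> is \<open>N\<close>, so the
   cross term contributes \<open>- 2*FF I N ?r\<close> and the last term restores one of the
   two.\<close>
 also have "... = (LINT z|GI I. FF I (H z) ?r) - FF I N ?r"
  using iH iN by (simp add: eN GI.prob_space)
 also have "FF I N ?r = FF I f s"
  unfolding N_def FF_NO[OF I f q(1,2) r] q(3) sa ..
 also have "(LINT z|GI I. FF I (H z) ?r) = FF I f (s+a)"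
 proof -
  have "(LINT z|GI I. FF I (H z) ?r) = (LINT z|GI I. LINT x|GI I. LINT y|GI I. H z x*H z (mix I ?r ?rh x y))"
   unfolding FF_def using H by (intro Bochner_Integration.integral_cong integral_mult_NO) auto
  also have "... = (LINT z|GI I. LINT x|GI I. LINT y|GI I. f (mix I 1 0 (mix I p q z x) y)*f (mix I 1 (q*?rh) (mix I p (q*?r) z x) y))"
  proof -
   have "mix I p q z (mix I ?r ?rh x y) = mix I 1 (q*?rh) (mix I p (q*?r) z x) y" for x y z
    by (auto simp: mix_def fun_eq_iff algebra_simps)
   then show ?thesis by (simp add: H_def mix_1_0)
  qed
  also have "... = (LINT x|GI I. LINT y|GI I. f (mix I 1 0 x y)*f (mix I (s+a) (sqrt (1 - (s+a)^2)) x y))"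
  proof (rule mix_integral3[OF I])
   show "bdd (GI I >< GI I) (b*b) (%(u, v). f u*f v)"
    by (rule bdd_mult2[OF bdd_fst[OF f] bdd_snd[OF f]])
   show "p^2+q^2+0^2 = 1^2+0^2" by (simp add: p q)
   have "p*p+q*(q*?r) = a+(1 - a)*?r" using p(2) q(3) by (simp add: power2_eq_square flip: mult.assoc)
   then show "p*p+q*(q*?r)+0*(q*?rh) = 1*(s+a)+0 * sqrt (1 - (s+a)^2)" using sa by simp
   show "p^2+(q*?r)^2+(q*?rh)^2 = (s+a)^2+(sqrt (1 - (s+a)^2))^2"
    unfolding power_mult_distrib p q r2 sa2 by (simp add: algebra_simps)
  qed
  also have "... = FF I f (s+a)"
   unfolding FF_def integral_mult_NO[OF f f] by (intro Bochner_Integration.integral_cong) (auto simp: mix_1_0)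
  finally show ?thesis .
 qed
 finally show "FF I f (s+a) - FF I f s = (LINT z|GI I. FF I (K z) (s/(1 - a)))" by simp
qed

primrec fdiff :: "real => nat => (real => real) => real => real" where
 "fdiff a 0 g s = g s"
| "fdiff a (Suc j) g s = fdiff a j (%s. g (s+a) - g s) s"

lemma fdiff_cong:
 "(!!i. i <= j ==> g (s+real i*a) = h (s+real i*a)) ==> fdiff a j g s = fdiff a j h s"
proof (induction j arbitrary: g h)
 case (Suc j)
 show ?case
  unfolding fdiff.simps
 proof (rule Suc.IH)
  fix i assume "i <= j"
  then show "g (s+real i*a+a) - g (s+real i*a) = h (s+real i*a+a) - h (s+real i*a)"
   using Suc.prems[of "Suc i"] Suc.prems[of i] by (simp add: algebra_simps)
 qed
next
 case 0
 from 0[of 0] show ?case by simp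
qed

lemma fdiff_scale: "fdiff a j (%s. g (s/c)) s = fdiff (a/c) j g (s/c)"
 by (induction j arbitrary: g) (simp_all add: add_divide_distrib)

lemma fdiff_integral:
 assumes "!!i. i <= j ==> integrable M (%z. G z (s+real i*a))"
 shows "fdiff a j (%s. (LINT z|M. G z s)) s = (LINT z|M. fdiff a j (G z) s)"
 using assms
proof (induction j arbitrary: G)
 case (Suc j)
 have i: "integrable M (%z. G z (s+real i*a+a))" if "i <= j" for i
  using Suc.prems[of "Suc i"] that by (simp add: algebra_simps)
 have "fdiff a j (%s. (LINT z|M. G z (s+a)) - (LINT z|M. G z s)) s = fdiff a j (%s. (LINT z|M. G z (s+a) - G z s)) s"
  using i Suc.prems by (intro fdiff_cong Bochner_Integration.integral_diff[symmetric]) auto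
 also have "... = (LINT z|M. fdiff a j (%s. G z (s+a) - G z s) s)"
  using i Suc.prems by (intro Suc.IH Bochner_Integration.integrable_diff) auto
 finally show ?case by simp
qed simp

text \<open>One difference is consumed by \<open>FF_increment\<close>, which rescales base point and
  step by \<open>1/(1 - a)\<close>. Under this rescaling the range condition for
  \<open>Suc j\<close> becomes the one for \<open>j\<close>. The function changes to
  \<open>K z\<close> with bound \<open>b+b\<close>, hence the generalization over \<open>f\<close>
  and \<open>b\<close>.\<close>

lemma fdiff_FF_nonneg:
 assumes I: "finite I" and "bdd (GI I) b f" "0 <= s" "0 <= a" "s+real j*a < 1"
 shows "0 <= fdiff a j (FF I f) s"
 using assms(2-)
proof (induction j arbitrary: f b s a)
 case 0
 then show ?case using FF_nonneg[OF I, of b f s] by simp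
next
 case (Suc j)
 note f = Suc.prems(1)
 have ja: "0 <= real j*a" using Suc.prems(3) by simp
 have "real (Suc j)*a = real j*a+a" by (simp add: algebra_simps)
 then have a: "0 <= a" "a < 1" "s+real j*a+a < 1" using Suc.prems ja by linarith+
 define K where "K = (%z y. f (mix I (sqrt a) (sqrt (1 - a)) z y) - NO I (sqrt (1 - a)) f y)"
 have dom: "0 <= s+real i*a" "s+real i*a+a <= 1" if "i <= j" for i
 proof -
  have "real i*a <= real j*a" using that a by (intro mult_right_mono) auto
  then show "0 <= s+real i*a" "s+real i*a+a <= 1" using a Suc.prems(2) by auto
 qed
 have r: "0 <= (s+real i*a)/(1 - a)" "(s+real i*a)/(1 - a) <= 1" if "i <= j" for i
  using dom[OF that] a by (auto simp: field_simps)
 have "fdiff a (Suc j) (FF I f) s = fdiff a j (%s. (LINT z|GI I. FF I (K z) (s/(1 - a)))) s"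
  unfolding fdiff.simps K_def using dom a by (intro fdiff_cong FF_increment(1)[OF I f]) auto
 also have "... = (LINT z|GI I. fdiff a j (%s. FF I (K z) (s/(1 - a))) s)"
  unfolding K_def using r a by (intro fdiff_integral FF_increment(3)[OF I f, of 0 a]) auto
 also have "... = (LINT z|GI I. fdiff (a/(1 - a)) j (FF I (K z)) (s/(1 - a)))"
  unfolding fdiff_scale ..
 also have "0 <= ..."
 proof (rule integral_nonneg_AE, rule AE_I2)
  fix z assume z: "z \<in> space (GI I)"
  have "s/(1 - a)+real j*(a/(1 - a)) = (s+real j*a)/(1 - a)" by (simp add: add_divide_distrib)
  also have "... < 1" using a by (simp add: field_simps)
  finally show "0 <= fdiff (a/(1 - a)) j (FF I (K z)) (s/(1 - a))"
   using a Suc.prems(2) FF_increment(2)[OF I f, of 0 a z] z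
   by (intro Suc.IH[of "b+b"]) (auto simp: K_def)
 qed
 finally show ?case .
qed

lemma FF_mono:
 assumes "finite I" "bdd (GI I) b f" "0 <= s" "s <= t" "t < 1"
 shows "FF I f s <= FF I f t"
 using fdiff_FF_nonneg[OF assms(1-3), of "t - s" 1] assms by simp

lemma FF_bound:
 assumes "finite I" "bdd (GI I) b f"
 shows "\<bar>FF I f r\<bar> <= b*b"
 unfolding FF_def by (rule GI.bdd_integral_le[OF bdd_mult[OF assms(2) bdd_NO[OF assms(2)]]])

text \<open>Convexity and boundedness: \<open>n\<close> consecutive increments dominate \<open>n\<close> times the first one.\<close>

lemma FF_increment_le:
 assumes I: "finite I" and f: "bdd (GI I) b f" and s: "0 <= s" and a: "0 <= a" and n: "s+real n*a < 1"
 shows "real n*(FF I f (s+a) - FF I f s) <= FF I f (s+real n*a) - FF I f s"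
 using n
proof (induction n)
 case (Suc n)
 have na: "0 <= real n*a" using a by simp
 have lt: "s+real n*a < 1" using Suc.prems a by (simp add: algebra_simps)
 have mono: "FF I f (s+a) - FF I f s <= FF I f (s+real m*a+a) - FF I f (s+real m*a)" if "s+real m*a+a < 1" for m
  using that
 proof (induction m)
  case (Suc m)
  have "s+real m*a+a < 1" using Suc.prems a by (simp add: algebra_simps)
  moreover have "0 <= fdiff a 2 (FF I f) (s+real m*a)"
   using Suc.prems s a by (intro fdiff_FF_nonneg[OF I f]) (auto simp: algebra_simps)
  ultimately show ?case using Suc.IH by (simp add: numeral_2_eq_2 algebra_simps)
 qed simp
 show ?case using Suc.IH[OF lt] mono[of n] Suc.prems by (simp add: algebra_simps)
qed simp

text \<open>By convexity, \<open>n\<close> increments of length \<open>t - s\<close> that fit below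
  \<open>1\<close> dominate \<open>n\<close> times the first one, while their sum is at most
  \<open>2*(b*b)\<close>. The modulus degrades towards \<open>1\<close>, and nothing is claimed
  about continuity at \<open>1\<close>.\<close>

lemma FF_continuous:
 assumes I: "finite I" and f: "bdd (GI I) b f" and rh: "0 <= rh" "rh < 1"
 shows "continuous_on {0..rh} (FF I f)"
 unfolding continuous_on_iff
proof (intro ballI allI impI)
 fix x e :: real assume x: "x \<in> {0..rh}" and e: "e > 0"
 obtain n :: nat where n: "2*(b*b)/e < real n" using reals_Archimedean2 by blast
 define d where "d = (1 - rh)/(real n+1)"
 have d: "d > 0" using rh by (simp add: d_def)
 have bb: "0 <= b*b" by simp
 then have n0: "0 < real n" using n e by (smt (verit) divide_nonneg_pos)
 have nd: "real n*d < 1 - rh" using rh by (simp add: d_def field_simps)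
 have main: "\<bar>FF I f t - FF I f s\<bar> < e" if "0 <= s" "s <= t" "t <= rh" "t - s < d" for s t
 proof -
  have "real n*(t - s) <= real n*d" using that by (intro mult_left_mono) auto
  then have "s+real n*(t - s) < 1" using nd that by linarith
  from FF_increment_le[OF I f that(1) _ this] that
  have "real n*(FF I f t - FF I f s) <= FF I f (s+real n*(t - s)) - FF I f s" by simp
  also have "... <= 2*(b*b)" using FF_bound[OF I f] by (smt (verit))
  also have "... < e*real n" using n e by (simp add: field_simps)
  finally have "FF I f t - FF I f s < e" using n0 by (simp add: mult.commute)
  moreover have "FF I f s <= FF I f t" using FF_mono[OF I f that(1,2)] that rh by simp
  ultimately show ?thesis by simp
 qed
 show "EX d>0. ALL x':{0..rh}. dist x' x < d --> dist (FF I f x') (FF I f x) < e"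
 proof (intro exI[of _ d] conjI ballI impI d)
  fix y assume y: "y \<in> {0..rh}" "dist y x < d"
  show "dist (FF I f y) (FF I f x) < e"
  proof (cases "y <= x")
   case True
   then show ?thesis using main[of y x] x y by (simp add: dist_real_def abs_minus_commute)
  next
   case False
   then show ?thesis using main[of x y] x y by (simp add: dist_real_def)
  qed
 qed
qed

lemma Bernstein_Suc:
 fixes x :: real
 shows "(\<Sum>k\<le>Suc n. g k*Bernstein (Suc n) k x) = (1 - x)*(\<Sum>k\<le>n. g k*Bernstein n k x)+x*(\<Sum>k\<le>n. g (Suc k)*Bernstein n k x)"
proof -
 define T where "T = (%k. g k*(of_nat (n choose k)*x ^ k*(1 - x)^(Suc n - k)))"
 have 1: "Bernstein (Suc n) (Suc k) x = x*Bernstein n k x + of_nat (n choose Suc k)*x^Suc k*(1 - x)^(n - k)" for k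
  by (simp add: Bernstein_def algebra_simps)
 have "(\<Sum>k\<le>Suc n. g k*Bernstein (Suc n) k x) = g 0*(1 - x)^Suc n+(\<Sum>k\<le>n. g (Suc k)*Bernstein (Suc n) (Suc k) x)"
  by (subst sum.atMost_Suc_shift) (simp add: Bernstein_def)
 also have "(\<Sum>k\<le>n. g (Suc k)*Bernstein (Suc n) (Suc k) x) = x*(\<Sum>k\<le>n. g (Suc k)*Bernstein n k x)+(\<Sum>k\<le>n. T (Suc k))"
  unfolding 1 T_def by (simp add: algebra_simps sum.distrib sum_distrib_left)
 also have "(\<Sum>k\<le>n. T (Suc k)) = (\<Sum>k\<le>Suc n. T k) - T 0"
  by (subst sum.atMost_Suc_shift) simp
 also have "(\<Sum>k\<le>Suc n. T k) = (\<Sum>k\<le>n. T k)"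
  by (simp add: T_def binomial_eq_0)
 also have "(\<Sum>k\<le>n. T k) = (1 - x)*(\<Sum>k\<le>n. g k*Bernstein n k x)"
  unfolding sum_distrib_left by (intro sum.cong) (auto simp: T_def Bernstein_def Suc_diff_le)
 also have "T 0 = g 0*(1 - x)^Suc n" by (simp add: T_def)
 finally show ?thesis by simp
qed

primrec ddiff :: "nat => (nat => real) => nat => real" where
 "ddiff 0 g = g"
| "ddiff (Suc j) g = ddiff j (%i. g (Suc i) - g i)"

text \<open>The recursion for Bernstein sums reads: the sum of degree \<open>Suc n\<close> for
  \<open>g\<close> is the sum of degree \<open>n\<close> for \<open>g\<close> plus \<open>x\<close>
  times the sum of degree \<open>n\<close> for the first difference of \<open>g\<close>. Both parts
  inherit the sign condition.\<close>

lemma Bernstein_nonneg_coeffs: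
 assumes "!!i j. i+j <= n ==> 0 <= ddiff j g i"
 shows "EX w. (ALL j. 0 <= w j) \<and> (ALL x::real. (\<Sum>k\<le>n. g k*Bernstein n k x) = (\<Sum>j\<le>n. w j*x^j))"
 using assms
proof (induction n arbitrary: g)
 case 0
 from 0[of 0 0] show ?case by (intro exI[of _ "%_. g 0"]) (simp add: Bernstein_def)
next
 case (Suc n)
 obtain w where w: "!!j. 0 <= w j" "!!x::real. (\<Sum>k\<le>n. g k*Bernstein n k x) = (\<Sum>j\<le>n. w j*x^j)"
  using Suc.IH[of g] Suc.prems by force
 have "0 <= ddiff j (%i. g (Suc i) - g i) i" if "i+j <= n" for i j
  using Suc.prems[of i "Suc j"] that by simp
 then obtain v where v: "!!j. 0 <= v j" "!!x::real. (\<Sum>k\<le>n. (g (Suc k) - g k)*Bernstein n k x) = (\<Sum>j\<le>n. v j*x^j)"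
  using Suc.IH[of "%i. g (Suc i) - g i"] by blast
 define u where "u = (%j. (if j <= n then w j else 0)+(case j of 0 => 0 | Suc i => v i))"
 show ?case
 proof (intro exI[of _ u] conjI allI)
  show "0 <= u j" for j using w(1) v(1) by (auto simp: u_def split: nat.split)
  fix x :: real
  have "(\<Sum>k\<le>Suc n. g k*Bernstein (Suc n) k x) = (\<Sum>k\<le>n. g k*Bernstein n k x)+x*(\<Sum>k\<le>n. (g (Suc k) - g k)*Bernstein n k x)"
   unfolding Bernstein_Suc by (simp add: algebra_simps sum_subtractf)
  also have "... = (\<Sum>j\<le>n. w j*x^j)+(\<Sum>j\<le>n. v j*x^Suc j)"
   unfolding w(2) v(2) by (simp add: sum_distrib_left algebra_simps)
  also have "(\<Sum>j\<le>n. w j*x^j) = (\<Sum>j\<le>Suc n. (if j <= n then w j else 0)*x^j)" by simp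
  also have "(\<Sum>j\<le>n. v j*x^Suc j) = (\<Sum>j\<le>Suc n. (case j of 0 => 0 | Suc i => v i)*x^j)"
   by (subst sum.atMost_Suc_shift) simp
  finally show "(\<Sum>k\<le>Suc n. g k*Bernstein (Suc n) k x) = (\<Sum>j\<le>Suc n. u j*x^j)"
   by (simp add: u_def distrib_right sum.distrib)
 qed
qed

lemma ddiff_fdiff: "ddiff j (%i. g (s+real i*a)) i = fdiff a j g (s+real i*a)"
proof (induction j arbitrary: g)
 case (Suc j)
 show ?case using Suc[of "%s. g (s+a) - g s"] by (simp add: algebra_simps)
qed simp

text \<open>In the Hermite expansion, \<open>FF f r\<close> is a power series in \<open>r\<close> with nonnegative coefficients, so a linear
  inequality that holds for all monomials \<open>r ^ j\<close> carries over to \<open>FF f\<close>. The expansion is replaced by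
  Bernstein approximation: all finite differences of \<open>FF f\<close> are nonnegative.\<close>

lemma FF_monomial_principle_aux:
 assumes I: "finite I" and f: "bdd (GI I) b f" and L: "finite L" and rh: "0 < rh" "rh < 1"
  and r: "!!l. l \<in> L ==> 0 <= r l \<and> r l <= rh"
  and pos: "!!j. 0 <= (\<Sum>l\<in>L. c l*r l^j)"
 shows "0 <= (\<Sum>l\<in>L. c l*FF I f (r l))"
proof (rule ccontr)
 assume "\<not> ?thesis"
 then have neg: "(\<Sum>l\<in>L. c l*FF I f (r l)) < 0" by simp
 \<comment> \<open>The interval up to \<open>rh\<close> is stretched to the unit interval, so that
   all Bernstein nodes lie where the differences of \<open>FF\<close> have a known sign.\<close>
 define g where "g = (%x. FF I f (rh*x))"
 have "continuous_on {0..1} g"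
  unfolding g_def using rh by (intro continuous_on_compose2[OF FF_continuous[OF I f, of rh]] continuous_intros) (auto intro!: mult_left_le)
 \<comment> \<open>The approximation error \<open>e\<close> is such that its total effect
   \<open>(C - 1)*e\<close> stays below the assumed gap \<open>C*e\<close>.\<close>
 define C where "C = (\<Sum>l\<in>L. \<bar>c l\<bar>)+1"
 have C: "C > 0" unfolding C_def by (simp add: add_nonneg_pos sum_nonneg)
 define e where "e = - (\<Sum>l\<in>L. c l*FF I f (r l))/C"
 have e: "e > 0" using divide_neg_pos[OF neg C] by (simp add: e_def)
 obtain n where n: "n >= 1" "!!x. x \<in> {0..1} ==> \<bar>g x - (\<Sum>k\<le>n. g (real k/real n)*Bernstein n k x)\<bar> < e"
  using Bernstein_Weierstrass[OF \<open>continuous_on {0..1} g\<close> e] by (metis max.cobounded1 max.cobounded2)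
 define h where "h = (%k. g (real k/real n))"
 have hh: "h = (%i. FF I f (0+real i*(rh/real n)))" by (simp add: h_def g_def mult.commute)
 have hd: "0 <= ddiff j h i" if "i+j <= n" for i j
 proof -
  have "real i*(rh/real n)+real j*(rh/real n) = real (i+j)/real n*rh" by (simp add: add_divide_distrib algebra_simps)
  also have "... <= 1*rh" using that n(1) rh by (intro mult_right_mono) (auto simp: divide_le_eq_1)
  finally have "0+real i*(rh/real n)+real j*(rh/real n) < 1" using rh by simp
  then show ?thesis unfolding hh ddiff_fdiff using rh by (intro fdiff_FF_nonneg[OF I f]) auto
 qed
 obtain w where w: "!!j. 0 <= w j" "!!x::real. (\<Sum>k\<le>n. h k*Bernstein n k x) = (\<Sum>j\<le>n. w j*x^j)"
  using Bernstein_nonneg_coeffs[of n h] hd by blast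
 have x: "r l/rh \<in> {0..1}" if "l \<in> L" for l using r[OF that] rh by (auto simp: field_simps)
 have ap: "\<bar>FF I f (r l) - (\<Sum>j\<le>n. w j*(r l/rh)^j)\<bar> <= e" if "l \<in> L" for l
  using n(2)[OF x[OF that]] rh unfolding w(2)[symmetric] h_def by (simp add: g_def)
 have "(\<Sum>l\<in>L. c l*(\<Sum>j\<le>n. w j*(r l/rh)^j)) = (\<Sum>j\<le>n. w j/rh^j*(\<Sum>l\<in>L. c l*r l^j))"
  unfolding sum_distrib_left by (subst sum.swap) (simp add: power_divide mult_ac)
 also have "0 <= ..."
 proof (rule sum_nonneg, rule mult_nonneg_nonneg)
  show "0 <= w j/rh^j" for j using w(1) rh by simp
 qed (rule pos)
 finally have p: "0 <= (\<Sum>l\<in>L. c l*(\<Sum>j\<le>n. w j*(r l/rh)^j))" .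
 have "\<bar>(\<Sum>l\<in>L. c l*FF I f (r l)) - (\<Sum>l\<in>L. c l*(\<Sum>j\<le>n. w j*(r l/rh)^j))\<bar> <= (\<Sum>l\<in>L. \<bar>c l\<bar> * e)"
  unfolding sum_subtractf[symmetric] right_diff_distrib[symmetric]
  by (rule order_trans[OF sum_abs]) (intro sum_mono, simp add: abs_mult mult_left_mono ap)
 also have "... = (C - 1)*e" by (simp add: C_def sum_distrib_right)
 also have "... < C*e" using e by (simp add: algebra_simps)
 also have "... = - (\<Sum>l\<in>L. c l*FF I f (r l))" using C by (simp add: e_def)
 finally show False using p by linarith
qed

text \<open>At the point \<open>1\<close> there is no continuity to rely on, only
  \<open>FF I f q <= FF I f 1\<close>. So all points are shrunk by a factor \<open>q < 1\<close>,
  the value at \<open>1\<close> is then put back, which is harmless because the coefficients at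
  \<open>1\<close> have a nonnegative sum, and finally \<open>q\<close> tends to
  \<open>1\<close>.\<close>

theorem FF_monomial_principle:
 assumes I: "finite I" and f: "bdd (GI I) b f" and L: "finite L"
  and r: "!!l. l \<in> L ==> 0 <= r l \<and> r l <= 1"
  and c1: "0 <= (\<Sum>l | l \<in> L \<and> r l = 1. c l)"
  and pos: "!!j. 0 <= (\<Sum>l\<in>L. c l*r l^j)"
 shows "0 <= (\<Sum>l\<in>L. c l*FF I f (r l))"
proof -
 define h where "h = (%q l. if r l = 1 then FF I f 1 else FF I f (q*r l))"
 have ge: "0 <= (\<Sum>l\<in>L. c l*h q l)" if q: "0 < q" "q < 1" for q
 proof -
  have "0 <= (\<Sum>l\<in>L. c l*FF I f (q*r l))"
  proof (rule FF_monomial_principle_aux[OF I f L q])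
   show "0 <= q*r l \<and> q*r l <= q" if "l \<in> L" for l using r[OF that] q by (simp add: mult_left_le)
   have "(\<Sum>l\<in>L. c l*(q*r l)^j) = q^j*(\<Sum>l\<in>L. c l*r l^j)" for j
    by (simp add: power_mult_distrib sum_distrib_left mult_ac)
   then show "0 <= (\<Sum>l\<in>L. c l*(q*r l)^j)" for j using pos q by simp
  qed
  also have "... <= (\<Sum>l\<in>L. c l*h q l)"
  proof -
   have e: "c l*h q l = c l*FF I f (q*r l)+(if r l = 1 then c l*(FF I f 1 - FF I f q) else 0)" for l
    by (simp add: h_def algebra_simps)
   have "0 <= (\<Sum>l | l \<in> L \<and> r l = 1. c l)*(FF I f 1 - FF I f q)"
    using c1 FF_le_1[OF I f, of q] q by (intro mult_nonneg_nonneg) auto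
   then show ?thesis unfolding e sum.distrib using L by (simp add: sum.inter_filter[symmetric] sum_distrib_right)
  qed
  finally show ?thesis .
 qed
 have "((%q. \<Sum>l\<in>L. c l*h q l) \<longlongrightarrow> (\<Sum>l\<in>L. c l*FF I f (r l))) (at_left 1)"
 proof (intro tendsto_sum tendsto_mult tendsto_const)
  fix l assume l: "l \<in> L"
  show "((%q. h q l) \<longlongrightarrow> FF I f (r l)) (at_left 1)"
  proof (cases "r l = 1")
   case False
   then have r1: "0 <= r l" "r l < 1" using r[OF l] by auto
   have ev: "eventually (%q::real. q*r l \<in> {0..r l}) (at_left 1)"
    using eventually_at_left[of 0 "1::real" ] r1 by (auto simp: eventually_at_left[of 0] intro!: exI[of _ 0] mult_left_le_one_le)
   have "((%q. q*r l) \<longlongrightarrow> 1*r l) (at_left 1)" by (intro tendsto_intros)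
   then have "((%q. FF I f (q*r l)) \<longlongrightarrow> FF I f (r l)) (at_left 1)"
    using FF_continuous[OF I f r1] ev r1 by (intro continuous_on_tendsto_compose[of "{0..r l}" "FF I f"]) auto
   then show ?thesis using False by (simp add: h_def)
  qed (simp add: h_def)
 qed
 then show ?thesis
 proof (rule tendsto_lowerbound)
  show "eventually (%q. 0 <= (\<Sum>l\<in>L. c l*h q l)) (at_left 1)"
   unfolding eventually_at_left[of 0 "1::real", simplified] using ge by (intro exI[of _ 0]) auto
 qed simp
qed

section \<open>Densities of Gaussian shifts and the Mehler kernel\<close>

text \<open>The density of the normal law with mean \<open>a\<close> and deviation \<open>sg\<close>
  relative to the standard Gaussian, not to Lebesgue measure.\<close>

definition gdens :: "real => real => real => real" where
 "gdens a sg u = exp (u^2/2 - ((u - a) / sg)^2/2) / sg"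

lemma gdens_nonneg: "0 < sg ==> 0 <= gdens a sg u"
 by (simp add: gdens_def)

lemma gdens_measurable [measurable (raw)]:
 assumes [measurable]: "f \<in> borel_measurable M" "g \<in> borel_measurable M"
 shows "(%x. gdens (f x) sg (g x)) \<in> borel_measurable M"
 unfolding gdens_def by measurable

lemma nn_integral_affine1:
 assumes [measurable]: "g \<in> borel_measurable borel" and sg: "0 < sg"
 shows "(\<integral>\<^sup>+y. g (a + sg*y) \<partial>std_gaussian) = (\<integral>\<^sup>+u. ennreal (gdens a sg u)*g u \<partial>std_gaussian)"
proof -
 have e: "a + sg*(- a / sg+1 / sg*u) = u" "- a / sg+1 / sg*u = (u - a) / sg" for u
  using sg by (auto simp: field_simps)
 have d: "ennreal (1 / sg)*ennreal (std_normal_density ((u - a) / sg)) = ennreal (std_normal_density u)*ennreal (gdens a sg u)" for u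
 proof -
  have "std_normal_density u*gdens a sg u = 1 / sg*(1 / sqrt (2*pi)*(exp (- u\<^sup>2/2)*exp (u^2/2 - ((u - a) / sg)^2/2)))"
   by (simp add: std_normal_density_def gdens_def)
  also have "exp (- u\<^sup>2/2)*exp (u^2/2 - ((u - a) / sg)^2/2) = exp (- ((u - a) / sg)\<^sup>2/2)"
   by (simp flip: exp_add)
  finally show ?thesis using sg by (simp add: std_normal_density_def gdens_nonneg flip: ennreal_mult)
 qed
 have "(\<integral>\<^sup>+y. g (a + sg*y) \<partial>std_gaussian) = (\<integral>\<^sup>+y. ennreal (std_normal_density y)*g (a + sg*y) \<partial>lborel)"
  by (rule nn_integral_std_gaussian) measurable
 also have "... = ennreal \<bar>1 / sg\<bar> * (\<integral>\<^sup>+u. ennreal (std_normal_density (- a / sg+1 / sg*u))*g (a + sg*(- a / sg+1 / sg*u)) \<partial>lborel)"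
  using sg by (intro nn_integral_real_affine) auto
 also have "... = (\<integral>\<^sup>+u. ennreal (1 / sg)*(ennreal (std_normal_density ((u - a) / sg))*g u) \<partial>lborel)"
  unfolding e using sg by (subst nn_integral_cmult) auto
 also have "... = (\<integral>\<^sup>+u. ennreal (std_normal_density u)*(ennreal (gdens a sg u)*g u) \<partial>lborel)"
  unfolding mult.assoc[symmetric] d ..
 also have "... = (\<integral>\<^sup>+u. ennreal (gdens a sg u)*g u \<partial>std_gaussian)"
  by (rule nn_integral_std_gaussian[symmetric]) measurable
 finally show ?thesis .
qed

definition GD :: "'a set => ('a => real) => real => ('a => real) => real" where
 "GD I a sg y = (\<Prod>i\<in>I. gdens (a i) sg (y i))"

lemma GD_nonneg: "0 < sg ==> 0 <= GD I a sg y"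
 by (simp add: GD_def prod_nonneg gdens_nonneg)

lemma GD_measurable [measurable (raw)]:
 assumes "!!i. i \<in> I ==> (%x. f x i) \<in> borel_measurable M" "!!i. i \<in> I ==> (%x. g x i) \<in> borel_measurable M"
 shows "(%x. GD I (f x) sg (g x)) \<in> borel_measurable M"
 unfolding GD_def using assms by (intro borel_measurable_prod gdens_measurable)

lemma nn_integral_affine:
 assumes "finite I" "g \<in> borel_measurable (GI I)" and sg: "0 < sg"
 shows "(\<integral>\<^sup>+y. g (mix I 1 sg a y) \<partial>GI I) = (\<integral>\<^sup>+u. ennreal (GD I a sg u)*g u \<partial>GI I)"
 using assms(1,2)
proof (induction I arbitrary: g rule: finite_induct)
 case empty
 have [simp]: "mix {} 1 sg a y = (%_. undefined)" for y by (auto simp: mix_def)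
 have "space (GI ({} :: 'a set)) = {%_. undefined}" by (simp add: space_GI)
 then have "(\<integral>\<^sup>+u. ennreal (GD {} a sg u)*g u \<partial>GI {}) = (\<integral>\<^sup>+u. g (%_. undefined) \<partial>GI ({} :: 'a set))"
  by (intro nn_integral_cong) (simp add: GD_def)
 then show ?case by simp
next
 case (insert i I)
 note g = insert.prems
 have m1: "(%y. g (mix (insert i I) 1 sg a y)) \<in> borel_measurable (GI (insert i I))"
 proof (rule measurable_compose[OF _ g], unfold mix_def, rule measurable_GI_restrict)
  fix j assume "j \<in> insert i I"
  then show "(%y. 1*a j + sg*y j) \<in> borel_measurable (GI (insert i I))" by measurable
 qed
 have m2: "(%u. ennreal (GD (insert i I) a sg u)*g u) \<in> borel_measurable (GI (insert i I))"
 proof -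
  have [measurable]: "(%u. GD (insert i I) a sg u) \<in> borel_measurable (GI (insert i I))" by (rule GD_measurable) auto
  note g[measurable]
  show ?thesis by measurable
 qed
 have upd: "(%p. (fst p)(i := snd p)) \<in> measurable (GI I >< std_gaussian) (GI (insert i I))"
  by (rule measurable_fun_upd[where J = I]) auto
 have g2[measurable]: "(%p. g ((fst p)(i := snd p))) \<in> borel_measurable (GI I >< std_gaussian)"
  by (rule measurable_compose[OF upd g])
 have g1: "(%u. g (v(i := u))) \<in> borel_measurable borel" if v: "v \<in> space (GI I)" for v
  using measurable_compose[OF measurable_Pair1'[OF v] g2] by simp
 have E1: "mix (insert i I) 1 sg a (y(i := t)) = (mix I 1 sg a y)(i := a i + sg*t)" for y t
  using insert.hyps by (auto simp: mix_def fun_eq_iff)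
 have E2: "GD (insert i I) a sg (v(i := u)) = GD I a sg v * gdens (a i) sg u" for v u
 proof -
  have "(\<Prod>j\<in>I. gdens (a j) sg ((v(i := u)) j)) = (\<Prod>j\<in>I. gdens (a j) sg (v j))"
   using insert.hyps by (intro prod.cong) auto
  then show ?thesis using insert.hyps by (simp add: GD_def mult.commute)
 qed
 define h where "h = (%v. \<integral>\<^sup>+u. ennreal (gdens (a i) sg u)*g (v(i := u)) \<partial>std_gaussian)"
 have h: "h \<in> borel_measurable (GI I)" unfolding h_def
 proof (rule sigma_finite_measure.borel_measurable_nn_integral[OF prob_space_imp_sigma_finite[OF prob_space_std_gaussian]])
  have "(%p. ennreal (gdens (a i) sg (snd p))*g ((fst p)(i := snd p))) \<in> borel_measurable (GI I >< std_gaussian)"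
   by measurable
  then show "(%(v, u). ennreal (gdens (a i) sg u)*g (v(i := u))) \<in> borel_measurable (GI I >< std_gaussian)"
   by (simp add: split_beta')
 qed
 have "(\<integral>\<^sup>+y. g (mix (insert i I) 1 sg a y) \<partial>GI (insert i I)) = (\<integral>\<^sup>+y. \<integral>\<^sup>+t. g ((mix I 1 sg a y)(i := a i + sg*t)) \<partial>std_gaussian \<partial>GI I)"
  unfolding nn_integral_GI_insert[OF insert.hyps m1] E1 ..
 also have "... = (\<integral>\<^sup>+y. h (mix I 1 sg a y) \<partial>GI I)"
  unfolding h_def by (intro nn_integral_cong nn_integral_affine1[OF g1 sg]) simp
 also have "... = (\<integral>\<^sup>+v. ennreal (GD I a sg v)*h v \<partial>GI I)"
  by (rule insert.IH[OF h])
 also have "... = (\<integral>\<^sup>+v. \<integral>\<^sup>+u. ennreal (GD (insert i I) a sg (v(i := u)))*g (v(i := u)) \<partial>std_gaussian \<partial>GI I)"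
 proof (rule nn_integral_cong)
  fix v assume v: "v \<in> space (GI I)"
  have "(%u. ennreal (gdens (a i) sg u)*g (v(i := u))) \<in> borel_measurable borel"
   using g1[OF v] by measurable
  then have "ennreal (GD I a sg v)*h v = (\<integral>\<^sup>+u. ennreal (GD I a sg v)*(ennreal (gdens (a i) sg u)*g (v(i := u))) \<partial>std_gaussian)"
   unfolding h_def by (intro nn_integral_cmult[symmetric]) simp
  also have "... = (\<integral>\<^sup>+u. ennreal (GD (insert i I) a sg (v(i := u)))*g (v(i := u)) \<partial>std_gaussian)"
   unfolding E2 using sg by (simp add: ennreal_mult GD_nonneg gdens_nonneg mult.assoc)
  finally show "ennreal (GD I a sg v)*h v = (\<integral>\<^sup>+u. ennreal (GD (insert i I) a sg (v(i := u)))*g (v(i := u)) \<partial>std_gaussian)" .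
 qed
 also have "... = (\<integral>\<^sup>+u. ennreal (GD (insert i I) a sg u)*g u \<partial>GI (insert i I))"
  by (rule nn_integral_GI_insert[OF insert.hyps m2, symmetric])
 finally show ?case .
qed

lemma mix_const_measurable: "mix I c d a \<in> measurable (GI I) (GI I)"
 unfolding mix_def by (intro measurable_GI_restrict) measurable

lemma distr_affine:
 assumes I: "finite I" and sg: "0 < sg"
 shows "distr (GI I) (GI I) (mix I 1 sg a) = density (GI I) (%u. ennreal (GD I a sg u))"
proof (rule measure_eqI)
 fix X assume "X \<in> sets (distr (GI I) (GI I) (mix I 1 sg a))"
 then have X: "X \<in> sets (GI I)" by simp
 have [measurable]: "(%u. GD I a sg u) \<in> borel_measurable (GI I)" by (rule GD_measurable) auto
 have "emeasure (distr (GI I) (GI I) (mix I 1 sg a)) X = (\<integral>\<^sup>+u. indicator X u \<partial>distr (GI I) (GI I) (mix I 1 sg a))"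
  using X by simp
 also have "... = (\<integral>\<^sup>+y. indicator X (mix I 1 sg a y) \<partial>GI I)"
  using X by (intro nn_integral_distr mix_const_measurable) auto
 also have "... = (\<integral>\<^sup>+u. ennreal (GD I a sg u)*indicator X u \<partial>GI I)"
  using X by (intro nn_integral_affine[OF I _ sg]) auto
 also have "... = emeasure (density (GI I) (%u. ennreal (GD I a sg u))) X"
  using X by (simp add: emeasure_density)
 finally show "emeasure (distr (GI I) (GI I) (mix I 1 sg a)) X = emeasure (density (GI I) (%u. ennreal (GD I a sg u))) X" .
qed simp

lemma integral_affine:
 fixes g :: "_ => real"
 assumes I: "finite I" and sg: "0 < sg" and g: "g \<in> borel_measurable (GI I)"
 shows "(LINT y|GI I. g (mix I 1 sg a y)) = (LINT u|GI I. GD I a sg u*g u)"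
  "integrable (GI I) (%y. g (mix I 1 sg a y)) \<longleftrightarrow> integrable (GI I) (%u. GD I a sg u*g u)"
proof -
 have D: "(%u. GD I a sg u) \<in> borel_measurable (GI I)" by (rule GD_measurable) auto
 have "(LINT y|GI I. g (mix I 1 sg a y)) = (LINT u|distr (GI I) (GI I) (mix I 1 sg a). g u)"
  by (rule integral_distr[OF mix_const_measurable g, symmetric])
 also have "... = (LINT u|GI I. GD I a sg u*g u)"
  unfolding distr_affine[OF I sg] using integral_density[OF g D AE_I2[OF GD_nonneg[OF sg]]] by simp
 finally show "(LINT y|GI I. g (mix I 1 sg a y)) = (LINT u|GI I. GD I a sg u*g u)" .
 have "integrable (GI I) (%y. g (mix I 1 sg a y)) \<longleftrightarrow> integrable (distr (GI I) (GI I) (mix I 1 sg a)) g"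
  by (rule integrable_distr_eq[OF mix_const_measurable g, symmetric])
 also have "... \<longleftrightarrow> integrable (GI I) (%u. GD I a sg u*g u)"
  unfolding distr_affine[OF I sg] using integrable_density[OF g D AE_I2[OF GD_nonneg[OF sg]]] by simp
 finally show "integrable (GI I) (%y. g (mix I 1 sg a y)) \<longleftrightarrow> integrable (GI I) (%u. GD I a sg u*g u)" .
qed

lemma nn_integral_std_normal_affine:
 assumes "sg ~= 0"
 shows "(\<integral>\<^sup>+u. ennreal (std_normal_density (t + sg*u)) \<partial>lborel) = ennreal (1/\<bar>sg\<bar>)"
proof -
 have "1 = (\<integral>\<^sup>+x. 1 \<partial>std_gaussian)" by (simp add: emeasure_std_gaussian_UNIV)
 also have "... = (\<integral>\<^sup>+x. ennreal (std_normal_density x) \<partial>lborel)"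
  by (subst nn_integral_std_gaussian) auto
 also have "... = ennreal \<bar>sg\<bar> * (\<integral>\<^sup>+u. ennreal (std_normal_density (t + sg*u)) \<partial>lborel)"
  using assms by (subst nn_integral_real_affine[where c = sg and t = t]) auto
 finally have "ennreal (1/\<bar>sg\<bar>) = ennreal (1/\<bar>sg\<bar>)*ennreal \<bar>sg\<bar> * (\<integral>\<^sup>+u. ennreal (std_normal_density (t + sg*u)) \<partial>lborel)"
  by (simp add: mult.assoc)
 also have "ennreal (1/\<bar>sg\<bar>)*ennreal \<bar>sg\<bar> = 1"
  using assms by (simp flip: ennreal_mult)
 finally show ?thesis by simp
qed

text \<open>One factor of the square serves as a density that makes the second variable the noisy
  copy of the first. A rotation then returns to independent variables, and what remains is the
  integral of a normal density in the variable \<open>ka * v + sg*u\<close>, which supplies a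
  further \<open>1 / sg\<close>.\<close>

lemma mehler_moment1:
 assumes k: "0 <= ka" "ka < 1"
 defines "sg == sqrt (1 - ka^2)"
 shows "(\<integral>\<^sup>+x. \<integral>\<^sup>+y. ennreal ((gdens (ka*x) sg y)^2) \<partial>std_gaussian \<partial>std_gaussian) = ennreal (1/(1 - ka^2))"
proof -
 have k2: "ka^2 < 1" using k by (simp add: abs_square_less_1)
 then have sg: "0 < sg" "sg^2 = 1 - ka^2" by (auto simp: sg_def)
 have "(\<integral>\<^sup>+y. ennreal ((gdens (ka*x) sg y)^2) \<partial>std_gaussian) = (\<integral>\<^sup>+y. ennreal (gdens (ka*x) sg (ka*x + sg*y)) \<partial>std_gaussian)" for x
  using sg by (subst nn_integral_affine1) (auto simp: power2_eq_square ennreal_mult gdens_nonneg)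
 then have "(\<integral>\<^sup>+x. \<integral>\<^sup>+y. ennreal ((gdens (ka*x) sg y)^2) \<partial>std_gaussian \<partial>std_gaussian)
   = (\<integral>\<^sup>+x. \<integral>\<^sup>+y. ennreal (gdens (ka*x) sg (ka*x + sg*y)) \<partial>std_gaussian \<partial>std_gaussian)" by simp
 also have "... = (\<integral>\<^sup>+x. \<integral>\<^sup>+y. (%(u, v). ennreal (exp (u^2/2 - (sg*u + ka * v)^2/2) / sg)) (ka*x + sg*y, - sg*x + ka*y) \<partial>std_gaussian \<partial>std_gaussian)"
 proof -
  have "sg*(ka*x + sg*y) + ka*(- sg*x + ka*y) = (sg^2 + ka^2)*y" for x y
   by (simp add: algebra_simps power2_eq_square)
  then have "sg*(ka*x + sg*y) + ka*(- sg*x + ka*y) = y" for x y unfolding sg by simp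
  then show ?thesis using sg by (simp add: gdens_def)
 qed
 also have "... = (\<integral>\<^sup>+u. \<integral>\<^sup>+v. ennreal (exp (u^2/2 - (sg*u + ka * v)^2/2) / sg) \<partial>std_gaussian \<partial>std_gaussian)"
  using sg by (subst std_gaussian_rotate) auto
 also have "... = (\<integral>\<^sup>+v. \<integral>\<^sup>+u. ennreal (exp (u^2/2 - (sg*u + ka * v)^2/2) / sg) \<partial>std_gaussian \<partial>std_gaussian)"
  by (rule std_gaussian_Fubini[symmetric]) measurable
 also have "... = (\<integral>\<^sup>+v. ennreal (1/(1 - ka^2)) \<partial>std_gaussian)"
 proof (rule nn_integral_cong)
  fix v :: real
  have "(\<integral>\<^sup>+u. ennreal (exp (u^2/2 - (sg*u + ka * v)^2/2) / sg) \<partial>std_gaussian)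
    = (\<integral>\<^sup>+u. ennreal (std_normal_density u)*ennreal (exp (u^2/2 - (sg*u + ka * v)^2/2) / sg) \<partial>lborel)"
   by (rule nn_integral_std_gaussian) measurable
  also have "... = (\<integral>\<^sup>+u. ennreal (1 / sg)*ennreal (std_normal_density (ka * v + sg*u)) \<partial>lborel)"
  proof (rule nn_integral_cong)
   fix u :: real
   have "exp (- u\<^sup>2/2)*exp (u^2/2 - (sg*u + ka * v)^2/2) = exp (- (ka * v + sg*u)\<^sup>2/2)"
    by (simp add: add.commute flip: exp_add)
   then have "std_normal_density u*(exp (u^2/2 - (sg*u + ka * v)^2/2) / sg) = 1 / sg * std_normal_density (ka * v + sg*u)"
    unfolding std_normal_density_def by simp
   then show "ennreal (std_normal_density u)*ennreal (exp (u^2/2 - (sg*u + ka * v)^2/2) / sg) = ennreal (1 / sg)*ennreal (std_normal_density (ka * v + sg*u))"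
    using sg by (simp flip: ennreal_mult)
  qed
  also have "... = ennreal (1 / sg)*(\<integral>\<^sup>+u. ennreal (std_normal_density (ka * v + sg*u)) \<partial>lborel)"
   by (rule nn_integral_cmult) measurable
  also have "... = ennreal (1 / sg*(1 / sg))"
   using sg by (subst nn_integral_std_normal_affine) (auto simp flip: ennreal_mult)
  also have "1 / sg*(1 / sg) = 1/(1 - ka^2)" unfolding sg(2)[symmetric] by (simp add: power2_eq_square)
  finally show "(\<integral>\<^sup>+u. ennreal (exp (u^2/2 - (sg*u + ka * v)^2/2) / sg) \<partial>std_gaussian) = ennreal (1/(1 - ka^2))" .
 qed
 finally show ?thesis by (simp add: emeasure_std_gaussian_UNIV)
qed

text \<open>The Mehler kernel, the density of the noise operator relative to the Gaussian measure;
  it exists only for \<open>ka < 1\<close>.\<close>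

definition mk :: "'a set => real => ('a => real) => ('a => real) => real" where
 "mk I ka x y = (\<Prod>i\<in>I. gdens (ka*x i) (sqrt (1 - ka^2)) (y i))"

lemma mk_measurable: "(%(x, y). mk I ka x y) \<in> borel_measurable (GI I >< GI I)"
 unfolding mk_def split_beta' by measurable

lemma mk_GD: "mk I ka x y = GD I (%i. ka*x i) (sqrt (1 - ka^2)) y"
 by (simp add: mk_def GD_def)

lemma mk_integral:
 fixes g :: "_ => real"
 assumes I: "finite I" and k: "0 <= ka" "ka < 1" and g: "g \<in> borel_measurable (GI I)"
 shows "(LINT y|GI I. mk I ka x y*g y) = (LINT y|GI I. g (mix I ka (sqrt (1 - ka^2)) x y))"
  "integrable (GI I) (%y. g (mix I ka (sqrt (1 - ka^2)) x y)) \<longleftrightarrow> integrable (GI I) (%y. mk I ka x y*g y)"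
proof -
 have "ka^2 < 1" using k by (simp add: abs_square_less_1)
 then have s: "0 < sqrt (1 - ka^2)" by simp
 have e: "mix I 1 c (%i. ka*x i) y = mix I ka c x y" for c y by (simp add: mix_def)
 note integral_affine[OF I s g, of "%i. ka*x i", unfolded e]
 then show "(LINT y|GI I. mk I ka x y*g y) = (LINT y|GI I. g (mix I ka (sqrt (1 - ka^2)) x y))"
  "integrable (GI I) (%y. g (mix I ka (sqrt (1 - ka^2)) x y)) \<longleftrightarrow> integrable (GI I) (%y. mk I ka x y*g y)"
  by (simp_all add: mk_GD)
qed

lemma mk_moment:
 assumes "finite I" and k: "0 <= ka" "ka < 1"
 shows "(\<integral>\<^sup>+x. \<integral>\<^sup>+y. ennreal ((mk I ka x y)^2) \<partial>GI I \<partial>GI I) = ennreal ((1/(1 - ka^2))^card I)"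
 using assms(1)
proof (induction I rule: finite_induct)
 case empty
 then show ?case by (simp add: mk_def GI.emeasure_space_1)
next
 case (insert i I)
 let ?s = "sqrt (1 - ka^2)"
 have k2: "ka^2 < 1" using k by (simp add: abs_square_less_1)
 let ?h = "%s t. ennreal ((gdens (ka * s) ?s t)^2)"
 have my: "(%y. ennreal ((mk J ka x y)^2)) \<in> borel_measurable (GI J)" for x and J :: "'a set"
  unfolding mk_def by measurable
 have mx: "(%x. \<integral>\<^sup>+y. ennreal ((mk J ka x y)^2) \<partial>GI J) \<in> borel_measurable (GI J)" for J :: "'a set"
 proof (rule sigma_finite_measure.borel_measurable_nn_integral[OF prob_space_imp_sigma_finite[OF prob_GI]])
  show "(%(x, y). ennreal ((mk J ka x y)^2)) \<in> borel_measurable (GI J >< GI J)"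
   unfolding mk_def by measurable
 qed
 have e: "ennreal ((mk (insert i I) ka (x(i := s)) (y(i := t)))^2) = ennreal ((mk I ka x y)^2)*?h s t" for x y s t
 proof -
  have "(\<Prod>j\<in>I. gdens (ka*(x(i := s)) j) ?s ((y(i := t)) j)) = (\<Prod>j\<in>I. gdens (ka*x j) ?s (y j))"
   using insert.hyps by (intro prod.cong) auto
  then show ?thesis using insert.hyps by (simp add: mk_def power_mult_distrib ennreal_mult mult.commute)
 qed
 have "(\<integral>\<^sup>+x. \<integral>\<^sup>+y. ennreal ((mk (insert i I) ka x y)^2) \<partial>GI (insert i I) \<partial>GI (insert i I))
   = (\<integral>\<^sup>+x. \<integral>\<^sup>+s. \<integral>\<^sup>+y. \<integral>\<^sup>+t. ennreal ((mk I ka x y)^2)*?h s t \<partial>std_gaussian \<partial>GI I \<partial>std_gaussian \<partial>GI I)"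
  by (subst nn_integral_GI_insert[OF insert.hyps mx]) (simp only: nn_integral_GI_insert[OF insert.hyps my] e)
 also have "... = (\<integral>\<^sup>+x. \<integral>\<^sup>+s. (\<integral>\<^sup>+y. ennreal ((mk I ka x y)^2) \<partial>GI I)*(\<integral>\<^sup>+t. ?h s t \<partial>std_gaussian) \<partial>std_gaussian \<partial>GI I)"
 proof -
  have "(\<integral>\<^sup>+t. c*?h s t \<partial>std_gaussian) = c*(\<integral>\<^sup>+t. ?h s t \<partial>std_gaussian)" for c s
   by (rule nn_integral_cmult) measurable
  then show ?thesis using my by (simp add: nn_integral_multc)
 qed
 also have "... = (\<integral>\<^sup>+x. (\<integral>\<^sup>+y. ennreal ((mk I ka x y)^2) \<partial>GI I)*(\<integral>\<^sup>+s. \<integral>\<^sup>+t. ?h s t \<partial>std_gaussian \<partial>std_gaussian) \<partial>GI I)"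
 proof -
  have "(%s. \<integral>\<^sup>+t. ?h s t \<partial>std_gaussian) \<in> borel_measurable std_gaussian"
   by (rule sigma_finite_measure.borel_measurable_nn_integral[OF prob_space_imp_sigma_finite[OF prob_space_std_gaussian]]) measurable
  then show ?thesis by (simp add: nn_integral_cmult)
 qed
 also have "... = ennreal ((1/(1 - ka^2))^card (insert i I))"
 proof -
  have "(\<integral>\<^sup>+x. (\<integral>\<^sup>+y. ennreal ((mk I ka x y)^2) \<partial>GI I)*C \<partial>GI I) = ennreal ((1/(1 - ka^2))^card I)*C" for C
   unfolding nn_integral_multc[OF mx] insert.IH ..
  then show ?thesis
   unfolding mehler_moment1[OF k] using k2 insert.hyps by (simp add: mult.commute flip: ennreal_mult)
 qed
 finally show ?case .
qed

lemma mk_L2: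
 assumes I: "finite I" and k: "0 <= ka" "ka < 1"
 shows "integrable (GI I >< GI I) (%(x, y). (mk I ka x y)^2)"
  "(LINT p|(GI I >< GI I). (mk I ka (fst p) (snd p))^2) = (1/(1 - ka^2))^card I"
proof -
 have k2: "ka^2 < 1" using k by (simp add: abs_square_less_1)
 have m: "(%(x, y). ennreal ((mk I ka x y)^2)) \<in> borel_measurable (GI I >< GI I)"
  using mk_measurable[of I ka] by (simp add: split_beta')
 have "(\<integral>\<^sup>+p. ennreal ((mk I ka (fst p) (snd p))^2) \<partial>(GI I >< GI I)) = (\<integral>\<^sup>+x. \<integral>\<^sup>+y. ennreal ((mk I ka x y)^2) \<partial>GI I \<partial>GI I)"
  using sigma_finite_measure.nn_integral_fst[OF prob_space_imp_sigma_finite[OF prob_GI] m] by (simp add: split_beta')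
 then have e: "(\<integral>\<^sup>+p. ennreal ((mk I ka (fst p) (snd p))^2) \<partial>(GI I >< GI I)) = ennreal ((1/(1 - ka^2))^card I)"
  unfolding mk_moment[OF I k] .
 have m': "(%p. (mk I ka (fst p) (snd p))^2) \<in> borel_measurable (GI I >< GI I)"
  using mk_measurable[of I ka] by (simp add: split_beta')
 show "integrable (GI I >< GI I) (%(x, y). (mk I ka x y)^2)"
  using e m' by (simp add: split_beta' integrable_iff_bounded)
 show "(LINT p|(GI I >< GI I). (mk I ka (fst p) (snd p))^2) = (1/(1 - ka^2))^card I"
  using e m' k2 by (subst integral_eq_nn_integral) auto
qed

section \<open>Linear functionals and the affine part of the noise operator\<close>

lemma std_gaussian_moments:
 "integrable std_gaussian (%x. x)" "(LINT x|std_gaussian. x) = 0"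
 "integrable std_gaussian (%x. x^2)" "(LINT x|std_gaussian. x^2) = 1"
proof -
 have d: "has_bochner_integral std_gaussian f c" if "has_bochner_integral lborel (%x. std_normal_density x*f x) c" "f \<in> borel_measurable borel" for f :: "real => real" and c
  using that unfolding std_gaussian_def has_bochner_integral_iff
  by (simp add: integrable_density integral_density)
 have 1: "has_bochner_integral std_gaussian (%x. x) 0"
  by (rule d) (use std_normal_moment_odd[of 0] in auto)
 have 2: "has_bochner_integral std_gaussian (%x. x^2) 1"
  by (rule d) (use std_normal_moment_even[of 1] in auto)
 show "integrable std_gaussian (%x. x)" "(LINT x|std_gaussian. x) = 0"
  "integrable std_gaussian (%x. x^2)" "(LINT x|std_gaussian. x^2) = 1"
  using 1 2 by (auto simp: has_bochner_integral_iff)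
qed

definition dot :: "'a set => ('a => real) => ('a => real) => real" where
 "dot I a x = (\<Sum>i\<in>I. a i*x i)"

lemma dot_measurable [measurable (raw)]:
 assumes "!!i. i \<in> I ==> (%x. f x i) \<in> borel_measurable M" "!!i. i \<in> I ==> (%x. g x i) \<in> borel_measurable M"
 shows "(%x. dot I (f x) (g x)) \<in> borel_measurable M"
 unfolding dot_def using assms by (intro borel_measurable_sum borel_measurable_times)

lemma dot_commute: "dot I a b = dot I b a"
 by (simp add: dot_def mult.commute)

lemma dot_mix: "dot I a (mix I c d x y) = c*dot I a x+d*dot I a y"
 by (simp add: dot_def mix_def algebra_simps sum.distrib sum_distrib_left)

lemma dot_self_nonneg: "0 <= dot I a a"
 by (simp add: dot_def sum_nonneg)

text \<open>The Gram criterion for a single row: only its norm matters, so it may be replaced by a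
  one-by-one matrix over the unit type.\<close>

lemma dot_law:
 assumes "finite I"
 shows "distr (GI I) std_gaussian (dot I a) = distr std_gaussian std_gaussian (%t. sqrt (dot I a a)*t)"
proof -
 have "0 <= dot I a a" by (rule dot_self_nonneg)
 let ?ev = "%v :: unit => real. v ()"
 have ev: "?ev \<in> measurable (GI {()}) std_gaussian" by simp
 have "distr (GI I) (GI {()}) (lf {()} I (%_. a)) = distr (GI {()}) (GI {()}) (lf {()} {()} (%_ _. sqrt (dot I a a)))"
  using assms \<open>0 <= dot I a a\<close> by (intro distr_gram) (auto simp: dot_def)
 then have "distr (distr (GI I) (GI {()}) (lf {()} I (%_. a))) std_gaussian ?ev
  = distr (distr (GI {()}) (GI {()}) (lf {()} {()} (%_ _. sqrt (dot I a a)))) std_gaussian ?ev" by simp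
 then have "distr (GI I) std_gaussian (?ev \<circ> lf {()} I (%_. a)) = distr (GI {()}) std_gaussian (?ev \<circ> lf {()} {()} (%_ _. sqrt (dot I a a)))"
  by (simp add: distr_distr[OF ev])
 also have "?ev \<circ> lf {()} I (%_. a) = dot I a" by (auto simp: lf_def dot_def)
 also have "?ev \<circ> lf {()} {()} (%_ _. sqrt (dot I a a)) = (%t. sqrt (dot I a a)*t) \<circ> ?ev" by (auto simp: lf_def)
 also have "distr (GI {()}) std_gaussian ... = distr (distr (GI {()}) std_gaussian ?ev) std_gaussian (%t. sqrt (dot I a a)*t)"
  using ev by (intro distr_distr[symmetric]) auto
 also have "distr (GI {()}) std_gaussian ?ev = std_gaussian"
  using distr_PiM_component[of "{()}" "%_. std_gaussian" "()"] by (simp add: prob_space_std_gaussian)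
 finally show ?thesis .
qed

lemma dot_measurable1: "dot I a \<in> borel_measurable (GI I)"
 by (rule dot_measurable) auto

lemma dot_moments:
 assumes I: "finite I"
 shows "integrable (GI I) (dot I a)" "(LINT x|GI I. dot I a x) = 0"
  "integrable (GI I) (%x. (dot I a x)^2)" "(LINT x|GI I. (dot I a x)^2) = dot I a a"
proof -
 have m: "dot I a \<in> measurable (GI I) std_gaussian" using dot_measurable1 by simp
 have m2: "(%t. sqrt (dot I a a)*t) \<in> measurable std_gaussian std_gaussian" by simp
 have i: "integrable (GI I) (%x. g (dot I a x)) \<longleftrightarrow> integrable std_gaussian (%t. g (sqrt (dot I a a)*t))"
  and e: "(LINT x|GI I. g (dot I a x)) = (LINT t|std_gaussian. g (sqrt (dot I a a)*t))"
  if g: "g \<in> borel_measurable borel" for g :: "real => real"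
 proof -
  have g': "g \<in> borel_measurable std_gaussian" using g by simp
  show "integrable (GI I) (%x. g (dot I a x)) \<longleftrightarrow> integrable std_gaussian (%t. g (sqrt (dot I a a)*t))"
   using integrable_distr_eq[OF m g'] integrable_distr_eq[OF m2 g'] dot_law[OF I] by simp
  show "(LINT x|GI I. g (dot I a x)) = (LINT t|std_gaussian. g (sqrt (dot I a a)*t))"
   using integral_distr[OF m g'] integral_distr[OF m2 g'] dot_law[OF I] by simp
 qed
 define c where "c = sqrt (dot I a a)"
 have c2: "c^2 = dot I a a" unfolding c_def using dot_self_nonneg by simp
 have i1: "integrable (GI I) (%x. dot I a x) \<longleftrightarrow> integrable std_gaussian (%t. c*t)"
  and e1: "(LINT x|GI I. dot I a x) = (LINT t|std_gaussian. c*t)"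
  unfolding c_def by (rule i, simp) (rule e, simp)
 show "integrable (GI I) (dot I a)" "(LINT x|GI I. dot I a x) = 0"
  using i1 e1 std_gaussian_moments(1,2) by simp_all
 have i2: "integrable (GI I) (%x. (dot I a x)^2) \<longleftrightarrow> integrable std_gaussian (%t. (c*t)^2)"
  and e2: "(LINT x|GI I. (dot I a x)^2) = (LINT t|std_gaussian. (c*t)^2)"
  unfolding c_def by (rule i, simp) (rule e, simp)
 show "integrable (GI I) (%x. (dot I a x)^2)" "(LINT x|GI I. (dot I a x)^2) = dot I a a"
  unfolding i2 e2 power_mult_distrib c2 using std_gaussian_moments(3,4) by simp_all
qed

lemma coord_moments:
 assumes I: "finite I" and i: "i \<in> I"
 shows "integrable (GI I) (%x. x i)" "(LINT x|GI I. x i) = 0"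
  "integrable (GI I) (%x. (x i)^2)" "(LINT x|GI I. (x i)^2) = 1"
proof -
 have "dot I (sc 1 i) = (%x. x i)" using I i by (auto simp: dot_def sum_sc)
 moreover have "dot I (sc 1 i) (sc 1 i) = 1" unfolding dot_def sum_sc(1)[OF I i] by (simp add: sc_def)
 ultimately show "integrable (GI I) (%x. x i)" "(LINT x|GI I. x i) = 0"
  "integrable (GI I) (%x. (x i)^2)" "(LINT x|GI I. (x i)^2) = 1"
  using dot_moments[OF I, of "sc 1 i"] by auto
qed

lemma norm2_moment:
 assumes I: "finite I"
 shows "integrable (GI I) (%x. dot I x x)" "(LINT x|GI I. dot I x x) = real (card I)"
 using coord_moments(3,4)[OF I] by (auto simp: dot_def power2_eq_square[symmetric])

text \<open>The first-order Hermite coefficients of \<open>H\<close>. For differentiable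
  \<open>H\<close> integration by parts identifies them with the mean gradient, but no derivative is
  involved here.\<close>

definition grad :: "'a set => (('a => real) => real) => 'a => real" where
 "grad I H = (\<lambda>i\<in>I. (LINT y|GI I. H y*y i))"

lemma bdd_times_integrable:
 assumes "bdd M b f" "integrable M g"
 shows "integrable M (%x. f x*g x)"
proof (rule Bochner_Integration.integrable_bound[of M "%x. b*g x"])
 show "AE x in M. norm (f x*g x) <= norm (b*g x)"
  using bddD(2)[OF assms(1)] by (intro AE_I2) (fastforce simp: abs_mult intro!: mult_right_mono)
qed (use assms bddD(1)[OF assms(1)] in auto)

lemma grad_dot:
 assumes I: "finite I" and H: "bdd (GI I) b H"
 shows "(LINT y|GI I. H y*dot I c y) = dot I c (grad I H)"
proof -
 have i: "integrable (GI I) (%y. H y*y i)" if "i \<in> I" for i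
  by (rule bdd_times_integrable[OF H coord_moments(1)[OF I that]])
 have "(LINT y|GI I. H y*dot I c y) = (LINT y|GI I. (\<Sum>i\<in>I. c i*(H y*y i)))"
  by (simp add: dot_def sum_distrib_left mult_ac)
 also have "... = dot I c (grad I H)"
  using i by (subst Bochner_Integration.integral_sum) (auto simp: dot_def grad_def)
 finally show ?thesis .
qed

text \<open>Cauchy-Schwarz for \<open>H\<close> against the linear functional whose coefficients are
  those of \<open>H\<close> itself.\<close>

lemma grad_bessel:
 assumes I: "finite I" and H: "bdd (GI I) b H"
 shows "dot I (grad I H) (grad I H) <= b^2"
proof -
 let ?a = "grad I H" let ?n = "dot I ?a ?a"
 have n0: "0 <= ?n" by (rule dot_self_nonneg)
 have H2: "integrable (GI I) (%x. (H x)^2)" by (rule GI.bdd_integrable[OF bdd_power2[OF H]])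
 have "?n^2 = (LINT y|GI I. H y*dot I ?a y)^2" by (simp add: grad_dot[OF I H])
 also have "... <= (LINT x|GI I. (H x)^2)*?n"
  using cauchy_schwarz_integral(2)[OF bddD(1)[OF H] dot_measurable1 H2 dot_moments(3)[OF I], of ?a] by (simp add: dot_moments(4)[OF I])
 also have "... <= b^2*?n"
  using GI.bdd_integral_le[OF bdd_power2[OF H]] n0 by (intro mult_right_mono) auto
 finally have "?n*?n <= b^2*?n" by (simp add: power2_eq_square)
 then show ?thesis using n0 by (cases "?n = 0") auto
qed

lemma integrable_pair_fst:
 fixes f :: "'a => real"
 assumes M: "prob_space M" and N: "prob_space N" and f: "integrable M f"
 shows "integrable (M >< N) (%p. f (fst p))"
proof -
 have "distr (M >< N) M fst = M" by (rule prob_space.distr_pair_fst[OF N])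
 then show ?thesis
  using integrable_distr_eq[of fst "M >< N" M f] f by simp
qed

lemma integrable_pair_snd:
 fixes f :: "'b => real"
 assumes M: "prob_space M" and N: "prob_space N" and f: "integrable N f"
 shows "integrable (M >< N) (%p. f (snd p))"
proof -
 interpret pair_sigma_finite N M
  by (intro pair_sigma_finite.intro prob_space_imp_sigma_finite M N)
 show ?thesis
  using integrable_product_swap_iff[of "%p. f (fst p)"] integrable_pair_fst[OF N M f] by (simp add: split_beta')
qed

text \<open>The linear factor is unbounded, so \<open>NO_sym\<close> does not apply and the exchange
  of the correlated pair is carried out again.\<close>

lemma NO_dot:
 assumes I: "finite I" and H: "bdd (GI I) b H" and k: "0 <= ka" "ka <= 1"
 shows "(LINT x|GI I. NO I ka H x*dot I c x) = ka*dot I c (grad I H)"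
proof -
 let ?s = "sqrt (1 - ka^2)" let ?P = "GI I >< GI I"
 have s: "?s^2 = 1 - ka^2" using k by (simp add: abs_square_le_1)
 interpret P: pair_prob_space "GI I" "GI I" by (intro pair_prob_spaceI prob_GI)
 define G where "G = (%p. H (fst p)*dot I c (snd p))"
 have m[measurable]: "G \<in> borel_measurable ?P"
  unfolding G_def using measurable_compose[OF measurable_fst bddD(1)[OF H]] measurable_compose[OF measurable_snd dot_measurable1]
  by (intro borel_measurable_times) auto
 have m1: "(%(x, y). (mix I a b x y, mix I c d x y)) \<in> measurable ?P ?P" for a b c d by measurable
 let ?T = "%(x, y). (mix I ka ?s x y, mix I 1 0 x y)" and ?S = "%(x, y). (mix I 1 0 x y, mix I ka ?s x y)"
 have law: "distr ?P ?P ?T = distr ?P ?P ?S"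
  using s by (intro mix_law[OF I]) auto
 have idot: "integrable ?P (%p. dot I c (fst p))" "integrable ?P (%p. dot I c (snd p))"
  using integrable_pair_fst[OF prob_GI prob_GI dot_moments(1)[OF I]] integrable_pair_snd[OF prob_GI prob_GI dot_moments(1)[OF I]]
  by auto
 have Hm: "bdd ?P b (%p. H (mix I a d (fst p) (snd p)))" for a d using bdd_mix2[OF H] by (simp add: split_beta')
 have iT: "integrable ?P (%p. H (mix I ka ?s (fst p) (snd p))*dot I c (fst p))"
  by (rule bdd_times_integrable[OF Hm idot(1)])
 have iS: "integrable ?P (%p. H (mix I 1 0 (fst p) (snd p))*(ka*dot I c (fst p)+?s*dot I c (snd p)))"
  using idot by (intro bdd_times_integrable[OF Hm]) auto
 have d1: "dot I c (mix I 1 0 x y) = dot I c x" for x y by (simp add: dot_mix)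
 have "(LINT x|GI I. NO I ka H x*dot I c x) = (LINT x|GI I. LINT y|GI I. H (mix I ka ?s x y)*dot I c x)"
  by (simp add: NO_def)
 also have "... = (LINT p|?P. G (?T p))"
  using P.integral_fst'[OF iT] by (simp add: G_def split_beta' d1)
 also have "... = (LINT p|distr ?P ?P ?T. G p)" by (rule integral_distr[OF m1 m, symmetric])
 also have "... = (LINT p|?P. G (?S p))" unfolding law by (rule integral_distr[OF m1 m])
 also have "... = (LINT x|GI I. LINT y|GI I. H (mix I 1 0 x y)*(ka*dot I c x+?s*dot I c y))"
  using P.integral_fst'[OF iS] by (simp add: G_def split_beta' dot_mix)
 also have "... = (LINT x|GI I. H x*(ka*dot I c x))"
  using dot_moments(1,2)[OF I, of c]
  by (intro Bochner_Integration.integral_cong) (auto simp: mix_1_0 GI.prob_space)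
 also have "... = ka*dot I c (grad I H)"
  using grad_dot[OF I H, of c] by (simp add: mult.left_commute)
 finally show ?thesis .
qed

text \<open>Pythagoras: the subtracted constant and linear parts are the projections of the noised
  function to the first two Hermite levels.\<close>

lemma affine_defect:
 assumes I: "finite I" and H: "bdd (GI I) b H" and k: "0 <= ka" "ka <= 1"
 defines "R == %x. NO I ka H x - (LINT y|GI I. H y) - ka*dot I (grad I H) x"
 shows "integrable (GI I) (%x. (R x)^2)" "R \<in> borel_measurable (GI I)"
  "(LINT x|GI I. (R x)^2) = FF I H (ka^2) - FF I H 0 - ka^2*dot I (grad I H) (grad I H)"
proof -
 let ?a = "grad I H" let ?n = "dot I ?a ?a" let ?e = "(LINT y|GI I. H y)"
 note N = bdd_NO[OF H, of ka]
 show "R \<in> borel_measurable (GI I)"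
  unfolding R_def using bddD(1)[OF N] dot_measurable1[of I ?a] by measurable
 have i: "integrable (GI I) (%x. (NO I ka H x)^2)" "integrable (GI I) (NO I ka H)"
  "integrable (GI I) (%x. NO I ka H x*dot I ?a x)" "integrable (GI I) (dot I ?a)" "integrable (GI I) (%x. (dot I ?a x)^2)"
  using GI.bdd_integrable[OF bdd_power2[OF N]] GI.bdd_integrable[OF N] bdd_times_integrable[OF N dot_moments(1)[OF I]]
   dot_moments[OF I] by auto
 have e: "(R x)^2 = (NO I ka H x)^2+?e^2 + ka^2*(dot I ?a x)^2 - 2*?e*NO I ka H x - 2 * ka*(NO I ka H x*dot I ?a x)+2 * ka*?e*dot I ?a x" for x
  by (simp add: R_def power2_eq_square algebra_simps)
 show "integrable (GI I) (%x. (R x)^2)" unfolding e using i by auto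
 have "(LINT x|GI I. (R x)^2) = (LINT x|GI I. (NO I ka H x)^2)+?e^2 + ka^2*?n - 2*?e*(LINT x|GI I. NO I ka H x) - 2 * ka*(LINT x|GI I. NO I ka H x*dot I ?a x)"
  unfolding e using i by (simp add: dot_moments[OF I] GI.prob_space)
 also have "... = FF I H (ka^2) - FF I H 0 - ka^2*?n"
  unfolding NO_L2[OF I H k] FF_0[OF I H] using k by (simp add: NO_integral[OF I H] NO_dot[OF I H k] power2_eq_square)
 finally show "(LINT x|GI I. (R x)^2) = FF I H (ka^2) - FF I H 0 - ka^2*?n" .
qed

text \<open>The error of the affine part is governed by the remainder of the Mehler kernel; this crude bound depends on the dimension.\<close>

lemma affine_defect_kernel:
 assumes I: "finite I" and H: "bdd (GI I) b H" and k: "0 <= ka" "ka < 1"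
 shows "FF I H (ka^2) - FF I H 0 - ka^2*dot I (grad I H) (grad I H) <= b^2*((1/(1 - ka^2))^card I - 1 - real (card I) * ka^2)"
proof -
 let ?P = "GI I >< GI I" let ?s = "sqrt (1 - ka^2)" let ?e = "(LINT y|GI I. H y)"
 interpret P: pair_prob_space "GI I" "GI I" by (intro pair_prob_spaceI prob_GI)
 define m where "m = (%p. mk I ka (fst p) (snd p))"
 define d where "d = (%p :: ('a => real) \<times> ('a => real). dot I (fst p) (snd p))"
 have mm[measurable]: "m \<in> borel_measurable ?P" using mk_measurable[of I ka] by (simp add: m_def split_beta')
 have dm[measurable]: "d \<in> borel_measurable ?P" unfolding d_def
  by (intro dot_measurable measurable_compose[OF measurable_fst measurable_GI_component] measurable_compose[OF measurable_snd measurable_GI_component])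
 have m2: "integrable ?P (%p. (m p)^2)" "(LINT p|?P. (m p)^2) = (1/(1 - ka^2))^card I"
  using mk_L2[OF I k] by (simp_all add: m_def split_beta')
 have dsq: "(\<integral>\<^sup>+p. ennreal ((d p)^2) \<partial>?P) = ennreal (real (card I))"
 proof -
  have "(\<integral>\<^sup>+p. ennreal ((d p)^2) \<partial>?P) = (\<integral>\<^sup>+x. \<integral>\<^sup>+y. ennreal ((dot I x y)^2) \<partial>GI I \<partial>GI I)"
  proof -
   have "(%p. ennreal ((d p)^2)) \<in> borel_measurable ?P" by measurable
   from sigma_finite_measure.nn_integral_fst[OF prob_space_imp_sigma_finite[OF prob_GI] this]
   show ?thesis by (simp add: d_def)
  qed
  also have "... = (\<integral>\<^sup>+x. ennreal (dot I x x) \<partial>GI I)"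
   using dot_moments(3,4)[OF I] by (intro nn_integral_cong) (simp add: nn_integral_eq_integral)
  also have "... = ennreal (real (card I))"
   using norm2_moment[OF I] by (simp add: nn_integral_eq_integral dot_self_nonneg)
  finally show ?thesis .
 qed
 have d2: "integrable ?P (%p. (d p)^2)" "(LINT p|?P. (d p)^2) = real (card I)"
 proof -
  show "integrable ?P (%p. (d p)^2)" using dsq by (simp add: integrable_iff_bounded)
  show "(LINT p|?P. (d p)^2) = real (card I)" using dsq by (subst integral_eq_nn_integral) auto
 qed
 note mi = P.abs_integral_power2_le(1)[OF mm m2(1)] and di = P.abs_integral_power2_le(1)[OF dm d2(1)]
 note mdi = cauchy_schwarz_integral(1)[OF mm dm m2(1) d2(1)]
 have m1: "(LINT p|?P. m p) = 1"
 proof -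
  have "(LINT y|GI I. mk I ka x y) = 1" for x
   using mk_integral(1)[OF I k, of "%_. 1" x] by (simp add: GI.prob_space)
  then show ?thesis using P.integral_fst'[OF mi] by (simp add: m_def GI.prob_space)
 qed
 have d1: "(LINT p|?P. d p) = 0"
  using P.integral_fst'[OF di] by (simp add: d_def dot_moments(2)[OF I])
 have md: "(LINT p|?P. m p*d p) = ka*real (card I)"
 proof -
  have "(LINT y|GI I. mk I ka x y*dot I x y) = ka*dot I x x" for x
   unfolding mk_integral(1)[OF I k dot_measurable1] dot_mix
   using dot_moments(1,2)[OF I, of x] by (simp add: GI.prob_space)
  then show ?thesis using P.integral_fst'[OF mdi] norm2_moment[OF I] by (simp add: m_def d_def)
 qed
 \<comment> \<open>The part of the Mehler kernel above the linear level. Its squared norm is the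
   total moment minus the contributions \<open>1\<close> and \<open>real (card I) * ka^2\<close> of
   levels zero and one.\<close>
 define R where "R = (%p. m p - 1 - ka*d p)"
 have Re: "(R p)^2 = (m p)^2+1 + ka^2*(d p)^2 - 2*m p - 2 * ka*(m p*d p)+2 * ka*d p" for p
  by (simp add: R_def power2_eq_square algebra_simps)
 have R2: "integrable ?P (%p. (R p)^2)" unfolding Re using m2 d2 mi di mdi by auto
 have "(LINT p|?P. (R p)^2) = (1/(1 - ka^2))^card I+1 + ka^2*real (card I) - 2 - 2 * ka*(ka*real (card I))"
  unfolding Re using m2 d2 mi di mdi m1 d1 md P.prob_space by simp
 also have "... = (1/(1 - ka^2))^card I - 1 - real (card I) * ka^2" by (simp add: power2_eq_square)
 finally have RR: "(LINT p|?P. (R p)^2) = (1/(1 - ka^2))^card I - 1 - real (card I) * ka^2" .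
 have Rm: "(%y. R (x, y)) \<in> borel_measurable (GI I)" if "x \<in> space (GI I)" for x
  using measurable_compose[OF measurable_Pair1'[OF that], of R "GI I" borel] unfolding R_def by measurable
 define S where "S = (%x. NO I ka H x - ?e - ka*dot I (grad I H) x)"
 have SR: "S x = (LINT y|GI I. H y*R (x, y))" for x
 proof -
  have im: "integrable (GI I) (%y. mk I ka x y)"
   using mk_integral(2)[OF I k, of "%_. 1" x] by simp
  have 1: "integrable (GI I) (%y. H y*mk I ka x y)" "integrable (GI I) H" "integrable (GI I) (%y. H y*dot I x y)"
   by (rule bdd_times_integrable[OF H im], rule GI.bdd_integrable[OF H], rule bdd_times_integrable[OF H dot_moments(1)[OF I]])
  have "(LINT y|GI I. H y*R (x, y)) = (LINT y|GI I. H y*mk I ka x y - H y - ka*(H y*dot I x y))"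
   by (simp add: R_def m_def d_def algebra_simps)
  also have "... = (LINT y|GI I. H y*mk I ka x y) - ?e - ka*(LINT y|GI I. H y*dot I x y)"
   using 1 by simp
  also have "(LINT y|GI I. H y*mk I ka x y) = NO I ka H x"
   unfolding NO_def using mk_integral(1)[OF I k bddD(1)[OF H], of x] by (simp add: mult.commute)
  finally show ?thesis unfolding S_def grad_dot[OF I H] dot_commute[of I "grad I H" x] ..
 qed
 have AE: "AE x in GI I. integrable (GI I) (%y. (R (x, y))^2)"
  using P.AE_integrable_fst'[OF R2] .
 have H2: "integrable (GI I) (%x. (H x)^2)" by (rule GI.bdd_integrable[OF bdd_power2[OF H]])
 have "(LINT x|GI I. (S x)^2) <= (LINT x|GI I. b^2*(LINT y|GI I. (R (x, y))^2))"
 proof (rule integral_mono_AE)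
  show "integrable (GI I) (%x. (S x)^2)" unfolding S_def using k by (intro affine_defect(1)[OF I H]) auto
  show "integrable (GI I) (%x. b^2*(LINT y|GI I. (R (x, y))^2))" using P.integrable_fst'[OF R2] by simp
  show "AE x in GI I. (S x)^2 <= b^2*(LINT y|GI I. (R (x, y))^2)"
   using AE
  proof (rule AE_mp, intro AE_I2 impI)
   fix x assume x: "x \<in> space (GI I)" and i: "integrable (GI I) (%y. (R (x, y))^2)"
   have "(S x)^2 <= (LINT y|GI I. (H y)^2)*(LINT y|GI I. (R (x, y))^2)"
    unfolding SR by (rule cauchy_schwarz_integral(2)[OF bddD(1)[OF H] Rm[OF x] H2 i])
   also have "... <= b^2*(LINT y|GI I. (R (x, y))^2)"
    using GI.bdd_integral_le[OF bdd_power2[OF H]] by (intro mult_right_mono) auto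
   finally show "(S x)^2 <= b^2*(LINT y|GI I. (R (x, y))^2)" .
  qed
 qed
 also have "... = b^2*(LINT p|?P. (R p)^2)" using P.integral_fst'[OF R2] by simp
 finally show ?thesis
  unfolding RR S_def using affine_defect(3)[OF I H, of ka] k by simp
qed

text \<open>The defect collects the levels \<open>j >= 2\<close>, where
  \<open>r^j <= 4*r^2*(1/2)^j\<close> for \<open>r = ka^2 <= 1/2\<close>, so it is at most
  \<open>4*r^2\<close> times the stability at \<open>1/2\<close>. The level-one weight is reached as
  a limit of difference quotients at \<open>t\<close> tending to \<open>0\<close>; the
  dimension-dependent kernel bound enters only in this limit, where it disappears.\<close>

theorem noise_almost_affine:
 assumes I: "finite I" and H: "bdd (GI I) b H" and k: "0 <= ka" "ka^2 <= 1/2"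
 shows "(LINT x|GI I. (NO I ka H x - (LINT y|GI I. H y) - ka*dot I (grad I H) x)^2) <= 4 * ka^4*b^2"
proof -
 let ?W = "dot I (grad I H) (grad I H)" let ?n = "card I"
 define r where "r = ka^2"
 have r: "0 <= r" "r <= 1/2" using k by (auto simp: r_def)
 have k1: "ka <= 1" using k by (smt (verit) one_power2 power2_le_imp_le field_sum_of_halves)
 have step: "FF I H r - FF I H 0 <= r*((FF I H t - FF I H 0)/t)+4*r^2*b^2" if t: "0 < t" "t < 1" for t
 proof -
  \<comment> \<open>Encodes \<open>r^j - 0^j <= r/t*(t^j - 0^j)+4*r^2*((1/2)^j - 0^j)\<close>, an
    equality for \<open>j = 0\<close>.\<close>
  define c where "c = (%i::nat. if i = 0 then 1 - r/t - 4*r^2 else if i = 1 then - 1 else if i = 2 then r/t else 4*r^2)"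
  define q where "q = (%i::nat. if i = 0 then 0 else if i = 1 then r else if i = 2 then t else 1/2 :: real)"
  have S: "(\<Sum>l\<in>{0, 1, 2, 3}. c l*G (q l)) = (1 - r/t - 4*r^2)*G 0 - G r+r/t*G t+4*r^2*G (1/2)" for G :: "real => real"
   by (simp add: c_def q_def)
  have "0 <= (\<Sum>l\<in>{0, 1, 2, 3}. c l*FF I H (q l))"
  proof (rule FF_monomial_principle[OF I H])
   show "0 <= q l \<and> q l <= 1" if "l \<in> {0, 1, 2, 3}" for l using that r t by (auto simp: q_def)
   have "{l \<in> {0, 1, 2, 3}. q l = 1} = {}" using r t by (auto simp: q_def split: if_splits)
   then show "0 <= (\<Sum>l | l \<in> {0, 1, 2, 3} \<and> q l = 1. c l)" by (simp only: sum.empty)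
   show "0 <= (\<Sum>l\<in>{0, 1, 2, 3}. c l*q l^j)" for j
   proof -
    consider "j = 0" | "j = 1" | i where "j = Suc (Suc i)" by (metis One_nat_def not0_implies_Suc)
    then show ?thesis
    proof cases
     case 3
     have "r^j = r^2*r^i" by (simp add: 3 power2_eq_square)
     also have "... <= r^2*(1/2)^i" using r by (intro mult_left_mono power_mono) auto
     also have "... = 4*r^2*(1/2)^j" by (simp add: 3)
     finally have "r^j <= 4*r^2*(1/2)^j" .
     moreover have "0 <= r/t*t^j" using r t by simp
     moreover have "(0::real)^j = 0" by (simp add: 3)
     ultimately show ?thesis unfolding S[of "%x. x^j"] by (simp add: 3 power_0_left del: power_Suc)
    qed (unfold S[of "%x. x^j"], use r t in auto)
   qed
  qed simp
  then have "FF I H r - FF I H 0 <= r*((FF I H t - FF I H 0)/t)+4*r^2*(FF I H (1/2) - FF I H 0)"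
   unfolding S[of "FF I H"] by (simp add: algebra_simps diff_divide_distrib)
  also have "... <= r*((FF I H t - FF I H 0)/t)+4*r^2*b^2"
  proof -
   have "FF I H (1/2) - FF I H 0 <= b^2"
    using FF_bound[OF I H, of "1/2"] FF_nonneg[OF I H, of 0] by (simp add: power2_eq_square)
   then show ?thesis by (intro add_left_mono mult_left_mono) auto
  qed
  finally show ?thesis .
 qed
 \<comment> \<open>The excess of the kernel bound per unit of \<open>t\<close>. The derivative of
   \<open>(1/(1 - t))^?n\<close> at \<open>0\<close> is \<open>?n\<close>, so it tends to
   \<open>0\<close>.\<close>
 define h where "h = (%t::real. ((1/(1 - t))^?n - 1)/t - real ?n)"
 have step2: "FF I H r - FF I H 0 <= r*(?W+b^2*h t)+4*r^2*b^2" if t: "0 < t" "t < 1" for t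
 proof -
  have "sqrt t < 1" using t by simp
  from affine_defect_kernel[OF I H _ this] t
  have "FF I H t - FF I H 0 <= t*?W+b^2*((1/(1 - t))^?n - 1 - real ?n*t)" by simp
  then have "(FF I H t - FF I H 0)/t <= (t*?W+b^2*((1/(1 - t))^?n - 1 - real ?n*t))/t"
   using t by (intro divide_right_mono) auto
  also have "... = ?W+b^2*h t" using t by (simp add: h_def field_simps)
  finally have "r*((FF I H t - FF I H 0)/t) <= r*(?W+b^2*h t)" using r by (intro mult_left_mono) auto
  then show ?thesis using step[OF t] by linarith
 qed
 have "h \<midarrow>0\<rightarrow> 0"
 proof -
  have "((%t::real. (1/(1 - t))^?n) has_real_derivative real ?n) (at 0)"
   by (auto intro!: derivative_eq_intros)
  then have "(%t. ((1/(1 - t))^?n - 1)/t) \<midarrow>0\<rightarrow> real ?n"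
   by (simp add: has_field_derivative_iff)
  then show ?thesis unfolding h_def by (auto intro: tendsto_eq_intros)
 qed
 then have "(h \<longlongrightarrow> 0) (at_right 0)" by (rule filterlim_mono) (auto simp: at_within_le_at)
 then have "((%t. r*(?W+b^2*h t)+4*r^2*b^2) \<longlongrightarrow> r*(?W+b^2*0)+4*r^2*b^2) (at_right 0)"
  by (intro tendsto_intros)
 then have "FF I H r - FF I H 0 <= r*(?W+b^2*0)+4*r^2*b^2"
 proof (rule tendsto_lowerbound)
  show "eventually (%t. FF I H r - FF I H 0 <= r*(?W+b^2*h t)+4*r^2*b^2) (at_right 0)"
   unfolding eventually_at_right[of 0 "1::real", simplified] using step2 by (intro exI[of _ 1]) auto
 qed simp
 then show ?thesis
  unfolding affine_defect(3)[OF I H k(1) k1] by (simp add: r_def power_mult_distrib mult_ac flip: power_mult)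
qed

text \<open>The squared density of the shifted measure has mean \<open>exp (dot I d d)\<close>, so
  the density differs from \<open>1\<close> by \<open>exp (dot I d d) - 1\<close> in mean square,
  which is linear in \<open>dot I d d\<close> for short shifts. For long shifts the trivial bound
  \<open>2\<close> is enough.\<close>

lemma gauss_shift:
 assumes I: "finite I" and g: "bdd (GI I) 1 g"
 shows "\<bar>(LINT y|GI I. g (mix I 1 1 d y)) - (LINT y|GI I. g y)\<bar> <= 2 * sqrt (dot I d d)"
proof -
 have gd: "bdd (GI I) 1 (%y. g (mix I 1 1 d y))" by (rule bdd_compose[OF g mix_const_measurable])
 show ?thesis
 proof (cases "dot I d d <= 1")
  case False
  have "\<bar>(LINT y|GI I. g (mix I 1 1 d y)) - (LINT y|GI I. g y)\<bar> <= 1+1"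
   using GI.bdd_integral_le[OF gd] GI.bdd_integral_le[OF g] by linarith
  also have "... <= 2 * sqrt (dot I d d)" using False by simp
  finally show ?thesis .
 next
  case True
  let ?D = "GD I d 1"
  have Dm: "?D \<in> borel_measurable (GI I)" by (rule GD_measurable) auto
  have sq1: "(\<integral>\<^sup>+y. ennreal ((gdens (d i) 1 y)^2) \<partial>std_gaussian) = ennreal (exp ((d i)^2))" for i
  proof -
   have "(gdens (d i) 1 y)^2 = exp ((d i)^2)*gdens (2*d i) 1 y" for y
    by (simp add: gdens_def power2_eq_square field_simps flip: exp_add)
   then have "(\<integral>\<^sup>+y. ennreal ((gdens (d i) 1 y)^2) \<partial>std_gaussian) = ennreal (exp ((d i)^2))*(\<integral>\<^sup>+y. ennreal (gdens (2*d i) 1 y)*1 \<partial>std_gaussian)"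
    by (simp add: ennreal_mult gdens_nonneg nn_integral_cmult)
   also have "(\<integral>\<^sup>+y. ennreal (gdens (2*d i) 1 y)*1 \<partial>std_gaussian) = 1"
    by (subst nn_integral_affine1[symmetric]) (auto simp: emeasure_std_gaussian_UNIV)
   finally show ?thesis by simp
  qed
  have D2: "(\<integral>\<^sup>+y. ennreal ((?D y)^2) \<partial>GI I) = ennreal (exp (dot I d d))"
  proof -
   have "(\<integral>\<^sup>+y. ennreal ((?D y)^2) \<partial>GI I) = (\<integral>\<^sup>+y. (\<Prod>i\<in>I. ennreal ((gdens (d i) 1 (y i))^2)) \<partial>GI I)"
    by (simp add: GD_def prod_ennreal prod_power_distrib)
   also have "... = (\<Prod>i\<in>I. \<integral>\<^sup>+y. ennreal ((gdens (d i) 1 y)^2) \<partial>std_gaussian)"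
    using I by (intro SG.product_nn_integral_prod) auto
   also have "... = ennreal (exp (dot I d d))"
    unfolding sq1 using I by (simp add: prod_ennreal exp_sum dot_def power2_eq_square)
   finally show ?thesis .
  qed
  have i2: "integrable (GI I) (%y. (?D y)^2)" using D2 Dm by (simp add: integrable_iff_bounded)
  have e2: "(LINT y|GI I. (?D y)^2) = exp (dot I d d)" using D2 Dm by (subst integral_eq_nn_integral) auto
  have i1: "integrable (GI I) ?D" by (rule GI.abs_integral_power2_le(1)[OF Dm i2])
  have e1: "(LINT y|GI I. ?D y) = 1" using integral_affine(1)[OF I, of 1 "%_. 1" d] by (simp add: GI.prob_space)
  have iD: "integrable (GI I) (%y. (?D y - 1)^2)" and eD: "(LINT y|GI I. (?D y - 1)^2) = exp (dot I d d) - 1"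
   unfolding power2_diff using i1 i2 e1 e2 by (auto simp: GI.prob_space)
  have Dm': "(%y. ?D y - 1) \<in> borel_measurable (GI I)" using Dm by simp
  have "((LINT y|GI I. g (mix I 1 1 d y)) - (LINT y|GI I. g y))^2 = (LINT y|GI I. g y*(?D y - 1))^2"
  proof -
   have "(LINT y|GI I. g y*(?D y - 1)) = (LINT y|GI I. g y*?D y) - (LINT y|GI I. g y)"
    unfolding right_diff_distrib using bdd_times_integrable[OF g i1] GI.bdd_integrable[OF g] by simp
   then show ?thesis using integral_affine(1)[OF I _ bddD(1)[OF g], of 1 d] by (simp add: mult.commute)
  qed
  also have "... <= (LINT y|GI I. (g y)^2)*(exp (dot I d d) - 1)"
   using cauchy_schwarz_integral(2)[OF bddD(1)[OF g] Dm' GI.bdd_integrable[OF bdd_power2[OF g]] iD] unfolding eD .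
  also have "... <= 1*(exp (dot I d d) - 1)"
   using GI.bdd_integral_le[OF bdd_power2[OF g]] dot_self_nonneg[of I d] by (intro mult_right_mono) auto
  also have "... <= (2 * sqrt (dot I d d))^2"
  proof -
   have "dot I d d*dot I d d <= dot I d d" using True dot_self_nonneg[of I d] by (rule mult_left_le)
   then have "exp (dot I d d) - 1 <= 4*dot I d d"
    using exp_bound[OF dot_self_nonneg True] dot_self_nonneg[of I d] by (simp add: power2_eq_square)
   then show ?thesis using dot_self_nonneg[of I d] by (simp add: power_mult_distrib)
  qed
  finally show ?thesis using dot_self_nonneg[of I d] by (subst (asm) abs_le_square_iff[symmetric]) simp
 qed
qed

section \<open>Polynomial approximation of smooth functions\<close>

text \<open>Smoothness over any index set, since it is applied both to functions on \<real>^n and to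
  their profiles on \<real>^k.\<close>

definition smo :: "'a set => real => (('a => real) => real) => bool" where
 "smo I s qs \<longleftrightarrow> bdd (GI I) 1 qs \<and> (ALL t>0. (LINT x|GI I. \<bar>qs x - NO I (exp (- t)) qs x\<bar>) <= s * sqrt t)"

lemma bounded_fun_bdd: "bounded_fun n f \<longleftrightarrow> bdd (GI {..<n}) 1 f"
 by (auto simp: bounded_fun_def bdd_def gaussian_GI Rn_def space_GI image_subset_iff abs_le_iff)

lemma smooth_fun_smo: "smooth_fun n s f \<longleftrightarrow> smo {..<n} s f"
 unfolding smooth_fun_def smo_def noise_NO[abs_def] bounded_fun_bdd gaussian_GI ..

lemma smo_energy:
 assumes I: "finite I" and qs: "smo I s qs" and t: "0 < t"
 shows "FF I qs 1 - FF I qs (exp (- t)) <= s * sqrt t"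
proof -
 note b = conjunct1[OF qs[unfolded smo_def]]
 note N = bdd_NO[OF b, of "exp (- t)"]
 have d: "bdd (GI I) (1+1) (%x. qs x - NO I (exp (- t)) qs x)" by (rule bdd_diff[OF b N])
 have "FF I qs 1 - FF I qs (exp (- t)) = (LINT x|GI I. qs x*(qs x - NO I (exp (- t)) qs x))"
  unfolding FF_1[OF b] unfolding FF_def
  using GI.bdd_integrable[OF bdd_power2[OF b]] GI.bdd_integrable[OF bdd_mult[OF b N]]
  by (simp add: right_diff_distrib power2_eq_square)
 also have "... <= (LINT x|GI I. \<bar>qs x - NO I (exp (- t)) qs x\<bar>)"
 proof (rule integral_mono)
  show "integrable (GI I) (%x. qs x*(qs x - NO I (exp (- t)) qs x))" by (rule GI.bdd_integrable[OF bdd_mult[OF b d]])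
  show "integrable (GI I) (%x. \<bar>qs x - NO I (exp (- t)) qs x\<bar>)" by (rule GI.bdd_integrable[OF bdd_abs[OF d]])
  fix x assume x: "x \<in> space (GI I)"
  have "qs x*(qs x - NO I (exp (- t)) qs x) <= \<bar>qs x\<bar> * \<bar>qs x - NO I (exp (- t)) qs x\<bar>"
   by (metis abs_ge_self abs_mult)
  also have "... <= 1*\<bar>qs x - NO I (exp (- t)) qs x\<bar>"
   using bddD(2)[OF b x] by (intro mult_right_mono) auto
  finally show "qs x*(qs x - NO I (exp (- t)) qs x) <= \<bar>qs x - NO I (exp (- t)) qs x\<bar>" by simp
 qed
 also have "... <= s * sqrt t" using qs t by (simp add: smo_def)
 finally show ?thesis .
qed

text \<open>Coefficients of the polynomial with roots \<open>1, ka, \<dots>, ka ^ (m - 1)\<close> and constant term \<open>1\<close>, whose value at \<open>NO ka\<close>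
  annihilates all Hermite components of degree less than \<open>m\<close>.\<close>

primrec fco :: "real => nat => nat => real" where
 "fco ka 0 l = (if l = 0 then 1 else 0)"
| "fco ka (Suc m) l = fco ka m l - (case l of 0 => 0 | Suc l' => (1 / ka)^m*fco ka m l')"

lemma fco_0: "fco ka m 0 = 1"
 by (induction m) auto

lemma fco_gt: "m < l ==> fco ka m l = 0"
 by (induction m arbitrary: l) (auto split: nat.split)

lemma fco_poly: "(\<Sum>l\<le>m. fco ka m l*x^l) = (\<Prod>i<m. 1 - (1 / ka)^i*x)"
proof (induction m)
 case (Suc m)
 have "(\<Sum>l\<le>Suc m. fco ka (Suc m) l*x^l) = (\<Sum>l\<le>Suc m. fco ka m l*x^l) - (\<Sum>l\<le>Suc m. (case l of 0 => 0 | Suc l' => (1 / ka)^m*fco ka m l')*x^l)"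
  by (simp add: left_diff_distrib sum_subtractf del: sum.atMost_Suc)
 also have "(\<Sum>l\<le>Suc m. fco ka m l*x^l) = (\<Sum>l\<le>m. fco ka m l*x^l)" by (simp add: fco_gt)
 also have "(\<Sum>l\<le>Suc m. (case l of 0 => 0 | Suc l' => (1 / ka)^m*fco ka m l')*x^l) = (1 / ka)^m*x*(\<Sum>l\<le>m. fco ka m l*x^l)"
  by (subst sum.atMost_Suc_shift) (simp add: sum_distrib_left mult_ac)
 finally show ?case using Suc.IH by (simp add: algebra_simps)
qed simp

lemma fco_abs:
 assumes "0 < ka"
 shows "(\<Sum>l\<le>m. \<bar>fco ka m l\<bar>) <= (\<Prod>i<m. 1+(1 / ka)^i)"
proof (induction m)
 case (Suc m)
 have "(\<Sum>l\<le>Suc m. \<bar>fco ka (Suc m) l\<bar>) <= (\<Sum>l\<le>Suc m. \<bar>fco ka m l\<bar> + (case l of 0 => 0 | Suc l' => (1 / ka)^m*\<bar>fco ka m l'\<bar>))"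
 proof (rule sum_mono)
  fix l
  show "\<bar>fco ka (Suc m) l\<bar> <= \<bar>fco ka m l\<bar> + (case l of 0 => 0 | Suc l' => (1 / ka)^m*\<bar>fco ka m l'\<bar>)"
   using assms abs_triangle_ineq4[of "fco ka m l" "(1 / ka)^m*fco ka m (l - 1)"] by (auto split: nat.split simp: abs_mult)
 qed
 also have "... = (\<Sum>l\<le>Suc m. \<bar>fco ka m l\<bar>)+(\<Sum>l\<le>Suc m. case l of 0 => 0 | Suc l' => (1 / ka)^m*\<bar>fco ka m l'\<bar>)"
  by (rule sum.distrib)
 also have "(\<Sum>l\<le>Suc m. case l of 0 => 0 | Suc l' => (1 / ka)^m*\<bar>fco ka m l'\<bar>) = (1 / ka)^m*(\<Sum>l\<le>m. \<bar>fco ka m l\<bar>)"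
  by (subst sum.atMost_Suc_shift) (simp add: sum_distrib_left)
 also have "(\<Sum>l\<le>Suc m. \<bar>fco ka m l\<bar>) = (\<Sum>l\<le>m. \<bar>fco ka m l\<bar>)" by (simp add: fco_gt)
 finally have "(\<Sum>l\<le>Suc m. \<bar>fco ka (Suc m) l\<bar>) <= (1+(1 / ka)^m)*(\<Sum>l\<le>m. \<bar>fco ka m l\<bar>)" by (simp add: algebra_simps)
 also have "... <= (1+(1 / ka)^m)*(\<Prod>i<m. 1+(1 / ka)^i)"
  using Suc.IH assms by (intro mult_left_mono) auto
 finally show ?case by (simp add: mult.commute)
qed simp

text \<open>As the constant coefficient is \<open>1\<close>, \<open>qs - Qop qs\<close> is the
  polynomial with coefficients \<open>fco\<close> applied to the noise operator. Leaving out
  \<open>l = 0\<close> keeps only integral operators with square integrable kernels.\<close>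

definition Qop :: "'a set => real => nat => (('a => real) => real) => ('a => real) => real" where
 "Qop I ka m qs x = - (\<Sum>l=1..m. fco ka m l*NO I (ka^l) qs x)"

text \<open>On Hermite level \<open>j\<close> the squared error factor is the square of the
  polynomial at \<open>ka^j\<close>: zero for \<open>j <= d\<close> and at most one beyond. For
  \<open>j > d\<close> and \<open>t = 1/d\<close> one has \<open>exp (- t)^j <= 1/2\<close>, so in
  all cases the factor is at most \<open>2*(1 - exp (- t)^j)\<close>, and \<open>smo_energy\<close>
  applies.\<close>

lemma Qop_approx:
 assumes I: "finite I" and qs: "smo I s qs" and k: "0 < ka" "ka < 1" and d: "0 < d"
 shows "integrable (GI I) (%x. (qs x - Qop I ka (Suc d) qs x)^2)" "(%x. qs x - Qop I ka (Suc d) qs x) \<in> borel_measurable (GI I)"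
  "(LINT x|GI I. (qs x - Qop I ka (Suc d) qs x)^2) <= 2 * s / sqrt d"
proof -
 note b = conjunct1[OF qs[unfolded smo_def]]
 define m where "m = Suc d"
 define c where "c = fco ka m"
 have N1: "NO I 1 qs x = qs x" if "x \<in> space (GI I)" for x
  using that by (simp add: NO_def mix_1_0 GI.prob_space)
 have e: "qs x - Qop I ka m qs x = (\<Sum>l\<le>m. c l*NO I (ka^l) qs x)" if "x \<in> space (GI I)" for x
  using that by (simp add: Qop_def c_def fco_0 N1 atMost_atLeast0 sum.atLeast_Suc_atMost)
 have kl: "0 <= ka^l" "ka^l <= 1" for l using k by (auto intro: power_le_one)
 have bN: "bdd (GI I) 1 (NO I (ka^l) qs)" for l by (rule bdd_NO[OF b])
 have iN: "integrable (GI I) (%x. NO I (ka^l) qs x*NO I (ka^l') qs x)" for l l'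
  by (rule GI.bdd_integrable[OF bdd_mult[OF bN bN]])
 have NN: "(LINT x|GI I. NO I (ka^l) qs x*NO I (ka^l') qs x) = FF I qs (ka^(l+l'))" for l l'
 proof -
  have "(LINT x|GI I. NO I (ka^l) qs x*NO I (ka^l') qs x) = (LINT x|GI I. qs x*NO I (ka^l) (NO I (ka^l') qs) x)"
   using kl by (intro NO_sym[OF I b bN, symmetric]) auto
  also have "... = FF I qs (ka^(l+l'))"
   unfolding FF_def using kl by (intro Bochner_Integration.integral_cong) (auto simp: NO_NO[OF I b] power_add)
  finally show ?thesis .
 qed
 have sq: "(\<Sum>l\<le>m. c l*NO I (ka^l) qs x)^2 = (\<Sum>l\<le>m. \<Sum>l'\<le>m. c l*c l'*(NO I (ka^l) qs x*NO I (ka^l') qs x))" for x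
  by (simp add: power2_eq_square sum_product mult_ac)
 have "bdd (GI I) (1+\<bar>Qb\<bar>) (%x. qs x)" for Qb :: real by (rule bdd_mono[OF b]) simp
 show meas: "(%x. qs x - Qop I ka (Suc d) qs x) \<in> borel_measurable (GI I)"
  unfolding Qop_def using bddD(1)[OF b] bddD(1)[OF bN]
  by (intro borel_measurable_diff borel_measurable_uminus borel_measurable_sum borel_measurable_times) auto
 have "integrable (GI I) (%x. (\<Sum>l\<le>m. c l*NO I (ka^l) qs x)^2)"
  unfolding sq using iN by auto
 then show "integrable (GI I) (%x. (qs x - Qop I ka (Suc d) qs x)^2)"
  by (rule Bochner_Integration.integrable_cong[THEN iffD1, rotated -1]) (auto simp: e m_def[symmetric])
 define t where "t = 1/real d"
 have t: "0 < t" using d by (simp add: t_def)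
 have "(LINT x|GI I. (qs x - Qop I ka m qs x)^2) = (LINT x|GI I. (\<Sum>l\<le>m. c l*NO I (ka^l) qs x)^2)"
  by (intro Bochner_Integration.integral_cong) (auto simp: e)
 also have "... = (\<Sum>l\<le>m. \<Sum>l'\<le>m. c l*c l'*FF I qs (ka^(l+l')))"
  unfolding sq using iN by (simp add: Bochner_Integration.integral_sum NN)
 also have "... <= 2*(FF I qs 1 - FF I qs (exp (- t)))"
 proof -
  \<comment> \<open>The evaluation points: a pair \<open>(l, l')\<close> stands for
    \<open>ka^(l+l')\<close>, while \<open>True\<close> and \<open>False\<close> stand for
    \<open>1\<close> and \<open>exp (- t)\<close>.\<close>
  define L where "L = ({..m} \<times> {..m}) <+> {True, False}"
  define cc where "cc = (%u. case u of Inl (l, l') => - (c l*c l') | Inr b => if b then 2 else - 2)"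
  define r where "r = (%u. case u of Inl (l, l') => ka^(l+l') | Inr b => if b then 1 else exp (- t))"
  have S: "(\<Sum>u\<in>L. cc u*G (r u)) = 2*(G 1 - G (exp (- t))) - (\<Sum>l\<le>m. \<Sum>l'\<le>m. c l*c l'*G (ka^(l+l')))" for G :: "real => real"
  proof -
   have "(\<Sum>p\<in>{..m} \<times> {..m}. cc (Inl p)*G (r (Inl p))) = (\<Sum>p\<in>{..m} \<times> {..m}. - (c (fst p)*c (snd p)*G (ka^(fst p + snd p))))"
    by (intro sum.cong) (auto simp: cc_def r_def)
   also have "... = - (\<Sum>l\<le>m. \<Sum>l'\<le>m. c l*c l'*G (ka^(l+l')))"
    unfolding sum_negf sum.cartesian_product by (simp only: split_beta')
   finally have 1: "(\<Sum>p\<in>{..m} \<times> {..m}. cc (Inl p)*G (r (Inl p))) = - (\<Sum>l\<le>m. \<Sum>l'\<le>m. c l*c l'*G (ka^(l+l')))" .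
   have 2: "(\<Sum>u\<in>{True, False}. cc (Inr u)*G (r (Inr u))) = 2*(G 1 - G (exp (- t)))"
    by (simp add: cc_def r_def)
   have "(\<Sum>u\<in>L. cc u*G (r u)) = (\<Sum>p\<in>{..m} \<times> {..m}. cc (Inl p)*G (r (Inl p)))+(\<Sum>u\<in>{True, False}. cc (Inr u)*G (r (Inr u)))"
    unfolding L_def by (subst sum.Plus) (simp_all add: comp_def)
   then show ?thesis unfolding 1 2 by simp
  qed
  have "0 <= (\<Sum>u\<in>L. cc u*FF I qs (r u))"
  proof (rule FF_monomial_principle[OF I b])
   show "finite L" by (simp add: L_def)
   show "0 <= r u \<and> r u <= 1" if "u \<in> L" for u
    using t kl by (auto simp: r_def split: sum.splits)
   have k1: "ka^j = 1 \<longleftrightarrow> j = 0" for j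
    using k power_strict_decreasing[of 0 j ka] by (cases "j = 0") auto
   have "{u \<in> L. r u = 1} = {Inl (0, 0), Inr True}"
   proof -
    have r1: "r (Inl (a, b)) = ka^(a+b)" "r (Inr True) = 1" "r (Inr False) ~= 1" for a b
     using t by (auto simp: r_def)
    show ?thesis
    proof (intro set_eqI iffI)
     fix u assume u: "u \<in> {u \<in> L. r u = 1}"
     show "u \<in> {Inl (0, 0), Inr True}"
     proof (cases u)
      case (Inl p)
      then show ?thesis using u r1(1)[of "fst p" "snd p"] by (cases p) (simp add: k1)
     next
      case (Inr b)
      then show ?thesis using u r1(3) by (cases b) auto
     qed
    next
     fix u :: "nat \<times> nat+bool" assume "u \<in> {Inl (0, 0), Inr True}"
     then show "u \<in> {u \<in> L. r u = 1}" using r1(1)[of 0 0] r1(2) by (auto simp: L_def Plus_def)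
    qed
   qed
   \<comment> \<open>At the point \<open>1\<close> the pair \<open>(0, 0)\<close> contributes
     \<open>- 1\<close> and the energy term \<open>2\<close>.\<close>
   then have "(\<Sum>u | u \<in> L \<and> r u = 1. cc u) = 1" by (simp add: cc_def c_def fco_0)
   then show "0 <= (\<Sum>u | u \<in> L \<and> r u = 1. cc u)" by simp
   fix j :: nat
   define p where "p = (\<Prod>i<m. 1 - (1 / ka)^i * ka^j)"
   have "(\<Sum>l\<le>m. \<Sum>l'\<le>m. c l*c l'*(ka^(l+l'))^j) = (\<Sum>l\<le>m. c l*(ka^j)^l)^2"
    by (simp add: power2_eq_square sum_product power_add power_mult_distrib mult_ac flip: power_mult)
   also have "... = p^2" by (simp add: c_def fco_poly p_def)
   finally have pe: "(\<Sum>l\<le>m. \<Sum>l'\<le>m. c l*c l'*(ka^(l+l'))^j) = p^2" .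
   have "p^2 <= 2*(1 - exp (- t)^j)"
   proof (cases "j < m")
    case True
    have "1 - (1 / ka)^j * ka^j = 0" using k by (simp add: power_divide)
    then have "p = 0" unfolding p_def using True by (intro prod_zero) auto
    then show ?thesis using t by (simp add: power_le_one)
   next
    case False
    have f: "0 <= 1 - (1 / ka)^i * ka^j" "1 - (1 / ka)^i * ka^j <= 1" if "i < m" for i
    proof -
     have "(1 / ka)^i * ka^j = ka^(j - i)" using that False k by (simp add: power_diff power_divide)
     then show "0 <= 1 - (1 / ka)^i * ka^j" "1 - (1 / ka)^i * ka^j <= 1" using kl by auto
    qed
    have "0 <= p" "p <= 1" unfolding p_def using f by (auto intro!: prod_nonneg prod_le_1)
    then have "p^2 <= 1" by (simp add: power_le_one)
    moreover have "exp (- t)^j <= 1/2"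
    proof -
     have "1 <= real j*t" using False d by (simp add: t_def m_def field_simps)
     then have "2 <= 1+real j*t" by simp
     also have "... <= exp (real j*t)" by (rule exp_ge_add_one_self)
     finally have "1/exp (real j*t) <= 1/2" by (intro divide_left_mono) auto
     moreover have "exp (- t)^j = 1/exp (real j*t)"
      by (simp only: exp_minus inverse_eq_divide power_one_over exp_of_nat_mult)
     ultimately show ?thesis by simp
    qed
    ultimately show ?thesis by simp
   qed
   then show "0 <= (\<Sum>u\<in>L. cc u*r u^j)"
    unfolding S[of "%x. x^j"] pe by simp
  qed
  then show ?thesis unfolding S[of "FF I qs"] by simp
 qed
 also have "... <= 2*(s * sqrt t)" using smo_energy[OF I qs t] by simp
 also have "... = 2 * s / sqrt d" by (simp add: t_def real_sqrt_divide)
 finally show "(LINT x|GI I. (qs x - Qop I ka (Suc d) qs x)^2) <= 2 * s / sqrt d" by (simp add: m_def)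
qed

definition qk :: "'a set => real => nat => ('a => real) \<times> ('a => real) => real" where
 "qk I ka m p = - (\<Sum>l=1..m. fco ka m l*mk I (ka^l) (fst p) (snd p))"

lemma qk_measurable [measurable]: "qk I ka m \<in> borel_measurable (GI I >< GI I)"
proof -
 have "(%p. mk I (ka^l) (fst p) (snd p)) \<in> borel_measurable (GI I >< GI I)" for l
  using mk_measurable[of I "ka^l"] by (simp add: split_beta')
 then show ?thesis unfolding qk_def[abs_def] by (intro borel_measurable_uminus borel_measurable_sum borel_measurable_times) auto
qed

lemma qk_Qop:
 assumes I: "finite I" and b: "bdd (GI I) 1 qs" and k: "0 < ka" "ka < 1"
 shows "integrable (GI I) (%y. qk I ka m (x, y)*qs y)" "(LINT y|GI I. qk I ka m (x, y)*qs y) = Qop I ka m qs x"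
proof -
 have kl: "0 <= ka^l" "ka^l < 1" if "l \<in> {1..m}" for l
  using k that power_strict_decreasing[of 0 l ka] by auto
 have i: "integrable (GI I) (%y. mk I (ka^l) x y*qs y)" if l: "l \<in> {1..m}" for l
 proof -
  have "integrable (GI I) (%y. mk I (ka^l) x y*1)"
   using mk_integral(2)[OF I kl[OF l], of "%_. 1" x] by simp
  from bdd_times_integrable[OF b this] show ?thesis by (simp add: mult.commute)
 qed
 have e: "qk I ka m (x, y)*qs y = - (\<Sum>l=1..m. fco ka m l*(mk I (ka^l) x y*qs y))" for y
  by (simp add: qk_def sum_distrib_right mult.assoc)
 show "integrable (GI I) (%y. qk I ka m (x, y)*qs y)" unfolding e using i by auto
 have "(LINT y|GI I. qk I ka m (x, y)*qs y) = - (\<Sum>l=1..m. fco ka m l*(LINT y|GI I. mk I (ka^l) x y*qs y))"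
  unfolding e using i by (simp add: Bochner_Integration.integral_sum)
 also have "... = Qop I ka m qs x"
  unfolding Qop_def using mk_integral(1)[OF I kl bddD(1)[OF b]] by (simp add: NO_def)
 finally show "(LINT y|GI I. qk I ka m (x, y)*qs y) = Qop I ka m qs x" .
qed

text \<open>The square of a bound for the sum of absolute coefficients, times the kernel moment at
  \<open>ka\<close>, the largest correlation that occurs in \<open>qk\<close>.\<close>

definition Vq :: "real => nat => nat => real" where
 "Vq ka m n = (\<Prod>i<m. 1+(1 / ka)^i)^2*(1/(1 - ka^2))^n"

lemma Vq_pos:
 assumes "0 < ka" "ka < 1"
 shows "0 < Vq ka m n"
proof -
 have "ka^2 < 1" using assms by (simp add: abs_square_less_1)
 moreover have "0 < (\<Prod>i<m. 1+(1 / ka)^i)"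
  using assms by (intro prod_pos) (simp add: add_pos_nonneg)
 ultimately show ?thesis unfolding Vq_def by (intro mult_pos_pos zero_less_power) auto
qed

lemma Vq_nonneg: "0 < ka ==> ka < 1 ==> 0 <= Vq ka m n"
 using Vq_pos[of ka m n] by simp

lemma qk_moment:
 assumes I: "finite I" and k: "0 < ka" "ka < 1"
 shows "(\<integral>\<^sup>+x. \<integral>\<^sup>+y. ennreal ((qk I ka m (x, y))^2) \<partial>GI I \<partial>GI I) <= ennreal (Vq ka m (card I))"
proof -
 let ?P = "GI I >< GI I"
 define c where "c = (%l. \<bar>fco ka m l\<bar>)"
 define A where "A = (\<Sum>l=1..m. c l)"
 have A0: "0 <= A" by (simp add: A_def c_def sum_nonneg)
 have kl: "0 <= ka^l" "ka^l < 1" "(ka^l)^2 <= ka^2" if "l \<in> {1..m}" for l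
  using k that power_strict_decreasing[of 0 l ka] power_decreasing[of 1 l ka] by (auto intro!: power_mono)
 have k2: "ka^2 < 1" using k by (simp add: abs_square_less_1)
 have mm: "(%p. mk I (ka^l) (fst p) (snd p)) \<in> borel_measurable ?P" for l
  using mk_measurable[of I "ka^l"] by (simp add: split_beta')
 \<comment> \<open>Cauchy-Schwarz with each weight \<open>c l\<close> split into two square roots,
   so that the weights are summed but not squared.\<close>
 have pt: "(qk I ka m p)^2 <= A*(\<Sum>l=1..m. c l*(mk I (ka^l) (fst p) (snd p))^2)" for p
 proof -
  let ?m = "%l. mk I (ka^l) (fst p) (snd p)"
  have q1: "\<bar>qk I ka m p\<bar> <= (\<Sum>l=1..m. sqrt (c l)*(sqrt (c l)*\<bar>?m l\<bar>))"
  proof -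
   have "sqrt (c l)*(sqrt (c l)*x) = c l*x" for l x by (simp add: c_def flip: mult.assoc)
   then show ?thesis
    unfolding qk_def abs_minus_cancel using sum_abs[of "%l. fco ka m l*?m l" "{1..m}"] by (simp only: abs_mult c_def)
  qed
  then have "(qk I ka m p)^2 <= (\<Sum>l=1..m. sqrt (c l)*(sqrt (c l)*\<bar>?m l\<bar>))^2"
   using power_mono[OF q1 abs_ge_zero, of 2] by simp
  also have "... <= (\<Sum>l=1..m. (sqrt (c l))^2)*(\<Sum>l=1..m. (sqrt (c l)*\<bar>?m l\<bar>)^2)"
   by (rule Cauchy_Schwarz_ineq_sum)
  also have "... = A*(\<Sum>l=1..m. c l*(?m l)^2)" by (simp add: A_def c_def power_mult_distrib)
  finally show ?thesis .
 qed
 have fst: "(\<integral>\<^sup>+x. \<integral>\<^sup>+y. ennreal ((g (x, y))^2) \<partial>GI I \<partial>GI I) = (\<integral>\<^sup>+p. ennreal ((g p)^2) \<partial>?P)" if [measurable]: "g \<in> borel_measurable ?P" for g :: "_ => real"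
 proof -
  have "(%p. ennreal ((g p)^2)) \<in> borel_measurable ?P" by measurable
  from sigma_finite_measure.nn_integral_fst[OF prob_space_imp_sigma_finite[OF prob_GI] this] show ?thesis .
 qed
 have "(\<integral>\<^sup>+x. \<integral>\<^sup>+y. ennreal ((qk I ka m (x, y))^2) \<partial>GI I \<partial>GI I) = (\<integral>\<^sup>+p. ennreal ((qk I ka m p)^2) \<partial>?P)"
  by (rule fst) measurable
 also have "... <= (\<integral>\<^sup>+p. ennreal A*(\<Sum>l=1..m. ennreal (c l)*ennreal ((mk I (ka^l) (fst p) (snd p))^2)) \<partial>?P)"
  using pt A0 by (intro nn_integral_mono) (simp add: c_def sum_nonneg ennreal_mult[symmetric] sum_ennreal)
 also have "... = ennreal A*(\<Sum>l=1..m. ennreal (c l)*(\<integral>\<^sup>+p. ennreal ((mk I (ka^l) (fst p) (snd p))^2) \<partial>?P))"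
  using mm by (simp add: nn_integral_cmult nn_integral_sum)
 also have "... <= ennreal A*(\<Sum>l=1..m. ennreal (c l)*ennreal ((1/(1 - ka^2))^card I))"
 proof (intro mult_left_mono sum_mono)
  fix l assume l: "l \<in> {1..m}"
  have "(\<integral>\<^sup>+p. ennreal ((mk I (ka^l) (fst p) (snd p))^2) \<partial>?P) = ennreal ((1/(1 - (ka^l)^2))^card I)"
   using fst[OF mm, of l] mk_moment[OF I kl(1,2)[OF l]] by simp
  also have "... <= ennreal ((1/(1 - ka^2))^card I)"
   using kl(3)[OF l] k2 by (intro ennreal_leI power_mono divide_left_mono) auto
  finally show "(\<integral>\<^sup>+p. ennreal ((mk I (ka^l) (fst p) (snd p))^2) \<partial>?P) <= ennreal ((1/(1 - ka^2))^card I)" .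
 qed auto
 also have "... = ennreal (A*(A*(1/(1 - ka^2))^card I))"
  using A0 k2 by (simp add: ennreal_mult sum_distrib_right[symmetric] A_def c_def sum_ennreal)
 also have "... <= ennreal (Vq ka m (card I))"
 proof (rule ennreal_leI)
  have "A <= (\<Sum>l\<le>m. c l)" unfolding A_def by (rule sum_mono2) (auto simp: c_def)
  also have "... <= (\<Prod>i<m. 1+(1 / ka)^i)" unfolding c_def by (rule fco_abs[OF k(1)])
  finally have "A^2 <= (\<Prod>i<m. 1+(1 / ka)^i)^2" using A0 by (intro power_mono)
  then have "A^2*(1/(1 - ka^2))^card I <= Vq ka m (card I)"
   unfolding Vq_def using k2 by (intro mult_right_mono) auto
  then show "A*(A*(1/(1 - ka^2))^card I) <= Vq ka m (card I)" by (simp add: power2_eq_square mult.assoc)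
 qed
 finally show ?thesis .
qed

section \<open>Empirical averages and finite nets of smooth functions\<close>

text \<open>Centered independent copies are orthogonal, so only the diagonal terms of the squared
  sum survive.\<close>

lemma iid_average_variance:
 fixes h :: "'a => real" and J :: "'b set"
 assumes N: "prob_space N" and J: "finite J" "J ~= {}" and hm[measurable]: "h \<in> borel_measurable N" and h2: "integrable N (%x. (h x)^2)"
 defines "D == %Y. (\<Sum>j\<in>J. h (Y j))/real (card J) - (LINT x|N. h x)"
 shows "integrable (PiM J (%_. N)) (%Y. (D Y)^2)" "(LINT Y|PiM J (%_. N). (D Y)^2) <= (LINT x|N. (h x)^2)/real (card J)"
proof -
 interpret N: prob_space N by (rule N)
 interpret P: product_prob_space "%_. N" UNIV by (intro product_prob_spaceI N)
 interpret PP: prob_space "PiM J (%_. N)" by (intro prob_space_PiM N)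
 define um where "um = (LINT x|N. h x)"
 define g where "g = (%x. h x - um)"
 have ih: "integrable N h" by (rule N.abs_integral_power2_le(1)[OF hm h2])
 have ig: "integrable N g" and eg: "(LINT x|N. g x) = 0"
  using ih by (auto simp: g_def um_def N.prob_space)
 have ig2: "integrable N (%x. (g x)^2)" and eg2: "(LINT x|N. (g x)^2) = (LINT x|N. (h x)^2) - um^2"
  using ih h2 N.variance_eq[OF ih h2] by (auto simp: g_def um_def power2_diff)
 have c0: "real (card J) > 0" using J by (simp add: card_gt_0_iff)
 have De: "D Y = (\<Sum>j\<in>J. g (Y j))/real (card J)" for Y
  using c0 by (simp add: D_def g_def um_def sum_subtractf field_simps)
 \<comment> \<open>Writes \<open>g (Y i)*g (Y j)\<close> as a product over all coordinates, in a
   form that also covers \<open>i = j\<close>.\<close>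
 define f :: "'b => 'b => 'b => 'a => real" where "f = (%i j k x. (if k = i then g x else 1)*(if k = j then g x else (1::real)))"
 have fi: "integrable N (f i j k)" for i j k
  using ig ig2 by (cases "k = i"; cases "k = j") (auto simp: f_def power2_eq_square)
 have fe: "(\<Prod>k\<in>J. f i j k (Y k)) = g (Y i)*g (Y j)" if "i \<in> J" "j \<in> J" for i j Y
  using that J by (simp add: f_def prod.distrib prod.delta)
 have i2: "integrable (PiM J (%_. N)) (%Y. g (Y i)*g (Y j))" if "i \<in> J" "j \<in> J" for i j
  using P.product_integrable_prod[OF J(1), of "f i j"] fi by (simp add: fe that)
 have e2: "(LINT Y|PiM J (%_. N). g (Y i)*g (Y j)) = (if i = j then (LINT x|N. (g x)^2) else 0)" if ij: "i \<in> J" "j \<in> J" for i j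
 proof -
  have "(LINT Y|PiM J (%_. N). g (Y i)*g (Y j)) = (\<Prod>k\<in>J. (LINT x|N. f i j k x))"
   using P.product_integral_prod[OF J(1), of "f i j"] fi by (simp add: fe ij)
  also have "... = (if i = j then (LINT x|N. (g x)^2) else 0)"
  proof (cases "i = j")
   case True
   have "(LINT x|N. f i j k x) = (if k = i then (LINT x|N. (g x)^2) else 1)" for k
    using True by (auto simp: f_def power2_eq_square N.prob_space)
   then show ?thesis using True ij J by (simp add: prod.delta)
  next
   case False
   have "(LINT x|N. f i j i x) = 0" using False eg by (simp add: f_def)
   then have "(\<Prod>k\<in>J. (LINT x|N. f i j k x)) = 0" using ij J by (intro prod_zero) auto
   then show ?thesis using False by simp
  qed
  finally show ?thesis .
 qed
 have sq: "(D Y)^2 = (\<Sum>i\<in>J. \<Sum>j\<in>J. g (Y i)*g (Y j))/(real (card J))^2" for Y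
  unfolding De power_divide by (simp add: power2_eq_square sum_product)
 show "integrable (PiM J (%_. N)) (%Y. (D Y)^2)" unfolding sq using i2 by auto
 have "(LINT Y|PiM J (%_. N). (D Y)^2) = (\<Sum>i\<in>J. \<Sum>j\<in>J. if i = j then (LINT x|N. (g x)^2) else 0)/(real (card J))^2"
  unfolding sq using i2 e2 by (simp add: Bochner_Integration.integral_sum)
 also have "... = (LINT x|N. (g x)^2)/real (card J)"
  using J c0 by (simp add: sum.delta power2_eq_square)
 also have "... <= (LINT x|N. (h x)^2)/real (card J)"
  unfolding eg2 by (intro divide_right_mono) auto
 finally show "(LINT Y|PiM J (%_. N). (D Y)^2) <= (LINT x|N. (h x)^2)/real (card J)" .
qed

abbreviation unif :: "real measure" where
 "unif == uniform_measure lborel {- 1..1}"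

lemma prob_unif: "prob_space unif"
 by (intro prob_space_uniform_measure) auto

text \<open>For uniform \<open>u\<close> a random sign with mean \<open>v\<close>. Replacing values
  by signs leaves only finitely many outcomes to count.\<close>

definition rsgn :: "real => real => real" where
 "rsgn v u = (if u <= v then 1 else - 1)"

lemma rsgn_integral:
 assumes "\<bar>v\<bar> <= 1"
 shows "(LINT u|unif. rsgn v u) = v"
proof -
 interpret U: prob_space unif by (rule prob_unif)
 have "rsgn v = (%u. 2*indicator {..v} u - 1)" by (auto simp: rsgn_def fun_eq_iff)
 moreover have "measure unif {..v} = (v + 1)/2"
 proof -
  have "{- 1..1} \<inter> {..v} = {- 1..v}" using assms by auto
  then show ?thesis using assms by (subst measure_uniform_measure) auto
 qed
 ultimately show ?thesis by (simp add: U.prob_space U.emeasure_eq_measure field_simps)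
qed

text \<open>Maurey's empirical method: randomized signs of \<open>qs\<close> at \<open>M\<close> random points determine \<open>Qop qs\<close> up to \<open>O(1 / sqrt M)\<close>
  in mean square. So for a large separated family, at some choice of the points half of the members
  have different sign vectors.\<close>

lemma maurey:
 fixes m :: nat
 assumes I: "finite I" and b: "bdd (GI I) 1 qs" and k: "0 < ka" "ka < 1" and M: "0 < M"
 defines "N == GI I >< unif"
 defines "g == %Y x. (\<Sum>j<M. qk I ka m (x, fst (Y j))*rsgn (qs (fst (Y j))) (snd (Y j)))/real M"
 shows "(\<integral>\<^sup>+Y. \<integral>\<^sup>+x. ennreal ((g Y x - Qop I ka m qs x)^2) \<partial>GI I \<partial>PiM {..<M} (%_. N)) <= ennreal (Vq ka m (card I)/real M)"
  "(%Y. \<integral>\<^sup>+x. ennreal ((g Y x - Qop I ka m qs x)^2) \<partial>GI I) \<in> borel_measurable (PiM {..<M} (%_. N))"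
  "(%(Y, x). (g Y x - Qop I ka m qs x)^2) \<in> borel_measurable (PiM {..<M} (%_. N) >< GI I)"
proof -
 let ?P = "PiM {..<M} (%_. N)"
 have N: "prob_space N" unfolding N_def by (intro prob_space_pairI prob_GI prob_unif)
 interpret P: pair_prob_space ?P "GI I" by (intro pair_prob_spaceI prob_space_PiM N prob_GI)
 interpret NN: pair_prob_space "GI I" unif by (intro pair_prob_spaceI prob_unif prob_GI)
 note [measurable] = bddD(1)[OF b]
 define q where "q = qk I ka m"
 have q[measurable]: "q \<in> borel_measurable (GI I >< GI I)" by (simp add: q_def)
 have Qm[measurable]: "Qop I ka m qs \<in> borel_measurable (GI I)"
  unfolding Qop_def[abs_def] using bddD(1)[OF bdd_NO[OF b]] by (intro borel_measurable_uminus borel_measurable_sum borel_measurable_times) auto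
 have rs: "(%p. rsgn (qs (fst p)) (snd p)) \<in> borel_measurable N"
  unfolding rsgn_def N_def by measurable
 have comp: "(%p. fst p j) \<in> measurable (?P >< GI I) N" if "j < M" for j
  using that by (intro measurable_compose[OF measurable_fst measurable_component_singleton]) auto
 have gm: "(%p. g (fst p) (snd p)) \<in> borel_measurable (?P >< GI I)"
  unfolding g_def q_def[symmetric]
 proof (intro borel_measurable_divide borel_measurable_sum borel_measurable_times borel_measurable_const)
  fix j assume "j \<in> {..<M}"
  then have c: "(%p. fst p j) \<in> measurable (?P >< GI I) N" by (intro comp) simp
  have c1: "(%p. fst (fst p j)) \<in> measurable (?P >< GI I) (GI I)"
   using measurable_compose[OF c, of fst "GI I"] by (simp add: N_def)
  show "(%p. q (snd p, fst (fst p j))) \<in> borel_measurable (?P >< GI I)"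
   by (rule measurable_compose[OF measurable_Pair[OF measurable_snd c1] q])
  show "(%p. rsgn (qs (fst (fst p j))) (snd (fst p j))) \<in> borel_measurable (?P >< GI I)"
   by (rule measurable_compose[OF c rs])
 qed
 show m3: "(%(Y, x). (g Y x - Qop I ka m qs x)^2) \<in> borel_measurable (?P >< GI I)"
  using gm by (simp add: split_beta')
 then have m4: "(%(Y, x). ennreal ((g Y x - Qop I ka m qs x)^2)) \<in> borel_measurable (?P >< GI I)"
  by (simp add: split_beta')
 show "(%Y. \<integral>\<^sup>+x. ennreal ((g Y x - Qop I ka m qs x)^2) \<partial>GI I) \<in> borel_measurable ?P"
  by (rule sigma_finite_measure.borel_measurable_nn_integral[OF prob_space_imp_sigma_finite[OF prob_GI] m4])
 have "(\<integral>\<^sup>+Y. \<integral>\<^sup>+x. ennreal ((g Y x - Qop I ka m qs x)^2) \<partial>GI I \<partial>?P) = (\<integral>\<^sup>+x. \<integral>\<^sup>+Y. ennreal ((g Y x - Qop I ka m qs x)^2) \<partial>?P \<partial>GI I)"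
  using P.Fubini'[OF m4] by simp
 also have "... <= (\<integral>\<^sup>+x. (\<integral>\<^sup>+y. ennreal ((q (x, y))^2) \<partial>GI I)*ennreal (1/real M) \<partial>GI I)"
 proof (rule nn_integral_mono)
  fix x assume x: "x \<in> space (GI I)"
  have qx[measurable]: "(%y. q (x, y)) \<in> borel_measurable (GI I)"
   by (rule measurable_compose[OF measurable_Pair1'[OF x] q])
  show "(\<integral>\<^sup>+Y. ennreal ((g Y x - Qop I ka m qs x)^2) \<partial>?P) <= (\<integral>\<^sup>+y. ennreal ((q (x, y))^2) \<partial>GI I)*ennreal (1/real M)"
  \<comment> \<open>The section of the kernel at \<open>x\<close> may fail to be square integrable;
    then the claimed bound is infinite.\<close>
  proof (cases "(\<integral>\<^sup>+y. ennreal ((q (x, y))^2) \<partial>GI I) = \<infinity>")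
   case True
   then show ?thesis using M by (simp add: ennreal_top_mult)
  next
   case False
   then have q2: "integrable (GI I) (%y. (q (x, y))^2)"
    by (intro integrableI_bounded) (auto simp: less_top[symmetric])
   define h where "h = (%p. q (x, fst p)*rsgn (qs (fst p)) (snd p))"
   have hm: "h \<in> borel_measurable N"
    unfolding h_def using measurable_compose[OF measurable_fst qx, of unif] rs by (simp add: N_def)
   have h2e: "(h p)^2 = (q (x, fst p))^2" for p by (simp add: h_def rsgn_def)
   have h2: "integrable N (%p. (h p)^2)"
    unfolding h2e N_def by (rule integrable_pair_fst[OF prob_GI prob_unif q2])
   have h1: "integrable N h" by (rule prob_space.abs_integral_power2_le(1)[OF N hm h2])
   have eh2: "(LINT p|N. (h p)^2) = (LINT y|GI I. (q (x, y))^2)"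
    using NN.integral_fst'[OF h2[unfolded N_def]] NN.M2.prob_space by (simp add: h2e N_def)
   have eh: "(LINT p|N. h p) = Qop I ka m qs x"
   proof -
    have "(LINT p|N. h p) = (LINT y|GI I. LINT u|unif. h (y, u))"
     using NN.integral_fst'[OF h1[unfolded N_def]] by (simp add: N_def)
    also have "... = (LINT y|GI I. q (x, y)*qs y)"
     using bddD(2)[OF b] by (intro Bochner_Integration.integral_cong) (auto simp: h_def rsgn_integral)
    also have "... = Qop I ka m qs x" unfolding q_def by (rule qk_Qop(2)[OF I b k])
    finally show ?thesis .
   qed
   have "{..<M} ~= {}" using M by auto
   note var = iid_average_variance[OF N finite_lessThan this hm h2]
   have "(\<integral>\<^sup>+Y. ennreal ((g Y x - Qop I ka m qs x)^2) \<partial>?P) = ennreal (LINT Y|?P. ((\<Sum>j\<in>{..<M}. h (Y j))/real (card {..<M}) - (LINT p|N. h p))^2)"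
   proof -
    have gd: "g Y x - Qop I ka m qs x = (\<Sum>j\<in>{..<M}. h (Y j))/real (card {..<M}) - (LINT p|N. h p)" for Y
     unfolding eh by (simp add: g_def h_def q_def)
    show ?thesis unfolding gd using var(1) by (rule nn_integral_eq_integral) simp
   qed
   also have "... <= ennreal ((LINT y|GI I. (q (x, y))^2)/real M)"
    using var(2) by (intro ennreal_leI) (simp add: eh2)
   also have "... = (\<integral>\<^sup>+y. ennreal ((q (x, y))^2) \<partial>GI I)*ennreal (1/real M)"
    using q2 by (simp add: nn_integral_eq_integral ennreal_mult[symmetric])
   finally show ?thesis .
  qed
 qed
 also have "... = (\<integral>\<^sup>+x. \<integral>\<^sup>+y. ennreal ((q (x, y))^2) \<partial>GI I \<partial>GI I)*ennreal (1/real M)"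
 proof (rule nn_integral_multc)
  have "(%(x, y). ennreal ((q (x, y))^2)) \<in> borel_measurable (GI I >< GI I)" by measurable
  then show "(%x. \<integral>\<^sup>+y. ennreal ((q (x, y))^2) \<partial>GI I) \<in> borel_measurable (GI I)"
   by (rule sigma_finite_measure.borel_measurable_nn_integral[OF prob_space_imp_sigma_finite[OF prob_GI]])
 qed
 also have "... <= ennreal (Vq ka m (card I))*ennreal (1/real M)"
  unfolding q_def by (intro mult_right_mono qk_moment[OF I k]) auto
 also have "... = ennreal (Vq ka m (card I)/real M)"
  using Vq_nonneg[OF k] by (simp add: ennreal_mult[symmetric])
 finally show "(\<integral>\<^sup>+Y. \<integral>\<^sup>+x. ennreal ((g Y x - Qop I ka m qs x)^2) \<partial>GI I \<partial>?P) <= ennreal (Vq ka m (card I)/real M)" .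
qed

text \<open>By Markov each member exceeds twice its mean error with probability at most one half, so
  some choice \<open>Y\<close> of sample points serves at least half of the family. Two served
  members with equal sign vectors have the same empirical average, hence lie too close together; so
  the sign vectors are distinct.\<close>

lemma separated_card:
 assumes I: "finite I" and k: "0 < ka" "ka < 1" and M: "0 < M" and d: "0 < d" and F: "finite F" "!!qs. qs \<in> F ==> smo I s qs" and s: "0 <= s"
  and sep: "!!qs qs'. qs \<in> F ==> qs' \<in> F ==> qs ~= qs' ==> (LINT x|GI I. (qs x - qs' x)^2) > 16 * s / sqrt d+16*(Vq ka (Suc d) (card I)/real M)"
 shows "card F <= 2*2^M"
proof -
 define N where "N = GI I >< unif"
 define g where "g = (%qs Y x. (\<Sum>j<M. qk I ka (Suc d) (x, fst (Y j))*rsgn (qs (fst (Y j))) (snd (Y j)))/real M)"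
 define D where "D = (%qs Y. \<integral>\<^sup>+x. ennreal ((g qs Y x - Qop I ka (Suc d) qs x)^2) \<partial>GI I)"
 define v where "v = Vq ka (Suc d) (card I)/real M"
 have vp: "0 < v" unfolding v_def using Vq_pos[OF k] M by simp
 then have v0: "0 <= v" by simp
 let ?P = "PiM {..<M} (%_. N)"
 have N: "prob_space N" unfolding N_def by (intro prob_space_pairI prob_GI prob_unif)
 interpret P: prob_space ?P by (intro prob_space_PiM N)
 have b: "bdd (GI I) 1 qs" if "qs \<in> F" for qs using F(2)[OF that] by (simp add: smo_def)
 have Dm: "D qs \<in> borel_measurable ?P" and DI: "(\<integral>\<^sup>+Y. D qs Y \<partial>?P) <= ennreal v" if "qs \<in> F" for qs
  using maurey(1,2)[OF I b[OF that] k M, of "Suc d"] unfolding D_def g_def N_def v_def by auto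
 have "EX Y:space ?P. card {qs \<in> F. D qs Y > ennreal (2 * v)} <= card F div 2"
  proof (rule ccontr)
   assume "\<not> ?thesis"
   \<comment> \<open>The extra \<open>1\<close> is gained from rounding in \<open>div 2\<close> and
     makes the final inequality strict.\<close>
   then have "card F+1 <= 2*card {qs \<in> F. D qs Y > ennreal (2 * v)}" if "Y \<in> space ?P" for Y
    using that by (force simp: not_le)
   then have big: "real (card F)+1 <= 2*real (card {qs \<in> F. D qs Y > ennreal (2 * v)})" if "Y \<in> space ?P" for Y
    using that by (metis (mono_tags, lifting) of_nat_1 of_nat_add of_nat_le_iff of_nat_mult of_nat_numeral)
   have pm: "P.prob {Y \<in> space ?P. D qs Y > ennreal (2 * v)} <= 1/2" if p: "qs \<in> F" for qs
   proof -
    note Dm[OF p, measurable]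
    have "ennreal (2 * v)*emeasure ?P {Y \<in> space ?P. D qs Y > ennreal (2 * v)} = (\<integral>\<^sup>+Y. ennreal (2 * v)*indicator {Y \<in> space ?P. D qs Y > ennreal (2 * v)} Y \<partial>?P)"
     by (simp add: nn_integral_cmult_indicator)
    also have "... <= (\<integral>\<^sup>+Y. D qs Y \<partial>?P)"
     by (intro nn_integral_mono) (auto simp: indicator_def)
    also have "... <= ennreal v" by (rule DI[OF p])
    finally have "ennreal (2 * v * P.prob {Y \<in> space ?P. D qs Y > ennreal (2 * v)}) <= ennreal v"
     using vp by (simp add: P.emeasure_eq_measure ennreal_mult)
    then show ?thesis using vp by simp
   qed
   have cm: "(%Y. real (card {qs \<in> F. D qs Y > ennreal (2 * v)})) = (%Y. \<Sum>qs\<in>F. if D qs Y > ennreal (2 * v) then 1 else 0)"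
    using F(1) by (simp add: sum.If_cases Int_def)
   have ind: "integrable ?P (%Y. if D qs Y > ennreal (2 * v) then 1 else 0 :: real)"
     "(LINT Y|?P. (if D qs Y > ennreal (2 * v) then 1 else 0 :: real)) = P.prob {Y \<in> space ?P. D qs Y > ennreal (2 * v)}" if p: "qs \<in> F" for qs
   proof -
    note Dm[OF p, measurable]
    show "integrable ?P (%Y. if D qs Y > ennreal (2 * v) then 1 else 0 :: real)"
     by (rule P.integrable_const_bound[where B = 1]) auto
    have "(LINT Y|?P. (if D qs Y > ennreal (2 * v) then 1 else 0 :: real)) = (LINT Y|?P. indicator {Y \<in> space ?P. D qs Y > ennreal (2 * v)} Y)"
     by (intro Bochner_Integration.integral_cong) auto
    then show "(LINT Y|?P. (if D qs Y > ennreal (2 * v) then 1 else 0 :: real)) = P.prob {Y \<in> space ?P. D qs Y > ennreal (2 * v)}"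
     by simp
   qed
   have "(LINT Y|?P. real (card F)+1) <= (LINT Y|?P. 2*(\<Sum>qs\<in>F. if D qs Y > ennreal (2 * v) then 1 else 0))"
   proof (rule integral_mono)
    show "integrable ?P (%Y. 2*(\<Sum>qs\<in>F. if D qs Y > ennreal (2 * v) then 1 else 0 :: real))" using ind by auto
    show "real (card F)+1 <= 2*(\<Sum>qs\<in>F. if D qs Y > ennreal (2 * v) then 1 else 0)" if "Y \<in> space ?P" for Y
     using big[OF that] unfolding fun_cong[OF cm, symmetric] .
   qed simp
   also have "... = 2*(\<Sum>qs\<in>F. P.prob {Y \<in> space ?P. D qs Y > ennreal (2 * v)})"
    using ind by (simp add: Bochner_Integration.integral_sum)
   also have "... <= 2*(\<Sum>qs\<in>F. 1/2)" using pm by (intro mult_left_mono sum_mono) auto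
   finally show False by (simp add: P.prob_space)
  qed
 then obtain Y where Y: "Y \<in> space ?P" "card {qs \<in> F. D qs Y > ennreal (2 * v)} <= card F div 2"
  by blast
 define G where "G = {qs \<in> F. D qs Y <= ennreal (2 * v)}"
 have "F = G \<union> {qs \<in> F. D qs Y > ennreal (2 * v)}" by (auto simp: G_def)
 then have "card F <= card G+card {qs \<in> F. D qs Y > ennreal (2 * v)}" by (metis card_Un_le)
 then have cG: "card F <= 2*card G" using Y(2) by linarith
 define sv where "sv = (%qs. \<lambda>j\<in>{..<M}. rsgn (qs (fst (Y j))) (snd (Y j)))"
 have "inj_on sv G"
 proof (rule inj_onI, rule ccontr)
  fix qs qs' assume p: "qs \<in> G" "qs' \<in> G" "sv qs = sv qs'" "qs ~= qs'"
  have pF: "qs \<in> F" "qs' \<in> F" and pD: "D qs Y <= ennreal (2 * v)" "D qs' Y <= ennreal (2 * v)" using p by (auto simp: G_def)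
  have "rsgn (qs (fst (Y j))) (snd (Y j)) = rsgn (qs' (fst (Y j))) (snd (Y j))" if "j < M" for j
   using fun_cong[OF p(3), of j] that by (simp add: sv_def)
  then have gg: "g qs Y x = g qs' Y x" for x by (simp add: g_def)
  define e where "e = (%qs x. qs x - Qop I ka (Suc d) qs x)"
  define h where "h = (%qs x. g qs Y x - Qop I ka (Suc d) qs x)"
  have em: "e ph \<in> borel_measurable (GI I)" "integrable (GI I) (%x. (e ph x)^2)" "(LINT x|GI I. (e ph x)^2) <= 2 * s / sqrt d" if "ph \<in> F" for ph
   unfolding e_def using Qop_approx[OF I F(2)[OF that] k d] by auto
  have en: "(\<integral>\<^sup>+x. ennreal ((e ph x)^2) \<partial>GI I) <= ennreal (2 * s / sqrt d)" if "ph \<in> F" for ph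
   using em[OF that] by (simp add: nn_integral_eq_integral ennreal_leI)
  have hm: "(%x. (h ph x)^2) \<in> borel_measurable (GI I)" if "ph \<in> F" for ph
   using measurable_compose[OF measurable_Pair1'[OF Y(1)[unfolded N_def]] maurey(3)[OF I b[OF that] k M, of "Suc d"]]
   unfolding h_def g_def N_def by simp
  have hn: "(\<integral>\<^sup>+x. ennreal ((h ph x)^2) \<partial>GI I) = D ph Y" for ph unfolding D_def h_def ..
  \<comment> \<open>Four errors enter, two of polynomial approximation and two of sampling, each
    bounded with a factor \<open>2\<close>; together with the factor \<open>4\<close> here this
    explains the \<open>16\<close> in the separation.\<close>
  have s4: "(a+b+c+d)^2 <= 4*(a^2+b^2+c^2+d^2)" for a b c d :: real
  proof -
   have "4*(a^2+b^2+c^2+d^2) - (a+b+c+d)^2 = (a - b)^2+(a - c)^2+(a - d)^2+(b - c)^2+(b - d)^2+(c - d)^2"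
    by (simp add: power2_eq_square algebra_simps)
   then show ?thesis by (smt (verit) zero_le_power2)
  qed
  have pt: "(qs x - qs' x)^2 <= 4*((e qs x)^2+(h qs x)^2+(h qs' x)^2+(e qs' x)^2)" for x
  proof -
   have "qs x - qs' x = e qs x + - h qs x+h qs' x + - e qs' x" by (simp add: e_def h_def gg)
   then show ?thesis using s4[of "e qs x" "- h qs x" "h qs' x" "- e qs' x"] by (simp only: power2_minus)
  qed
  have bd: "bdd (GI I) ((1+1)^2) (%x. (qs x - qs' x)^2)" by (intro bdd_power2 bdd_diff b pF)
  have "ennreal (LINT x|GI I. (qs x - qs' x)^2) = (\<integral>\<^sup>+x. ennreal ((qs x - qs' x)^2) \<partial>GI I)"
   using GI.bdd_integrable[OF bd] by (simp add: nn_integral_eq_integral)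
  also have "... <= (\<integral>\<^sup>+x. ennreal (4*((e qs x)^2+(h qs x)^2+(h qs' x)^2+(e qs' x)^2)) \<partial>GI I)"
   by (intro nn_integral_mono ennreal_leI pt)
  also have "... = (\<integral>\<^sup>+x. ennreal 4*(ennreal ((e qs x)^2)+ennreal ((h qs x)^2)+ennreal ((h qs' x)^2)+ennreal ((e qs' x)^2)) \<partial>GI I)"
  proof -
   have "ennreal (4*(a+b+c+d)) = ennreal 4*(ennreal a+ennreal b+ennreal c+ennreal d)" if "0 <= a" "0 <= b" "0 <= c" "0 <= d" for a b c d
    by (subst ennreal_mult) (use that in \<open>simp_all del: ennreal_numeral\<close>)
   then show ?thesis by (simp only: zero_le_power2)
  qed
  also have "... = ennreal 4*((\<integral>\<^sup>+x. ennreal ((e qs x)^2) \<partial>GI I)+D qs Y+D qs' Y+(\<integral>\<^sup>+x. ennreal ((e qs' x)^2) \<partial>GI I))"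
   unfolding hn[symmetric] using hm[OF pF(1)] hm[OF pF(2)] em(1)[OF pF(1)] em(1)[OF pF(2)]
   by (simp add: nn_integral_cmult nn_integral_add del: ennreal_numeral)
  also have "... <= ennreal 4*(ennreal (2 * s / sqrt d)+ennreal (2 * v)+ennreal (2 * v)+ennreal (2 * s / sqrt d))"
   by (intro mult_left_mono add_mono en pF pD) auto
  also have "... = ennreal (16 * s / sqrt d+16 * v)"
   using s v0 by (simp add: ennreal_mult[symmetric] ennreal_plus[symmetric] algebra_simps del: ennreal_plus ennreal_numeral)
  finally have "(LINT x|GI I. (qs x - qs' x)^2) <= 16 * s / sqrt d+16 * v"
   using s v0 by (subst (asm) ennreal_le_iff) auto
  then show False using sep[OF pF p(4)] by (simp add: v_def)
 qed
 moreover have "sv ` G \<subseteq> {..<M} \<rightarrow>\<^sub>E {1, - 1}" by (auto simp: sv_def rsgn_def PiE_iff extensional_def split: if_splits)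
 ultimately have "card G <= card ({..<M} \<rightarrow>\<^sub>E {1, - 1 :: real})"
  by (intro card_inj_on_le[of sv]) (auto intro!: finite_PiE)
 also have "... = 2^M" by (simp add: card_PiE numeral_2_eq_2)
 finally show ?thesis using cG by simp
qed

text \<open>A separated family of greatest cardinality is a net. Its members are themselves
  \<open>s\<close>-smooth, so a candidate built from the net can be compared with the supremum over
  juntas without loss of smoothness.\<close>

theorem smooth_net:
 assumes I: "finite I" and k: "0 < ka" "ka < 1" and M: "0 < M" and d: "0 < d" and s: "0 <= s"
 shows "EX F. finite F \<and> F \<subseteq> Collect (smo I s) \<and> card F <= 2*2^M \<and>
  (ALL qs. smo I s qs --> (EX qs':F. (LINT x|GI I. (qs x - qs' x)^2) <= 16 * s / sqrt d+16*(Vq ka (Suc d) (card I)/real M)))"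
proof -
 let ?e = "16 * s / sqrt d+16*(Vq ka (Suc d) (card I)/real M)"
 define S where "S = (%F. finite F \<and> F \<subseteq> Collect (smo I s) \<and> (ALL qs:F. ALL qs':F. qs ~= qs' --> (LINT x|GI I. (qs x - qs' x)^2) > ?e))"
 have bound: "card F <= 2*2^M" if "S F" for F
  using that by (intro separated_card[OF I k M d _ _ s]) (auto simp: S_def)
 have "S {}" by (simp add: S_def)
 then obtain F where F: "S F" and max: "!!F'. S F' ==> card F' <= card F"
 proof -
  have "EX F. S F \<and> (ALL F'. S F' --> card F' <= card F)"
   using \<open>S {}\<close> bound by (intro ex_has_greatest_nat[where b = "2*2^M+1"]) (auto simp: less_Suc_eq_le)
  then show ?thesis using that by blast
 qed
 have e0: "0 <= ?e" using s Vq_nonneg[OF k] by simp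
 have "EX qs':F. (LINT x|GI I. (qs x - qs' x)^2) <= ?e" if qs: "smo I s qs" for qs
 proof (rule ccontr)
  assume "\<not> ?thesis"
  then have n: "(LINT x|GI I. (qs x - qs' x)^2) > ?e" if "qs' \<in> F" for qs' using that by force
  have "qs \<notin> F" using n[of qs] e0 by auto
  have "S (insert qs F)"
   using F qs n by (auto simp: S_def power2_commute[of _ "qs _"])
  from max[OF this] show False using \<open>qs \<notin> F\<close> F by (simp add: S_def)
 qed
 then show ?thesis using F bound[OF F] by (intro exI[of _ F]) (auto simp: S_def)
qed

section \<open>Contractions and completion of covariances\<close>

text \<open>The semidefinite case has to be covered: a zero pivot forces its whole row and column to
  vanish, while a positive pivot leaves a semidefinite Schur complement.\<close>

lemma cholesky:
 assumes "!!i j. i < k ==> j < k ==> S i j = S j i" "!!y. 0 <= (\<Sum>i<k. \<Sum>j<k. y i*S i j*y j)"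
 shows "EX L :: nat => nat => real. ALL i<k. ALL j<k. (\<Sum>l<k. L i l*L j l) = S i j"
 using assms
proof (induction k arbitrary: S)
 case (Suc m)
 note sym = Suc.prems(1) and psd = Suc.prems(2)
 have exp: "(\<Sum>i<Suc m. \<Sum>j<Suc m. y i*S i j*y j) = (\<Sum>i<m. \<Sum>j<m. y i*S i j*y j)+2*y m*(\<Sum>i<m. y i*S i m)+y m*y m*S m m" for y
 proof -
  have "(\<Sum>j<m. y m*S m j*y j) = y m*(\<Sum>i<m. y i*S i m)"
   using sym by (simp add: sum_distrib_left mult_ac)
  then show ?thesis by (simp add: sum.distrib sum_distrib_left algebra_simps)
 qed
 have d0: "0 <= S m m" using psd[of "%i. if i = m then 1 else 0"] unfolding exp by simp
 show ?case
 proof (cases "S m m = 0")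
  case True
  have z: "S i m = 0" if i: "i < m" for i
  proof (rule ccontr)
   assume nz: "S i m ~= 0"
   have "0 <= S i i+2*t*S i m" for t
   proof -
    let ?y = "%j. if j = i then 1 else if j = m then t else 0"
    have 1: "(\<Sum>j<m. ?y j*S j m) = S i m"
     using i sum.delta[of "{..<m}" i "%j. S j m"] by (subst sum.cong[OF refl, of _ _ "%j. if j = i then S j m else 0"]) auto
    have 2: "(\<Sum>a<m. \<Sum>b<m. ?y a*S a b*?y b) = S i i"
    proof -
     have "(\<Sum>b<m. ?y a*S a b*?y b) = (if a = i then S i i else 0)" if "a < m" for a
     proof -
      have "(\<Sum>b<m. ?y a*S a b*?y b) = (\<Sum>b<m. if b = i then ?y a*S a i else 0)"
       by (rule sum.cong) auto
      then show ?thesis using that i by auto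
     qed
     then have "(\<Sum>a<m. \<Sum>b<m. ?y a*S a b*?y b) = (\<Sum>a<m. if a = i then S i i else 0)"
      by (intro sum.cong) auto
     then show ?thesis using i by simp
    qed
    show ?thesis using psd[of ?y] i unfolding exp 1 2 using True by simp
   qed
   \<comment> \<open>This \<open>t\<close> makes the quadratic form equal to
     \<open>- 1\<close>.\<close>
   from this[of "- (S i i+1)/(2*S i m)"] show False using nz by (simp add: field_simps)
  qed
  obtain L where L: "ALL i<m. ALL j<m. (\<Sum>l<m. L i l*L j l) = S i j"
  proof -
   have "0 <= (\<Sum>i<m. \<Sum>j<m. y i*S i j*y j)" for y
    using psd[of "%i. if i = m then 0 else y i"] unfolding exp by simp
   then show ?thesis using Suc.IH[of S] sym that by auto
  qed
  define L' where "L' = (%i l. if i = m \<or> l = m then 0 else L i l)"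
  show ?thesis
  proof (intro exI[of _ L'] allI impI)
   fix i j assume ij: "i < Suc m" "j < Suc m"
   show "(\<Sum>l<Suc m. L' i l*L' j l) = S i j"
   proof (cases "i = m \<or> j = m")
    case True': True
    then have "S i j = 0" using ij z sym[of i j] True by (metis less_Suc_eq lessI)
    then show ?thesis using True' by (auto simp: L'_def)
   next
    case False
    have "(\<Sum>l<m. L' i l*L' j l) = (\<Sum>l<m. L i l*L j l)"
     using False by (intro sum.cong) (auto simp: L'_def)
    then show ?thesis using False ij L by (auto simp: L'_def)
   qed
  qed
 next
  case False
  then have d: "0 < S m m" using d0 by simp
  define T where "T = (%i j. S i j - S i m*S j m/S m m)"
  have psdT: "0 <= (\<Sum>i<m. \<Sum>j<m. y i*T i j*y j)" for y
  proof -
   define sg where "sg = (\<Sum>i<m. y i*S i m)"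
   let ?y = "%i. if i = m then - sg/S m m else y i"
   have "(\<Sum>i<m. \<Sum>j<m. y i*T i j*y j) = (\<Sum>i<m. \<Sum>j<m. y i*S i j*y j) - (\<Sum>i<m. \<Sum>j<m. (y i*S i m)*(y j*S j m))/S m m"
    by (simp add: T_def algebra_simps sum_subtractf sum_divide_distrib)
   also have "(\<Sum>i<m. \<Sum>j<m. (y i*S i m)*(y j*S j m)) = sg * sg"
    by (simp add: sg_def sum_product)
   finally have e: "(\<Sum>i<m. \<Sum>j<m. y i*T i j*y j) = (\<Sum>i<m. \<Sum>j<m. y i*S i j*y j) - sg * sg/S m m" .
   have "0 <= (\<Sum>i<m. \<Sum>j<m. y i*S i j*y j)+2*(- sg/S m m) * sg+(- sg/S m m)*(- sg/S m m)*S m m"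
    using psd[of ?y] unfolding exp by (simp add: sg_def)
   also have "... = (\<Sum>i<m. \<Sum>j<m. y i*S i j*y j) - sg * sg/S m m" using d by (simp add: field_simps)
   finally show ?thesis unfolding e .
  qed
  obtain L where L: "ALL i<m. ALL j<m. (\<Sum>l<m. L i l*L j l) = T i j"
   using Suc.IH[of T] psdT sym by (auto simp: T_def mult.commute)
  define L' where "L' = (%i l. if l = m then S i m / sqrt (S m m) else if i = m then 0 else L i l)"
  show ?thesis
  proof (intro exI[of _ L'] allI impI)
   fix i j assume ij: "i < Suc m" "j < Suc m"
   have s1: "L' i m*L' j m = S i m*S j m/S m m" using d by (simp add: L'_def)
   show "(\<Sum>l<Suc m. L' i l*L' j l) = S i j"
   proof (cases "i = m \<or> j = m")
    case True
    then have "(\<Sum>l<m. L' i l*L' j l) = 0" by (intro sum.neutral) (auto simp: L'_def)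
    then show ?thesis using True s1 d sym[of i j] ij by auto
   next
    case False'': False
    have "(\<Sum>l<m. L' i l*L' j l) = (\<Sum>l<m. L i l*L j l)"
     using False'' by (intro sum.cong) (auto simp: L'_def)
    then show ?thesis using False'' ij L s1 by (auto simp: T_def)
   qed
  qed
 qed
qed simp

text \<open>Says that the identity minus the Gram matrix of the rows of \<open>B\<close> is positive
  semidefinite.\<close>

definition contr :: "nat => nat => (nat => nat => real) => bool" where
 "contr k n B \<longleftrightarrow> (ALL y. (\<Sum>j<n. (\<Sum>i<k. y i*B i j)^2) <= (\<Sum>i<k. (y i)^2))"

lemma quad_gram:
 fixes y :: "'b => real"
 shows "(\<Sum>i\<in>R. \<Sum>i'\<in>R. y i*(\<Sum>j\<in>J. B i j*B i' j)*y i') = (\<Sum>j\<in>J. (\<Sum>i\<in>R. y i*B i j)^2)"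
proof -
 have "(\<Sum>i\<in>R. \<Sum>i'\<in>R. y i*(\<Sum>j\<in>J. B i j*B i' j)*y i') = (\<Sum>i\<in>R. \<Sum>i'\<in>R. \<Sum>j\<in>J. (y i*B i j)*(y i'*B i' j))"
  by (simp add: sum_distrib_left sum_distrib_right mult_ac)
 also have "... = (\<Sum>i\<in>R. \<Sum>j\<in>J. \<Sum>i'\<in>R. (y i*B i j)*(y i'*B i' j))"
  by (intro sum.cong refl sum.swap)
 also have "... = (\<Sum>j\<in>J. \<Sum>i\<in>R. \<Sum>i'\<in>R. (y i*B i j)*(y i'*B i' j))"
  by (rule sum.swap)
 also have "... = (\<Sum>j\<in>J. (\<Sum>i\<in>R. y i*B i j)^2)"
  by (simp add: power2_eq_square sum_product)
 finally show ?thesis .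
qed

lemma quad_diag:
 fixes y :: "nat => real"
 shows "(\<Sum>i<k. \<Sum>i'<k. y i*(if i = i' then c else 0)*y i') = c*(\<Sum>i<k. (y i)^2)"
proof -
 have "(\<Sum>i'<k. y i*(if i = i' then c else 0)*y i') = c*(y i)^2" if "i < k" for i
 proof -
  have "(\<Sum>i'<k. y i*(if i = i' then c else 0)*y i') = (\<Sum>i'<k. if i = i' then c*(y i)^2 else 0)"
   by (intro sum.cong) (auto simp: power2_eq_square)
  then show ?thesis using that by simp
 qed
 then show ?thesis by (simp add: sum_distrib_left)
qed

text \<open>Orthonormal rows, which is exactly the condition that the linear forms of a Gaussian
  vector are again standard Gaussian.\<close>

definition orth :: "nat => 'a set => (nat => 'a => real) => bool" where
 "orth k J A \<longleftrightarrow> (ALL i<k. ALL i'<k. (\<Sum>l\<in>J. A i l*A i' l) = (if i = i' then 1 else 0))"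

text \<open>The \<open>Inl\<close> coordinates carry the input in \<real>^n, the \<open>Inr\<close>
  coordinates the auxiliary noise of a randomized projection.\<close>

abbreviation JJ :: "nat => nat => (nat+nat) set" where
 "JJ n k == {..<n} <+> {..<k}"

text \<open>The noise block is a Cholesky factor of the covariance that \<open>B\<close> leaves
  missing.\<close>

lemma contr_complete:
 assumes "contr k n B"
 shows "EX A. orth k (JJ n k) A \<and> (ALL i j. A i (Inl j) = B i j)"
proof -
 define S where "S = (%i i'. (if i = i' then 1 else 0) - (\<Sum>j<n. B i j*B i' j))"
 have "0 <= (\<Sum>i<k. \<Sum>i'<k. y i*S i i'*y i')" for y
 proof -
  have "(\<Sum>i<k. \<Sum>i'<k. y i*S i i'*y i') = 1*(\<Sum>i<k. (y i)^2) - (\<Sum>j<n. (\<Sum>i<k. y i*B i j)^2)"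
   unfolding quad_diag[symmetric] quad_gram[symmetric] by (simp add: S_def right_diff_distrib left_diff_distrib sum_subtractf)
  then show ?thesis using assms by (simp add: contr_def)
 qed
 moreover have "S i i' = S i' i" for i i' by (simp add: S_def mult.commute)
 ultimately obtain L where L: "ALL i<k. ALL j<k. (\<Sum>l<k. L i l*L j l) = S i j" using cholesky[of k S] by blast
 have "orth k (JJ n k) (%i. case_sum (B i) (L i))"
  using L by (auto simp: orth_def sum.Plus S_def)
 then show ?thesis by (intro exI[of _ "%i. case_sum (B i) (L i)"]) auto
qed

section \<open>The value of a frame and its change along a path\<close>

definition pr :: "nat => (nat+nat => real) => nat => real" where
 "pr n W = (\<lambda>i\<in>{..<n}. W (Inl i))"

definition Pr :: "nat => nat+nat => real" where
 "Pr i = case_sum (sc 1 i) (%_. 0)"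

lemma pr_lf: "pr n W = lf {..<n} (JJ n k) Pr W"
 unfolding pr_def lf_def Pr_def by (intro restrict_ext) (simp add: sum.Plus sum_sc)

lemma sum_Pr: "i < n ==> (\<Sum>l\<in>JJ n k. A l*Pr i l) = A (Inl i)"
 by (simp add: Pr_def sum.Plus sum_sc)

lemma pr_measurable: "pr n \<in> measurable (GI (JJ n k)) (GI {..<n})"
proof -
 have "pr n = lf {..<n} (JJ n k) Pr" by (rule ext) (rule pr_lf)
 then show ?thesis using lf_measurable[of "{..<n}" "JJ n k" Pr] by simp
qed

lemma pr_csum: "x \<in> space (GI {..<n}) ==> pr n (csum {..<n} {..<k} x w) = x"
 by (auto simp: pr_def csum_def fun_eq_iff space_GI PiE_def extensional_def)

text \<open>With \<open>A\<close> split as \<open>(B, L)\<close> this is the correlation of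
  \<open>qs (B x + L w)\<close> with \<open>f x\<close>, where \<open>w\<close> is independent
  noise.\<close>

definition VV :: "nat => nat => ((nat => real) => real) => ((nat => real) => real) => (nat => nat+nat => real) => real" where
 "VV k n qs f A = (LINT W|GI (JJ n k). qs (lf {..<k} (JJ n k) A W)*f (pr n W))"

lemma lf_id: "w \<in> space (GI I) ==> finite I ==> lf I I (sc 1) w = w"
 by (auto simp: lf_def sum_sc fun_eq_iff space_GI PiE_def extensional_def)

lemma orth_law:
 assumes A: "orth k J A" and J: "finite J"
 shows "distr (GI J) (GI {..<k}) (lf {..<k} J A) = GI {..<k}"
proof -
 have "distr (GI J) (GI {..<k}) (lf {..<k} J A) = distr (GI {..<k}) (GI {..<k}) (lf {..<k} {..<k} (sc 1))"
  using A J by (intro distr_gram) (auto simp: orth_def sc_mult sum_sc1)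
 also have "... = distr (GI {..<k}) (GI {..<k}) (%x. x)"
  by (intro distr_cong) (auto simp: lf_id)
 finally show ?thesis by (simp add: distr_id)
qed

lemma orth_integral:
 fixes F :: "_ => real"
 assumes A: "orth k J A" and J: "finite J" and F: "F \<in> borel_measurable (GI {..<k})"
 shows "(LINT W|GI J. F (lf {..<k} J A W)) = (LINT u|GI {..<k}. F u)"
 using integral_distr[OF lf_measurable F, of J A] orth_law[OF A J] by simp

lemma csum_integral:
 assumes "finite I" "finite Q" and G: "bdd (GI (I <+> Q)) b G"
 shows "(LINT W|GI (I <+> Q). G W) = (LINT x|GI I. LINT w|GI Q. G (csum I Q x w))"
  "bdd (GI I >< GI Q) b (%(x, w). G (csum I Q x w))"
proof -
 show b: "bdd (GI I >< GI Q) b (%(x, w). G (csum I Q x w))"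
  using bdd_compose[OF G csum_measurable] by (simp add: split_beta')
 have "(LINT W|GI (I <+> Q). G W) = (LINT W|distr (GI I >< GI Q) (GI (I <+> Q)) (%(x, y). csum I Q x y). G W)"
  unfolding GI_Plus[OF assms(1,2)] ..
 also have "... = (LINT p|(GI I >< GI Q). G ((%(x, y). csum I Q x y) p))"
  by (rule integral_distr[OF csum_measurable bddD(1)[OF G]])
 also have "... = (LINT x|GI I. LINT w|GI Q. G (csum I Q x w))"
  using bdd_fubini(1)[OF prob_GI prob_GI b] by (simp add: split_beta')
 finally show "(LINT W|GI (I <+> Q). G W) = (LINT x|GI I. LINT w|GI Q. G (csum I Q x w))" .
qed

lemma bdd_lf: "bdd (GI {..<k}) b qs ==> bdd (GI J) b (%W. qs (lf {..<k} J A W))"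
 by (rule bdd_compose[OF _ lf_measurable])

lemma bdd_pr: "bdd (GI {..<n}) b f ==> bdd (GI (JJ n k)) b (%W. f (pr n W))"
 by (rule bdd_compose[OF _ pr_measurable])

lemma finite_JJ [simp]: "finite (JJ n k)" by simp

lemma bdd_pair2: "bdd M b f ==> bdd N c g ==> bdd (M >< N) (b*c) (%(u, v). f u*g v)"
 using bdd_mult2[OF bdd_fst bdd_snd, of M b f N c g] .

text \<open>The rows of both matrices are orthonormal, and their products with the coordinates of
  the input just read off the \<open>Inl\<close> block; so all inner products agree.\<close>

lemma VV_cong:
 assumes qs: "bdd (GI {..<k}) 1 qs" and f: "bdd (GI {..<n}) 1 f" and A: "orth k (JJ n k) A" "orth k (JJ n k) A'"
  and e: "!!i j. i < k ==> j < n ==> A i (Inl j) = A' i (Inl j)"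
 shows "VV k n qs f A = VV k n qs f A'"
proof -
 let ?G = "%(u, v). qs u*f v"
 have G: "?G \<in> borel_measurable (GI {..<k} >< GI {..<n})" using bddD(1)[OF bdd_pair2[OF qs f]] .
 have m: "(%W. (lf {..<k} (JJ n k) A W, lf {..<n} (JJ n k) Pr W)) \<in> measurable (GI (JJ n k)) (GI {..<k} >< GI {..<n})" for A
  by (intro measurable_Pair lf_measurable)
 have "VV k n qs f A = (LINT p|distr (GI (JJ n k)) (GI {..<k} >< GI {..<n}) (%W. (lf {..<k} (JJ n k) A W, lf {..<n} (JJ n k) Pr W)). ?G p)" for A
  unfolding VV_def pr_lf[of n _ k] using integral_distr[OF m G, of A] by simp
 moreover have "distr (GI (JJ n k)) (GI {..<k} >< GI {..<n}) (%W. (lf {..<k} (JJ n k) A W, lf {..<n} (JJ n k) Pr W))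
   = distr (GI (JJ n k)) (GI {..<k} >< GI {..<n}) (%W. (lf {..<k} (JJ n k) A' W, lf {..<n} (JJ n k) Pr W))"
  using A e by (intro distr_gram2) (auto simp: orth_def sum_Pr)
 ultimately show ?thesis by simp
qed

text \<open>Input and projection are both built from two independent sources with weights
  \<open>c\<close> and \<open>tt\<close>. Their own covariances stay the identity, and the mixed one
  becomes the combination of the two blocks with weights \<open>c^2\<close> and
  \<open>tt^2\<close>.\<close>

lemma VV_mix:
 assumes qs: "bdd (GI {..<k}) 1 qs" and f: "bdd (GI {..<n}) 1 f" and A: "orth k (JJ n k) A1" "orth k (JJ n k) A2" "orth k (JJ n k) A3"
  and c: "c^2+tt^2 = 1"
  and e: "!!i j. i < k ==> j < n ==> A3 i (Inl j) = c^2*A1 i (Inl j)+tt^2*A2 i (Inl j)"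
 shows "VV k n qs f A3 = (LINT W1|GI (JJ n k). LINT W2|GI (JJ n k). qs (mix {..<k} c tt (lf {..<k} (JJ n k) A1 W1) (lf {..<k} (JJ n k) A2 W2))*f (mix {..<n} c tt (pr n W1) (pr n W2)))"
proof -
 let ?J = "JJ n k" let ?N = "GI {..<k} >< GI {..<n}"
 let ?G = "%(u, v). qs u*f v"
 have Gb: "bdd ?N 1 ?G" using bdd_pair2[OF qs f] by simp
 note G = bddD(1)[OF Gb]
 have m: "(%W. (lf {..<k} (JJ n k) A W, lf {..<n} (JJ n k) Pr W)) \<in> measurable (GI (JJ n k)) ?N" for A
  by (intro measurable_Pair lf_measurable)
 let ?T = "%(W1, W2). (mix {..<k} c tt (lf {..<k} ?J A1 W1) (lf {..<k} ?J A2 W2), mix {..<n} c tt (pr n W1) (pr n W2))"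
 have T: "?T \<in> measurable (GI ?J >< GI ?J) ?N"
  using measurable_compose[OF measurable_fst lf_measurable] measurable_compose[OF measurable_snd lf_measurable]
   measurable_compose[OF measurable_fst pr_measurable] measurable_compose[OF measurable_snd pr_measurable]
  unfolding split_beta' by (intro measurable_Pair measurable_mix) auto
 let ?L = "%i. case_sum (%l. c*A1 i l) (%l. tt*A2 i l)" and ?P = "%i. case_sum (%l. c*Pr i l) (%l. tt*Pr i l)"
 have "distr (GI ?J >< GI ?J) ?N ?T = distr (GI (?J <+> ?J)) ?N (%w. (lf {..<k} (?J <+> ?J) ?L w, lf {..<n} (?J <+> ?J) ?P w))"
 proof (rule pair_law)
  fix x y
  show "?T (x, y) = (lf {..<k} (?J <+> ?J) ?L (csum ?J ?J x y), lf {..<n} (?J <+> ?J) ?P (csum ?J ?J x y))"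
   unfolding lf_Plus[OF finite_JJ finite_JJ] pr_lf[of n _ k]
   by (auto simp: mix_def lf_def sum_distrib_left mult_ac intro!: restrict_ext)
 qed (auto intro!: measurable_Pair lf_measurable)
 also have "... = distr (GI ?J) ?N (%W. (lf {..<k} ?J A3 W, lf {..<n} ?J Pr W))"
 proof (rule distr_gram2)
  have cc: "c*c+tt*tt = 1" using c by (simp add: power2_eq_square)
  have pp: "(\<Sum>l\<in>?J <+> ?J. case_sum (%l. c*X l) (%l. tt*Y l) l*case_sum (%l. c*X' l) (%l. tt*Y' l) l)
   = c^2*(\<Sum>l\<in>?J. X l*X' l)+tt^2*(\<Sum>l\<in>?J. Y l*Y' l)" for X Y X' Y'
   by (subst sum.Plus) (auto simp: sum_distrib_left power2_eq_square mult_ac)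
  show "(\<Sum>l\<in>?J <+> ?J. ?L i l*?L i' l) = (\<Sum>l\<in>?J. A3 i l*A3 i' l)" if "i \<in> {..<k}" "i' \<in> {..<k}" for i i'
   unfolding pp using A that c by (simp add: orth_def)
  show "(\<Sum>l\<in>?J <+> ?J. ?L i l*?P i' l) = (\<Sum>l\<in>?J. A3 i l*Pr i' l)" if "i \<in> {..<k}" "i' \<in> {..<n}" for i i'
   unfolding pp using e that by (simp add: sum_Pr)
  show "(\<Sum>l\<in>?J <+> ?J. ?P i l*?P i' l) = (\<Sum>l\<in>?J. Pr i l*Pr i' l)" if "i \<in> {..<n}" "i' \<in> {..<n}" for i i'
   unfolding pp using c by (simp flip: distrib_right)
 qed auto
 finally have d: "distr (GI ?J >< GI ?J) ?N ?T = distr (GI ?J) ?N (%W. (lf {..<k} ?J A3 W, lf {..<n} ?J Pr W))" .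
 have "VV k n qs f A3 = (LINT p|distr (GI ?J) ?N (%W. (lf {..<k} ?J A3 W, lf {..<n} ?J Pr W)). ?G p)"
  unfolding VV_def pr_lf[of n _ k] using integral_distr[OF m G, of A3] by simp
 also have "... = (LINT p|(GI ?J >< GI ?J). ?G (?T p))"
  unfolding d[symmetric] by (rule integral_distr[OF T G])
 also have "... = (LINT W1|GI ?J. LINT W2|GI ?J. qs (mix {..<k} c tt (lf {..<k} ?J A1 W1) (lf {..<k} ?J A2 W2))*f (mix {..<n} c tt (pr n W1) (pr n W2)))"
  using bdd_fubini(1)[OF prob_GI prob_GI, of "GI ?J" "GI ?J"] bdd_compose[OF Gb T]
  by (subst bdd_fubini(1)[OF prob_GI prob_GI, where b = 1]) (auto simp: split_beta')
 finally show ?thesis .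
qed

text \<open>Flipping the sign of the form \<open>v\<close> preserves all inner products, hence the
  joint law, so the integral equals its own negative.\<close>

lemma orth_indep:
 fixes k :: nat
 assumes xi: "bdd (GI {..<k}) 1 xi" and J: "finite J" and v: "!!i. i < k ==> (\<Sum>l\<in>J. A i l * v l) = 0"
 shows "(LINT W|GI J. xi (lf {..<k} J A W)*dot J v W) = 0"
proof -
 let ?N = "GI {..<k} >< GI {()}"
 let ?G = "%p. xi (fst p) * snd p ()"
 have Gm: "?G \<in> borel_measurable ?N"
  using measurable_compose[OF measurable_fst bddD(1)[OF xi]] measurable_compose[OF measurable_snd measurable_GI_component[of "()" "{()}"]]
  by (intro borel_measurable_times) auto
 have m: "(%W. (lf {..<k} J A W, lf {()} J (%_. u) W)) \<in> measurable (GI J) ?N" for u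
  by (intro measurable_Pair lf_measurable)
 have "(LINT W|GI J. xi (lf {..<k} J A W)*dot J u W) = (LINT p|distr (GI J) ?N (%W. (lf {..<k} J A W, lf {()} J (%_. u) W)). ?G p)" for u
  using integral_distr[OF m Gm, of u] by (simp add: lf_def dot_def)
 moreover have "distr (GI J) ?N (%W. (lf {..<k} J A W, lf {()} J (%_. v) W)) = distr (GI J) ?N (%W. (lf {..<k} J A W, lf {()} J (%_ l. - v l) W))"
  using J v by (intro distr_gram2) (auto simp: sum_negf)
 ultimately have "(LINT W|GI J. xi (lf {..<k} J A W)*dot J v W) = (LINT W|GI J. xi (lf {..<k} J A W)*dot J (%l. - v l) W)" by simp
 also have "... = - (LINT W|GI J. xi (lf {..<k} J A W)*dot J v W)"
  by (simp add: dot_def sum_negf)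
 finally show ?thesis by simp
qed

text \<open>With \<open>h\<close> the conditional expectation of \<open>xi\<close> for the
  projection \<open>D\<close>, shrinking \<open>D\<close> by \<open>et\<close> amounts to applying
  the noise operator to \<open>h\<close>. This is affine up to \<open>2*et^2\<close> in mean by
  \<open>noise_almost_affine\<close>, and the linear part pairs the gradients of \<open>h\<close>
  and \<open>g\<close>.\<close>

lemma first_order:
 assumes xi: "bdd (GI {..<k}) 1 xi" and g: "bdd (GI {..<n}) 1 g" and D: "contr k n D" and A2: "orth k (JJ n k) A2"
  and et: "0 <= et" "et^2 <= 1/2" and e: "!!i j. i < k ==> j < n ==> A2 i (Inl j) = et*D i j"
 shows "\<bar>(LINT W|GI (JJ n k). xi (lf {..<k} (JJ n k) A2 W)*g (pr n W)) - (LINT u|GI {..<k}. xi u)*(LINT y|GI {..<n}. g y)\<bar>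
  <= et * sqrt (\<Sum>i<k. (dot {..<n} (D i) (grad {..<n} g))^2)+2*et^2"
proof -
 let ?J = "JJ n k" let ?n = "{..<n}" let ?k = "{..<k}"
 obtain A where A: "orth k ?J A" "!!i j. A i (Inl j) = D i j" using contr_complete[OF D] by auto
 define h where "h = (%y. (LINT w|GI ?k. xi (lf ?k ?J A (csum ?n ?k y w))))"
 have b1: "bdd (GI ?n >< GI ?k) 1 (%(y, w). xi (lf ?k ?J B (csum ?n ?k y w)))" for B
  by (rule csum_integral(2)[OF _ _ bdd_lf[OF xi]]) auto
 have h: "bdd (GI ?n) 1 h" unfolding h_def by (rule bdd_fubini(3)[OF prob_GI prob_GI b1])
 have Eh: "(LINT y|GI ?n. h y) = (LINT u|GI ?k. xi u)"
  unfolding h_def using csum_integral(1)[OF _ _ bdd_lf[OF xi], of ?n ?k A] orth_integral[OF A(1) finite_JJ bddD(1)[OF xi]] by simp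
 have e1: "et^2 <= 1" using et by simp
 have eta1: "et <= 1" using power2_le_imp_le[of et 1] e1 by simp
 define sg where "sg = sqrt (1 - et^2)"
 have s2: "sg * sg = 1 - et^2" using e1 by (simp add: sg_def)
 \<comment> \<open>The noise belonging to \<open>et*D\<close> has covariance
   \<open>I - et^2*(D*D^T) = (1 - et^2)*(D*D^T) + (I - D*D^T)\<close>: fresh input passed through
   \<open>D\<close>, plus the old noise.\<close>
 have NOh: "(LINT w|GI ?k. xi (lf ?k ?J A2 (csum ?n ?k y w))) = NO ?n et h y" if y: "y \<in> space (GI ?n)" for y
 proof -
  define F where "F = (%v. xi (\<lambda>i\<in>?k. et*(\<Sum>j<n. D i j*y j) + v i))"
  have Fm: "(%v. \<lambda>i\<in>?k. et*(\<Sum>j<n. D i j*y j) + v i) \<in> measurable (GI ?k) (GI ?k)"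
   by (rule measurable_GI_restrict) measurable
  have F: "bdd (GI ?k) 1 F" unfolding F_def by (rule bdd_compose[OF xi Fm])
  define A' where "A' = (%i. case_sum (%j. sg*D i j) (%l. A i (Inr l)))"
  have "(LINT w|GI ?k. xi (lf ?k ?J A2 (csum ?n ?k y w))) = (LINT w|GI ?k. F (lf ?k ?k (%i l. A2 i (Inr l)) w))"
  proof -
   have "lf ?k ?J A2 (csum ?n ?k y w) = (\<lambda>i\<in>?k. et*(\<Sum>j<n. D i j*y j)+lf ?k ?k (%i l. A2 i (Inr l)) w i)" for w
    unfolding lf_Plus[OF finite_lessThan finite_lessThan]
    by (intro restrict_ext) (simp add: e lf_def sum_distrib_left mult_ac)
   then show ?thesis by (simp add: F_def)
  qed
  also have "... = (LINT v|distr (GI ?k) (GI ?k) (lf ?k ?k (%i l. A2 i (Inr l))). F v)"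
   by (rule integral_distr[OF lf_measurable bddD(1)[OF F], symmetric])
  also have "distr (GI ?k) (GI ?k) (lf ?k ?k (%i l. A2 i (Inr l))) = distr (GI ?J) (GI ?k) (lf ?k ?J A')"
  proof (rule distr_gram)
   fix i i' assume i: "i \<in> ?k" "i' \<in> ?k"
   define G where "G = (\<Sum>j<n. D i j*D i' j)"
   have a2: "et^2*G+(\<Sum>l<k. A2 i (Inr l)*A2 i' (Inr l)) = (if i = i' then 1 else 0)"
   proof -
    have "(\<Sum>j<n. A2 i (Inl j)*A2 i' (Inl j)) = et^2*G"
     using i by (simp add: e G_def power2_eq_square sum_distrib_left mult_ac)
    then have "(\<Sum>l\<in>?J. A2 i l*A2 i' l) = et^2*G+(\<Sum>l<k. A2 i (Inr l)*A2 i' (Inr l))"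
     by (simp add: sum.Plus)
    moreover have "(\<Sum>l\<in>?J. A2 i l*A2 i' l) = (if i = i' then 1 else 0)"
     using A2 i unfolding orth_def lessThan_iff by blast
    ultimately show ?thesis by (rule trans[OF sym])
   qed
   have a1: "G+(\<Sum>l<k. A i (Inr l)*A i' (Inr l)) = (if i = i' then 1 else 0)"
   proof -
    have "(\<Sum>l\<in>?J. A i l*A i' l) = G+(\<Sum>l<k. A i (Inr l)*A i' (Inr l))"
     by (simp add: sum.Plus G_def A(2))
    moreover have "(\<Sum>l\<in>?J. A i l*A i' l) = (if i = i' then 1 else 0)"
     using A(1) i unfolding orth_def lessThan_iff by blast
    ultimately show ?thesis by (rule trans[OF sym])
   qed
   have "(\<Sum>l\<in>?J. A' i l*A' i' l) = (sg * sg)*G+(\<Sum>l<k. A i (Inr l)*A i' (Inr l))"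
    by (simp add: A'_def sum.Plus G_def sum_distrib_left mult_ac)
   also have "... = (\<Sum>l<k. A2 i (Inr l)*A2 i' (Inr l))"
    unfolding s2 using a1 a2 by (simp add: algebra_simps)
   finally show "(\<Sum>l\<in>?k. A2 i (Inr l)*A2 i' (Inr l)) = (\<Sum>l\<in>?J. A' i l*A' i' l)" by simp
  qed auto
  also have "(LINT v|distr (GI ?J) (GI ?k) (lf ?k ?J A'). F v) = (LINT W|GI ?J. F (lf ?k ?J A' W))"
   by (rule integral_distr[OF lf_measurable bddD(1)[OF F]])
  also have "... = (LINT y'|GI ?n. LINT w|GI ?k. F (lf ?k ?J A' (csum ?n ?k y' w)))"
   by (rule csum_integral(1)[OF _ _ bdd_lf[OF F]]) auto
  also have "... = NO ?n et h y"
  proof -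
   have "F (lf ?k ?J A' (csum ?n ?k y' w)) = xi (lf ?k ?J A (csum ?n ?k (mix ?n et sg y y') w))" for y' w
   proof -
    have "(\<lambda>i\<in>?k. et*(\<Sum>j<n. D i j*y j)+lf ?k ?J A' (csum ?n ?k y' w) i) = lf ?k ?J A (csum ?n ?k (mix ?n et sg y y') w)"
     unfolding lf_Plus[OF finite_lessThan finite_lessThan]
     by (intro restrict_ext) (simp add: A'_def A(2) mix_def sum_distrib_left sum.distrib algebra_simps)
    then show ?thesis by (simp add: F_def)
   qed
   then show ?thesis by (simp add: NO_def h_def sg_def)
  qed
  finally show ?thesis .
 qed
 have gp: "bdd (GI ?J) 1 (%W. g (pr n W))" by (rule bdd_pr[OF g])
 have "(LINT W|GI ?J. xi (lf ?k ?J A2 W)*g (pr n W)) = (LINT y|GI ?n. LINT w|GI ?k. xi (lf ?k ?J A2 (csum ?n ?k y w))*g (pr n (csum ?n ?k y w)))"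
  by (rule csum_integral(1)[OF _ _ bdd_mult[OF bdd_lf[OF xi] gp]]) auto
 also have "... = (LINT y|GI ?n. NO ?n et h y*g y)"
  by (intro Bochner_Integration.integral_cong) (auto simp: pr_csum NOh)
 finally have lhs: "(LINT W|GI ?J. xi (lf ?k ?J A2 W)*g (pr n W)) = (LINT y|GI ?n. NO ?n et h y*g y)" .
 define a where "a = grad ?n h"
 define R where "R = (%y. NO ?n et h y - (LINT y|GI ?n. h y) - et*dot ?n a y)"
 have Rm: "R \<in> borel_measurable (GI ?n)" and R2: "integrable (GI ?n) (%y. (R y)^2)"
  unfolding R_def a_def using affine_defect(1,2)[OF finite_lessThan h et(1) eta1] by auto
 have RI: "(LINT y|GI ?n. (R y)^2) <= 4*et^4"
  unfolding R_def a_def using noise_almost_affine[OF finite_lessThan h et] by simp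
 have Ri: "integrable (GI ?n) R" by (rule GI.abs_integral_power2_le(1)[OF Rm R2])
 have Rabs: "(LINT y|GI ?n. \<bar>R y\<bar>) <= 2*et^2"
 proof -
  have "(LINT y|GI ?n. \<bar>R y\<bar>)^2 <= (2*et^2)^2"
   using GI.abs_integral_power2_le(2)[OF Rm R2] RI by (simp add: power_mult_distrib flip: power_mult)
  then show ?thesis by (rule power2_le_imp_le) simp
 qed
 have Rg: "\<bar>(LINT y|GI ?n. g y*R y)\<bar> <= 2*et^2"
 proof -
  have "\<bar>(LINT y|GI ?n. g y*R y)\<bar> <= (LINT y|GI ?n. \<bar>g y*R y\<bar>)" by simp
  also have "... <= (LINT y|GI ?n. \<bar>R y\<bar>)"
  proof (rule integral_mono)
   show "integrable (GI ?n) (%y. \<bar>g y*R y\<bar>)" by (rule integrable_abs[OF bdd_times_integrable[OF g Ri]])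
   show "integrable (GI ?n) (%y. \<bar>R y\<bar>)" by (rule integrable_abs[OF Ri])
   show "\<bar>g y*R y\<bar> <= \<bar>R y\<bar>" if "y \<in> space (GI ?n)" for y
    using bddD(2)[OF g that] by (simp add: abs_mult mult_left_le_one_le)
  qed
  finally show ?thesis using Rabs by simp
 qed
 have "(LINT y|GI ?n. NO ?n et h y*g y) = (LINT y|GI ?n. g y*R y+(LINT y|GI ?n. h y)*g y+et*(g y*dot ?n a y))"
  by (simp add: R_def algebra_simps)
 also have "... = (LINT y|GI ?n. g y*R y)+(LINT y|GI ?n. h y)*(LINT y|GI ?n. g y)+et*(LINT y|GI ?n. g y*dot ?n a y)"
  using bdd_times_integrable[OF g Ri] GI.bdd_integrable[OF g] bdd_times_integrable[OF g dot_moments(1)[OF finite_lessThan]] by simp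
 also have "(LINT y|GI ?n. g y*dot ?n a y) = dot ?n a (grad ?n g)" by (rule grad_dot[OF finite_lessThan g])
 finally have main: "(LINT W|GI ?J. xi (lf ?k ?J A2 W)*g (pr n W)) - (LINT u|GI ?k. xi u)*(LINT y|GI ?n. g y)
   = (LINT y|GI ?n. g y*R y)+et*dot ?n a (grad ?n g)" unfolding lhs Eh by simp
 define c where "c = grad ?n g"
 define e' where "e' = (%i. dot ?n (D i) c)"
 \<comment> \<open>\<open>D\<close> is moved from one gradient to the other: the gradient of
   \<open>h\<close> is the transpose of \<open>D\<close> applied to that of \<open>xi\<close>. The
   part \<open>v\<close> of the input direction orthogonal to the rows of \<open>A\<close> drops out
   by \<open>orth_indep\<close>.\<close>
 have ac: "dot ?n a c = dot ?k e' (grad ?k xi)"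
 proof -
  define ch :: "nat+nat => real" where "ch = (%l. case_sum c (%_. 0) l)"
  define v where "v = (%l. ch l - (\<Sum>i<k. e' i*A i l))"
  have Ach: "(\<Sum>l\<in>?J. A i l*ch l) = e' i" for i
   by (simp add: ch_def sum.Plus A(2) e'_def dot_def)
  have v0: "(\<Sum>l\<in>?J. A i l * v l) = 0" if "i < k" for i
  proof -
   have "(\<Sum>l\<in>?J. A i l * v l) = e' i - (\<Sum>i'<k. e' i'*(\<Sum>l\<in>?J. A i l*A i' l))"
   proof -
    have "(\<Sum>l\<in>?J. A i l*(\<Sum>i'<k. e' i'*A i' l)) = (\<Sum>l\<in>?J. \<Sum>i'<k. e' i'*(A i l*A i' l))"
     by (simp add: sum_distrib_left mult_ac)
    also have "... = (\<Sum>i'<k. e' i'*(\<Sum>l\<in>?J. A i l*A i' l))"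
     unfolding sum_distrib_left by (rule sum.swap)
    finally show ?thesis unfolding v_def right_diff_distrib sum_subtractf Ach by simp
   qed
   also have "(\<Sum>i'<k. e' i'*(\<Sum>l\<in>?J. A i l*A i' l)) = (\<Sum>i'<k. if i = i' then e' i' else 0)"
    using A(1) that by (intro sum.cong) (auto simp: orth_def)
   finally show ?thesis using that by simp
  qed
  have chW: "dot ?J ch W = dot ?J v W+dot ?k e' (lf ?k ?J A W)" for W
  proof -
   have "dot ?k e' (lf ?k ?J A W) = (\<Sum>i<k. \<Sum>l\<in>?J. e' i*A i l*W l)"
    by (simp add: dot_def lf_def sum_distrib_left mult_ac)
   also have "... = (\<Sum>l\<in>?J. (\<Sum>i<k. e' i*A i l)*W l)"
    unfolding sum_distrib_right by (rule sum.swap)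
   finally show ?thesis by (simp add: dot_def v_def left_diff_distrib sum_subtractf)
  qed
  have chi: "integrable (GI ?J) (%W. xi (lf ?k ?J A W)*dot ?J u W)" for u
   by (rule bdd_times_integrable[OF bdd_lf[OF xi] dot_moments(1)[OF finite_JJ]])
  have Fm: "(%u. xi u*dot ?k e' u) \<in> borel_measurable (GI ?k)"
   using bddD(1)[OF xi] dot_measurable1 by (intro borel_measurable_times)
  have Fi: "integrable (GI ?J) (%W. xi (lf ?k ?J A W)*dot ?k e' (lf ?k ?J A W))"
   using Bochner_Integration.integrable_diff[OF chi[of ch] chi[of v]] by (simp add: chW algebra_simps)
  have Gm: "(%W. xi (lf ?k ?J A W)*dot ?J ch W) \<in> borel_measurable (GI ?J)" using chi[of ch] by simp
  have "dot ?n a c = (LINT y|GI ?n. h y*dot ?n c y)"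
   unfolding a_def grad_dot[OF finite_lessThan h] by (rule dot_commute)
  also have "... = (LINT y|GI ?n. LINT w|GI ?k. xi (lf ?k ?J A (csum ?n ?k y w))*dot ?J ch (csum ?n ?k y w))"
  proof -
   have "dot ?J ch (csum ?n ?k y w) = dot ?n c y" for y w
    by (simp add: dot_def ch_def sum.Plus csum_simps)
   then show ?thesis by (simp add: h_def)
  qed
  also have "... = (LINT p|(GI ?n >< GI ?k). xi (lf ?k ?J A (csum ?n ?k (fst p) (snd p)))*dot ?J ch (csum ?n ?k (fst p) (snd p)))"
  proof -
   interpret P: pair_prob_space "GI ?n" "GI ?k" by (intro pair_prob_spaceI prob_GI)
   have "integrable (distr (GI ?n >< GI ?k) (GI ?J) (%(x, y). csum ?n ?k x y)) (%W. xi (lf ?k ?J A W)*dot ?J ch W)"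
    unfolding GI_Plus[OF finite_lessThan finite_lessThan] by (rule chi)
   then have "integrable (GI ?n >< GI ?k) (%p. xi (lf ?k ?J A (csum ?n ?k (fst p) (snd p)))*dot ?J ch (csum ?n ?k (fst p) (snd p)))"
    using integrable_distr_eq[OF csum_measurable Gm] by (simp add: split_beta')
   from P.integral_fst'[OF this] show ?thesis by simp
  qed
  also have "... = (LINT W|GI ?J. xi (lf ?k ?J A W)*dot ?J ch W)"
   using integral_distr[OF csum_measurable Gm] unfolding GI_Plus[OF finite_lessThan finite_lessThan] by (simp add: split_beta')
  also have "... = (LINT W|GI ?J. xi (lf ?k ?J A W)*dot ?J v W+xi (lf ?k ?J A W)*dot ?k e' (lf ?k ?J A W))"
   by (simp add: chW distrib_left)
  also have "... = (LINT W|GI ?J. xi (lf ?k ?J A W)*dot ?k e' (lf ?k ?J A W))"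
   using chi[of v] Fi orth_indep[OF xi finite_JJ v0] by simp
  also have "... = (LINT u|GI ?k. xi u*dot ?k e' u)"
   by (rule orth_integral[OF A(1) finite_JJ Fm])
  also have "... = dot ?k e' (grad ?k xi)" by (rule grad_dot[OF finite_lessThan xi])
  finally show ?thesis .
 qed
 have "\<bar>dot ?k e' (grad ?k xi)\<bar> <= sqrt (\<Sum>i<k. (e' i)^2)"
 proof -
  have "(dot ?k e' (grad ?k xi))^2 <= (\<Sum>i<k. (e' i)^2)*(\<Sum>i<k. (grad ?k xi i)^2)"
   unfolding dot_def by (rule Cauchy_Schwarz_ineq_sum)
  also have "... <= (\<Sum>i<k. (e' i)^2)*1"
   using grad_bessel[OF finite_lessThan xi] by (intro mult_left_mono) (auto simp: dot_def power2_eq_square sum_nonneg)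
  finally show ?thesis by (simp add: real_le_rsqrt)
 qed
 then have "\<bar>et*dot ?n a (grad ?n g)\<bar> <= et * sqrt (\<Sum>i<k. (dot ?n (D i) (grad ?n g))^2)"
  using et(1) ac by (simp add: abs_mult mult_left_mono c_def e'_def)
 then show ?thesis unfolding main using Rg by linarith
qed

lemma contr_scale: "contr k n B ==> \<bar>t\<bar> <= 1 ==> contr k n (%i j. t*B i j)"
proof -
 assume B: "contr k n B" and t: "\<bar>t\<bar> <= 1"
 have t2: "t^2 <= 1" using t by (simp add: abs_square_le_1)
 have e: "(\<Sum>j<n. (\<Sum>i<k. y i*(t*B i j))^2) = t^2*(\<Sum>j<n. (\<Sum>i<k. y i*B i j)^2)" for y
 proof -
  have "(\<Sum>i<k. y i*(t*B i j)) = t*(\<Sum>i<k. y i*B i j)" for j by (simp add: sum_distrib_left mult_ac)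
  then show ?thesis by (simp only: power_mult_distrib sum_distrib_left[of "t^2"])
 qed
 have "t^2*(\<Sum>j<n. (\<Sum>i<k. y i*B i j)^2) <= 1*(\<Sum>i<k. (y i)^2)" for y
  using B t2 by (intro mult_mono) (auto simp: contr_def sum_nonneg)
 then show "contr k n (%i j. t*B i j)" unfolding contr_def e by simp
qed

lemma contr_comb:
 assumes B: "contr k n B0" "contr k n B1" and t: "\<bar>a\<bar> + \<bar>b\<bar> <= 1"
 shows "contr k n (%i j. a*B0 i j+b*B1 i j)"
 unfolding contr_def
proof
 fix y
 let ?u = "%j. \<Sum>i<k. y i*B0 i j" and ?v = "%j. \<Sum>i<k. y i*B1 i j" and ?S = "\<Sum>i<k. (y i)^2"
 have S: "0 <= ?S" by (simp add: sum_nonneg)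
 have "(\<Sum>i<k. y i*(a*B0 i j+b*B1 i j)) = a*?u j+b*?v j" for j
  by (simp add: sum_distrib_left sum.distrib algebra_simps)
 moreover have "(a*u+b * v)^2 <= (\<bar>a\<bar> + \<bar>b\<bar>)*(\<bar>a\<bar> * u^2+\<bar>b\<bar> * v^2)" for u v :: real
 proof -
  have "(a*u+b * v)^2 <= (\<bar>a\<bar> * \<bar>u\<bar> + \<bar>b\<bar> * \<bar>v\<bar>)^2"
   by (rule power2_le_iff_abs_le[THEN iffD2]) (auto simp flip: abs_mult)
  also have "... = (\<bar>a\<bar> + \<bar>b\<bar>)*(\<bar>a\<bar> * u^2+\<bar>b\<bar> * v^2) - \<bar>a\<bar> * \<bar>b\<bar> * (\<bar>u\<bar> - \<bar>v\<bar>)^2"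
  proof -
   have "(p * s+q*t)^2 = (p+q)*(p * s^2+q*t^2) - p*q*(s - t)^2" for p q s t :: real
    by (simp add: power2_eq_square algebra_simps)
   from this[of "\<bar>a\<bar>" "\<bar>u\<bar>" "\<bar>b\<bar>" "\<bar>v\<bar>"] show ?thesis by simp
  qed
  finally show ?thesis by (smt (verit) mult_nonneg_nonneg abs_ge_zero zero_le_power2)
 qed
 ultimately have "(\<Sum>j<n. (\<Sum>i<k. y i*(a*B0 i j+b*B1 i j))^2) <= (\<Sum>j<n. (\<bar>a\<bar> + \<bar>b\<bar>)*(\<bar>a\<bar> * (?u j)^2+\<bar>b\<bar> * (?v j)^2))"
  by (simp only:) (intro sum_mono, simp)
 also have "... = (\<bar>a\<bar> + \<bar>b\<bar>)*(\<bar>a\<bar> * (\<Sum>j<n. (?u j)^2)+\<bar>b\<bar> * (\<Sum>j<n. (?v j)^2))"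
  by (simp add: sum_distrib_left sum.distrib algebra_simps)
 also have "... <= (\<bar>a\<bar> + \<bar>b\<bar>)*(\<bar>a\<bar> * ?S+\<bar>b\<bar> * ?S)"
  using B by (intro mult_left_mono add_mono) (auto simp: contr_def)
 also have "... = (\<bar>a\<bar> + \<bar>b\<bar>)^2*?S" by (simp add: power2_eq_square algebra_simps)
 also have "... <= 1*?S" using t S by (intro mult_right_mono power_le_one) auto
 finally show "(\<Sum>j<n. (\<Sum>i<k. y i*(a*B0 i j+b*B1 i j))^2) <= ?S" by simp
qed

text \<open>Up to scale, the gradient at \<open>z\<close> of the Gaussian smoothing of
  \<open>f\<close>: the first Hermite coefficients of \<open>f\<close> on noisy copies of
  \<open>z\<close>.\<close>

definition gz :: "nat => real => ((nat => real) => real) => (nat => real) => nat => real" where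
 "gz n c f z = grad {..<n} (%y. f (mix {..<n} c (sqrt (1 - c^2)) z y))"

lemma gz_measurable:
 assumes f: "bdd (GI {..<n}) 1 f" and j: "j < n"
 shows "(%z. gz n c f z j) \<in> borel_measurable (GI {..<n})"
proof -
 have "(%p. f (mix {..<n} c (sqrt (1 - c^2)) (fst p) (snd p)) * snd p j) \<in> borel_measurable (GI {..<n} >< GI {..<n})"
  using bddD(1)[OF bdd_mix2[OF f]] measurable_compose[OF measurable_snd measurable_GI_component[of j "{..<n}"]] j
  by (intro borel_measurable_times) (auto simp: split_beta')
 then have "(%z. (LINT y|GI {..<n}. f (mix {..<n} c (sqrt (1 - c^2)) z y)*y j)) \<in> borel_measurable (GI {..<n})"
  by (intro sigma_finite_measure.borel_measurable_lebesgue_integral[OF prob_space_imp_sigma_finite[OF prob_GI]]) (simp add: split_beta')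
 then show ?thesis using j by (simp add: gz_def grad_def)
qed

lemma gz_norm:
 assumes f: "bdd (GI {..<n}) 1 f" and z: "z \<in> space (GI {..<n})"
 shows "(\<Sum>j<n. (gz n c f z j)^2) <= 1"
 using grad_bessel[OF finite_lessThan bdd_NO_integrand[OF f z]] by (simp add: gz_def dot_def power2_eq_square)

text \<open>The rate at which the value can change when the frame moves in direction
  \<open>D\<close>, seen from the base point \<open>z\<close>.\<close>

definition pen :: "nat => nat => real => ((nat => real) => real) => (nat => nat => real) => (nat => real) => real" where
 "pen k n c f D z = sqrt (\<Sum>i<k. (dot {..<n} (D i) (gz n c f z))^2)"

lemma pen_bdd:
 assumes f: "bdd (GI {..<n}) 1 f"
 shows "bdd (GI {..<n}) (sqrt (\<Sum>i<k. dot {..<n} (D i) (D i))) (pen k n c f D)"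
proof (rule bddI)
 have "(%z. dot {..<n} (D i) (gz n c f z)) \<in> borel_measurable (GI {..<n})" for i
  using gz_measurable[OF f] by (intro dot_measurable) auto
 then show "pen k n c f D \<in> borel_measurable (GI {..<n})"
  unfolding pen_def[abs_def] by measurable
 fix z assume z: "z \<in> space (GI {..<n})"
 have "(\<Sum>i<k. (dot {..<n} (D i) (gz n c f z))^2) <= (\<Sum>i<k. dot {..<n} (D i) (D i))"
 proof (rule sum_mono)
  fix i
  have "(dot {..<n} (D i) (gz n c f z))^2 <= (\<Sum>j<n. (D i j)^2)*(\<Sum>j<n. (gz n c f z j)^2)"
   unfolding dot_def by (rule Cauchy_Schwarz_ineq_sum)
  also have "... <= (\<Sum>j<n. (D i j)^2)*1"
   using gz_norm[OF f z] by (intro mult_left_mono sum_nonneg) auto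
  finally show "(dot {..<n} (D i) (gz n c f z))^2 <= dot {..<n} (D i) (D i)" by (simp add: dot_def power2_eq_square)
 qed
 then show "\<bar>pen k n c f D z\<bar> <= sqrt (\<Sum>i<k. dot {..<n} (D i) (D i))"
  by (simp add: pen_def sum_nonneg)
qed

lemma pr_law:
 assumes F: "bdd (GI {..<n}) b F"
 shows "(LINT W|GI (JJ n k). F (pr n W)) = (LINT z|GI {..<n}. F z)"
 unfolding csum_integral(1)[OF finite_lessThan finite_lessThan bdd_pr[OF F]]
 by (intro Bochner_Integration.integral_cong) (auto simp: pr_csum GI.prob_space)

text \<open>The frame \<open>B\<close> is carried by the first source and the small move
  \<open>et*D\<close> by the second. Given the first source, \<open>first_order\<close> applies with
  and without the move, and the product of means cancels in the difference.\<close>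

lemma path_step:
 assumes qs: "bdd (GI {..<k}) 1 qs" and f: "bdd (GI {..<n}) 1 f" and B: "contr k n B" and D: "contr k n D"
  and c: "0 < c" "c < 1" and et: "0 <= et" "et^2 <= 1/2"
  and A3: "orth k (JJ n k) A3" "!!i j. i < k ==> j < n ==> A3 i (Inl j) = c^2*B i j+(1 - c^2)*(et*D i j)"
  and A0: "orth k (JJ n k) A0" "!!i j. i < k ==> j < n ==> A0 i (Inl j) = c^2*B i j"
 shows "\<bar>VV k n qs f A3 - VV k n qs f A0\<bar> <= et*(LINT z|GI {..<n}. pen k n c f D z)+2*et^2"
proof -
 let ?J = "JJ n k" let ?n = "{..<n}" let ?k = "{..<k}"
 define tt where "tt = sqrt (1 - c^2)"
 have c2: "c^2 < 1" using c by (simp add: abs_square_less_1)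
 have th: "c^2+tt^2 = 1" "tt^2 = 1 - c^2" using c2 by (auto simp: tt_def)
 obtain A1 where A1: "orth k ?J A1" "!!i j. A1 i (Inl j) = B i j" using contr_complete[OF B] by auto
 have "et^2 <= 1^2" using et by simp
 then have e1: "\<bar>et\<bar> <= 1" using et power2_le_imp_le[of et 1] by simp
 obtain A2 where A2: "orth k ?J A2" "!!i j. A2 i (Inl j) = et*D i j" using contr_complete[OF contr_scale[OF D e1]] by auto
 obtain Az where Az: "orth k ?J Az" "!!i j. Az i (Inl j) = 0*D i j" using contr_complete[OF contr_scale[OF D, of 0]] by auto
 define G where "G = (%A W1. (LINT W2|GI ?J. qs (mix ?k c tt (lf ?k ?J A1 W1) (lf ?k ?J A W2))*f (mix ?n c tt (pr n W1) (pr n W2))))"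
 have V3: "VV k n qs f A3 = (LINT W1|GI ?J. G A2 W1)"
  unfolding G_def using A3(2) A1(2) A2(2) th by (intro VV_mix[OF qs f A1(1) A2(1) A3(1) th(1)]) auto
 have V0: "VV k n qs f A0 = (LINT W1|GI ?J. G Az W1)"
  unfolding G_def using A0(2) A1(2) Az(2) th by (intro VV_mix[OF qs f A1(1) Az(1) A0(1) th(1)]) auto
 have Gb: "bdd (GI ?J) 1 (G A)" for A
 proof -
  have m: "(%p. (mix ?k c tt (lf ?k ?J A1 (fst p)) (lf ?k ?J A (snd p)), mix ?n c tt (pr n (fst p)) (pr n (snd p)))) \<in> measurable (GI ?J >< GI ?J) (GI ?k >< GI ?n)"
   using measurable_compose[OF measurable_fst lf_measurable] measurable_compose[OF measurable_snd lf_measurable]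
    measurable_compose[OF measurable_fst pr_measurable] measurable_compose[OF measurable_snd pr_measurable]
   by (intro measurable_Pair measurable_mix) auto
  have "bdd (GI ?J >< GI ?J) 1 (%(W1, W2). qs (mix ?k c tt (lf ?k ?J A1 W1) (lf ?k ?J A W2))*f (mix ?n c tt (pr n W1) (pr n W2)))"
   using bdd_compose[OF bdd_pair2[OF qs f] m] by (simp add: split_beta')
  then show ?thesis unfolding G_def by (rule bdd_fubini(3)[OF prob_GI prob_GI])
 qed
 have pt: "\<bar>G A2 W1 - G Az W1\<bar> <= et*pen k n c f D (pr n W1)+2*et^2" if W1: "W1 \<in> space (GI ?J)" for W1
 proof -
  let ?x = "%u. qs (mix ?k c tt (lf ?k ?J A1 W1) u)" and ?g = "%y. f (mix ?n c tt (pr n W1) y)"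
  have sp: "lf ?k ?J A1 W1 \<in> space (GI ?k)" "pr n W1 \<in> space (GI ?n)"
   using measurable_space[OF pr_measurable W1] by (simp_all add: space_GI)
  have x: "bdd (GI ?k) 1 ?x" and g: "bdd (GI ?n) 1 ?g"
   by (rule bdd_NO_integrand[OF qs sp(1)], rule bdd_NO_integrand[OF f sp(2)])
  have "\<bar>G A2 W1 - (LINT u|GI ?k. ?x u)*(LINT y|GI ?n. ?g y)\<bar> <= et*pen k n c f D (pr n W1)+2*et^2"
   using first_order[OF x g D A2(1) et] A2(2) by (simp add: G_def pen_def gz_def tt_def)
  \<comment> \<open>With \<open>et = 0\<close> the same estimate says that projection and input are
    uncorrelated given the first source.\<close>
  moreover have "\<bar>G Az W1 - (LINT u|GI ?k. ?x u)*(LINT y|GI ?n. ?g y)\<bar> <= 0"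
   using first_order[OF x g D Az(1), of 0] Az(2) by (simp add: G_def)
  ultimately show ?thesis by linarith
 qed
 note pb = pen_bdd[OF f, where k = k and D = D and c = c]
 have "\<bar>VV k n qs f A3 - VV k n qs f A0\<bar> = \<bar>(LINT W1|GI ?J. G A2 W1 - G Az W1)\<bar>"
  unfolding V3 V0 using GI.bdd_integrable[OF Gb] by simp
 also have "... <= (LINT W1|GI ?J. \<bar>G A2 W1 - G Az W1\<bar>)" by simp
 also have "... <= (LINT W1|GI ?J. et*pen k n c f D (pr n W1)+2*et^2)"
  using GI.bdd_integrable[OF Gb] GI.bdd_integrable[OF bdd_pr[OF pb]] pt by (intro integral_mono) auto
 also have "... = et*(LINT z|GI ?n. pen k n c f D z)+2*et^2"
  using GI.bdd_integrable[OF bdd_pr[OF pb]] by (simp add: pr_law[OF pb] GI.prob_space)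
 finally show ?thesis .
qed

text \<open>The segment between the frames is cut into \<open>T\<close> steps. The quadratic errors
  of the steps add up to order \<open>1/T\<close> and vanish as \<open>T\<close> grows, so that only
  the linear term remains.\<close>

theorem VV_path:
 assumes qs: "bdd (GI {..<k}) 1 qs" and f: "bdd (GI {..<n}) 1 f" and B: "contr k n B0" "contr k n B1" and c: "0 < c" "c < 1"
  and A0: "orth k (JJ n k) A0" "!!i j. i < k ==> j < n ==> A0 i (Inl j) = c^2*B0 i j"
  and A1: "orth k (JJ n k) A1" "!!i j. i < k ==> j < n ==> A1 i (Inl j) = c^2*B1 i j"
 shows "\<bar>VV k n qs f A1 - VV k n qs f A0\<bar> <= 2*c^2/(1 - c^2)*(LINT z|GI {..<n}. pen k n c f (%i j. 1/2*B1 i j + - (1/2)*B0 i j) z)"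
proof -
 let ?J = "JJ n k"
 define D where "D = (%i j. 1/2*B1 i j + - (1/2)*B0 i j)"
 have D: "contr k n D" unfolding D_def by (rule contr_comb[OF B(2,1)]) simp
 define P where "P = (LINT z|GI {..<n}. pen k n c f D z)"
 have c2: "c^2 < 1" "0 < c^2" using c by (auto simp: abs_square_less_1)
 \<comment> \<open>Determined by \<open>c^2*(B1 - B0)/T = (1 - c^2)*(r/T)*D\<close> with
   \<open>D\<close> half the difference of the frames.\<close>
 define r where "r = 2*c^2/(1 - c^2)"
 have r: "0 < r" using c2 by (simp add: r_def)
 have bound: "\<bar>VV k n qs f A1 - VV k n qs f A0\<bar> <= r*P+2*r^2/real T" if T: "0 < T" "2*r <= real T" for T :: nat
 proof -
  define et where "et = r/real T"
  have "et <= 1/2" "0 <= et" using T r by (auto simp: et_def field_simps)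
  then have "et^2 <= (1/2)^2" by (intro power_mono)
  then have et: "0 <= et" "et^2 <= 1/2" using \<open>0 <= et\<close> by (auto simp: power2_eq_square)
  define Bm where "Bm = (%m i j. (1 - real m/real T)*B0 i j+real m/real T*B1 i j)"
  have Bm: "contr k n (Bm m)" if "m <= T" for m
   unfolding Bm_def using that T by (intro contr_comb[OF B]) auto
  have "EX A. orth k ?J A \<and> (ALL i j. A i (Inl j) = c^2*Bm m i j)" if "m <= T" for m
   using c2 by (intro contr_complete contr_scale Bm that) auto
  then obtain A where A: "!!m. m <= T ==> orth k ?J (A m)" "!!m i j. m <= T ==> A m i (Inl j) = c^2*Bm m i j"
   by metis
  have st: "\<bar>VV k n qs f (A (Suc m)) - VV k n qs f (A m)\<bar> <= et*P+2*et^2" if m: "m < T" for m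
   unfolding P_def
  proof (rule path_step[OF qs f Bm[OF less_imp_le[OF m]] D c et])
   fix i j
   have "(1 - c^2)*et = 2*c^2/real T" using c2 by (simp add: et_def r_def)
   then have "(1 - c^2)*(et*D i j) = 2*c^2/real T*D i j" by (simp add: mult.assoc[symmetric])
   also have "... = c^2*(Bm (Suc m) i j - Bm m i j)" by (simp add: D_def Bm_def add_divide_distrib algebra_simps)
   finally show "A (Suc m) i (Inl j) = c^2*Bm m i j+(1 - c^2)*(et*D i j)"
    using m by (simp add: A(2) algebra_simps)
  qed (use A m in auto)
  have "\<bar>VV k n qs f (A T) - VV k n qs f (A 0)\<bar> = \<bar>\<Sum>m<T. VV k n qs f (A (Suc m)) - VV k n qs f (A m)\<bar>"
   using sum_lessThan_telescope[of "%m. VV k n qs f (A m)" T] by (simp only:)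
  also have "... <= (\<Sum>m<T. et*P+2*et^2)" by (rule order_trans[OF sum_abs sum_mono]) (use st in auto)
  also have "... = r*P+2*r^2/real T" using T by (simp add: et_def power2_eq_square field_simps)
  also have "VV k n qs f (A T) = VV k n qs f A1"
   using T A A1 by (intro VV_cong[OF qs f]) (auto simp: Bm_def)
  also have "VV k n qs f (A 0) = VV k n qs f A0"
   using T A A0 by (intro VV_cong[OF qs f]) (auto simp: Bm_def)
  finally show ?thesis .
 qed
 have "(%T. r*P+2*r^2/real T) \<longlonglongrightarrow> r*P+0"
  by (intro tendsto_intros lim_const_over_n)
 moreover have "eventually (%T. \<bar>VV k n qs f A1 - VV k n qs f A0\<bar> <= r*P+2*r^2/real T) sequentially"
 proof (rule eventually_sequentiallyI)
  fix T assume "nat \<lceil>2*r\<rceil> + 1 <= T"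
  then show "\<bar>VV k n qs f A1 - VV k n qs f A0\<bar> <= r*P+2*r^2/real T" by (intro bound) linarith+
 qed
 ultimately have "\<bar>VV k n qs f A1 - VV k n qs f A0\<bar> <= r*P+0"
  by (rule tendsto_lowerbound) simp
 then show ?thesis by (simp add: r_def P_def D_def)
qed

section \<open>Orthonormal frames and orthogonal projections\<close>

lemma sum_combine:
 fixes a :: "'b => real"
 shows "(\<Sum>j\<in>J. (\<Sum>l\<in>L. a l*e l j)*y j) = (\<Sum>l\<in>L. a l*(\<Sum>j\<in>J. e l j*y j))"
 unfolding sum_distrib_right sum_distrib_left by (subst sum.swap) (simp only: mult.assoc)

lemma orth_combine:
 assumes e: "orth r {..<n} e" and l: "l < r"
 shows "(\<Sum>j<n. (\<Sum>m<r. a m*e m j)*e l j) = a l"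
proof -
 have "(\<Sum>j<n. (\<Sum>m<r. a m*e m j)*e l j) = (\<Sum>m<r. a m*(\<Sum>j<n. e m j*e l j))"
  unfolding sum_distrib_right sum_distrib_left by (subst sum.swap) (simp add: mult_ac)
 also have "... = (\<Sum>m<r. if m = l then a m else 0)"
  using e l by (intro sum.cong) (auto simp: orth_def)
 finally show ?thesis using l by simp
qed

lemma frame_step:
 assumes e: "orth r {..<n} e" and u: "!!l. l < r ==> (\<Sum>j<n. u j*e l j) = 0" and nz: "(\<Sum>j<n. (u j)^2) ~= 0"
 shows "orth (Suc r) {..<n} (e(r := %j. u j / sqrt (\<Sum>j<n. (u j)^2)))"
proof -
 define N where "N = (\<Sum>j<n. (u j)^2)"
 have N: "0 < N" using nz unfolding N_def by (simp add: sum_nonneg order_less_le)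
 define v where "v = (%j. u j / sqrt N)"
 have vv: "(\<Sum>j<n. v j * v j) = 1"
 proof -
  have "(\<Sum>j<n. v j * v j) = (\<Sum>j<n. (u j)^2/N)" using N by (simp add: v_def power2_eq_square)
  then show ?thesis using N by (simp add: N_def flip: sum_divide_distrib)
 qed
 have ve: "(\<Sum>j<n. v j*e l j) = 0" if "l < r" for l
 proof -
  have "(\<Sum>j<n. v j*e l j) = (\<Sum>j<n. u j*e l j) / sqrt N" by (simp add: v_def sum_divide_distrib)
  then show ?thesis using u[OF that] by simp
 qed
 have ev: "(\<Sum>j<n. e l j * v j) = 0" if "l < r" for l using ve[OF that] by (simp add: mult.commute)
 have "orth (Suc r) {..<n} (e(r := v))"
  using e vv ve ev by (auto simp: orth_def less_Suc_eq)
 then show ?thesis by (simp add: v_def N_def)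
qed

text \<open>Gram-Schmidt for rows that may be dependent: if the next row already lies in the span, a
  coordinate direction outside the span fills the slot. The frame thus has exactly \<open>r\<close>
  vectors, which is where \<open>r <= n\<close> enters.\<close>

lemma orth_frame_covering:
 assumes "r <= n"
 shows "EX e. orth r {..<n} e \<and> (ALL i<r. EX a. ALL j<n. B i j = (\<Sum>l<r. a l*e l j))"
 using assms
proof (induction r)
 case 0
 show ?case by (simp add: orth_def)
next
 case (Suc r)
 then obtain e where e: "orth r {..<n} e" and sp: "!!i. i < r ==> EX a. ALL j<n. B i j = (\<Sum>l<r. a l*e l j)"
  by auto
 have res: "(\<Sum>j<n. (b j - (\<Sum>l<r. (\<Sum>j<n. b j*e l j)*e l j))*e m j) = 0" if "m < r" for b m
  using orth_combine[OF e that, of "%l. \<Sum>j<n. b j*e l j"] by (simp add: left_diff_distrib sum_subtractf)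
 have "EX e'. orth (Suc r) {..<n} e' \<and> (ALL l<r. e' l = e l) \<and> (EX a. ALL j<n. B r j = (\<Sum>l<Suc r. a l*e' l j))"
 proof -
  define u where "u = (%j. B r j - (\<Sum>l<r. (\<Sum>j<n. B r j*e l j)*e l j))"
  show ?thesis
  proof (cases "(\<Sum>j<n. (u j)^2) = 0")
   case False
   define N where "N = sqrt (\<Sum>j<n. (u j)^2)"
   have N: "N ~= 0" using False by (simp add: N_def)
   let ?e = "e(r := %j. u j/N)"
   have oe: "orth (Suc r) {..<n} ?e"
    unfolding N_def by (rule frame_step[OF e _ False]) (simp add: u_def res)
   have "B r j = (\<Sum>l<Suc r. (if l = r then N else \<Sum>j<n. B r j*e l j)*?e l j)" for j
   proof -
    have "(\<Sum>l<r. (if l = r then N else \<Sum>j<n. B r j*e l j)*?e l j) = (\<Sum>l<r. (\<Sum>j<n. B r j*e l j)*e l j)"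
     by (intro sum.cong) auto
    then show ?thesis using N by (simp add: u_def)
   qed
   note br = this
   show ?thesis
   proof (intro exI[of _ ?e] conjI)
    show "EX a. ALL j<n. B r j = (\<Sum>l<Suc r. a l*?e l j)"
     by (intro exI[of _ "%l. if l = r then N else \<Sum>j<n. B r j*e l j"] allI impI) (rule br)
   qed (rule oe, simp)
  next
   case True
   then have u0: "u j = 0" if "j < n" for j using that by (simp add: sum_nonneg_eq_0_iff)
   \<comment> \<open>The squared projections of the coordinate vectors onto \<open>r\<close>
     orthonormal vectors sum to \<open>r < n\<close>, so one of them is less than one.\<close>
   have "EX p<n. (\<Sum>l<r. (e l p)^2) < 1"
   proof (rule ccontr)
    assume "\<not> ?thesis"
    then have "(\<Sum>p<n. 1) <= (\<Sum>p<n. \<Sum>l<r. (e l p)^2)" by (intro sum_mono) force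
    also have "... = (\<Sum>l<r. \<Sum>p<n. e l p*e l p)" by (subst sum.swap) (simp add: power2_eq_square)
    also have "... = (\<Sum>l<r. 1)" using e by (intro sum.cong) (auto simp: orth_def)
    finally show False using Suc.prems by simp
   qed
   then obtain p where p: "p < n" "(\<Sum>l<r. (e l p)^2) < 1" by auto
   define d where "d = (%j. if j = p then 1 else 0 :: real)"
   have de: "(\<Sum>j<n. d j*e l j) = e l p" for l
   proof -
    have "(\<Sum>j<n. d j*e l j) = (\<Sum>j<n. if j = p then e l j else 0)" by (intro sum.cong) (auto simp: d_def)
    then show ?thesis using p by simp
   qed
   define w where "w = (%j. d j - (\<Sum>l<r. e l p*e l j))"
   have we: "(\<Sum>j<n. w j*e m j) = 0" if "m < r" for m
    using res[OF that, of d] by (simp add: w_def de)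
   have "w p ~= 0" using p(2) by (simp add: w_def d_def power2_eq_square)
   then have wn: "(\<Sum>j<n. (w j)^2) ~= 0" using p(1) by (auto simp: sum_nonneg_eq_0_iff)
   let ?e = "e(r := %j. w j / sqrt (\<Sum>j<n. (w j)^2))"
   have oe: "orth (Suc r) {..<n} ?e" by (rule frame_step[OF e we wn])
   have "B r j = (\<Sum>l<Suc r. (if l = r then 0 else \<Sum>j<n. B r j*e l j)*?e l j)" if "j < n" for j
   proof -
    have "(\<Sum>l<r. (if l = r then 0 else \<Sum>j<n. B r j*e l j)*?e l j) = (\<Sum>l<r. (\<Sum>j<n. B r j*e l j)*e l j)"
     by (intro sum.cong) auto
    then show ?thesis using u0[OF that] by (simp add: u_def)
   qed
   note br = this
   show ?thesis
   proof (intro exI[of _ ?e] conjI)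
    show "EX a. ALL j<n. B r j = (\<Sum>l<Suc r. a l*?e l j)"
     by (intro exI[of _ "%l. if l = r then 0 else \<Sum>j<n. B r j*e l j"] allI impI) (rule br, assumption)
   qed (rule oe, simp)
  qed
 qed
 then obtain e' where e': "orth (Suc r) {..<n} e'" "ALL l<r. e' l = e l" and br: "EX a. ALL j<n. B r j = (\<Sum>l<Suc r. a l*e' l j)"
  by blast
 have "EX a. ALL j<n. B i j = (\<Sum>l<Suc r. a l*e' l j)" if i: "i < r" for i
 proof -
  obtain a where a: "ALL j<n. B i j = (\<Sum>l<r. a l*e l j)" using sp[OF i] by auto
  have "(\<Sum>l<r. (a(r := 0)) l*e' l j) = (\<Sum>l<r. a l*e l j)" for j using e'(2) by (intro sum.cong) auto
  then show ?thesis using a by (intro exI[of _ "a(r := 0)"]) simp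
 qed
 then show ?case using e'(1) br by (intro exI[of _ e']) (auto simp: less_Suc_eq)
qed

lemma lin_comb_measurable: "lin_comb n k b \<in> measurable (GI {..<k}) (GI {..<n})"
 unfolding lin_comb_def[abs_def] by (rule measurable_GI_restrict) measurable

lemma lin_comb_cong: "(!!l. l < k ==> c l = d l) ==> lin_comb n k b c = lin_comb n k b d"
 unfolding lin_comb_def by (intro restrict_ext sum.cong) auto

lemma orth_proj_frame:
 assumes e: "orth k {..<n} e" and x: "x \<in> Rn n"
 shows "orth_proj n (range (lin_comb n k e)) x = lin_comb n k e (%l. dot {..<n} (e l) x)"
 unfolding orth_proj_def
proof (rule the_equality)
 let ?P = "lin_comb n k e (%l. dot {..<n} (e l) x)"
 have expand: "(\<Sum>i<n. u i*lin_comb n k e c i) = (\<Sum>l<k. c l*dot {..<n} (e l) u)" for u c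
 proof -
  have "(\<Sum>i<n. u i*lin_comb n k e c i) = (\<Sum>i<n. \<Sum>l<k. c l*(e l i*u i))"
   by (simp add: lin_comb_def sum_distrib_left mult_ac)
  also have "... = (\<Sum>l<k. c l*dot {..<n} (e l) u)"
   unfolding dot_def sum_distrib_left by (rule sum.swap)
  finally show ?thesis .
 qed
 have de: "dot {..<n} (e l) (lin_comb n k e c) = c l" if "l < k" for l c
  using orth_combine[OF e that, of c] by (simp add: dot_def lin_comb_def mult.commute)
 have lin: "(\<Sum>i<n. (x i - p i)*lin_comb n k e c i) = (\<Sum>l<k. c l*(dot {..<n} (e l) x - dot {..<n} (e l) p))" for p c
  unfolding left_diff_distrib sum_subtractf expand by (simp add: sum_subtractf right_diff_distrib)
 show "?P \<in> range (lin_comb n k e) \<and> (ALL u:range (lin_comb n k e). (\<Sum>i<n. (x i - ?P i)*u i) = 0)"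
  by (auto simp: lin de)
 fix p assume p: "p \<in> range (lin_comb n k e) \<and> (ALL u:range (lin_comb n k e). (\<Sum>i<n. (x i - p i)*u i) = 0)"
 then obtain c where c: "p = lin_comb n k e c" by auto
 have "(\<Sum>l<k. d l*(dot {..<n} (e l) x - c l)) = 0" for d
 proof -
  have "(\<Sum>i<n. (x i - p i)*lin_comb n k e d i) = 0" using p by auto
  then show ?thesis unfolding lin c by (simp add: de)
 qed
 from this[of "%l. dot {..<n} (e l) x - c l"] have "c l = dot {..<n} (e l) x" if "l < k" for l
  using that by (auto simp: sum_nonneg_eq_0_iff)
 then show "p = ?P" unfolding c by (intro lin_comb_cong) auto
qed

lemma frame_subspace:
 assumes e: "orth k {..<n} e"
 shows "subspace_of_dim n k (range (lin_comb n k e))"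
proof -
 define b where "b = (%l. \<lambda>i\<in>{..<n}. e l i)"
 have lb: "lin_comb n k b = lin_comb n k e"
  by (auto simp: lin_comb_def b_def fun_eq_iff)
 have "c l = 0" if z: "lin_comb n k b c = (\<lambda>i\<in>{..<n}. 0)" and l: "l < k" for c l
 proof -
  have "(\<Sum>m<k. c m*e m j) = 0" if "j < n" for j
   using fun_cong[OF z, of j] that unfolding lb by (simp add: lin_comb_def)
  then have "(\<Sum>j<n. (\<Sum>m<k. c m*e m j)*e l j) = 0" by simp
  then show ?thesis unfolding orth_combine[OF e l] .
 qed
 then show ?thesis
  unfolding subspace_of_dim_def
 proof (intro exI[of _ b] conjI allI impI)
  show "range (lin_comb n k e) = range (lin_comb n k b)" by (simp only: lb)
 qed (auto simp: b_def Rn_def)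
qed

section \<open>From frames to smooth linear juntas and back\<close>

text \<open>Averages only the auxiliary noise, leaving a function of the input.\<close>

definition UU :: "nat => nat => ((nat => real) => real) => (nat => nat+nat => real) => (nat => real) => real" where
 "UU k n qs A x = (LINT w|GI {..<k}. qs (lf {..<k} (JJ n k) A (csum {..<n} {..<k} x w)))"

lemma UU_bdd2:
 assumes "bdd (GI {..<k}) b qs"
 shows "bdd (GI {..<n} >< GI {..<k}) b (%(x, w). qs (lf {..<k} (JJ n k) A (csum {..<n} {..<k} x w)))"
 by (rule csum_integral(2)[OF finite_lessThan finite_lessThan bdd_lf[OF assms]])

lemma UU_bdd: "bdd (GI {..<k}) b qs ==> bdd (GI {..<n}) b (UU k n qs A)"
 unfolding UU_def[abs_def] by (rule bdd_fubini(3)[OF prob_GI prob_GI UU_bdd2])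

lemma VV_UU:
 assumes qs: "bdd (GI {..<k}) 1 qs" and f: "bdd (GI {..<n}) 1 f"
 shows "VV k n qs f A = (LINT x|GI {..<n}. UU k n qs A x*f x)"
proof -
 have b: "bdd (GI (JJ n k)) 1 (%W. qs (lf {..<k} (JJ n k) A W)*f (pr n W))"
  using bdd_mult[OF bdd_lf[OF qs] bdd_pr[OF f]] by simp
 show ?thesis
  unfolding VV_def UU_def csum_integral(1)[OF finite_lessThan finite_lessThan b]
  by (intro Bochner_Integration.integral_cong) (auto simp: pr_csum)
qed

lemma UU_integral:
 assumes F: "bdd (GI {..<k}) b F" and A: "orth k (JJ n k) A"
 shows "(LINT x|GI {..<n}. UU k n F A x) = (LINT u|GI {..<k}. F u)"
 unfolding UU_def csum_integral(1)[OF finite_lessThan finite_lessThan bdd_lf[OF F], symmetric]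
 by (rule orth_integral[OF A finite_JJ bddD(1)[OF F]])

text \<open>Noise on the input commutes with lifting a profile. If \<open>G\<close> and
  \<open>H\<close> are the Gram matrices of the input and the noise block, \<open>G + H = I\<close>
  gives \<open>(1 - c^2)*G + H = c^2*H + (1 - c^2)*I\<close>.\<close>

lemma NO_UU:
 assumes qs: "bdd (GI {..<k}) 1 qs" and A: "orth k (JJ n k) A" and c: "0 <= c" "c <= 1"
 shows "NO {..<n} c (UU k n qs A) x = UU k n (NO {..<k} c qs) A x"
proof -
 let ?J = "JJ n k" let ?n = "{..<n}" let ?k = "{..<k}"
 define sg where "sg = sqrt (1 - c^2)"
 have s2: "sg * sg = 1 - c*c" using c by (simp add: sg_def power2_eq_square mult_le_one)
 define F where "F = (%v. qs (\<lambda>i\<in>?k. c*(\<Sum>j<n. A i (Inl j)*x j) + v i))"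
 have Fm: "(%v. \<lambda>i\<in>?k. c*(\<Sum>j<n. A i (Inl j)*x j) + v i) \<in> measurable (GI ?k) (GI ?k)"
  by (rule measurable_GI_restrict) measurable
 have F: "bdd (GI ?k) 1 F" unfolding F_def by (rule bdd_compose[OF qs Fm])
 define A' where "A' = (%i. case_sum (%j. sg*A i (Inl j)) (%l. A i (Inr l)))"
 define A'' where "A'' = (%i. case_sum (%l. c*A i (Inr l)) (sc sg i))"
 have "NO ?n c (UU k n qs A) x = (LINT y|GI ?n. LINT w|GI ?k. F (lf ?k ?J A' (csum ?n ?k y w)))"
 proof -
  have "(\<lambda>i\<in>?k. c*(\<Sum>j<n. A i (Inl j)*x j)+lf ?k ?J A' (csum ?n ?k y w) i) = lf ?k ?J A (csum ?n ?k (mix ?n c sg x y) w)" for y w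
   unfolding lf_Plus[OF finite_lessThan finite_lessThan]
   by (intro restrict_ext) (simp add: A'_def mix_def sum_distrib_left sum.distrib algebra_simps)
  then show ?thesis by (simp add: NO_def UU_def F_def sg_def)
 qed
 also have "... = (LINT W|GI ?J. F (lf ?k ?J A' W))"
  by (rule csum_integral(1)[OF finite_lessThan finite_lessThan bdd_lf[OF F], symmetric])
 also have "... = (LINT v|distr (GI ?J) (GI ?k) (lf ?k ?J A'). F v)"
  by (rule integral_distr[OF lf_measurable bddD(1)[OF F], symmetric])
 also have "distr (GI ?J) (GI ?k) (lf ?k ?J A') = distr (GI (?k <+> ?k)) (GI ?k) (lf ?k (?k <+> ?k) A'')"
 proof (rule distr_gram)
  fix i i' assume i: "i \<in> ?k" "i' \<in> ?k"
  define G where "G = (\<Sum>j<n. A i (Inl j)*A i' (Inl j))"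
  define H where "H = (\<Sum>l<k. A i (Inr l)*A i' (Inr l))"
  have "G+H = (\<Sum>l\<in>?J. A i l*A i' l)" by (simp add: sum.Plus G_def H_def)
  also have "... = (if i = i' then 1 else 0)" using A i unfolding orth_def lessThan_iff by blast
  finally have GH: "G+H = (if i = i' then 1 else 0)" .
  have "(\<Sum>l\<in>?J. A' i l*A' i' l) = (sg * sg)*G+H"
   by (simp add: A'_def sum.Plus G_def H_def sum_distrib_left mult_ac)
  also have "... = c*c*H+(sg * sg)*(if i = i' then 1 else 0)"
   unfolding s2 GH[symmetric] by (simp add: algebra_simps)
  also have "c*c*H = (\<Sum>l<k. (c*A i (Inr l))*(c*A i' (Inr l)))"
   by (simp add: H_def sum_distrib_left mult_ac)
  also have "(sg * sg)*(if i = i' then 1 else 0) = (\<Sum>l<k. sc sg i l * sc sg i' l)"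
   using i by (simp add: sc_mult sum_sc1)
  finally show "(\<Sum>l\<in>?J. A' i l*A' i' l) = (\<Sum>l\<in>?k <+> ?k. A'' i l*A'' i' l)"
   by (simp add: A''_def sum.Plus)
 qed auto
 also have "(LINT v|distr (GI (?k <+> ?k)) (GI ?k) (lf ?k (?k <+> ?k) A''). F v) = (LINT W|GI (?k <+> ?k). F (lf ?k (?k <+> ?k) A'' W))"
  by (rule integral_distr[OF lf_measurable bddD(1)[OF F]])
 also have "... = (LINT w|GI ?k. LINT u|GI ?k. F (lf ?k (?k <+> ?k) A'' (csum ?k ?k w u)))"
  by (rule csum_integral(1)[OF finite_lessThan finite_lessThan bdd_lf[OF F]])
 also have "... = UU k n (NO ?k c qs) A x"
 proof -
  have "(\<lambda>i\<in>?k. c*(\<Sum>j<n. A i (Inl j)*x j)+lf ?k (?k <+> ?k) A'' (csum ?k ?k w u) i) = mix ?k c sg (lf ?k ?J A (csum ?n ?k x w)) u" for w u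
   unfolding lf_Plus[OF finite_lessThan finite_lessThan] mix_def
   by (intro restrict_ext) (simp add: A''_def sum_sc sum_distrib_left algebra_simps)
  then show ?thesis by (simp add: NO_def UU_def F_def sg_def)
 qed
 finally show ?thesis .
qed

lemma UU_smooth:
 assumes qs: "smo {..<k} s qs" and A: "orth k (JJ n k) A"
 shows "smo {..<n} s (UU k n qs A)"
 unfolding smo_def
proof (intro conjI allI impI)
 note b = conjunct1[OF qs[unfolded smo_def]]
 show U: "bdd (GI {..<n}) 1 (UU k n qs A)" by (rule UU_bdd[OF b])
 fix t :: real assume t: "0 < t"
 let ?c = "exp (- t)"
 let ?d = "%u. qs u - NO {..<k} ?c qs u"
 have c: "0 <= ?c" "?c <= 1" using t by auto
 have d: "bdd (GI {..<k}) (1+1) ?d" by (rule bdd_diff[OF b bdd_NO[OF b]])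
 have pt: "\<bar>UU k n qs A x - NO {..<n} ?c (UU k n qs A) x\<bar> <= UU k n (%u. \<bar>?d u\<bar>) A x" if x: "x \<in> space (GI {..<n})" for x
 proof -
  have i: "integrable (GI {..<k}) (%w. F (lf {..<k} (JJ n k) A (csum {..<n} {..<k} x w)))" if "bdd (GI {..<k}) 1 F" for F
   by (rule GI.bdd_integrable[OF bdd_fubini(5)[OF prob_GI prob_GI UU_bdd2[OF that] x]])
  have "UU k n qs A x - NO {..<n} ?c (UU k n qs A) x = UU k n ?d A x"
   unfolding NO_UU[OF b A c] unfolding UU_def using i[OF b] i[OF bdd_NO[OF b]] by simp
  also have "\<bar>...\<bar> <= UU k n (%u. \<bar>?d u\<bar>) A x" unfolding UU_def by (rule integral_abs_bound)
  finally show ?thesis .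
 qed
 have "(LINT x|GI {..<n}. \<bar>UU k n qs A x - NO {..<n} ?c (UU k n qs A) x\<bar>) <= (LINT x|GI {..<n}. UU k n (%u. \<bar>?d u\<bar>) A x)"
  using pt by (intro integral_mono GI.bdd_integrable[OF bdd_abs[OF bdd_diff[OF U bdd_NO[OF U]]]] GI.bdd_integrable[OF UU_bdd[OF bdd_abs[OF d]]])
 also have "... = (LINT u|GI {..<k}. \<bar>?d u\<bar>)" by (rule UU_integral[OF bdd_abs[OF d] A])
 also have "... <= s * sqrt t" using qs t by (simp add: smo_def)
 finally show "(LINT x|GI {..<n}. \<bar>UU k n qs A x - NO {..<n} ?c (UU k n qs A) x\<bar>) <= s * sqrt t" .
qed

lemma Rn_space: "Rn n = space (GI {..<n})"
 by (simp add: Rn_def space_GI)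

text \<open>The lift depends on the input only through the rows of the \<open>Inl\<close> block.
  These lie in the span of an orthonormal frame of exactly \<open>k\<close> vectors even if the
  block has smaller rank.\<close>

lemma UU_junta:
 assumes qs: "smo {..<k} s qs" and A: "orth k (JJ n k) A" and kn: "k <= n"
 shows "smooth_linear_junta n k s (UU k n qs A)"
 unfolding smooth_linear_junta_def smooth_fun_smo
proof (intro conjI UU_smooth[OF qs A])
 obtain e where e: "orth k {..<n} e" and sp: "ALL i<k. EX a. ALL j<n. A i (Inl j) = (\<Sum>l<k. a l*e l j)"
  using orth_frame_covering[OF kn, of "%i j. A i (Inl j)"] by auto
 then obtain a where a: "!!i j. i < k ==> j < n ==> A i (Inl j) = (\<Sum>l<k. a i l*e l j)" by metis
 have "UU k n qs A x = UU k n qs A z" if x: "x \<in> Rn n" and z: "z \<in> Rn n" and eq: "orth_proj n (range (lin_comb n k e)) x = orth_proj n (range (lin_comb n k e)) z" for x z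
 proof -
  have l: "lin_comb n k e (%l. dot {..<n} (e l) x) = lin_comb n k e (%l. dot {..<n} (e l) z)"
   using eq unfolding orth_proj_frame[OF e x] orth_proj_frame[OF e z] .
  have "dot {..<n} (e l) x = dot {..<n} (e l) z" if "l < k" for l
  proof -
   have "(\<Sum>j<n. lin_comb n k e c j*e l j) = c l" for c
    using orth_combine[OF e that, of c] by (simp add: lin_comb_def)
   from this[of "%l. dot {..<n} (e l) x"] this[of "%l. dot {..<n} (e l) z"] show ?thesis unfolding l by simp
  qed
  then have "(\<Sum>l<k. a i l*dot {..<n} (e l) x) = (\<Sum>l<k. a i l*dot {..<n} (e l) z)" for i by simp
  moreover have "(\<Sum>j<n. A i (Inl j)*y j) = (\<Sum>l<k. a i l*dot {..<n} (e l) y)" if "i < k" for i y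
  proof -
   have "(\<Sum>j<n. A i (Inl j)*y j) = (\<Sum>j<n. (\<Sum>l<k. a i l*e l j)*y j)"
    by (rule sum.cong) (simp_all add: a[OF that])
   then show ?thesis unfolding dot_def sum_combine .
  qed
  ultimately have "lf {..<k} (JJ n k) A (csum {..<n} {..<k} x w) = lf {..<k} (JJ n k) A (csum {..<n} {..<k} z w)" for w
   unfolding lf_Plus[OF finite_lessThan finite_lessThan] by (intro restrict_ext) simp
  then show ?thesis by (simp add: UU_def)
 qed
 then show "EX E. subspace_of_dim n k E \<and> (ALL x:Rn n. ALL z:Rn n. orth_proj n E x = orth_proj n E z --> UU k n qs A x = UU k n qs A z)"
  using frame_subspace[OF e] by blast
qed

lemma junta_corr_upper:
 assumes f: "bdd (GI {..<n}) 1 f" and ph: "smooth_linear_junta n k s ph"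
 shows "(LINT x|GI {..<n}. ph x*f x) <= junta_corr n k s f"
 unfolding junta_corr_def gaussian_GI
proof (rule cSUP_upper)
 show "bdd_above ((%ph. (LINT x|GI {..<n}. ph x*f x)) ` Collect (smooth_linear_junta n k s))"
 proof (rule bdd_aboveI2[of _ _ 1])
  fix ph assume "ph \<in> Collect (smooth_linear_junta n k s)"
  then have "bdd (GI {..<n}) 1 ph" by (simp add: smooth_linear_junta_def smooth_fun_smo smo_def)
  from GI.bdd_integral_le[OF bdd_mult[OF this f]] show "(LINT x|GI {..<n}. ph x*f x) <= 1" by simp
 qed
qed (use ph in simp)

theorem VV_le_junta_corr:
 assumes f: "bdd (GI {..<n}) 1 f" and qs: "smo {..<k} s qs" and A: "orth k (JJ n k) A" and kn: "k <= n"
 shows "VV k n qs f A <= junta_corr n k s f"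
 unfolding VV_UU[OF conjunct1[OF qs[unfolded smo_def]] f]
 by (rule junta_corr_upper[OF f UU_junta[OF qs A kn]])

text \<open>The profile is the junta composed with the isometric embedding of \<real>^k along an
  orthonormal frame of its subspace. Noise on the input projects to noise on the profile, so
  smoothness carries over with the same \<open>s\<close>.\<close>

lemma junta_profile:
 assumes ph: "smooth_linear_junta n k s ph" and kn: "k <= n"
 shows "EX e qs. orth k {..<n} e \<and> smo {..<k} s qs \<and> (ALL x:space (GI {..<n}). ph x = qs (lf {..<k} {..<n} e x))"
proof -
 have sm: "smo {..<n} s ph" using ph by (simp add: smooth_linear_junta_def smooth_fun_smo)
 note b = conjunct1[OF sm[unfolded smo_def]]
 obtain E where E: "subspace_of_dim n k E" "!!x z. x \<in> Rn n ==> z \<in> Rn n ==> orth_proj n E x = orth_proj n E z ==> ph x = ph z"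
  using ph by (auto simp: smooth_linear_junta_def)
 then obtain B where B: "E = range (lin_comb n k B)" by (auto simp: subspace_of_dim_def)
 obtain e where e: "orth k {..<n} e" and sp: "ALL i<k. EX a. ALL j<n. B i j = (\<Sum>l<k. a l*e l j)"
  using orth_frame_covering[OF kn, of B] by auto
 then obtain a where a: "!!i j. i < k ==> j < n ==> B i j = (\<Sum>l<k. a i l*e l j)" by metis
 define qs where "qs = (%u. ph (lin_comb n k e u))"
 have qsb: "bdd (GI {..<k}) 1 qs" unfolding qs_def by (rule bdd_compose[OF b lin_comb_measurable])
 have lf_e: "lf {..<k} {..<n} e x = (\<lambda>l\<in>{..<k}. dot {..<n} (e l) x)" for x by (simp add: lf_def dot_def)
 have prof: "ph x = qs (lf {..<k} {..<n} e x)" if x: "x \<in> space (GI {..<n})" for x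
 proof -
  let ?P = "lin_comb n k e (%l. dot {..<n} (e l) x)"
  have P: "lin_comb n k e (lf {..<k} {..<n} e x) = ?P" unfolding lf_e by (rule lin_comb_cong) simp
  have Pr: "?P \<in> Rn n" by (simp add: lin_comb_def Rn_def)
  have xr: "x \<in> Rn n" using x by (simp add: Rn_space)
  \<comment> \<open>The input and its projection \<open>?P\<close> have equal inner products with
    \<open>E\<close>, so the descriptions defining \<open>orth_proj\<close> at both points
    coincide.\<close>
  have "(\<Sum>i<n. (x i - p i) * v i) = (\<Sum>i<n. (?P i - p i) * v i)" if v: "v \<in> E" for v p
  proof -
   obtain c where c: "v = lin_comb n k B c" using v B by auto
   have pe: "(\<Sum>i<n. e l i*(x i - ?P i)) = 0" if l: "l < k" for l
   proof -
    have "(\<Sum>i<n. e l i*?P i) = dot {..<n} (e l) x"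
     using orth_combine[OF e l, of "%l. dot {..<n} (e l) x"] by (simp add: lin_comb_def mult.commute)
    then show ?thesis by (simp add: right_diff_distrib sum_subtractf dot_def)
   qed
   have Bm: "(\<Sum>i<n. B m i*(x i - ?P i)) = 0" if m: "m < k" for m
   proof -
    have "(\<Sum>i<n. B m i*(x i - ?P i)) = (\<Sum>i<n. (\<Sum>l<k. a m l*e l i)*(x i - ?P i))"
     by (rule sum.cong) (simp_all add: a[OF m])
    then show ?thesis unfolding sum_combine using pe by simp
   qed
   have "(\<Sum>i<n. (x i - ?P i) * v i) = (\<Sum>i<n. (\<Sum>m<k. c m*B m i)*(x i - ?P i))"
    unfolding c by (rule sum.cong) (simp_all add: lin_comb_def mult.commute)
   also have "... = 0" unfolding sum_combine using Bm by simp
   finally have "(\<Sum>i<n. x i * v i) = (\<Sum>i<n. ?P i * v i)" by (simp add: left_diff_distrib sum_subtractf)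
   then show ?thesis by (simp add: left_diff_distrib sum_subtractf)
  qed
  then have "orth_proj n E x = orth_proj n E ?P" unfolding orth_proj_def by (metis (no_types, lifting))
  then show ?thesis using E(2)[OF xr Pr] by (simp add: qs_def P)
 qed
 have NOc: "NO {..<k} c qs (lf {..<k} {..<n} e x) = NO {..<n} c ph x" for c x
 proof -
  define F where "F = (%v. qs (mix {..<k} c (sqrt (1 - c^2)) (lf {..<k} {..<n} e x) v))"
  have F: "bdd (GI {..<k}) 1 F" unfolding F_def by (rule bdd_NO_integrand[OF qsb]) (simp add: space_GI)
  have "NO {..<k} c qs (lf {..<k} {..<n} e x) = (LINT y|GI {..<n}. F (lf {..<k} {..<n} e y))"
   using orth_integral[OF e finite_lessThan bddD(1)[OF F]] by (simp add: NO_def F_def)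
  also have "... = NO {..<n} c ph x"
  proof -
   have "mix {..<k} c d (lf {..<k} {..<n} e x) (lf {..<k} {..<n} e y) = lf {..<k} {..<n} e (mix {..<n} c d x y)" for d y
    unfolding mix_def by (auto simp: lf_def sum_distrib_left sum.distrib algebra_simps intro!: restrict_ext)
   then show ?thesis by (simp add: NO_def F_def prof)
  qed
  finally show ?thesis .
 qed
 have "smo {..<k} s qs"
  unfolding smo_def
 proof (intro conjI qsb allI impI)
  fix t :: real assume t: "0 < t"
  let ?F = "%u. \<bar>qs u - NO {..<k} (exp (- t)) qs u\<bar>"
  have "?F \<in> borel_measurable (GI {..<k})" using bddD(1)[OF bdd_abs[OF bdd_diff[OF qsb bdd_NO[OF qsb]]]] .
  then have "(LINT u|GI {..<k}. ?F u) = (LINT x|GI {..<n}. ?F (lf {..<k} {..<n} e x))"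
   by (rule orth_integral[OF e finite_lessThan, symmetric])
  also have "... = (LINT x|GI {..<n}. \<bar>ph x - NO {..<n} (exp (- t)) ph x\<bar>)"
   by (intro Bochner_Integration.integral_cong) (auto simp: NOc prof)
  also have "... <= s * sqrt t" using sm t by (simp add: smo_def)
  finally show "(LINT u|GI {..<k}. ?F u) <= s * sqrt t" .
 qed
 then show ?thesis using e prof by blast
qed

text \<open>Scaling the frame by \<open>exp (- t)\<close> replaces the profile by its noised version, which smoothness controls.\<close>

lemma junta_corr_frame:
 assumes f: "bdd (GI {..<n}) 1 f" and kn: "k <= n" and s: "0 <= s" and dl: "0 < dl" and t: "0 < t"
 shows "EX e qs A. orth k {..<n} e \<and> smo {..<k} s qs \<and> orth k (JJ n k) A \<and> (ALL i j. A i (Inl j) = exp (- t)*e i j) \<and>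
  junta_corr n k s f <= VV k n qs f A + s * sqrt t+dl"
proof -
 \<comment> \<open>A supremum over the empty set would be unspecified; the lift of the zero profile
   is a member.\<close>
 have ne: "Collect (smooth_linear_junta n k s) ~= {}"
 proof -
  have "smo {..<k} s (%_. 0)" using s by (auto simp: smo_def bdd_def NO_def)
  moreover obtain A where "orth k (JJ n k) A" using contr_complete[of k n "%_ _. 0"] by (auto simp: contr_def sum_nonneg)
  ultimately show ?thesis using UU_junta kn by blast
 qed
 have "junta_corr n k s f - dl < (SUP ph\<in>Collect (smooth_linear_junta n k s). (LINT x|gaussian n. ph x*f x))"
  using dl by (simp add: junta_corr_def)
 then have "EX y:(%ph. (LINT x|gaussian n. ph x*f x)) ` Collect (smooth_linear_junta n k s). junta_corr n k s f - dl < y"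
  using ne by (intro less_cSupD) auto
 then obtain ph where ph: "smooth_linear_junta n k s ph" "junta_corr n k s f - dl < (LINT x|GI {..<n}. ph x*f x)"
  unfolding gaussian_GI by blast
 obtain e qs where e: "orth k {..<n} e" and qs: "smo {..<k} s qs" and pe: "!!x. x \<in> space (GI {..<n}) ==> ph x = qs (lf {..<k} {..<n} e x)"
  using junta_profile[OF ph(1) kn] by auto
 note b = conjunct1[OF qs[unfolded smo_def]]
 define c where "c = exp (- t)"
 define A where "A = (%i. case_sum (%j. c*e i j) (sc (sqrt (1 - c^2)) i))"
 have "c^2 <= 1" using t by (simp add: c_def power_le_one)
 then have c2: "sqrt (1 - c^2) * sqrt (1 - c^2) = 1 - c*c" by (simp add: power2_eq_square)
 have A: "orth k (JJ n k) A"
  unfolding orth_def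
 proof (intro allI impI)
  fix i i' assume i: "i < k" "i' < k"
  have "(\<Sum>j<n. (c*e i j)*(c*e i' j)) = c*c*(\<Sum>j<n. e i j*e i' j)" by (simp add: sum_distrib_left mult_ac)
  also have "(\<Sum>j<n. e i j*e i' j) = (if i = i' then 1 else 0)" using e i unfolding orth_def by blast
  finally have 1: "(\<Sum>j<n. (c*e i j)*(c*e i' j)) = c*c*(if i = i' then 1 else 0)" .
  have 2: "(\<Sum>l<k. sc (sqrt (1 - c^2)) i l * sc (sqrt (1 - c^2)) i' l) = (if i = i' then 1 - c*c else 0)"
   using i by (simp only: sc_mult c2) (simp add: sum_sc1)
  show "(\<Sum>l\<in>JJ n k. A i l*A i' l) = (if i = i' then 1 else 0)"
   unfolding A_def by (simp add: sum.Plus 1 2)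
 qed
 have UA: "UU k n qs A x = NO {..<k} c qs (lf {..<k} {..<n} e x)" for x
 proof -
  have "lf {..<k} (JJ n k) A (csum {..<n} {..<k} x w) = mix {..<k} c (sqrt (1 - c^2)) (lf {..<k} {..<n} e x) w" for w
   unfolding lf_Plus[OF finite_lessThan finite_lessThan] mix_def
   by (intro restrict_ext) (simp add: A_def sum_sc lf_in sum_distrib_left mult_ac)
  then show ?thesis by (simp add: UU_def NO_def)
 qed
 let ?d = "%u. qs u - NO {..<k} c qs u"
 have d: "bdd (GI {..<k}) (1+1) ?d" by (rule bdd_diff[OF b bdd_NO[OF b]])
 have eb: "bdd (GI {..<n}) q (%x. F (lf {..<k} {..<n} e x))" if "bdd (GI {..<k}) q F" for F q by (rule bdd_lf[OF that])
 have "(LINT x|GI {..<n}. ph x*f x) - VV k n qs f A = (LINT x|GI {..<n}. qs (lf {..<k} {..<n} e x)*f x) - (LINT x|GI {..<n}. NO {..<k} c qs (lf {..<k} {..<n} e x)*f x)"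
  unfolding VV_UU[OF b f] UA by (simp add: pe cong: Bochner_Integration.integral_cong)
 also have "... = (LINT x|GI {..<n}. ?d (lf {..<k} {..<n} e x)*f x)"
  using GI.bdd_integrable[OF bdd_mult[OF eb[OF b] f]] GI.bdd_integrable[OF bdd_mult[OF eb[OF bdd_NO[OF b]] f]]
  by (simp add: left_diff_distrib)
 also have "... <= (LINT x|GI {..<n}. \<bar>?d (lf {..<k} {..<n} e x)\<bar>)"
 proof (rule integral_mono)
  show "integrable (GI {..<n}) (%x. ?d (lf {..<k} {..<n} e x)*f x)" by (rule GI.bdd_integrable[OF bdd_mult[OF eb[OF d] f]])
  show "integrable (GI {..<n}) (%x. \<bar>?d (lf {..<k} {..<n} e x)\<bar>)" by (rule GI.bdd_integrable[OF eb[OF bdd_abs[OF d]]])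
  fix x assume "x \<in> space (GI {..<n})"
  from bddD(2)[OF f this] show "?d (lf {..<k} {..<n} e x)*f x <= \<bar>?d (lf {..<k} {..<n} e x)\<bar>"
   using abs_ge_self[of "?d (lf {..<k} {..<n} e x)*f x"] mult_left_le[of "\<bar>f x\<bar>" "\<bar>?d (lf {..<k} {..<n} e x)\<bar>"] by (simp add: abs_mult)
 qed
 also have "... = (LINT u|GI {..<k}. \<bar>?d u\<bar>)"
  by (rule orth_integral[OF e finite_lessThan bddD(1)[OF bdd_abs[OF d]]])
 also have "... <= s * sqrt t" using qs t by (simp add: smo_def c_def)
 finally have "junta_corr n k s f <= VV k n qs f A + s * sqrt t+dl" using ph(2) by linarith
 then show ?thesis using e qs A by (intro exI[of _ e] exI[of _ qs] exI[of _ A]) (auto simp: A_def c_def)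
qed

section \<open>Landweber iteration on sampled gradients\<close>

text \<open>The empirical second moment operator \<open>S\<close> of the vectors \<open>v p\<close>.
  It is self-adjoint with \<open>0 <= S <= I\<close> when they lie in the unit ball; the iteration
  \<open>lw\<close> applies powers of \<open>I - S\<close>.\<close>

definition lws :: "nat => nat => (nat => nat => real) => (nat => real) => nat => real" where
 "lws n N v x = (%i. (\<Sum>p<N. dot {..<n} (v p) x * v p i)/real N)"

primrec lw :: "nat => nat => (nat => nat => real) => nat => (nat => real) => nat => real" where
 "lw n N v 0 x = x"
| "lw n N v (Suc j) x = (%i. lw n N v j x i - lws n N v (lw n N v j x) i)"

definition energy :: "nat => nat => (nat => nat => real) => (nat => real) => real" where
 "energy n N v x = (\<Sum>p<N. (dot {..<n} (v p) x)^2)/real N"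

lemma energy_nonneg: "0 <= energy n N v x"
 by (simp add: energy_def sum_nonneg)

lemma dot_minus: "dot I a (%i. x i - y i) = dot I a x - dot I a y" "dot I (%i. x i - y i) a = dot I x a - dot I y a"
 by (simp_all add: dot_def algebra_simps sum_subtractf)

lemma dot_lws: "dot {..<n} y (lws n N v x) = (\<Sum>p<N. dot {..<n} (v p) x*dot {..<n} (v p) y)/real N"
proof -
 have "dot {..<n} y (lws n N v x) = (\<Sum>i<n. (\<Sum>p<N. dot {..<n} (v p) x * v p i)*y i)/real N"
  unfolding dot_def[of _ y] lws_def times_divide_eq_right sum_divide_distrib[symmetric] by (simp add: mult.commute)
 then show ?thesis unfolding sum_combine by (simp add: dot_def)
qed

lemma lws_sym: "dot {..<n} y (lws n N v x) = dot {..<n} x (lws n N v y)"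
 by (simp add: dot_lws mult.commute)

lemma dot_lws_energy: "dot {..<n} x (lws n N v x) = energy n N v x"
 by (simp add: dot_lws energy_def power2_eq_square)

lemma dot_CS: "(dot I a b)^2 <= dot I a a*dot I b b"
 using Cauchy_Schwarz_ineq_sum[of a b I] by (simp add: dot_def power2_eq_square)

text \<open>This is \<open>S^2 <= S\<close>, obtained by applying Cauchy-Schwarz to the sum over the
  samples.\<close>

lemma lws_norm:
 assumes v: "!!p. p < N ==> dot {..<n} (v p) (v p) <= 1"
 shows "dot {..<n} (lws n N v x) (lws n N v x) <= energy n N v x"
proof (cases "N = 0")
 case True
 then show ?thesis by (simp add: lws_def energy_def dot_def)
next
 case False
 let ?s = "lws n N v x"
 have ee: "energy n N v ?s <= dot {..<n} ?s ?s"
 proof -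
  have "(\<Sum>p<N. (dot {..<n} (v p) ?s)^2) <= (\<Sum>p<N. dot {..<n} ?s ?s)"
  proof (rule sum_mono)
   fix p assume "p \<in> {..<N}"
   then have "dot {..<n} (v p) (v p)*dot {..<n} ?s ?s <= 1*dot {..<n} ?s ?s"
    using v by (intro mult_right_mono dot_self_nonneg) auto
   then show "(dot {..<n} (v p) ?s)^2 <= dot {..<n} ?s ?s" using dot_CS[of "{..<n}" "v p" ?s] by linarith
  qed
  then show ?thesis using False by (simp add: energy_def field_simps)
 qed
 have "(dot {..<n} ?s ?s)^2 = (\<Sum>p<N. dot {..<n} (v p) x*dot {..<n} (v p) ?s)^2/(real N)^2"
  unfolding dot_lws by (simp add: power_divide)
 also have "... <= ((\<Sum>p<N. (dot {..<n} (v p) x)^2)*(\<Sum>p<N. (dot {..<n} (v p) ?s)^2))/(real N)^2"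
  by (intro divide_right_mono Cauchy_Schwarz_ineq_sum) auto
 also have "... = energy n N v x*energy n N v ?s" by (simp add: energy_def power2_eq_square)
 also have "... <= energy n N v x*dot {..<n} ?s ?s" by (intro mult_left_mono ee energy_nonneg)
 finally have "dot {..<n} ?s ?s*dot {..<n} ?s ?s <= energy n N v x*dot {..<n} ?s ?s" by (simp add: power2_eq_square)
 then show ?thesis using dot_self_nonneg[of "{..<n}" ?s] energy_nonneg[of n N v x] by (cases "dot {..<n} ?s ?s = 0") auto
qed

lemma lw_step:
 assumes v: "!!p. p < N ==> dot {..<n} (v p) (v p) <= 1"
 shows "dot {..<n} (lw n N v (Suc j) x) (lw n N v (Suc j) x) <= dot {..<n} (lw n N v j x) (lw n N v j x) - energy n N v (lw n N v j x)"
proof -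
 let ?y = "lw n N v j x" let ?s = "lws n N v ?y"
 have "dot {..<n} (lw n N v (Suc j) x) (lw n N v (Suc j) x) = dot {..<n} ?y ?y - 2*dot {..<n} ?y ?s+dot {..<n} ?s ?s"
  by (simp add: dot_minus) (simp add: dot_commute)
 then show ?thesis using lws_norm[OF v, where x = ?y] by (simp add: dot_lws_energy)
qed

text \<open>Each step decreases the squared norm by at least the current energy, so the initial norm
  pays for all energies.\<close>

lemma lw_norm:
 assumes v: "!!p. p < N ==> dot {..<n} (v p) (v p) <= 1"
 shows "dot {..<n} (lw n N v j x) (lw n N v j x)+(\<Sum>i<j. energy n N v (lw n N v i x)) <= dot {..<n} x x"
proof (induction j)
 case (Suc j)
 then show ?case using lw_step[where n = n and N = N and v = v and j = j and x = x, OF v] by simp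
qed simp

lemma lw_add: "lw n N v (i+j) x = lw n N v i (lw n N v j x)"
 by (induction i) simp_all

lemma lw_sym: "dot {..<n} y (lw n N v j x) = dot {..<n} (lw n N v j y) x"
proof (induction j arbitrary: x y)
 case (Suc j)
 have "dot {..<n} y (lw n N v (Suc j) x) = dot {..<n} (lw n N v j y) x - dot {..<n} (lw n N v j x) (lws n N v y)"
  by (simp add: dot_minus Suc lws_sym[of n y])
 also have "dot {..<n} (lw n N v j x) (lws n N v y) = dot {..<n} x (lw n N v j (lws n N v y))"
  by (rule Suc[symmetric])
 also have "lw n N v j (lws n N v y) = lws n N v (lw n N v j y)"
 proof (induction j)
  case (Suc j)
  have "lws n N v (%i. a i - b i) = (%i. lws n N v a i - lws n N v b i)" for a b
   by (simp add: lws_def dot_minus left_diff_distrib sum_subtractf diff_divide_distrib)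
  then show ?case by (simp add: Suc)
 qed simp
 finally show ?case by (simp add: dot_minus dot_commute)
qed simp

text \<open>For a self-adjoint contraction \<open>R\<close>, the squared norm of
  \<open>x - R (R x)\<close> is that of \<open>x\<close> minus twice that of \<open>R x\<close> plus
  that of \<open>R (R x)\<close>, and the last does not exceed the second.\<close>

lemma lw_even_contr:
 assumes v: "!!p. p < N ==> dot {..<n} (v p) (v p) <= 1"
 shows "dot {..<n} (%i. x i - lw n N v (2*j) x i) (%i. x i - lw n N v (2*j) x i) <= dot {..<n} x x"
proof -
 let ?R = "lw n N v j"
 have e: "lw n N v (2*j) x = ?R (?R x)" using lw_add[of n N v j j x] by (simp add: mult_2)
 have le: "dot {..<n} (?R y) (?R y) <= dot {..<n} y y" for y
  using lw_norm[where n = n and N = N and v = v and j = j and x = y, OF v] sum_nonneg[of "{..<j}" "%i. energy n N v (lw n N v i y)"] energy_nonneg by force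
 have "dot {..<n} (%i. x i - ?R (?R x) i) (%i. x i - ?R (?R x) i) = dot {..<n} x x - 2*dot {..<n} x (?R (?R x))+dot {..<n} (?R (?R x)) (?R (?R x))"
  by (simp add: dot_minus) (simp add: dot_commute)
 also have "dot {..<n} x (?R (?R x)) = dot {..<n} (?R x) (?R x)" by (rule lw_sym)
 finally show ?thesis unfolding e using le[of "?R x"] dot_self_nonneg[of "{..<n}" "?R x"] by linarith
qed

lemma lw_linear: "lw n N v j (%q. \<Sum>i\<in>R. y i*b i q) = (%q. \<Sum>i\<in>R. y i*lw n N v j (b i) q)"
proof (induction j)
 case (Suc j)
 have l: "lws n N v (%q. \<Sum>i\<in>R. y i*a i q) q = (\<Sum>i\<in>R. y i*lws n N v (a i) q)" for a q
 proof -
  have "dot {..<n} (v p) (%q. \<Sum>i\<in>R. y i*a i q) = (\<Sum>i\<in>R. y i*dot {..<n} (v p) (a i))" for p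
   using sum_combine[of y a R "v p" "{..<n}"] by (simp add: dot_def mult.commute)
  then have "lws n N v (%q. \<Sum>i\<in>R. y i*a i q) q = (\<Sum>p<N. (\<Sum>i\<in>R. y i*dot {..<n} (v p) (a i)) * v p q)/real N"
   by (simp add: lws_def)
  also have "... = (\<Sum>i\<in>R. y i*(\<Sum>p<N. dot {..<n} (v p) (a i) * v p q))/real N"
   unfolding sum_combine ..
  also have "... = (\<Sum>i\<in>R. y i*lws n N v (a i) q)"
   unfolding lws_def times_divide_eq_right sum_divide_distrib[symmetric] ..
  finally show ?thesis .
 qed
 show ?case by (simp add: Suc l right_diff_distrib sum_subtractf)
qed simp

lemma lw_span: "x q - lw n N v m x q = (\<Sum>p<N. ((\<Sum>j<m. dot {..<n} (v p) (lw n N v j x))/real N) * v p q)"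
proof (induction m)
 case (Suc m)
 have "x q - lw n N v (Suc m) x q = (x q - lw n N v m x q)+lws n N v (lw n N v m x) q" by simp
 then show ?case unfolding Suc by (simp add: lws_def add_divide_distrib distrib_right sum.distrib sum_divide_distrib)
qed simp

definition Mz :: "nat => real => ((nat => real) => real) => nat => nat => real" where
 "Mz n c f l l' = (LINT z|GI {..<n}. gz n c f z l*gz n c f z l')"

text \<open>The squared Hilbert-Schmidt distance between the empirical and the true second moment
  matrix of the gradients.\<close>

definition disc :: "nat => nat => real => ((nat => real) => real) => (nat => nat => real) => real" where
 "disc n N c f Z = (\<Sum>l<n. \<Sum>l'<n. ((\<Sum>p<N. gz n c f (Z p) l*gz n c f (Z p) l')/real N - Mz n c f l l')^2)"

lemma gz_bdd: "bdd (GI {..<n}) 1 f ==> j < n ==> bdd (GI {..<n}) 1 (%z. gz n c f z j)"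
proof (rule bddI)
 assume f: "bdd (GI {..<n}) 1 f" and j: "j < n"
 show "(%z. gz n c f z j) \<in> borel_measurable (GI {..<n})" by (rule gz_measurable[OF f j])
 fix z assume z: "z \<in> space (GI {..<n})"
 have "(gz n c f z j)^2 <= (\<Sum>j<n. (gz n c f z j)^2)" using j by (intro member_le_sum) auto
 also have "... <= 1" by (rule gz_norm[OF f z])
 finally show "\<bar>gz n c f z j\<bar> <= 1" by (simp add: abs_square_le_1)
qed

lemma integral_sum2:
 fixes F :: "nat => nat => 'a => real"
 assumes "!!i j. i < m ==> j < m' ==> integrable M (F i j)"
 shows "integrable M (%x. \<Sum>i<m. \<Sum>j<m'. F i j x)"
  "(LINT x|M. (\<Sum>i<m. \<Sum>j<m'. F i j x)) = (\<Sum>i<m. \<Sum>j<m'. (LINT x|M. F i j x))"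
proof -
 have i: "integrable M (%x. \<Sum>j<m'. F i j x)" if "i < m" for i
  using assms[OF that] by (intro Bochner_Integration.integrable_sum) auto
 then show "integrable M (%x. \<Sum>i<m. \<Sum>j<m'. F i j x)" by (rule Bochner_Integration.integrable_sum) simp
 have "(LINT x|M. (\<Sum>i<m. \<Sum>j<m'. F i j x)) = (\<Sum>i<m. (LINT x|M. (\<Sum>j<m'. F i j x)))"
  by (rule Bochner_Integration.integral_sum) (simp add: i)
 also have "... = (\<Sum>i<m. \<Sum>j<m'. (LINT x|M. F i j x))"
  by (intro sum.cong refl Bochner_Integration.integral_sum) (simp add: assms)
 finally show "(LINT x|M. (\<Sum>i<m. \<Sum>j<m'. F i j x)) = (\<Sum>i<m. \<Sum>j<m'. (LINT x|M. F i j x))" .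
qed

text \<open>Free of the dimension although it has \<open>n^2\<close> entries: the second moments of
  the entries sum to the fourth power of the norm of a gradient, which is at most one.\<close>

lemma disc_expectation:
 assumes f: "bdd (GI {..<n}) 1 f" and N: "0 < N"
 shows "(LINT Z|PiM {..<N} (%_. GI {..<n}). disc n N c f Z) <= 1/real N"
  "integrable (PiM {..<N} (%_. GI {..<n})) (disc n N c f)"
proof -
 let ?P = "PiM {..<N} (%_. GI {..<n})"
 have ne: "{..<N} ~= {}" using N by auto
 have b: "bdd (GI {..<n}) (1*1) (%z. gz n c f z l*gz n c f z l')" if "l < n" "l' < n" for l l'
  by (rule bdd_mult[OF gz_bdd[OF f that(1)] gz_bdd[OF f that(2)]])
 note var = iid_average_variance[OF prob_GI finite_lessThan ne bddD(1)[OF b] GI.bdd_integrable[OF bdd_power2[OF b]]]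
 show "integrable ?P (disc n N c f)"
  unfolding disc_def Mz_def by (rule integral_sum2(1)) (use var(1) in simp)
 have "(LINT Z|?P. disc n N c f Z) = (\<Sum>l<n. \<Sum>l'<n. (LINT Z|?P. ((\<Sum>p<N. gz n c f (Z p) l*gz n c f (Z p) l')/real N - Mz n c f l l')^2))"
  unfolding disc_def Mz_def by (rule integral_sum2(2)) (use var(1) in simp)
 also have "... <= (\<Sum>l<n. \<Sum>l'<n. (LINT z|GI {..<n}. (gz n c f z l*gz n c f z l')^2)/real N)"
  unfolding Mz_def using var(2) by (intro sum_mono) auto
 also have "... = (LINT z|GI {..<n}. (\<Sum>l<n. \<Sum>l'<n. (gz n c f z l*gz n c f z l')^2))/real N"
  by (subst integral_sum2(2)) (rule GI.bdd_integrable[OF bdd_power2[OF b]], assumption+, simp add: sum_divide_distrib)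
 also have "... <= (LINT z|GI {..<n}. 1)/real N"
 proof (intro divide_right_mono integral_mono)
  show "integrable (GI {..<n}) (%z. \<Sum>l<n. \<Sum>l'<n. (gz n c f z l*gz n c f z l')^2)"
   using GI.bdd_integrable[OF bdd_power2[OF b]] by (intro Bochner_Integration.integrable_sum) auto
  fix z assume z: "z \<in> space (GI {..<n})"
  have "(\<Sum>l<n. \<Sum>l'<n. (gz n c f z l*gz n c f z l')^2) = (\<Sum>l<n. (gz n c f z l)^2)*(\<Sum>l<n. (gz n c f z l)^2)"
   by (simp add: power_mult_distrib sum_product)
  also have "... <= 1*1" using gz_norm[OF f z] by (intro mult_mono) (auto intro: sum_nonneg)
  finally show "(\<Sum>l<n. \<Sum>l'<n. (gz n c f z l*gz n c f z l')^2) <= 1" by simp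
 qed auto
 finally show "(LINT Z|?P. disc n N c f Z) <= 1/real N" by (simp add: GI.prob_space)
qed

lemma quad_M:
 assumes f: "bdd (GI {..<n}) 1 f"
 shows "integrable (GI {..<n}) (%z. (dot {..<n} x (gz n c f z))^2)"
  "(LINT z|GI {..<n}. (dot {..<n} x (gz n c f z))^2) = (\<Sum>l<n. \<Sum>l'<n. x l*x l'*Mz n c f l l')"
proof -
 have e: "(dot {..<n} x (gz n c f z))^2 = (\<Sum>l<n. \<Sum>l'<n. x l*x l'*(gz n c f z l*gz n c f z l'))" for z
  by (simp add: dot_def power2_eq_square sum_product mult_ac)
 have i: "integrable (GI {..<n}) (%z. gz n c f z l*gz n c f z l')" if "l < n" "l' < n" for l l'
  by (rule GI.bdd_integrable[OF bdd_mult[OF gz_bdd[OF f that(1)] gz_bdd[OF f that(2)]]])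
 show "integrable (GI {..<n}) (%z. (dot {..<n} x (gz n c f z))^2)" unfolding e by (intro integral_sum2(1) integrable_mult_right i)
 show "(LINT z|GI {..<n}. (dot {..<n} x (gz n c f z))^2) = (\<Sum>l<n. \<Sum>l'<n. x l*x l'*Mz n c f l l')"
  unfolding e by (subst integral_sum2(2)) (auto intro!: integrable_mult_right i simp: Mz_def)
qed

text \<open>The quadratic form of a matrix at a vector of norm at most one is bounded by its
  Hilbert-Schmidt norm.\<close>

lemma energy_disc:
 assumes f: "bdd (GI {..<n}) 1 f" and x: "dot {..<n} x x <= 1"
 shows "(LINT z|GI {..<n}. (dot {..<n} x (gz n c f z))^2) <= energy n N (%p. gz n c f (Z p)) x + sqrt (disc n N c f Z)"
proof -
 define DE where "DE = (%l l'. (\<Sum>p<N. gz n c f (Z p) l*gz n c f (Z p) l')/real N - Mz n c f l l')"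
 have en: "energy n N (%p. gz n c f (Z p)) x = (\<Sum>l<n. \<Sum>l'<n. x l*x l'*((\<Sum>p<N. gz n c f (Z p) l*gz n c f (Z p) l')/real N))"
 proof -
  have "(\<Sum>p<N. (dot {..<n} (gz n c f (Z p)) x)^2) = (\<Sum>p<N. \<Sum>l<n. \<Sum>l'<n. x l*x l'*(gz n c f (Z p) l*gz n c f (Z p) l'))"
   by (simp add: dot_def power2_eq_square sum_product mult_ac)
  also have "... = (\<Sum>l<n. \<Sum>l'<n. \<Sum>p<N. x l*x l'*(gz n c f (Z p) l*gz n c f (Z p) l'))"
   by (subst sum.swap) (intro sum.cong refl sum.swap)
  finally show ?thesis by (simp add: energy_def sum_divide_distrib sum_distrib_left)
 qed
 have "(\<Sum>l<n. \<Sum>l'<n. x l*x l'*DE l l')^2 <= disc n N c f Z"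
 proof -
  have "(\<Sum>l<n. \<Sum>l'<n. x l*x l'*DE l l')^2 = (\<Sum>u\<in>{..<n} \<times> {..<n}. (x (fst u)*x (snd u))*DE (fst u) (snd u))^2"
   by (simp add: sum.cartesian_product split_beta')
  also have "... <= (\<Sum>u\<in>{..<n} \<times> {..<n}. (x (fst u)*x (snd u))^2)*(\<Sum>u\<in>{..<n} \<times> {..<n}. (DE (fst u) (snd u))^2)"
   by (rule Cauchy_Schwarz_ineq_sum)
  also have "(\<Sum>u\<in>{..<n} \<times> {..<n}. (x (fst u)*x (snd u))^2) = dot {..<n} x x*dot {..<n} x x"
   by (simp add: dot_def sum_product sum.cartesian_product split_beta' power2_eq_square mult_ac)
  also have "(\<Sum>u\<in>{..<n} \<times> {..<n}. (DE (fst u) (snd u))^2) = disc n N c f Z"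
   by (simp add: disc_def DE_def sum.cartesian_product split_beta')
  also have "dot {..<n} x x*dot {..<n} x x*disc n N c f Z <= 1*disc n N c f Z"
   using x dot_self_nonneg[of "{..<n}" x] by (intro mult_right_mono mult_le_one) (auto simp: disc_def sum_nonneg)
  finally show ?thesis by simp
 qed
 then have "\<bar>\<Sum>l<n. \<Sum>l'<n. x l*x l'*DE l l'\<bar> <= sqrt (disc n N c f Z)" by (simp add: real_le_rsqrt)
 moreover have "(\<Sum>l<n. \<Sum>l'<n. x l*x l'*DE l l') = energy n N (%p. gz n c f (Z p)) x - (\<Sum>l<n. \<Sum>l'<n. x l*x l'*Mz n c f l l')"
  unfolding en DE_def by (simp add: right_diff_distrib sum_subtractf)
 ultimately show ?thesis unfolding quad_M(2)[OF f] by linarith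
qed

text \<open>Landweber iteration pulls a frame into the span of the sampled gradients, with bounded coefficients; the
  remainder has small energy. An even number of steps keeps the result a contraction.\<close>

lemma landweber_frame:
 fixes c :: real and Z :: "nat => nat => real"
 assumes f: "bdd (GI {..<n}) 1 f" and e: "orth k {..<n} e" and Z: "!!p. p < N ==> Z p \<in> space (GI {..<n})" and L: "0 < L"
 defines "v == %p. gz n c f (Z p)"
 shows "EX C. (ALL i<k. ALL p<N. \<bar>C i p\<bar> <= 2*real L/real N) \<and> contr k n (%i j. \<Sum>p<N. C i p * v p j) \<and>
  (LINT z|GI {..<n}. pen k n c f (%i j. 1/2*(\<Sum>p<N. C i p * v p j) + - (1/2)*e i j) z) <= 1/2 * sqrt (real k/real L+real k * sqrt (disc n N c f Z))"
proof -
 have v: "dot {..<n} (v p) (v p) <= 1" if "p < N" for p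
  using gz_norm[OF f Z[OF that]] by (simp add: v_def dot_def power2_eq_square)
 have e1: "dot {..<n} (e i) (e i) = 1" if "i < k" for i using e that by (simp add: orth_def dot_def)
 define x where "x = (%j i. lw n N v j (e i))"
 have x1: "dot {..<n} (x j i) (x j i) <= 1" if "i < k" for i j
  using lw_norm[where n = n and N = N and v = v and j = j and x = "e i", OF v] sum_nonneg[of "{..<j}" "%q. energy n N v (lw n N v q (e i))"]
   energy_nonneg[of n N v] e1[OF that] by (simp add: x_def)
 have en: "(\<Sum>j<2*L. energy n N v (x j i)) <= 1" if "i < k" for i
  using lw_norm[where n = n and N = N and v = v and j = "2*L" and x = "e i", OF v] dot_self_nonneg[of "{..<n}" "lw n N v (2*L) (e i)"] e1[OF that]
  by (simp add: x_def)
 \<comment> \<open>Each row spends total energy at most one over all steps, so the energies of the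
   \<open>k\<close> rows at the \<open>L\<close> even steps sum to at most \<open>k\<close>, and
   some step is below average for all rows together.\<close>
 have "EX j<L. real L*(\<Sum>i<k. energy n N v (x (2*j) i)) <= real k"
 proof (rule ccontr)
  assume "\<not> ?thesis"
  then have "(\<Sum>j<L. real k) < (\<Sum>j<L. real L*(\<Sum>i<k. energy n N v (x (2*j) i)))"
   using L by (intro sum_strict_mono) auto
  also have "... = real L*(\<Sum>i<k. \<Sum>j<L. energy n N v (x (2*j) i))"
   by (subst sum.swap) (simp add: sum_distrib_left)
  also have "... <= real L*(\<Sum>i<k. 1)"
  proof (intro mult_left_mono sum_mono)
   fix i assume i: "i \<in> {..<k}"
   have "(\<Sum>j<L. energy n N v (x (2*j) i)) = (\<Sum>j\<in>(%j. 2*j) ` {..<L}. energy n N v (x j i))"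
    by (subst sum.reindex) (auto simp: inj_on_def)
   also have "... <= (\<Sum>j<2*L. energy n N v (x j i))"
    by (intro sum_mono2) (auto simp: energy_nonneg)
   also have "... <= 1" using en i by simp
   finally show "(\<Sum>j<L. energy n N v (x (2*j) i)) <= 1" .
  qed simp
  finally show False by simp
 qed
 then obtain j where j: "j < L" "(\<Sum>i<k. energy n N v (x (2*j) i)) <= real k/real L"
  using L by (auto simp: field_simps)
 define C where "C = (%i p. (\<Sum>q<2*j. dot {..<n} (v p) (x q i))/real N)"
 have Cv: "(\<Sum>p<N. C i p * v p q) = e i q - x (2*j) i q" for i q
  unfolding C_def x_def by (rule lw_span[symmetric])
 have Cb: "\<bar>C i p\<bar> <= 2*real L/real N" if "i < k" "p < N" for i p
 proof -
  have "\<bar>dot {..<n} (v p) (x q i)\<bar> <= 1" for q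
  proof -
   have "(dot {..<n} (v p) (x q i))^2 <= dot {..<n} (v p) (v p)*dot {..<n} (x q i) (x q i)" by (rule dot_CS)
   also have "... <= 1*1" using v[OF that(2)] x1[OF that(1)] by (intro mult_mono dot_self_nonneg) auto
   finally show ?thesis by (simp add: abs_square_le_1)
  qed
  then have "\<bar>\<Sum>q<2*j. dot {..<n} (v p) (x q i)\<bar> <= (\<Sum>q<2*j. 1)"
   by (intro order_trans[OF sum_abs sum_mono])
  also have "... <= 2*real L" using j(1) by simp
  finally show ?thesis by (simp add: C_def divide_right_mono)
 qed
 have con: "contr k n (%i q. \<Sum>p<N. C i p * v p q)"
  unfolding contr_def Cv
 proof
  fix y
  define b where "b = (%q. \<Sum>i<k. y i*e i q)"
  have "(\<Sum>i<k. y i*(e i q - x (2*j) i q)) = b q - lw n N v (2*j) b q" for q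
   unfolding b_def lw_linear by (simp add: x_def right_diff_distrib sum_subtractf)
  then have "(\<Sum>q<n. (\<Sum>i<k. y i*(e i q - x (2*j) i q))^2) <= dot {..<n} b b"
   using lw_even_contr[where n = n and N = N and v = v and j = j and x = b, OF v] by (simp add: dot_def power2_eq_square)
  also have "... = (\<Sum>i<k. y i*(\<Sum>q<n. e i q*b q))" unfolding dot_def by (subst (1) b_def) (rule sum_combine)
  also have "... = (\<Sum>i<k. y i*y i)"
  proof (intro sum.cong refl arg_cong2[where f = "(*)"])
   fix i assume "i \<in> {..<k}"
   then show "(\<Sum>q<n. e i q*b q) = y i"
    using orth_combine[OF e, of i y] by (simp add: b_def mult.commute)
  qed
  finally show "(\<Sum>q<n. (\<Sum>i<k. y i*(e i q - x (2*j) i q))^2) <= (\<Sum>i<k. (y i)^2)" by (simp add: power2_eq_square)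
 qed
 define D where "D = (%i q. 1/2*(\<Sum>p<N. C i p * v p q) + - (1/2)*e i q)"
 have De: "D i q = - (1/2)*x (2*j) i q" for i q unfolding D_def Cv by (simp add: field_simps)
 have Dd: "(dot {..<n} (D i) y)^2 = 1/4*(dot {..<n} (x (2*j) i) y)^2" for i y
 proof -
  have "dot {..<n} (D i) y = - (1/2)*dot {..<n} (x (2*j) i) y" by (simp add: dot_def De sum_distrib_left sum_negf sum_divide_distrib)
  then show ?thesis by (simp add: power2_eq_square)
 qed
 note pb = pen_bdd[OF f, where k = k and D = D and c = c]
 have "(LINT z|GI {..<n}. pen k n c f D z)^2 <= (LINT z|GI {..<n}. (pen k n c f D z)^2)"
  by (rule GI.power2_integral_le[OF GI.bdd_integrable[OF pb] GI.bdd_integrable[OF bdd_power2[OF pb]]])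
 also have "... = (LINT z|GI {..<n}. (\<Sum>i<k. 1/4*(dot {..<n} (x (2*j) i) (gz n c f z))^2))"
  unfolding pen_def by (simp add: sum_nonneg Dd)
 also have "... = 1/4*(\<Sum>i<k. (LINT z|GI {..<n}. (dot {..<n} (x (2*j) i) (gz n c f z))^2))"
  using quad_M(1)[OF f] by (simp add: Bochner_Integration.integral_sum sum_divide_distrib)
 also have "... <= 1/4*(\<Sum>i<k. energy n N v (x (2*j) i) + sqrt (disc n N c f Z))"
  using energy_disc[OF f x1] unfolding v_def by (intro mult_left_mono sum_mono) auto
 also have "... <= 1/4*(real k/real L+real k * sqrt (disc n N c f Z))"
  using j(2) by (intro mult_left_mono) (simp_all add: sum.distrib)
 also have "... = (1/2 * sqrt (real k/real L+real k * sqrt (disc n N c f Z)))^2"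
  by (simp add: power_mult_distrib power2_eq_square disc_def sum_nonneg)
 finally have "(LINT z|GI {..<n}. pen k n c f D z) <= 1/2 * sqrt (real k/real L+real k * sqrt (disc n N c f Z))"
  by (rule power2_le_imp_le) (simp add: disc_def sum_nonneg)
 then show ?thesis using Cb con unfolding D_def by blast
qed

section \<open>Smoothed values and candidate functions\<close>

text \<open>Gaussian convolution with variance \<open>um\<close>. It makes a profile that is merely
  bounded Lipschitz, so that errors in frames and features have controlled effect.\<close>

definition hs :: "nat => real => ((nat => real) => real) => (nat => real) => real" where
 "hs k um qs u = (LINT w|GI {..<k}. qs (mix {..<k} 1 (sqrt um) u w))"

text \<open>Like \<open>VV\<close>, with the part \<open>um\<close> of the covariance supplied by
  the convolution. The number \<open>m\<close> of noise coordinates is free, because comparisons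
  need room for additional noise.\<close>

definition val :: "nat => nat => nat => real => ((nat => real) => real) => ((nat => real) => real) => (nat => nat+nat => real) => real" where
 "val k n m um qs f A = (LINT W|GI (JJ n m). hs k um qs (lf {..<k} (JJ n m) A W)*f (pr n W))"

lemma hs_bdd2:
 assumes qs: "bdd (GI {..<k}) 1 qs"
 shows "bdd (GI {..<k} >< GI {..<k}) 1 (%(u, w). qs (mix {..<k} 1 (sqrt um) u w))"
 by (rule bdd_mix2[OF qs])

lemma hs_bdd: "bdd (GI {..<k}) 1 qs ==> bdd (GI {..<k}) 1 (hs k um qs)"
 unfolding hs_def[abs_def] by (rule bdd_fubini(3)[OF prob_GI prob_GI hs_bdd2])

text \<open>Moving the argument shifts the Gaussian being averaged over, so the total variation
  bound \<open>gauss_shift\<close> applies to bounded profiles without any regularity.\<close>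

lemma hs_Lipschitz:
 assumes qs: "bdd (GI {..<k}) 1 qs" and um: "0 < um"
 shows "\<bar>hs k um qs u - hs k um qs u'\<bar> <= 2 / sqrt um * sqrt (\<Sum>i<k. (u i - u' i)^2)"
proof -
 let ?d = "%i. (u i - u' i) / sqrt um"
 let ?g = "%y. qs (mix {..<k} 1 (sqrt um) u' y)"
 have "mix {..<k} 1 (sqrt um) u' (mix {..<k} 1 1 ?d y) = mix {..<k} 1 (sqrt um) u y" for y
  using um by (auto simp: mix_def fun_eq_iff field_simps)
 then have "\<bar>hs k um qs u - hs k um qs u'\<bar> <= 2 * sqrt (dot {..<k} ?d ?d)"
  using gauss_shift[OF finite_lessThan bdd_compose[OF qs mix_const_measurable], of 1 "sqrt um" u' ?d] by (simp add: hs_def)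
 also have "dot {..<k} ?d ?d = (\<Sum>i<k. (u i - u' i)^2)/um"
  using um by (simp add: dot_def power2_eq_square sum_divide_distrib)
 finally show ?thesis by (simp add: real_sqrt_divide)
qed

text \<open>The law of \<open>(A W + \<surd>um w, pr W)\<close>, and hence the value, depends only on its covariance.\<close>

lemma val_cong:
 assumes qs: "bdd (GI {..<k}) 1 qs" and f: "bdd (GI {..<n}) 1 f" and um: "0 <= um" "0 <= um'"
  and e: "!!i j. i < k ==> j < n ==> A i (Inl j) = A' i (Inl j)"
  and g: "!!i i'. i < k ==> i' < k ==> (\<Sum>l\<in>JJ n m. A i l*A i' l)+(if i = i' then um else 0) = (\<Sum>l\<in>JJ n m'. A' i l*A' i' l)+(if i = i' then um' else 0)"
 shows "val k n m um qs f A = val k n m' um' qs f A'"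
proof -
 let ?N = "GI {..<k} >< GI {..<n}" let ?G = "%(u, v). qs u*f v"
 let ?T = "%m um A. %(W, w). (mix {..<k} 1 (sqrt um) (lf {..<k} (JJ n m) A W) w, pr n W)"
 let ?A = "%um A i. case_sum (A i) (sc (sqrt um) i)" and ?P = "%i. case_sum (Pr i) (%_::nat. 0)"
 let ?h = "%m um A w. (lf {..<k} (JJ n m <+> {..<k}) (?A um A) w, lf {..<n} (JJ n m <+> {..<k}) ?P w)"
 have Gb: "bdd ?N 1 ?G" using bdd_pair2[OF qs f] by simp
 have T: "?T m um A \<in> measurable (GI (JJ n m) >< GI {..<k}) ?N" for m um A
 proof -
  note pr_measurable[measurable]
  show ?thesis unfolding split_beta' by measurable
 qed
 have v: "val k n m um qs f A = (LINT p|distr (GI (JJ n m) >< GI {..<k}) ?N (?T m um A). ?G p)" for m um A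
 proof -
  have b: "bdd (GI (JJ n m) >< GI {..<k}) 1 (%(W, w). qs (mix {..<k} 1 (sqrt um) (lf {..<k} (JJ n m) A W) w)*f (pr n W))"
   using bdd_compose[OF Gb T] by (simp add: split_beta')
  have "val k n m um qs f A = (LINT W|GI (JJ n m). LINT w|GI {..<k}. qs (mix {..<k} 1 (sqrt um) (lf {..<k} (JJ n m) A W) w)*f (pr n W))"
   by (simp add: val_def hs_def)
  also have "... = (LINT p|(GI (JJ n m) >< GI {..<k}). ?G (?T m um A p))"
   unfolding bdd_fubini(1)[OF prob_GI prob_GI b] by (simp add: split_beta')
  finally show ?thesis by (subst integral_distr[OF T bddD(1)[OF Gb]])
 qed
 have p: "distr (GI (JJ n m) >< GI {..<k}) ?N (?T m um A) = distr (GI (JJ n m <+> {..<k})) ?N (?h m um A)" for m um A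
 proof (rule pair_law)
  show "?h m um A \<in> measurable (GI (JJ n m <+> {..<k})) ?N" by (intro measurable_Pair lf_measurable)
  fix x y
  show "?T m um A (x, y) = ?h m um A (csum (JJ n m) {..<k} x y)"
   unfolding split_conv lf_Plus[OF finite_JJ finite_lessThan] by (auto simp: pr_lf[of n _ m] mix_def lf_def sum_sc fun_eq_iff)
 qed auto
 have "distr (GI (JJ n m <+> {..<k})) ?N (?h m um A) = distr (GI (JJ n m' <+> {..<k})) ?N (?h m' um' A')"
 proof (rule distr_gram2)
  fix i i' assume i: "i \<in> {..<k}" "i' \<in> {..<k}"
  then have "(\<Sum>l\<in>JJ n m <+> {..<k}. ?A um A i l*?A um A i' l) = (\<Sum>l\<in>JJ n m. A i l*A i' l)+(if i = i' then um else 0)" if "0 <= um" for m um A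
   using that by (subst sum.Plus) (auto simp: sc_mult sum_sc1)
  then show "(\<Sum>l\<in>JJ n m <+> {..<k}. ?A um A i l*?A um A i' l) = (\<Sum>l\<in>JJ n m' <+> {..<k}. ?A um' A' i l*?A um' A' i' l)"
   using g i um by simp
 next
  fix i i' assume i: "i \<in> {..<k}" "i' \<in> {..<n}"
  have "(\<Sum>l\<in>JJ n m <+> {..<k}. ?A um A i l*?P i' l) = A i (Inl i')" for m um A
   using i by (subst sum.Plus) (auto simp: sum_Pr)
  then show "(\<Sum>l\<in>JJ n m <+> {..<k}. ?A um A i l*?P i' l) = (\<Sum>l\<in>JJ n m' <+> {..<k}. ?A um' A' i l*?P i' l)" using i e by simp
 next
  fix i i' assume i: "i \<in> {..<n}" "i' \<in> {..<n}"
  have "(\<Sum>l\<in>JJ n m <+> {..<k}. ?P i l*?P i' l) = Pr i (Inl i')" for m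
   using i by (subst sum.Plus) (auto simp: sum_Pr)
  then show "(\<Sum>l\<in>JJ n m <+> {..<k}. ?P i l*?P i' l) = (\<Sum>l\<in>JJ n m' <+> {..<k}. ?P i l*?P i' l)" by simp
 qed auto
 then show ?thesis unfolding v p by simp
qed

lemma VV_val:
 assumes qs: "bdd (GI {..<k}) 1 qs"
 shows "VV k n qs f A = val k n k 0 qs f A"
proof -
 have "hs k 0 qs (lf {..<k} (JJ n k) A W) = qs (lf {..<k} (JJ n k) A W)" for W
 proof -
  have "mix {..<k} 1 0 (lf {..<k} (JJ n k) A W) w = lf {..<k} (JJ n k) A W" for w
   by (auto simp: mix_def lf_def fun_eq_iff)
  then show ?thesis by (simp add: hs_def GI.prob_space)
 qed
 then show ?thesis by (simp add: VV_def val_def)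
qed

lemma val_integrand: "bdd (GI {..<k}) 1 qs ==> bdd (GI {..<n}) 1 f ==> bdd (GI (JJ n m)) 1 (%W. hs k um qs (lf {..<k} (JJ n m) A W)*f (pr n W))"
 by (intro bdd_mult1 bdd_lf hs_bdd bdd_pr)

lemma val_Lipschitz:
 assumes qs: "bdd (GI {..<k}) 1 qs" and f: "bdd (GI {..<n}) 1 f" and um: "0 < um"
 shows "\<bar>val k n m um qs f A - val k n m um qs f A'\<bar> <= 2 / sqrt um * sqrt (\<Sum>i<k. \<Sum>l\<in>JJ n m. (A i l - A' i l)^2)"
proof -
 let ?J = "JJ n m" let ?G = "%A W. hs k um qs (lf {..<k} ?J A W)*f (pr n W)"
 note b = val_integrand[OF qs f]
 let ?S = "%W. \<Sum>i<k. (dot ?J (%l. A i l - A' i l) W)^2"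
 have i: "integrable (GI ?J) ?S" by (intro Bochner_Integration.integrable_sum dot_moments(3)) simp
 have m: "(%W. sqrt (?S W)) \<in> borel_measurable (GI ?J)"
  using borel_measurable_integrable[OF i] by measurable
 have i2: "integrable (GI ?J) (%W. (sqrt (?S W))^2)" using i by (simp add: sum_nonneg)
 have pt: "\<bar>?G A W - ?G A' W\<bar> <= 2 / sqrt um * sqrt (?S W)" if W: "W \<in> space (GI ?J)" for W
 proof -
  have "\<bar>?G A W - ?G A' W\<bar> = \<bar>hs k um qs (lf {..<k} ?J A W) - hs k um qs (lf {..<k} ?J A' W)\<bar> * \<bar>f (pr n W)\<bar>"
   by (simp add: abs_mult left_diff_distrib[symmetric])
  also have "... <= \<bar>hs k um qs (lf {..<k} ?J A W) - hs k um qs (lf {..<k} ?J A' W)\<bar> * 1"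
   using bddD(2)[OF bdd_pr[OF f] W] by (intro mult_left_mono) auto
  also have "... <= 2 / sqrt um * sqrt (\<Sum>i<k. (lf {..<k} ?J A W i - lf {..<k} ?J A' W i)^2)"
   using hs_Lipschitz[OF qs um] by simp
  also have "(\<Sum>i<k. (lf {..<k} ?J A W i - lf {..<k} ?J A' W i)^2) = ?S W"
   by (simp add: lf_def dot_def left_diff_distrib sum_subtractf)
  finally show ?thesis .
 qed
 have "\<bar>val k n m um qs f A - val k n m um qs f A'\<bar> = \<bar>(LINT W|GI ?J. ?G A W - ?G A' W)\<bar>"
  unfolding val_def using GI.bdd_integrable[OF b] by (subst Bochner_Integration.integral_diff) auto
 also have "... <= (LINT W|GI ?J. \<bar>?G A W - ?G A' W\<bar>)" by (rule integral_abs_bound)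
 also have "... <= (LINT W|GI ?J. 2 / sqrt um * sqrt (?S W))"
  using GI.abs_integral_power2_le(1)[OF m i2] GI.bdd_integrable[OF bdd_abs[OF bdd_diff[OF b b]]] pt
  by (intro integral_mono) auto
 also have "... = 2 / sqrt um*(LINT W|GI ?J. \<bar>sqrt (?S W)\<bar>)" by (simp add: sum_nonneg)
 also have "... <= 2 / sqrt um * sqrt (LINT W|GI ?J. ?S W)"
  using GI.abs_integral_power2_le(2)[OF m i2] um by (intro mult_left_mono real_le_rsqrt) (auto simp: sum_nonneg)
 also have "(LINT W|GI ?J. ?S W) = (\<Sum>i<k. \<Sum>l\<in>?J. (A i l - A' i l)^2)"
  by (subst Bochner_Integration.integral_sum) (simp_all add: dot_moments, simp add: dot_def power2_eq_square)
 finally show ?thesis .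
qed

text \<open>A candidate sees the input only through the values \<open>u p\<close> of
  \<open>N\<close> features. The rows of \<open>K\<close> supply the covariance that is missing from
  the combination of features.\<close>

definition cand :: "nat => nat => real => ((nat => real) => real) => (nat => nat => real) => (nat => nat => real) => (nat => real) => real" where
 "cand k N um qs C K u = (LINT w|GI {..<k}. hs k um qs (\<lambda>i\<in>{..<k}. (\<Sum>p<N. C i p*u p)+(\<Sum>l<k. K i l*w l)))"

lemma cand_integrand:
 assumes qs: "bdd (GI {..<k}) 1 qs"
 shows "bdd (PiM {..<N} (%_. borel) >< GI {..<k}) 1 (%(u, w). hs k um qs (\<lambda>i\<in>{..<k}. (\<Sum>p<N. C i p*u p)+(\<Sum>l<k. K i l*w l)))"
proof -
 have "(%q. \<lambda>i\<in>{..<k}. (\<Sum>p<N. C i p*fst q p)+(\<Sum>l<k. K i l * snd q l)) \<in> measurable (PiM {..<N} (%_. borel) >< GI {..<k}) (GI {..<k})"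
  by (intro measurable_GI_restrict borel_measurable_add borel_measurable_sum borel_measurable_times borel_measurable_const
   measurable_compose[OF measurable_fst measurable_component_singleton] measurable_compose[OF measurable_snd measurable_GI_component])
 from bdd_compose[OF hs_bdd[OF qs] this] show ?thesis by (simp add: split_beta')
qed

lemma cand_bdd: "bdd (GI {..<k}) 1 qs ==> bdd (PiM {..<N} (%_. borel)) 1 (cand k N um qs C K)"
 unfolding cand_def[abs_def]
proof -
 assume qs: "bdd (GI {..<k}) 1 qs"
 show "bdd (PiM {..<N} (%_. borel)) 1 (%u. (LINT w|GI {..<k}. hs k um qs (\<lambda>i\<in>{..<k}. (\<Sum>p<N. C i p*u p)+(\<Sum>l<k. K i l*w l))))"
 proof (rule bddI)
  show "(%u. (LINT w|GI {..<k}. hs k um qs (\<lambda>i\<in>{..<k}. (\<Sum>p<N. C i p*u p)+(\<Sum>l<k. K i l*w l)))) \<in> borel_measurable (PiM {..<N} (%_. borel))"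
   by (rule GI.borel_measurable_lebesgue_integral[OF bddD(1)[OF cand_integrand[OF qs]]])
  fix u
  have "(%w. \<lambda>i\<in>{..<k}. (\<Sum>p<N. C i p*u p)+(\<Sum>l<k. K i l*w l)) \<in> measurable (GI {..<k}) (GI {..<k})"
   by (intro measurable_GI_restrict borel_measurable_add borel_measurable_sum borel_measurable_times borel_measurable_const measurable_GI_component)
  then show "\<bar>(LINT w|GI {..<k}. hs k um qs (\<lambda>i\<in>{..<k}. (\<Sum>p<N. C i p*u p)+(\<Sum>l<k. K i l*w l)))\<bar> <= 1"
   by (intro GI.bdd_integral_le bdd_compose[OF hs_bdd[OF qs]])
 qed
qed

lemma cand_Lipschitz:
 assumes qs: "bdd (GI {..<k}) 1 qs" and um: "0 < um" and C: "!!i p. i < k ==> p < N ==> \<bar>C i p\<bar> <= 1"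
 shows "\<bar>cand k N um qs C K u - cand k N um qs C K u'\<bar> <= 2 / sqrt um*(sqrt k*(\<Sum>p<N. \<bar>u p - u' p\<bar>))"
proof -
 let ?U = "%u w. \<lambda>i\<in>{..<k}. (\<Sum>p<N. C i p*u p)+(\<Sum>l<k. K i l*w l)"
 have "?U u \<in> measurable (GI {..<k}) (GI {..<k})" for u
  by (intro measurable_GI_restrict borel_measurable_add borel_measurable_sum borel_measurable_times borel_measurable_const measurable_GI_component)
 note b = bdd_compose[OF hs_bdd[OF qs] this, of um]
 have pt: "\<bar>hs k um qs (?U u w) - hs k um qs (?U u' w)\<bar> <= 2 / sqrt um*(sqrt k*(\<Sum>p<N. \<bar>u p - u' p\<bar>))" for w
 proof -
  have "(\<Sum>i<k. (?U u w i - ?U u' w i)^2) <= (\<Sum>i<k. (\<Sum>p<N. \<bar>u p - u' p\<bar>)^2)"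
  proof (rule sum_mono)
   fix i assume i: "i \<in> {..<k}"
   have "\<bar>?U u w i - ?U u' w i\<bar> = \<bar>\<Sum>p<N. C i p*(u p - u' p)\<bar>" using i by (simp add: right_diff_distrib sum_subtractf)
   also have "... <= (\<Sum>p<N. \<bar>C i p*(u p - u' p)\<bar>)" by (rule sum_abs)
   also have "... <= (\<Sum>p<N. 1*\<bar>u p - u' p\<bar>)"
    unfolding abs_mult using C i by (intro sum_mono mult_right_mono) auto
   finally show "(?U u w i - ?U u' w i)^2 <= (\<Sum>p<N. \<bar>u p - u' p\<bar>)^2" by (intro power2_le_iff_abs_le[THEN iffD2]) (auto simp: sum_nonneg)
  qed
  also have "... = k*(\<Sum>p<N. \<bar>u p - u' p\<bar>)^2" by simp
  finally have "sqrt (\<Sum>i<k. (?U u w i - ?U u' w i)^2) <= sqrt (k*(\<Sum>p<N. \<bar>u p - u' p\<bar>)^2)"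
   by (rule real_sqrt_le_mono)
  also have "... = sqrt k*(\<Sum>p<N. \<bar>u p - u' p\<bar>)" by (simp add: real_sqrt_mult sum_nonneg)
  finally have "sqrt (\<Sum>i<k. (?U u w i - ?U u' w i)^2) <= sqrt k*(\<Sum>p<N. \<bar>u p - u' p\<bar>)" .
  then show ?thesis
   using um by (intro order_trans[OF hs_Lipschitz[OF qs um]] mult_left_mono) auto
 qed
 have "cand k N um qs C K u - cand k N um qs C K u' = (LINT w|GI {..<k}. hs k um qs (?U u w) - hs k um qs (?U u' w))"
  unfolding cand_def using GI.bdd_integrable[OF b] by (subst Bochner_Integration.integral_diff) auto
 moreover have "bdd (GI {..<k}) (2 / sqrt um*(sqrt k*(\<Sum>p<N. \<bar>u p - u' p\<bar>))) (%w. hs k um qs (?U u w) - hs k um qs (?U u' w))"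
  using bddD(1)[OF bdd_diff[OF b b]] pt by (intro bddI) auto
 ultimately show ?thesis using GI.bdd_integral_le by simp
qed

definition CV :: "nat => (nat => nat => real) => (nat => nat => real) => (nat => nat => real) => nat => nat+nat => real" where
 "CV N C v K i = case_sum (%j. \<Sum>p<N. C i p * v p j) (K i)"

lemma val_cand:
 assumes qs: "bdd (GI {..<k}) 1 qs" and f: "bdd (GI {..<n}) 1 f"
 shows "val k n k um qs f (CV N C v K) = (LINT x|GI {..<n}. cand k N um qs C K (%p. dot {..<n} (v p) x)*f x)"
proof -
 have "lf {..<k} (JJ n k) (CV N C v K) (csum {..<n} {..<k} x w) = (\<lambda>i\<in>{..<k}. (\<Sum>p<N. C i p*dot {..<n} (v p) x)+(\<Sum>l<k. K i l*w l))" for x w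
  unfolding lf_Plus[OF finite_lessThan finite_lessThan] CV_def by (simp add: sum_combine dot_def)
 then show ?thesis
  unfolding val_def cand_def csum_integral(1)[OF finite_lessThan finite_lessThan val_integrand[OF qs f]]
  by (intro Bochner_Integration.integral_cong refl) (simp add: pr_csum)
qed

lemma sum_lessThan_add: "(\<Sum>l<a+b. g l) = (\<Sum>l<a. g l)+(\<Sum>l<b. g (a+l) :: real)" for a b :: nat
 by (induction b) (simp_all add: add.assoc)

text \<open>If the covariance falls short of its target by a semidefinite \<open>S\<close>, adding
  independent noise with covariance \<open>S\<close> completes it. In the Lipschitz bound this costs
  the square root of the trace of \<open>S\<close>.\<close>

lemma val_deficit:
 assumes qs: "bdd (GI {..<k}) 1 qs" and f: "bdd (GI {..<n}) 1 f" and um: "0 < um"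
 defines "S == %A i i'. (if i = i' then 1 - um else 0) - (\<Sum>l\<in>JJ n k. A i l*A i' l)"
 assumes psd: "!!y. 0 <= (\<Sum>i<k. \<Sum>i'<k. y i*S A i i'*y i')"
 shows "EX A'. orth k (JJ n k) A' \<and> (ALL i j. A' i (Inl j) = A i (Inl j)) \<and> \<bar>val k n k um qs f A - VV k n qs f A'\<bar> <= 2 / sqrt um * sqrt (\<Sum>i<k. S A i i)"
proof -
 have "S A i i' = S A i' i" for i i' by (simp add: S_def mult.commute)
 then obtain D :: "nat => nat => real" where D: "ALL i<k. ALL j<k. (\<Sum>l<k. D i l*D j l) = S A i j" using cholesky[of k "S A"] psd by blast
 \<comment> \<open>Appends a second group of \<open>k\<close> noise coordinates carrying the factor
   of the deficit; with the zero factor it leaves the value unchanged.\<close>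
 define P :: "(nat => nat => real) => nat => nat+nat => real" where "P = (%D i. case_sum (%j. A i (Inl j)) (%l. if l < k then A i (Inr l) else D i (l - k)))"
 have Pg: "(\<Sum>l\<in>JJ n (k + k). P D i l*P D i' l) = (\<Sum>l\<in>JJ n k. A i l*A i' l)+(\<Sum>l<k. D i l*D i' l)" for D i i'
  by (simp add: sum.Plus P_def sum_lessThan_add)
 have g: "(\<Sum>l\<in>JJ n (k + k). P D i l*P D i' l)+(if i = i' then um else 0) = (if i = i' then 1 else 0)" if "i < k" "i' < k" for i i'
  unfolding Pg using D that by (simp add: S_def)
 have "contr k n (%i j. A i (Inl j))"
  unfolding contr_def
 proof
  fix y
  have "(\<Sum>j<n. (\<Sum>i<k. y i*A i (Inl j))^2) <= (\<Sum>l\<in>JJ n (k + k). (\<Sum>i<k. y i*P D i l)^2)+um*(\<Sum>i<k. (y i)^2)"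
   using um by (simp add: sum.Plus P_def sum_nonneg)
  also have "... = (\<Sum>i<k. \<Sum>i'<k. y i*((\<Sum>l\<in>JJ n (k + k). P D i l*P D i' l)+(if i = i' then um else 0))*y i')"
   unfolding quad_gram[symmetric] quad_diag[symmetric] by (simp add: sum.distrib distrib_left distrib_right)
  also have "... = (\<Sum>i<k. \<Sum>i'<k. y i*(if i = i' then 1 else 0)*y i')"
   using g by (intro sum.cong refl arg_cong2[where f = "(*)"]) auto
  finally show "(\<Sum>j<n. (\<Sum>i<k. y i*A i (Inl j))^2) <= (\<Sum>i<k. (y i)^2)" unfolding quad_diag by simp
 qed
 from contr_complete[OF this] obtain A' where A': "orth k (JJ n k) A'" "ALL i j. A' i (Inl j) = A i (Inl j)" by auto
 have "VV k n qs f A' = val k n (k + k) um qs f (P D)"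
  unfolding VV_val[OF qs] using A' g um by (intro val_cong[OF qs f]) (auto simp: orth_def P_def)
 moreover have "val k n k um qs f A = val k n (k + k) um qs f (P (%_ _. 0))"
  using um by (intro val_cong[OF qs f]) (simp_all add: Pg, simp add: P_def)
 moreover have "(\<Sum>i<k. \<Sum>l\<in>JJ n (k + k). (P (%_ _. 0) i l - P D i l)^2) = (\<Sum>i<k. S A i i)"
  using D by (intro sum.cong refl) (simp add: sum.Plus P_def sum_lessThan_add power2_eq_square)
 ultimately have "\<bar>val k n k um qs f A - VV k n qs f A'\<bar> <= 2 / sqrt um * sqrt (\<Sum>i<k. S A i i)"
  using val_Lipschitz[OF qs f um, of "k + k" "P (%_ _. 0)" "P D"] by simp
 then show ?thesis using A' by blast
qed

text \<open>The deviation of the Gram matrix of the rows from \<open>(1 - al)\<close> times the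
  identity. It is used with \<open>al = um+be\<close>, where the slack \<open>be\<close> leaves room
  for errors in the entries.\<close>

definition cov :: "nat => nat => (nat => nat+nat => real) => real => nat => nat => real" where
 "cov n k A al i i' = (\<Sum>l\<in>JJ n k. A i l*A i' l)+(if i = i' then al - 1 else 0)"

text \<open>Entry errors of size \<open>et\<close> change the quadratic form by at most
  \<open>real k*et\<close>, relative to the squared norm, and the slack \<open>be\<close> absorbs
  this. Hence the deficit is semidefinite, its trace is at most \<open>real k*(be+et)\<close>, and
  the completed candidate is a genuine average over juntas.\<close>

theorem cand_sound:
 assumes qs: "smo {..<k} s qs" and f: "bdd (GI {..<n}) 1 f" and kn: "k <= n" and um: "0 < um"
  and et: "0 <= et" "real k*et <= be"
  and valid: "!!i i'. i < k ==> i' < k ==> \<bar>cov n k (CV N C v K) (um+be) i i'\<bar> <= et"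
 shows "(LINT x|GI {..<n}. cand k N um qs C K (%p. dot {..<n} (v p) x)*f x) <= junta_corr n k s f+2 / sqrt um * sqrt (real k*(be+et))"
proof -
 have qsb: "bdd (GI {..<k}) 1 qs" using qs by (simp add: smo_def)
 let ?A = "CV N C v K" let ?R = "cov n k ?A (um+be)"
 define S where "S = (%i i'. (if i = i' then 1 - um else 0) - (\<Sum>l\<in>JJ n k. ?A i l*?A i' l))"
 have SR: "S i i' = (if i = i' then be else 0) - ?R i i'" for i i' by (simp add: S_def cov_def)
 have psd: "0 <= (\<Sum>i<k. \<Sum>i'<k. y i*S i i'*y i')" for y
 proof -
  have "(\<Sum>i<k. \<Sum>i'<k. y i*?R i i'*y i') <= (\<Sum>i<k. \<Sum>i'<k. \<bar>y i\<bar> * et*\<bar>y i'\<bar>)"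
  proof (intro sum_mono)
   fix i i' assume "i \<in> {..<k}" "i' \<in> {..<k}"
   then have "\<bar>y i\<bar> * \<bar>?R i i'\<bar> * \<bar>y i'\<bar> <= \<bar>y i\<bar> * et*\<bar>y i'\<bar>"
    using valid by (intro mult_right_mono mult_left_mono) auto
   then show "y i*?R i i'*y i' <= \<bar>y i\<bar> * et*\<bar>y i'\<bar>" using abs_ge_self[of "y i*?R i i'*y i'"] by (simp add: abs_mult)
  qed
  also have "... = et*(\<Sum>i<k. \<bar>y i\<bar>)^2" by (simp add: power2_eq_square sum_product sum_distrib_left mult_ac)
  also have "... <= et*(real k*(\<Sum>i<k. (y i)^2))"
   using Cauchy_Schwarz_ineq_sum[of "%_. 1" "%i. \<bar>y i\<bar>" "{..<k}"] et(1) by (intro mult_left_mono) auto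
  also have "... <= be*(\<Sum>i<k. (y i)^2)" using mult_right_mono[OF et(2) sum_nonneg[of "{..<k}" "%i. (y i)^2"]] by (simp add: mult_ac)
  also have "... = (\<Sum>i<k. \<Sum>i'<k. y i*(if i = i' then be else 0)*y i')" by (rule quad_diag[symmetric])
  finally show ?thesis unfolding SR by (simp add: right_diff_distrib left_diff_distrib sum_subtractf)
 qed
 obtain A' where A': "orth k (JJ n k) A'"
  and le: "\<bar>val k n k um qs f ?A - VV k n qs f A'\<bar> <= 2 / sqrt um * sqrt (\<Sum>i<k. S i i)"
  using val_deficit[OF qsb f um psd[unfolded S_def]] unfolding S_def by blast
 have "(\<Sum>i<k. S i i) <= (\<Sum>i<k. be+et)"
 proof (rule sum_mono)
  fix i assume "i \<in> {..<k}"
  then show "S i i <= be+et" unfolding SR using valid[of i i] by auto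
 qed
 then have "2 / sqrt um * sqrt (\<Sum>i<k. S i i) <= 2 / sqrt um * sqrt (real k*(be+et))"
  using um by (intro mult_left_mono) auto
 then show ?thesis using le VV_le_junta_corr[OF f qs A' kn] unfolding val_cand[OF qsb f, symmetric] by linarith
qed

definition gr :: "nat => real set" where "gr R = (%z. real_of_int z/real R) ` {- int R..int R}"

lemma finite_gr [simp]: "finite (gr R)" by (simp add: gr_def)

lemma card_gr: "card (gr R) <= 2*R+1"
 unfolding gr_def using card_image_le[of "{- int R..int R}" "%z. real_of_int z/real R"] by simp

lemma gr_le: "x \<in> gr R ==> \<bar>x\<bar> <= 1"
 by (cases "R = 0") (auto simp: gr_def abs_le_iff field_simps)

lemma gr_round:
 assumes "\<bar>x\<bar> <= 1" "0 < R"
 shows "EX y:gr R. \<bar>y - x\<bar> <= 1/real R"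
proof (intro bexI)
 have x: "- real R <= x*real R" "x*real R <= real R" using assms mult_right_mono[of "-1" x "real R"] mult_right_mono[of x 1 "real R"] by auto
 then have "- int R <= \<lfloor>x*real R\<rfloor>" "\<lfloor>x*real R\<rfloor> <= int R" by linarith+
 then show "real_of_int \<lfloor>x*real R\<rfloor> / real R \<in> gr R" unfolding gr_def by (intro imageI) auto
 have "\<bar>real_of_int \<lfloor>x*real R\<rfloor> - x*real R\<bar> <= 1" by linarith
 moreover have "real_of_int \<lfloor>x*real R\<rfloor> / real R - x = (real_of_int \<lfloor>x*real R\<rfloor> - x*real R)/real R" using assms by (simp add: field_simps)
 ultimately show "\<bar>real_of_int \<lfloor>x*real R\<rfloor> / real R - x\<bar> <= 1/real R" by (simp add: abs_divide divide_right_mono)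
qed

lemma dot_perturb:
 assumes rh: "0 <= rh" "rh <= 1" and a: "dot J a a <= 1" "dot J b b <= 1"
  and d: "dot J (%l. a' l - a l) (%l. a' l - a l) <= rh^2" "dot J (%l. b' l - b l) (%l. b' l - b l) <= rh^2"
 shows "\<bar>dot J a' b' - dot J a b\<bar> <= 3*rh"
proof -
 have cs: "\<bar>dot J x y\<bar> <= r*r'" if "dot J x x <= r^2" "dot J y y <= r'^2" "0 <= r" "0 <= r'" for x y r r'
 proof -
  have "(dot J x y)^2 <= r^2*r'^2" using that by (intro order_trans[OF dot_CS] mult_mono dot_self_nonneg) auto
  then have "(dot J x y)^2 <= (r*r')^2" by (simp add: power_mult_distrib)
  then show ?thesis using that by (simp add: power2_le_iff_abs_le)
 qed
 let ?x = "%l. a' l - a l" and ?y = "%l. b' l - b l"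
 have "dot J a' b' - dot J a b = dot J a ?y+dot J ?x b+dot J ?x ?y"
  by (simp add: dot_minus)
 moreover have "\<bar>dot J a ?y\<bar> <= 1*rh" by (rule cs) (use a d rh(1) in simp_all)
 moreover have "\<bar>dot J ?x b\<bar> <= rh*1" by (rule cs) (use a d rh(1) in simp_all)
 moreover have "\<bar>dot J ?x ?y\<bar> <= rh*rh" by (rule cs) (use a d rh(1) in simp_all)
 moreover have "rh*rh <= rh*1" using rh by (intro mult_left_mono) auto
 ultimately show ?thesis by linarith
qed

lemma orth_contr:
 assumes e: "orth k {..<n} e"
 shows "contr k n e"
 unfolding contr_def
proof
 fix y
 have "(\<Sum>j<n. (\<Sum>i<k. y i*e i j)^2) = (\<Sum>i<k. \<Sum>i'<k. y i*(if i = i' then 1 else 0)*y i')"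
  unfolding quad_gram[symmetric] using e by (intro sum.cong refl arg_cong2[where f = "(*)"]) (auto simp: orth_def)
 then show "(\<Sum>j<n. (\<Sum>i<k. y i*e i j)^2) <= (\<Sum>i<k. (y i)^2)" unfolding quad_diag by simp
qed

text \<open>The losses are accounted for one by one: \<open>j1\<close> for the supremum and the
  damping, \<open>j2\<close> for moving the frame into the span of the sampled gradients,
  \<open>j3\<close> for the net, \<open>j4\<close> for the slack \<open>be\<close>, and
  \<open>j5\<close> for rounding to the grid.\<close>

theorem cand_complete:
 fixes c t :: real and Z :: "nat => nat => real"
 assumes f: "bdd (GI {..<n}) 1 f" and kn: "k <= n" and s: "0 <= s" and dl: "0 < dl" and t: "0 < t" and c: "c = exp (- t/2)"
  and Z: "!!p. p < N ==> Z p \<in> space (GI {..<n})" and L: "0 < L" "2*L <= N" and disc: "disc n N c f Z <= DE"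
  and F: "F \<subseteq> Collect (smo {..<k} s)" "!!qs. smo {..<k} s qs ==> EX qs':F. (LINT x|GI {..<k}. (qs x - qs' x)^2) <= ep1^2" and ep1: "0 <= ep1"
  and um: "0 < um" "0 <= be" "um+be <= 1 - c^2" and R: "0 < R" and rh: "(real N+real k)/real R <= rh" "rh <= 1"
 defines "v == %p. gz n c f (Z p)"
 shows "EX qs:F. EX C:{..<k} \<rightarrow>\<^sub>E {..<N} \<rightarrow>\<^sub>E gr R. EX K:{..<k} \<rightarrow>\<^sub>E {..<k} \<rightarrow>\<^sub>E gr R.
  (ALL i<k. ALL i'<k. \<bar>cov n k (CV N C v K) (um+be) i i'\<bar> <= 3*rh) \<and>
  junta_corr n k s f <= (LINT x|GI {..<n}. cand k N um qs C K (%p. dot {..<n} (v p) x)*f x)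
   + (s * sqrt t+dl+c^2/(1 - c^2) * sqrt (real k/real L+real k * sqrt DE)+ep1+2 / sqrt um * sqrt (real k*be)+2 / sqrt um*(sqrt k*rh))"
proof -
 \<comment> \<open>The damping \<open>exp (- t)\<close> of the frame is \<open>c^2\<close>, the
   factor with which frames enter \<open>VV_path\<close>.\<close>
 have c01: "0 < c" "c < 1" and c2: "c^2 = exp (- t)" using t by (auto simp: c power2_eq_square exp_add[symmetric])
 have c21: "c^2 < 1" "0 < c^2" using t by (auto simp: c2)
 have rh0: "0 <= rh" using rh(1) by (rule order_trans[rotated]) simp
 have v1: "dot {..<n} (v p) (v p) <= 1" if "p < N" for p
  using gz_norm[OF f Z[OF that]] by (simp add: v_def dot_def power2_eq_square)
 from junta_corr_frame[OF f kn s dl t] obtain e qs A where e: "orth k {..<n} e" and qs: "smo {..<k} s qs" and A: "orth k (JJ n k) A" "ALL i j. A i (Inl j) = exp (- t)*e i j"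
  and j1: "junta_corr n k s f <= VV k n qs f A + s * sqrt t+dl" by blast
 from landweber_frame[where Z = Z and c = c, OF f e Z L(1)] obtain C where C: "ALL i<k. ALL p<N. \<bar>C i p\<bar> <= 2*real L/real N"
  and Cc: "contr k n (%i j. \<Sum>p<N. C i p * v p j)"
  and pen: "(LINT z|GI {..<n}. pen k n c f (%i j. 1/2*(\<Sum>p<N. C i p * v p j) + - (1/2)*e i j) z) <= 1/2 * sqrt (real k/real L+real k * sqrt (disc n N c f Z))"
  unfolding v_def by blast
 define B where "B = (%i j. \<Sum>p<N. C i p * v p j)"
 have Bc: "contr k n B" using Cc by (simp add: B_def)
 have "contr k n (%i j. c^2*B i j)" using c21 by (intro contr_scale[OF Bc]) auto
 from contr_complete[OF this] obtain A1 where A1: "orth k (JJ n k) A1" "ALL i j. A1 i (Inl j) = c^2*B i j" by auto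
 from F(2)[OF qs] obtain qs' where qs': "qs' \<in> F" and n2: "(LINT x|GI {..<k}. (qs x - qs' x)^2) <= ep1^2" by blast
 have qsb: "bdd (GI {..<k}) 1 qs" and qs'b: "bdd (GI {..<k}) 1 qs'" using qs qs' F(1) by (auto simp: smo_def)
 have j2: "VV k n qs f A <= VV k n qs f A1+c^2/(1 - c^2) * sqrt (real k/real L+real k * sqrt DE)"
 proof -
  have "\<bar>VV k n qs f A1 - VV k n qs f A\<bar> <= 2*c^2/(1 - c^2)*(LINT z|GI {..<n}. pen k n c f (%i j. 1/2*B i j + - (1/2)*e i j) z)"
   using A A1 by (intro VV_path[OF qsb f orth_contr[OF e] Bc c01]) (auto simp: c2)
  also have "... <= 2*c^2/(1 - c^2)*(1/2 * sqrt (real k/real L+real k * sqrt DE))"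
  proof (intro mult_left_mono)
   have "1/2 * sqrt (real k/real L+real k * sqrt (disc n N c f Z)) <= 1/2 * sqrt (real k/real L+real k * sqrt DE)"
    using disc by (intro mult_left_mono real_sqrt_le_mono add_left_mono) auto
   then show "(LINT z|GI {..<n}. pen k n c f (%i j. 1/2*B i j + - (1/2)*e i j) z) <= 1/2 * sqrt (real k/real L+real k * sqrt DE)"
    using pen by (simp only: B_def)
  qed (use c21 in simp)
  also have "... = c^2/(1 - c^2) * sqrt (real k/real L+real k * sqrt DE)"
   using c21 by (simp add: field_simps)
  finally show ?thesis by linarith
 qed
 have j3: "VV k n qs f A1 <= VV k n qs' f A1+ep1"
 proof -
  let ?J = "JJ n k"
  have b: "bdd (GI ?J) 1 (%W. qs (lf {..<k} ?J A1 W)*f (pr n W))" if "bdd (GI {..<k}) 1 qs" for qs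
   by (intro bdd_mult1 bdd_lf bdd_pr f that)
  note d = bdd_diff[OF qsb qs'b]
  have "VV k n qs f A1 - VV k n qs' f A1 = (LINT W|GI ?J. (qs (lf {..<k} ?J A1 W) - qs' (lf {..<k} ?J A1 W))*f (pr n W))"
   unfolding VV_def left_diff_distrib
   using GI.bdd_integrable[OF b[OF qsb]] GI.bdd_integrable[OF b[OF qs'b]] by (rule Bochner_Integration.integral_diff[symmetric])
  also have "... <= (LINT W|GI ?J. \<bar>qs (lf {..<k} ?J A1 W) - qs' (lf {..<k} ?J A1 W)\<bar>)"
  proof (rule integral_mono)
   show "integrable (GI ?J) (%W. (qs (lf {..<k} ?J A1 W) - qs' (lf {..<k} ?J A1 W))*f (pr n W))"
    using GI.bdd_integrable[OF bdd_mult[OF bdd_lf[OF d] bdd_pr[OF f]]] by simp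
   show "integrable (GI ?J) (%W. \<bar>qs (lf {..<k} ?J A1 W) - qs' (lf {..<k} ?J A1 W)\<bar>)"
    by (rule GI.bdd_integrable[OF bdd_abs[OF bdd_lf[OF d]]])
   fix W assume "W \<in> space (GI ?J)"
   then have "\<bar>qs (lf {..<k} ?J A1 W) - qs' (lf {..<k} ?J A1 W)\<bar> * \<bar>f (pr n W)\<bar> <= \<bar>qs (lf {..<k} ?J A1 W) - qs' (lf {..<k} ?J A1 W)\<bar> * 1"
    using bddD(2)[OF bdd_pr[OF f]] by (intro mult_left_mono) auto
   then show "(qs (lf {..<k} ?J A1 W) - qs' (lf {..<k} ?J A1 W))*f (pr n W) <= \<bar>qs (lf {..<k} ?J A1 W) - qs' (lf {..<k} ?J A1 W)\<bar>"
    using abs_ge_self[of "(qs (lf {..<k} ?J A1 W) - qs' (lf {..<k} ?J A1 W))*f (pr n W)"] by (simp add: abs_mult)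
  qed
  also have "... = (LINT u|GI {..<k}. \<bar>qs u - qs' u\<bar>)"
   by (rule orth_integral[OF A1(1) finite_JJ bddD(1)[OF bdd_abs[OF d]]])
  also have "... <= ep1"
   using GI.abs_integral_power2_le(2)[OF bddD(1)[OF d] GI.bdd_integrable[OF bdd_power2[OF d]]] n2 ep1 by (rule power2_le_imp_le[OF order_trans])
  finally show ?thesis by simp
 qed
 \<comment> \<open>The Landweber coefficients are at most \<open>2*L/N <= 1\<close>, so they lie in
   the range of the grid.\<close>
 define C0 where "C0 = (%i p. c^2*C i p)"
 have C01: "\<bar>C0 i p\<bar> <= 1" if "i < k" "p < N" for i p
 proof -
  have "\<bar>C i p\<bar> <= 2*real L/real N" using C that by auto
  also have "... <= 1" using L by (simp add: field_simps)
  finally show ?thesis using c21 by (simp add: C0_def abs_mult mult_le_one)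
 qed
 \<comment> \<open>The covariance that the noise block must supply after reserving \<open>um\<close>
   for smoothing and \<open>be\<close> as slack. It is semidefinite because the damped frame uses at
   most \<open>c^2 <= 1 - um - be\<close>.\<close>
 define S where "S = (%i i'. (if i = i' then 1 - um - be else 0) - (\<Sum>j<n. (c^2*B i j)*(c^2*B i' j)))"
 have psd: "0 <= (\<Sum>i<k. \<Sum>i'<k. y i*S i i'*y i')" for y
 proof -
  have "(\<Sum>i<k. y i*(c^2*B i j)) = c^2*(\<Sum>i<k. y i*B i j)" for j
   by (simp add: sum_distrib_left mult.left_commute)
  then have "(\<Sum>j<n. (\<Sum>i<k. y i*(c^2*B i j))^2) = (c^2)^2*(\<Sum>j<n. (\<Sum>i<k. y i*B i j)^2)"
   by (simp only: power_mult_distrib sum_distrib_left[symmetric])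
  also have "... <= c^2*(\<Sum>i<k. (y i)^2)"
   using Bc c21 mult_left_mono[of "c^2" 1 "c^2"] by (intro mult_mono) (auto simp: contr_def power2_eq_square[of "c^2"] sum_nonneg)
  also have "... <= (1 - um - be)*(\<Sum>i<k. (y i)^2)" using um(3) by (intro mult_right_mono) (auto simp: sum_nonneg)
  finally show ?thesis unfolding quad_diag[symmetric] quad_gram[symmetric] by (simp add: S_def right_diff_distrib left_diff_distrib sum_subtractf)
 qed
 have sym: "S i i' = S i' i" for i i' by (simp add: S_def mult.commute)
 have "EX L :: nat => nat => real. ALL i<k. ALL j<k. (\<Sum>l<k. L i l*L j l) = S i j" by (rule cholesky[OF sym psd])
 then obtain K0 :: "nat => nat => real" where K0: "ALL i<k. ALL j<k. (\<Sum>l<k. K0 i l*K0 j l) = S i j" by (elim exE)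
 define A0 where "A0 = CV N C0 v K0"
 have A0l: "A0 i (Inl j) = c^2*B i j" for i j
  by (simp add: A0_def CV_def C0_def B_def sum_distrib_left mult.assoc)
 have A0r: "A0 i (Inr l) = K0 i l" for i l by (simp add: A0_def CV_def)
 have A0g: "(\<Sum>l\<in>JJ n k. A0 i l*A0 i' l) = (if i = i' then 1 - um - be else 0)" if "i < k" "i' < k" for i i'
  using K0 that by (simp add: sum.Plus A0l A0r S_def)
 have j4: "VV k n qs' f A1 <= val k n k um qs' f A0+2 / sqrt um * sqrt (real k*be)"
 proof -
  have "(\<Sum>i<k. \<Sum>i'<k. y i*((if i = i' then 1 - um else 0) - (\<Sum>l\<in>JJ n k. A0 i l*A0 i' l))*y i') = (\<Sum>i<k. \<Sum>i'<k. y i*(if i = i' then be else 0)*y i')" for y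
   using A0g by (intro sum.cong refl arg_cong2[where f = "(*)"]) auto
  then have "0 <= (\<Sum>i<k. \<Sum>i'<k. y i*((if i = i' then 1 - um else 0) - (\<Sum>l\<in>JJ n k. A0 i l*A0 i' l))*y i')" for y
   unfolding quad_diag using um(2) by (simp add: sum_nonneg)
  from val_deficit[OF qs'b f um(1) this] obtain A' where A': "orth k (JJ n k) A'" "ALL i j. A' i (Inl j) = A0 i (Inl j)"
   and le: "\<bar>val k n k um qs' f A0 - VV k n qs' f A'\<bar> <= 2 / sqrt um * sqrt (\<Sum>i<k. (if i = i then 1 - um else 0) - (\<Sum>l\<in>JJ n k. A0 i l*A0 i l))" by blast
  have "VV k n qs' f A1 = VV k n qs' f A'"
   using A1 A' by (intro VV_cong[OF qs'b f A1(1) A'(1)]) (simp add: A0l)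
  moreover have "(\<Sum>i<k. (if i = i then 1 - um else 0) - (\<Sum>l\<in>JJ n k. A0 i l*A0 i l)) = (\<Sum>i<k. be)" using A0g by (intro sum.cong refl) simp
  ultimately show ?thesis using le by simp
 qed
 have K01: "\<bar>K0 i l\<bar> <= 1" if "i < k" "l < k" for i l
 proof -
  have "(K0 i l)^2 <= (\<Sum>l<k. (K0 i l)^2)" using that by (intro member_le_sum) auto
  also have "... = S i i" using K0 that by (simp add: power2_eq_square)
  also have "... <= 1" using um c21 sum_nonneg[of "{..<n}" "%j. (c^2*B i j)*(c^2*B i j)"] by (simp add: S_def)
  finally show ?thesis by (simp add: abs_square_le_1)
 qed
 define rd where "rd = (%x. SOME y. y \<in> gr R \<and> \<bar>y - x\<bar> <= 1/real R)"
 have rd: "rd x \<in> gr R \<and> \<bar>rd x - x\<bar> <= 1/real R" if "\<bar>x\<bar> <= 1" for x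
  unfolding rd_def by (rule someI_ex) (use gr_round[OF that R] in blast)
 define C' where "C' = (\<lambda>i\<in>{..<k}. \<lambda>p\<in>{..<N}. rd (C0 i p))"
 define K' where "K' = (\<lambda>i\<in>{..<k}. \<lambda>l\<in>{..<k}. rd (K0 i l))"
 define A2 where "A2 = CV N C' v K'"
 have d: "dot (JJ n k) (%l. A2 i l - A0 i l) (%l. A2 i l - A0 i l) <= rh^2" if i: "i < k" for i
 proof -
  let ?a = "%p. C' i p - C0 i p"
  have a: "\<bar>?a p\<bar> <= 1/real R" if "p < N" for p using rd[OF C01[OF i that]] i that by (simp add: C'_def)
  have b: "(K' i l - K0 i l)^2 <= (1/real R)^2" if "l < k" for l
   using rd[OF K01[OF i that]] i that by (simp add: K'_def power2_le_iff_abs_le)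
  have "(\<Sum>j<n. (\<Sum>p<N. ?a p * v p j)^2) <= (\<Sum>j<n. (\<Sum>p<N. (?a p)^2)*(\<Sum>p<N. (v p j)^2))"
   by (intro sum_mono Cauchy_Schwarz_ineq_sum)
  also have "... = (\<Sum>p<N. (?a p)^2)*(\<Sum>p<N. \<Sum>j<n. (v p j)^2)"
   by (subst sum.swap) (simp add: sum_distrib_left)
  also have "... <= (\<Sum>p<N. (1/real R)^2)*(\<Sum>p<N. 1)"
  proof (intro mult_mono sum_mono)
   fix p assume p: "p \<in> {..<N}"
   then show "(?a p)^2 <= (1/real R)^2" using a by (simp add: power2_le_iff_abs_le)
   show "(\<Sum>j<n. (v p j)^2) <= 1" using v1[of p] p by (simp add: dot_def power2_eq_square)
  qed (auto simp: sum_nonneg)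
  also have "... = (real N/real R)^2" by (simp add: power2_eq_square)
  finally have 1: "(\<Sum>j<n. (\<Sum>p<N. ?a p * v p j)^2) <= (real N/real R)^2" .
  have "(\<Sum>l<k. (K' i l - K0 i l)^2) <= (\<Sum>l<k. (1/real R)^2)" using b by (intro sum_mono) auto
  also have "... = real k*(1/real R)^2" by simp
  also have "... <= (real k)^2*(1/real R)^2" by (intro mult_right_mono) (cases k, auto simp: power2_eq_square)
  also have "... = (real k/real R)^2"  by (simp add: power_divide)
  finally have "(\<Sum>j<n. (\<Sum>p<N. ?a p * v p j)^2)+(\<Sum>l<k. (K' i l - K0 i l)^2) <= (real N/real R)^2+(real k/real R)^2"
   using 1 by simp
  also have "... <= ((real N+real k)/real R)^2"
   by (simp add: add_divide_distrib power2_sum)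
  also have "... <= rh^2" using rh by (intro power_mono) auto
  finally have fin: "(\<Sum>j<n. (\<Sum>p<N. ?a p * v p j)^2)+(\<Sum>l<k. (K' i l - K0 i l)^2) <= rh^2" .
  have e1: "A2 i (Inl j) - A0 i (Inl j) = (\<Sum>p<N. ?a p * v p j)" for j
   by (simp add: A2_def A0_def CV_def left_diff_distrib sum_subtractf)
  have e2: "A2 i (Inr l) - A0 i (Inr l) = K' i l - K0 i l" for l by (simp add: A2_def A0_def CV_def)
  have "dot (JJ n k) g g = (\<Sum>j<n. (g (Inl j))^2)+(\<Sum>l<k. (g (Inr l))^2)" for g
   by (simp add: dot_def sum.Plus power2_eq_square)
  from this[of "%l. A2 i l - A0 i l"] show ?thesis using fin by (simp only: e1 e2)
 qed
 have A01: "dot (JJ n k) (A0 i) (A0 i) <= 1" if "i < k" for i using A0g[OF that that] um by (simp add: dot_def)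
 have cv: "\<bar>cov n k A2 (um+be) i i'\<bar> <= 3*rh" if "i < k" "i' < k" for i i'
  unfolding cov_def using dot_perturb[OF rh0 rh(2) A01[OF that(1)] A01[OF that(2)] d[OF that(1)] d[OF that(2)]] A0g[OF that] by (cases "i = i'") (simp_all add: dot_def algebra_simps)
 have m: "C' \<in> {..<k} \<rightarrow>\<^sub>E {..<N} \<rightarrow>\<^sub>E gr R" "K' \<in> {..<k} \<rightarrow>\<^sub>E {..<k} \<rightarrow>\<^sub>E gr R"
  using rd C01 K01 by (auto simp: C'_def K'_def)
 have j5: "val k n k um qs' f A0 <= val k n k um qs' f A2+2 / sqrt um*(sqrt k*rh)"
 proof -
  have "(\<Sum>i<k. \<Sum>l\<in>JJ n k. (A2 i l - A0 i l)^2) <= (\<Sum>i<k. rh^2)"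
   using d by (intro sum_mono) (simp add: dot_def power2_eq_square)
  then have "sqrt (\<Sum>i<k. \<Sum>l\<in>JJ n k. (A2 i l - A0 i l)^2) <= sqrt (real k*rh^2)" by simp
  also have "... = sqrt k*rh" using rh0 by (simp add: real_sqrt_mult)
  finally have "2 / sqrt um * sqrt (\<Sum>i<k. \<Sum>l\<in>JJ n k. (A2 i l - A0 i l)^2) <= 2 / sqrt um*(sqrt k*rh)"
   using um by (intro mult_left_mono) auto
  then show ?thesis using val_Lipschitz[OF qs'b f um(1), of k A2 A0] by linarith
 qed
 have "junta_corr n k s f <= (LINT x|GI {..<n}. cand k N um qs' C' K' (%p. dot {..<n} (v p) x)*f x)
   + (s * sqrt t+dl+c^2/(1 - c^2) * sqrt (real k/real L+real k * sqrt DE)+ep1+2 / sqrt um * sqrt (real k*be)+2 / sqrt um*(sqrt k*rh))"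
  using j1 j2 j3 j4 j5 unfolding A2_def val_cand[OF qs'b f] by linarith
 then show ?thesis using qs' m cv unfolding A2_def by blast
qed

section \<open>Independence and concentration\<close>

lemma indep_coordinates:
 assumes N: "!!i. i \<in> I ==> prob_space (N i)" and I: "I ~= {}"
 shows "prob_space.indep_vars (PiM I N) N (%i om. om i) I"
proof -
 interpret prob_space "PiM I N" by (rule prob_space_PiM) (rule N)
 have "distr (PiM I N) (PiM I N) (%om. \<lambda>i\<in>I. om i) = distr (PiM I N) (PiM I N) (%om. om)"
  by (intro distr_cong) (auto simp: space_PiM)
 also have "... = PiM I (%i. distr (PiM I N) (N i) (%om. om i))"
  by (simp add: distr_id) (intro PiM_cong refl distr_PiM_component[OF N, symmetric])
 finally show ?thesis by (subst indep_vars_iff_distr_eq_PiM'[OF I]) auto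
qed

lemma PiM_restrict_pair:
 assumes N: "prob_space N" and AB: "A \<inter> B = {}" "finite A" "finite B" "A \<subseteq> I" "B \<subseteq> I"
 shows "distr (PiM I (%_. N)) (PiM A (%_. N) >< PiM B (%_. N)) (%W. (restrict W A, restrict W B)) = PiM A (%_. N) >< PiM B (%_. N)"
proof -
 interpret P: product_prob_space "%_. N" I by (intro product_prob_spaceI N)
 let ?P = "%A. PiM A (%_. N)" let ?T = "?P A >< ?P B" let ?r = "%W. (restrict W A, restrict W B)"
 have r: "?r \<in> measurable (?P C) ?T" if "A \<union> B \<subseteq> C" for C
  using that by (intro measurable_Pair measurable_restrict_subset) auto
 have mg: "merge A B \<in> measurable ?T (?P (A \<union> B))" by (rule measurable_merge)
 have "distr (?P I) ?T ?r = distr (distr (?P I) (?P (A \<union> B)) (%W. restrict W (A \<union> B))) ?T ?r"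
  using AB by (subst distr_distr[OF r measurable_restrict_subset]) (auto simp: comp_def Int_absorb1 restrict_restrict intro!: distr_cong)
 also have "... = distr (distr ?T (?P (A \<union> B)) (merge A B)) ?T ?r"
  using AB by (subst P.distr_PiM_restrict_finite) (simp_all add: P.distr_merge)
 also have "... = distr ?T ?T (?r \<circ> merge A B)" by (rule distr_distr[OF r mg]) simp
 also have "... = distr ?T ?T (%x. x)"
  using AB by (intro distr_cong) (auto simp: space_pair_measure space_PiM)
 finally show ?thesis by (simp add: distr_id)
qed

lemma hoeffding_iid:
 assumes N: "prob_space N" and K: "finite K" "K ~= {}" and g: "bdd N b g" and b: "0 < b" and et: "0 <= et"
 shows "measure (PiM K (%_. N)) {X \<in> space (PiM K (%_. N)). \<bar>(\<Sum>j\<in>K. g (X j))/real (card K) - (LINT x|N. g x)\<bar> >= et} <= 2*exp (- (real (card K)*et^2/(2*b^2)))"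
proof -
 let ?P = "PiM K (%_. N)"
 have P: "prob_space ?P" by (intro prob_space_PiM N)
 have c: "0 < real (card K)" using K by (simp add: card_gt_0_iff)
 interpret P: Hoeffding_ineq ?P K "%i X. g (X i)" "%_. - b" "%_. b" "\<Sum>i\<in>K. (LINT X|?P. g (X i))"
 proof (intro Hoeffding_ineq.intro indep_interval_bounded_random_variables.intro indep_interval_bounded_random_variables_axioms.intro P K)
  show "prob_space.indep_vars ?P (%_. borel) (%i X. g (X i)) K"
   by (rule prob_space.indep_vars_compose2[OF P indep_coordinates[OF N K(2)] bddD(1)[OF g]])
  fix i assume i: "i \<in> K"
  show "AE X in ?P. g (X i) \<in> {- b..b}"
  proof (rule AE_I2)
   fix X assume "X \<in> space ?P"
   then have "X i \<in> space N" using i by (auto simp: space_PiM)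
   then show "g (X i) \<in> {- b..b}" using bddD(2)[OF g, of "X i"] by (auto simp: abs_le_iff)
  qed
 qed
 have "(LINT X|?P. g (X i)) = (LINT x|N. g x)" if "i \<in> K" for i
  using integral_distr[OF measurable_component_singleton[OF that, of "%_. N"] bddD(1)[OF g]] distr_PiM_component[of K "%_. N", OF N that] by simp
 then have mu: "(\<Sum>i\<in>K. (LINT X|?P. g (X i))) = real (card K)*(LINT x|N. g x)" by simp
 have e: "et <= \<bar>S/real (card K) - m\<bar> \<longleftrightarrow> real (card K)*et <= \<bar>S - real (card K)*m\<bar>" for S m
 proof -
  have "S/real (card K) - m = (S - real (card K)*m)/real (card K)" using c by (simp add: diff_divide_distrib)
  then show ?thesis using c by (simp only: abs_divide abs_of_nat) (simp add: field_simps)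
 qed
 have "(\<Sum>i\<in>K. (b - - b)^2) = 4*b^2*real (card K)" by (simp add: power2_eq_square)
 moreover have "- 2*(real (card K)*et)^2/(4*b^2*real (card K)) = - (real (card K)*et^2/(2*b^2))"
  using c by (simp add: power2_eq_square)
 ultimately show ?thesis using P.Hoeffding_ineq_abs_ge[of "real (card K)*et"] c b et unfolding e mu by simp
qed

text \<open>The averaged function itself depends on the random coordinates in \<open>A\<close>.
  Given those, it is fixed and the coordinates in \<open>K\<close> are still independent, so
  Hoeffding applies conditionally and the bound is integrated.\<close>

lemma hoeffding_param:
 assumes N: "prob_space N" and AK: "A \<inter> K = {}" "finite A" "finite K" "A \<subseteq> I" "K \<subseteq> I" "K ~= {}"
  and g: "bdd (PiM A (%_. N) >< N) b (%(a, x). g a x)" and b: "0 < b" and et: "0 <= et"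
 defines "B == {W \<in> space (PiM I (%_. N)). \<bar>(\<Sum>j\<in>K. g (restrict W A) (W j))/real (card K) - (LINT x|N. g (restrict W A) x)\<bar> >= et}"
 shows "B \<in> sets (PiM I (%_. N))" "measure (PiM I (%_. N)) B <= 2*exp (- (real (card K)*et^2/(2*b^2)))"
proof -
 let ?P = "%A. PiM A (%_. N)" let ?r = "%W. (restrict W A, restrict W K)"
 note P = prob_space_PiM[OF N]
 note bg = bdd_fubini(3,5)[OF P N g]
 let ?d = "%(a, X). \<bar>(\<Sum>j\<in>K. g a (X j))/real (card K) - (LINT x|N. g a x)\<bar>"
 have gm: "(%p. g (fst p) (snd p j)) \<in> borel_measurable (?P A >< ?P K)" if "j \<in> K" for j
  using measurable_compose[OF measurable_Pair[OF measurable_fst measurable_compose[OF measurable_snd measurable_component_singleton[OF that]]] bddD(1)[OF g]] by simp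
 have d: "?d \<in> borel_measurable (?P A >< ?P K)"
  unfolding split_beta' using gm measurable_compose[OF measurable_fst bddD(1)[OF bg(1)]]
  by (intro borel_measurable_abs borel_measurable_diff borel_measurable_divide borel_measurable_sum) auto
 have r: "?r \<in> measurable (?P I) (?P A >< ?P K)"
  using AK by (intro measurable_Pair measurable_restrict_subset) auto
 let ?S = "{p \<in> space (?P A >< ?P K). et <= ?d p}"
 have S: "?S \<in> sets (?P A >< ?P K)" using d by measurable
 have B: "B = ?r -` ?S \<inter> space (?P I)"
  using measurable_space[OF r] unfolding B_def by auto
 show "B \<in> sets (?P I)" unfolding B by (rule measurable_sets[OF r S])
 let ?i = "indicator ?S :: _ => real"
 have "bdd (?P A >< ?P K) 1 ?i" using S by (intro bddI) (auto simp: indicator_def)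
 then have ib: "bdd (?P A >< ?P K) 1 (%(a, X). ?i (a, X))" by simp
 have "measure (?P I) B = measure (distr (?P I) (?P A >< ?P K) ?r) ?S" unfolding B by (rule measure_distr[OF r S, symmetric])
 also have "... = measure (?P A >< ?P K) ?S" using AK by (simp add: PiM_restrict_pair[OF N])
 also have "... = (LINT p|(?P A >< ?P K). ?i p)" using S by simp
 also have "... = (LINT a|?P A. LINT X|?P K. ?i (a, X))" using bdd_fubini(1)[OF P P ib] by simp
 also have "... <= (LINT a|?P A. 2*exp (- (real (card K)*et^2/(2*b^2))))"
 proof (rule integral_mono)
  show "integrable (?P A) (%a. (LINT X|?P K. ?i (a, X)))" by (rule prob_space.bdd_integrable[OF P bdd_fubini(3)[OF P P ib]])
  show "integrable (?P A) (%a. 2*exp (- (real (card K)*et^2/(2*b^2))))" by (rule finite_measure.integrable_const) (rule prob_space.finite_measure[OF P])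
  fix a assume a: "a \<in> space (?P A)"
  have "(LINT X|?P K. ?i (a, X)) = measure (?P K) {X \<in> space (?P K). et <= ?d (a, X)}"
  proof -
   have "(LINT X|?P K. ?i (a, X)) = (LINT X|?P K. indicator {X \<in> space (?P K). et <= ?d (a, X)} X)"
    using a by (intro Bochner_Integration.integral_cong refl) (auto simp: indicator_def space_pair_measure)
   then show ?thesis by (simp add: Int_absorb2 subset_eq)
  qed
  also have "... <= 2*exp (- (real (card K)*et^2/(2*b^2)))"
   using hoeffding_iid[OF N AK(3,6) bg(2)[OF a] b et] by simp
  finally show "(LINT X|?P K. ?i (a, X)) <= 2*exp (- (real (card K)*et^2/(2*b^2)))" .
 qed
 finally show "measure (?P I) B <= 2*exp (- (real (card K)*et^2/(2*b^2)))" by (simp add: prob_space.prob_space[OF P])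
qed

text \<open>The factor \<open>12\<close> limits each of the two moment events to probability
  \<open>1/12\<close>; together they use half of the allowed failure probability
  \<open>1/3\<close>.\<close>

lemma markov_bdd:
 fixes h :: "_ => real"
 assumes P: "prob_space P" and h: "integrable P h" "!!x. x \<in> space P ==> 0 <= h x" and E: "(LINT x|P. h x) <= e" and e: "0 < e"
 shows "{x \<in> space P. 12*e <= h x} \<in> sets P" "measure P {x \<in> space P. 12*e <= h x} <= 1/12"
proof -
 show "{x \<in> space P. 12*e <= h x} \<in> sets P" using borel_measurable_integrable[OF h(1)] by measurable
 have "measure P {x \<in> space P. 12*e <= h x} <= (LINT x|P. h x)/(12*e)"
  using e h by (intro integral_Markov_inequality_measure[of P h "{}" "12*e"]) (auto intro!: AE_I2)
 also have "... <= e/(12*e)" using E e by (intro divide_right_mono) auto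
 finally show "measure P {x \<in> space P. 12*e <= h x} <= 1/12" using e by simp
qed

section \<open>The random source and nonadaptive algorithms\<close>

definition blk :: "nat => nat => (nat => real) => nat => real" where
 "blk n j om = (\<lambda>i\<in>{..<n}. om (j*n+i))"

lemma blk_measurable: "blk n j \<in> measurable random_source (GI {..<n})"
 unfolding blk_def[abs_def] random_source_def by (intro measurable_restrict measurable_component_singleton) simp

lemma blk_law: "distr random_source (GI {..<n}) (blk n j) = GI {..<n}"
 unfolding random_source_def blk_def[abs_def] by (rule distr_PiM_reindex[OF prob_space_std_gaussian]) (auto simp: inj_on_def)

text \<open>The blocks occupy disjoint stretches of the random sequence, hence are independent
  copies of the Gaussian on \<real>^n.\<close>

lemma blocks_law:
 assumes I: "I ~= {}"
 shows "distr random_source (PiM I (%_. GI {..<n})) (%om. \<lambda>j\<in>I. blk n j om) = PiM I (%_. GI {..<n})"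
proof -
 interpret prob_space random_source unfolding random_source_def by (rule prob_space_PiM[OF prob_space_std_gaussian])
 have "indep_vars (%_. std_gaussian) (%i om. om i) UNIV"
  unfolding random_source_def by (rule indep_coordinates[OF prob_space_std_gaussian]) simp
 then have 1: "indep_vars (%j. PiM {j*n..<j*n+n} (%_. std_gaussian)) (%j om. \<lambda>i\<in>{j*n..<j*n+n}. om i) I"
 proof (rule indep_vars_restrict)
  show "disjoint_family_on (%j. {j*n..<j*n+n}) I"
  proof (unfold disjoint_family_on_def, intro ballI impI)
   fix a b :: nat assume "a ~= b"
   have "a*n+n <= b*n" if "a < b" for a b :: nat using mult_le_mono1[of "Suc a" b n] that by simp
   then show "{a*n..<a*n+n} \<inter> {b*n..<b*n+n} = {}" using \<open>a ~= b\<close> by (cases "a < b") (force simp: not_less)+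
  qed
 qed simp
 have "indep_vars (%_. GI {..<n}) (%j om. (%v. \<lambda>i\<in>{..<n}. v (j*n+i)) (\<lambda>i\<in>{j*n..<j*n+n}. om i)) I"
  by (rule indep_vars_compose2[OF 1]) (intro measurable_restrict measurable_component_singleton, simp)
 also have "(%j om. (%v. \<lambda>i\<in>{..<n}. v (j*n+i)) (\<lambda>i\<in>{j*n..<j*n+n}. om i)) = blk n"
  by (auto simp: blk_def fun_eq_iff)
 finally show ?thesis
  using indep_vars_iff_distr_eq_PiM'[OF I, where M' = "%_. GI {..<n}" and X = "blk n"] by (simp add: blk_measurable blk_law)
qed

text \<open>Queries that depend only on the random source may be indexed by any finite set: an
  enumeration fixes their order, and the estimate reads the answers as a family over that
  set.\<close>

lemma nonadaptive_alg:
 fixes S :: "'s set" and Q :: "'s => (nat => real) => rvec"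
 assumes S: "finite S" and Q: "!!s. s \<in> S ==> Q s \<in> measurable random_source (GI {..<n})"
  and E: "E \<in> borel_measurable (PiM S (%_. borel))"
 shows "EX A. num_queries A = card S \<and> randomized_query_alg n A \<and> (ALL f om. run_alg A f om = E (\<lambda>s\<in>S. f (Q s om)))"
proof -
 obtain h where h: "bij_betw h {..<card S} S" using S by (metis ex_bij_betw_nat_finite lessThan_atLeast0)
 define g where "g = the_inv_into {..<card S} h"
 have g: "g s < card S" "h (g s) = s" if "s \<in> S" for s
  using h that the_inv_into_into[of h "{..<card S}" s "{..<card S}"] f_the_inv_into_f_bij_betw[OF h] by (auto simp: g_def bij_betw_def)
 define A where "A = \<lparr>num_queries = card S, next_query = (%j p. Q (h j) (fst p)), estimate = (%p. E (\<lambda>s\<in>S. snd p (g s)))\<rparr>"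
 have ans: "answers A f om m = (%j. if j < m then f (Q (h j) om) else undefined)" for f om m
  by (induction m) (auto simp: A_def fun_eq_iff less_Suc_eq)
 have "run_alg A f om = E (\<lambda>s\<in>S. f (Q s om))" for f om
 proof -
  have "(\<lambda>s\<in>S. answers A f om (card S) (g s)) = (\<lambda>s\<in>S. f (Q s om))" using g by (auto simp: ans fun_eq_iff)
  then show ?thesis by (simp add: run_alg_def A_def)
 qed
 moreover have "randomized_query_alg n A"
 proof -
  have "(%p. Q (h j) (fst p)) \<in> measurable (random_source >< M) (PiM {..<n} (%_. borel))" if "j < card S" for j and M :: "(nat => real) measure"
  proof -
   have "sets (PiM {..<n} (%_. borel)) = sets (GI {..<n})" by (intro sets_PiM_cong) (auto simp: std_gaussian_def)
   moreover have "h j \<in> S" using h that by (auto simp: bij_betw_def)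
   ultimately show ?thesis using measurable_compose[OF measurable_fst Q] measurable_cong_sets by blast
  qed
  moreover have "(%p. E (\<lambda>s\<in>S. snd p (g s))) \<in> borel_measurable (random_source >< PiM {..<card S} (%_. borel))"
   using g(1) by (intro measurable_compose[OF _ E] measurable_restrict measurable_compose[OF measurable_snd] measurable_component_singleton) auto
  ultimately show ?thesis by (simp add: randomized_query_alg_def A_def)
 qed
 ultimately show ?thesis by (intro exI[of _ A]) (simp add: A_def)
qed

section \<open>Estimating gradient functionals from values of \<open>f\<close>\<close>

text \<open>Both points are noisy copies of \<open>z\<close>; in the first the noise has correlation
  \<open>ka\<close> with the input \<open>x\<close>. Over random \<open>y\<close> the mean is
  \<open>(NO ka H x - E H) / ka\<close> for the section \<open>H\<close> of \<open>f\<close> at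
  \<open>z\<close>, whose leading part is linear in \<open>x\<close>.\<close>

definition dif :: "nat => real => real => ((nat => real) => real) => (nat => real) => (nat => real) => (nat => real) => real" where
 "dif n c ka f z x y = (f (mix {..<n} c (sqrt (1 - c^2)) z (mix {..<n} ka (sqrt (1 - ka^2)) x y)) - f (mix {..<n} c (sqrt (1 - c^2)) z y)) / ka"

text \<open>The same averaging points \<open>Y j\<close> are used for every \<open>x\<close>, so
  that for fixed random choices the feature is a function of \<open>x\<close> that can be evaluated
  anywhere.\<close>

definition lh :: "nat => real => real => ((nat => real) => real) => nat set => (nat => real) => (nat => nat => real) => (nat => real) => real" where
 "lh n c ka f J z Y x = (\<Sum>j\<in>J. dif n c ka f z x (Y j))/real (card J)"

definition md :: "nat => real => real => ((nat => real) => real) => (nat => real) => (nat => real) => real" where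
 "md n c ka f z x = (LINT y|GI {..<n}. dif n c ka f z x y)"

lemma bdd_minus_dot_square:
 fixes n :: nat
 assumes u: "bdd (GI {..<n}) b u"
 shows "integrable (GI {..<n}) (%x. (u x - r*dot {..<n} a x)^2)"
proof -
 have "(u x - r*dot {..<n} a x)^2 = (u x)^2 - 2*r*(u x*dot {..<n} a x)+r^2*(dot {..<n} a x)^2" for x
  by (simp add: power2_diff power_mult_distrib)
 then show ?thesis
  using GI.bdd_integrable[OF bdd_power2[OF u]] bdd_times_integrable[OF u dot_moments(1)[OF finite_lessThan]] dot_moments(3)[OF finite_lessThan]
  by simp
qed

lemma lh_restrict: "lh n c ka f J z (restrict Y J) x = lh n c ka f J z Y x"
 by (simp add: lh_def)

context
 fixes n :: nat and c ka :: real and f :: "(nat => real) => real"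
 assumes f: "bdd (GI {..<n}) 1 f" and k0: "0 < ka"
begin

abbreviation "G == GI {..<n}"

lemma dif_bdd:
 assumes [measurable]: "a \<in> measurable M G" "b \<in> measurable M G" "d \<in> measurable M G"
 shows "bdd M (2 / ka) (%p. dif n c ka f (a p) (b p) (d p))"
proof -
 have "bdd M (\<bar>1 / ka\<bar> * (1+1)) (%p. 1 / ka*(f (mix {..<n} c (sqrt (1 - c^2)) (a p) (mix {..<n} ka (sqrt (1 - ka^2)) (b p) (d p))) - f (mix {..<n} c (sqrt (1 - c^2)) (a p) (d p))))"
  by (intro bdd_cmult bdd_diff bdd_compose[OF f]) measurable
 then show ?thesis using k0 by (simp add: dif_def)
qed

lemma lh_bdd:
 assumes a: "a \<in> measurable M G" "b \<in> measurable M G" "!!j. j \<in> J ==> (%p. Y p j) \<in> measurable M G"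
 shows "bdd M (2 / ka) (%p. lh n c ka f J (a p) (Y p) (b p))"
proof (rule bddI)
 note d = dif_bdd[OF a(1,2,3)]
 show "(%p. lh n c ka f J (a p) (Y p) (b p)) \<in> borel_measurable M"
  unfolding lh_def using bddD(1)[OF d] by (intro borel_measurable_divide borel_measurable_sum) auto
 fix p assume p: "p \<in> space M"
 show "\<bar>lh n c ka f J (a p) (Y p) (b p)\<bar> <= 2 / ka"
 proof (cases "card J = 0")
  case True
  then show ?thesis using k0 by (simp add: lh_def)
 next
  case False
  have "\<bar>\<Sum>j\<in>J. dif n c ka f (a p) (b p) (Y p j)\<bar> <= (\<Sum>j\<in>J. 2 / ka)"
   using bddD(2)[OF d p] by (intro order_trans[OF sum_abs sum_mono]) auto
  then show ?thesis using False by (simp add: lh_def abs_divide field_simps)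
 qed
qed

lemma md_bdd:
 assumes M: "prob_space M" and a: "a \<in> measurable M G" "b \<in> measurable M G"
 shows "bdd M (2 / ka) (%p. md n c ka f (a p) (b p))"
proof -
 have "bdd (M >< G) (2 / ka) (%(p, y). dif n c ka f (a p) (b p) y)"
  unfolding split_beta' by (intro dif_bdd measurable_compose[OF measurable_fst] a measurable_snd)
 then show ?thesis unfolding md_def by (rule bdd_fubini(3)[OF M prob_GI])
qed

lemma feature_variance:
 assumes z: "z \<in> space G" and J: "finite J" "J ~= {}"
 shows "(LINT Y|PiM J (%_. G). LINT x|G. (lh n c ka f J z Y x - md n c ka f z x)^2) <= 4 / ka^2/real (card J)"
proof -
 let ?P = "PiM J (%_. G)"
 have P: "prob_space ?P" by (intro prob_space_PiM prob_GI)
 have "bdd (?P >< G) ((2 / ka+2 / ka)^2) (%p. (lh n c ka f J z (fst p) (snd p) - md n c ka f z (snd p))^2)"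
  using z by (intro bdd_power2 bdd_diff lh_bdd md_bdd prob_space_pairI P prob_GI measurable_const measurable_snd
   measurable_compose[OF measurable_fst measurable_component_singleton])
 then have b: "bdd (?P >< G) ((2 / ka+2 / ka)^2) (%(Y, x). (lh n c ka f J z Y x - md n c ka f z x)^2)" by (simp add: split_beta')
 have "(LINT x|G. LINT Y|?P. (lh n c ka f J z Y x - md n c ka f z x)^2) <= (LINT x|G. 4 / ka^2/real (card J))"
 proof (rule integral_mono[OF GI.bdd_integrable[OF bdd_fubini(4)[OF P prob_GI b]]])
  fix x assume x: "x \<in> space G"
  have d: "bdd G (2 / ka) (dif n c ka f z x)" using z x by (intro dif_bdd measurable_const) simp_all
  have "(LINT Y|?P. (lh n c ka f J z Y x - md n c ka f z x)^2) <= (LINT y|G. (dif n c ka f z x y)^2)/real (card J)"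
   unfolding lh_def md_def by (rule iid_average_variance(2)[OF prob_GI J bddD(1)[OF d] GI.bdd_integrable[OF bdd_power2[OF d]]])
  also have "... <= (2 / ka)^2/real (card J)"
   using GI.bdd_integral_le[OF bdd_power2[OF d]] by (intro divide_right_mono) auto
  finally show "(LINT Y|?P. (lh n c ka f J z Y x - md n c ka f z x)^2) <= 4 / ka^2/real (card J)" by (simp add: power_divide)
 qed simp
 then show ?thesis unfolding bdd_fubini(2)[OF P prob_GI b] by (simp add: GI.prob_space)
qed

text \<open>The base point and the averaging points are different blocks of one random array, which
  makes them independent.\<close>

lemma feature_variance_PiM:
 assumes J: "finite J" "J ~= {}" "J \<subseteq> I" "p \<in> I" "p \<notin> J"
 defines "F == %W. (LINT x|G. (lh n c ka f J (W p) W x - md n c ka f (W p) x)^2)"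
 shows "(LINT W|PiM I (%_. G). F W) <= 4 / ka^2/real (card J)" "bdd (PiM I (%_. G)) ((2 / ka+2 / ka)^2) F"
proof -
 let ?P = "%A. PiM A (%_. G)" let ?S = "?P {p} >< ?P J"
 have P: "prob_space (?P A)" for A by (intro prob_space_PiM prob_GI)
 define h where "h = (%q. (LINT x|G. (lh n c ka f J (fst q p) (snd q) x - md n c ka f (fst q p) x)^2))"
 have "bdd (?S >< G) ((2 / ka+2 / ka)^2) (%r. (lh n c ka f J (fst (fst r) p) (snd (fst r)) (snd r) - md n c ka f (fst (fst r) p) (snd r))^2)"
  by (intro bdd_power2 bdd_diff lh_bdd md_bdd prob_space_pairI P prob_GI measurable_snd
   measurable_compose[OF measurable_compose[OF measurable_fst measurable_fst] measurable_component_singleton]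
   measurable_compose[OF measurable_compose[OF measurable_fst measurable_snd] measurable_component_singleton]) simp_all
 then have "bdd (?S >< G) ((2 / ka+2 / ka)^2) (%(q, x). (lh n c ka f J (fst q p) (snd q) x - md n c ka f (fst q p) x)^2)"
  by (simp add: split_beta')
 from bdd_fubini(3)[OF prob_space_pairI[OF P P] prob_GI this] have hb: "bdd ?S ((2 / ka+2 / ka)^2) h" unfolding h_def .
 have r: "(%W. (restrict W {p}, restrict W J)) \<in> measurable (?P I) ?S"
  using J by (intro measurable_Pair measurable_restrict_subset) auto
 have F: "F W = h (restrict W {p}, restrict W J)" for W by (simp add: F_def h_def lh_restrict)
 show "bdd (?P I) ((2 / ka+2 / ka)^2) F" using bdd_compose[OF hb r] by (simp add: F[abs_def])
 have "(LINT W|?P I. F W) = (LINT q|distr (?P I) ?S (%W. (restrict W {p}, restrict W J)). h q)"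
  unfolding F by (rule integral_distr[OF r bddD(1)[OF hb], symmetric])
 also have "... = (LINT q|?S. h q)" using J by (subst PiM_restrict_pair[OF prob_GI]) auto
 also have "... = (LINT a|?P {p}. LINT Y|?P J. h (a, Y))"
  using bdd_fubini(1)[OF P P, of "{p}" J "(2 / ka+2 / ka)^2" "%a Y. h (a, Y)"] hb by simp
 also have "... <= (LINT a|?P {p}. 4 / ka^2/real (card J))"
 proof (rule integral_mono)
  have "bdd ?S ((2 / ka+2 / ka)^2) (%(a, Y). h (a, Y))" using hb by simp
  from prob_space.bdd_integrable[OF P bdd_fubini(3)[OF P P this]] show "integrable (?P {p}) (%a. (LINT Y|?P J. h (a, Y)))" .
  show "integrable (?P {p}) (%a. 4 / ka^2/real (card J))"
   by (rule finite_measure.integrable_const) (rule prob_space.finite_measure[OF P])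
  fix a assume "a \<in> space (?P {p})"
  then have "a p \<in> space G" by (auto simp: space_PiM)
  from feature_variance[OF this J(1,2)] show "(LINT Y|?P J. h (a, Y)) <= 4 / ka^2/real (card J)" by (simp add: h_def)
 qed
 finally show "(LINT W|?P I. F W) <= 4 / ka^2/real (card J)" by (simp add: prob_space.prob_space[OF P])
qed

text \<open>Sampling error and bias are separated at the cost of a factor \<open>2\<close>. The bias
  is the affine defect of the noise operator divided by \<open>ka^2\<close>, hence at most
  \<open>4 * ka^2\<close>.\<close>

lemma feature_error:
 assumes z: "z \<in> space G" and Y: "!!j. j \<in> J ==> Y j \<in> space G" and k1: "ka^2 <= 1/2"
 shows "(LINT x|G. (lh n c ka f J z Y x - dot {..<n} (gz n c f z) x)^2) <= 2*(LINT x|G. (lh n c ka f J z Y x - md n c ka f z x)^2)+8 * ka^2"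
proof -
 let ?l = "lh n c ka f J z Y" and ?m = "md n c ka f z" and ?d = "dot {..<n} (gz n c f z)"
 define H where "H = (%y. f (mix {..<n} c (sqrt (1 - c^2)) z y))"
 have H: "bdd G 1 H" unfolding H_def by (rule bdd_compose[OF f mix_const_measurable])
 have lb: "bdd G (2 / ka) ?l" using z Y by (intro lh_bdd measurable_const) simp_all
 have mb: "bdd G (2 / ka) ?m" using z by (intro md_bdd prob_GI measurable_const) simp_all
 have i: "integrable G (%x. (?m x - ?d x)^2)" "integrable G (%x. (?l x - ?d x)^2)"
  using bdd_minus_dot_square[OF mb, of 1] bdd_minus_dot_square[OF lb, of 1] by simp_all
 have me: "?m x = (NO {..<n} ka H x - (LINT y|G. H y)) / ka" if "x \<in> space G" for x
 proof -
  have "bdd G 1 (%y. H (mix {..<n} ka (sqrt (1 - ka^2)) x y))" by (rule bdd_compose[OF H mix_const_measurable])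
  then show ?thesis using GI.bdd_integrable[OF H] GI.bdd_integrable
   unfolding md_def dif_def H_def[symmetric] NO_def by (subst integral_divide_zero) (subst Bochner_Integration.integral_diff, auto simp: H_def)
 qed
 have "(LINT x|G. (?m x - ?d x)^2) = (LINT x|G. (NO {..<n} ka H x - (LINT y|G. H y) - ka*?d x)^2 / ka^2)"
 proof (rule Bochner_Integration.integral_cong[OF refl])
  fix x assume x: "x \<in> space G"
  have "?m x - ?d x = (NO {..<n} ka H x - (LINT y|G. H y) - ka*?d x) / ka" unfolding me[OF x] using k0 by (simp add: diff_divide_distrib)
  then show "(?m x - ?d x)^2 = (NO {..<n} ka H x - (LINT y|G. H y) - ka*?d x)^2 / ka^2" by (simp add: power_divide)
 qed
 also have "... = (LINT x|G. (NO {..<n} ka H x - (LINT y|G. H y) - ka*dot {..<n} (grad {..<n} H) x)^2) / ka^2"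
  by (simp add: gz_def H_def)
 also have "... <= 4 * ka^4*1^2 / ka^2"
  using k0 by (intro divide_right_mono noise_almost_affine[OF _ H _ k1]) auto
 also have "... = 4 * ka^2" using k0 by (simp add: power2_eq_square power4_eq_xxxx)
 finally have bias: "(LINT x|G. (?m x - ?d x)^2) <= 4 * ka^2" .
 note il = GI.bdd_integrable[OF bdd_power2[OF bdd_diff[OF lb mb]]]
 have "(LINT x|G. (?l x - ?d x)^2) <= (LINT x|G. 2*(?l x - ?m x)^2+2*(?m x - ?d x)^2)"
 proof (rule integral_mono[OF i(2)])
  show "integrable G (%x. 2*(?l x - ?m x)^2+2*(?m x - ?d x)^2)" using il i(1) by simp
  fix x
  show "(?l x - ?d x)^2 <= 2*(?l x - ?m x)^2+2*(?m x - ?d x)^2"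
   using sum_squares_bound[of "?l x - ?m x" "?m x - ?d x"] by (simp add: power2_eq_square algebra_simps)
 qed
 also have "... = 2*(LINT x|G. (?l x - ?m x)^2)+2*(LINT x|G. (?m x - ?d x)^2)" using il i(1) by simp
 finally show ?thesis using bias by simp
qed

end

lemma dot_product_integral:
 assumes I: "finite I"
 shows "integrable (GI I) (%x. dot I a x*dot I b x)" "(LINT x|GI I. dot I a x*dot I b x) = dot I a b"
proof -
 have s: "dot I (%i. a i+b i) x = dot I a x+dot I b x" for x by (simp add: dot_def distrib_right sum.distrib)
 have e: "dot I a x*dot I b x = ((dot I (%i. a i+b i) x)^2 - (dot I a x)^2 - (dot I b x)^2)/2" for x
  unfolding s by (simp add: power2_sum)
 have "dot I (%i. a i+b i) (%i. a i+b i) = dot I a a+2*dot I a b+dot I b b"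
  by (simp add: dot_def distrib_right distrib_left sum.distrib sum_distrib_left mult.commute)
 then show "(LINT x|GI I. dot I a x*dot I b x) = dot I a b" unfolding e using dot_moments(3,4)[OF I] by simp
 show "integrable (GI I) (%x. dot I a x*dot I b x)" unfolding e using dot_moments(3)[OF I] by simp
qed

text \<open>Expanding both factors around their linear parts leaves errors \<open>ze\<close>,
  \<open>ze\<close> and \<open>ze*ze\<close>.\<close>

lemma second_moment_close:
 fixes n :: nat
 assumes u: "bdd (GI {..<n}) b u" "bdd (GI {..<n}) b u'" and v: "dot {..<n} v v <= 1" "dot {..<n} v' v' <= 1" and ze: "0 <= ze"
  and d: "(LINT x|GI {..<n}. (u x - dot {..<n} v x)^2) <= ze^2" "(LINT x|GI {..<n}. (u' x - dot {..<n} v' x)^2) <= ze^2"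
 shows "\<bar>(LINT x|GI {..<n}. u x*u' x) - dot {..<n} v v'\<bar> <= (2+ze)*ze"
proof -
 let ?G = "GI {..<n}" let ?d = "%x. u x - dot {..<n} v x" and ?d' = "%x. u' x - dot {..<n} v' x"
 have i: "integrable ?G (%x. (?d x)^2)" "integrable ?G (%x. (?d' x)^2)"
  using bdd_minus_dot_square[OF u(1), of 1] bdd_minus_dot_square[OF u(2), of 1] by simp_all
 have m: "?d \<in> borel_measurable ?G" "?d' \<in> borel_measurable ?G"
  using bddD(1)[OF u(1)] bddD(1)[OF u(2)] dot_measurable1 by simp_all
 have cs: "\<bar>(LINT x|?G. g x*h x)\<bar> <= p*q" if "(LINT x|?G. (g x)^2) <= p^2" "(LINT x|?G. (h x)^2) <= q^2" "0 <= p" "0 <= q"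
  "(LINT x|?G. g x*h x)^2 <= (LINT x|?G. (g x)^2)*(LINT x|?G. (h x)^2)" for g h :: "_ => real" and p q
 proof -
  have "(LINT x|?G. g x*h x)^2 <= p^2*q^2" using that by (intro order_trans[OF that(5)] mult_mono) auto
  then show ?thesis using that by (simp add: power_mult_distrib[symmetric] power2_le_iff_abs_le)
 qed
 note dm = dot_moments(3)[OF finite_lessThan] dot_measurable1
 note c1 = cauchy_schwarz_integral[of ?d ?G "dot {..<n} v'", OF m(1) dm(2) i(1) dm(1)]
 note c2 = cauchy_schwarz_integral[of "dot {..<n} v" ?G ?d', OF dm(2) m(2) dm(1) i(2)]
 note c3 = cauchy_schwarz_integral[of ?d ?G ?d', OF m i]
 have e: "u x*u' x = ?d x*dot {..<n} v' x+dot {..<n} v x*?d' x+?d x*?d' x+dot {..<n} v x*dot {..<n} v' x" for x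
  by (simp add: algebra_simps)
 have "(LINT x|?G. u x*u' x) = (LINT x|?G. ?d x*dot {..<n} v' x)+(LINT x|?G. dot {..<n} v x*?d' x)+(LINT x|?G. ?d x*?d' x)+dot {..<n} v v'"
  unfolding e using c1(1) c2(1) c3(1) dot_product_integral[of "{..<n}" v v']
  by (subst Bochner_Integration.integral_add, auto)+
 moreover have "\<bar>(LINT x|?G. ?d x*dot {..<n} v' x)\<bar> <= ze*1" using v by (intro cs d ze c1(2)) (auto simp: dot_moments)
 moreover have "\<bar>(LINT x|?G. dot {..<n} v x*?d' x)\<bar> <= 1*ze" using v by (intro cs d ze c2(2)) (auto simp: dot_moments)
 moreover have "\<bar>(LINT x|?G. ?d x*?d' x)\<bar> <= ze*ze" by (intro cs d ze c3(2))
 ultimately show ?thesis by (simp add: algebra_simps abs_le_iff)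
qed

lemma cand_restrict: "cand k N um qs C K (restrict u {..<N}) = cand k N um qs C K u"
 by (simp add: cand_def)

lemma cand_compose:
 assumes qs: "bdd (GI {..<k}) 1 qs" and u: "!!p. p < N ==> u p \<in> borel_measurable M"
 shows "bdd M 1 (%x. cand k N um qs C K (%p. u p x))"
proof -
 have "(%x. \<lambda>p\<in>{..<N}. u p x) \<in> measurable M (PiM {..<N} (%_. borel))" using u by (intro measurable_restrict) auto
 from bdd_compose[OF cand_bdd[OF qs] this, of um C K] show ?thesis by (simp add: cand_restrict)
qed

lemma value_close:
 fixes n :: nat
 assumes qs: "bdd (GI {..<k}) 1 qs" and um: "0 < um" and C: "!!i p. i < k ==> p < N ==> \<bar>C i p\<bar> <= 1" and f: "bdd (GI {..<n}) 1 f"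
  and u: "!!p. p < N ==> bdd (GI {..<n}) b (u p)" and ze: "0 <= ze"
  and d: "!!p. p < N ==> (LINT x|GI {..<n}. (u p x - dot {..<n} (v p) x)^2) <= ze^2"
 shows "\<bar>(LINT x|GI {..<n}. cand k N um qs C K (%p. u p x)*f x) - (LINT x|GI {..<n}. cand k N um qs C K (%p. dot {..<n} (v p) x)*f x)\<bar>
  <= 2 / sqrt um*(sqrt k*(real N*ze))"
proof -
 let ?G = "GI {..<n}" let ?c = "cand k N um qs C K" let ?d = "%p x. u p x - dot {..<n} (v p) x"
 have b: "bdd ?G 1 (%x. ?c (%p. w p x)*f x)" if "!!p. p < N ==> w p \<in> borel_measurable ?G" for w
  by (intro bdd_mult1 cand_compose[OF qs] that f)
 note b1 = b[of u, OF bddD(1)[OF u]] and b2 = b[of "%p. dot {..<n} (v p)", OF dot_measurable1]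
 have i: "integrable ?G (%x. (?d p x)^2)" if "p < N" for p
  using bdd_minus_dot_square[OF u[OF that], of 1] by simp
 have m: "?d p \<in> borel_measurable ?G" if "p < N" for p using bddD(1)[OF u[OF that]] dot_measurable1 by simp
 note ai = GI.abs_integral_power2_le[OF m i]
 have a: "(LINT x|?G. \<bar>?d p x\<bar>) <= ze" "integrable ?G (%x. \<bar>?d p x\<bar>)" if "p < N" for p
 proof -
  have "(LINT x|?G. \<bar>?d p x\<bar>)^2 <= ze^2" using ai(2)[OF that that] d[OF that] by linarith
  then show "(LINT x|?G. \<bar>?d p x\<bar>) <= ze" using ze by (rule power2_le_imp_le)
  show "integrable ?G (%x. \<bar>?d p x\<bar>)" using ai(1)[OF that that] by (rule integrable_abs)
 qed
 have pt: "\<bar>?c (%p. u p x)*f x - ?c (%p. dot {..<n} (v p) x)*f x\<bar> <= 2 / sqrt um*(sqrt k*(\<Sum>p<N. \<bar>?d p x\<bar>))" if x: "x \<in> space ?G" for x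
 proof -
  have "\<bar>?c (%p. u p x)*f x - ?c (%p. dot {..<n} (v p) x)*f x\<bar> = \<bar>?c (%p. u p x) - ?c (%p. dot {..<n} (v p) x)\<bar> * \<bar>f x\<bar>"
   by (simp add: abs_mult[symmetric] left_diff_distrib)
  also have "... <= \<bar>?c (%p. u p x) - ?c (%p. dot {..<n} (v p) x)\<bar> * 1"
   using bddD(2)[OF f x] by (intro mult_left_mono) auto
  also have "... <= 2 / sqrt um*(sqrt k*(\<Sum>p<N. \<bar>?d p x\<bar>))" using cand_Lipschitz[OF qs um C] by simp
  finally show ?thesis .
 qed
 have "\<bar>(LINT x|?G. ?c (%p. u p x)*f x) - (LINT x|?G. ?c (%p. dot {..<n} (v p) x)*f x)\<bar> = \<bar>(LINT x|?G. ?c (%p. u p x)*f x - ?c (%p. dot {..<n} (v p) x)*f x)\<bar>"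
  using GI.bdd_integrable[OF b1] GI.bdd_integrable[OF b2] by simp
 also have "... <= (LINT x|?G. \<bar>?c (%p. u p x)*f x - ?c (%p. dot {..<n} (v p) x)*f x\<bar>)" by (rule integral_abs_bound)
 also have "... <= (LINT x|?G. 2 / sqrt um*(sqrt k*(\<Sum>p<N. \<bar>?d p x\<bar>)))"
  using GI.bdd_integrable[OF bdd_abs[OF bdd_diff[OF b1 b2]]] pt
  by (intro integral_mono integrable_mult_right Bochner_Integration.integrable_sum a(2)) auto
 also have "... = 2 / sqrt um*(sqrt k*(\<Sum>p<N. (LINT x|?G. \<bar>?d p x\<bar>)))"
  using a(2) by (simp add: Bochner_Integration.integral_sum)
 also have "... <= 2 / sqrt um*(sqrt k*(\<Sum>p<N. ze))"
  using a(1) um by (intro mult_left_mono sum_mono) auto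
 finally show ?thesis by simp
qed

section \<open>The estimator and its accuracy\<close>

type_synonym cfg = "(rvec => real) \<times> (nat => nat => real) \<times> (nat => nat => real)"

definition cand3 :: "nat => nat => real => cfg => (nat => real) => real" where
 "cand3 k N um tt = (case tt of (qs, C, K) => cand k N um qs C K)"

text \<open>The computable counterpart of \<open>cov\<close>, with \<open>H p q\<close> in place of
  the unknown inner products of gradients.\<close>

definition ch :: "nat => nat => real => (nat => nat => real) => cfg => nat => nat => real" where
 "ch k N al H tt i i' = (case tt of (qs, C, K) =>
  (\<Sum>p<N. \<Sum>q<N. C i p*C i' q*H p q)+(\<Sum>l<k. K i l*K i' l)+(if i = i' then al - 1 else 0))"

text \<open>The value \<open>- 2\<close> excludes inadmissible candidates: empirical correlations
  are at least \<open>- 1\<close>, so one admissible candidate suffices for the maximum to be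
  attained at an admissible one.\<close>

definition est :: "nat => nat => real => real => cfg set => (cfg => real) => (nat => nat => real) => real" where
 "est k N al et TH S H = Max ((%tt. if ALL i<k. ALL i'<k. \<bar>ch k N al H tt i i'\<bar> <= et then S tt else - 2) ` TH)"

lemma Max_selection:
 fixes S :: "'a => real"
 assumes TH: "finite TH" "tt \<in> TH" "V tt" and lo: "r <= S tt+e" "- 1 <= S tt" and up: "!!tt. tt \<in> TH ==> V tt ==> S tt <= r+e"
 shows "\<bar>Max ((%tt. if V tt then S tt else - 2) ` TH) - r\<bar> <= e"
proof -
 let ?h = "%tt. if V tt then S tt else - 2"
 have "?h tt <= Max (?h ` TH)" using TH by (intro Max_ge) auto
 moreover have "Max (?h ` TH) \<in> ?h ` TH" using TH by (intro Max_in) auto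
 then obtain tt' where "tt' \<in> TH" "Max (?h ` TH) = ?h tt'" by blast
 ultimately show ?thesis using lo up[of tt'] TH(3) by (cases "V tt'") auto
qed

lemma ch_close:
 assumes C: "!!i p. i < k ==> p < N ==> \<bar>C i p\<bar> <= 1" and H: "!!p q. p < N ==> q < N ==> \<bar>H p q - dot {..<n} (v p) (v q)\<bar> <= ga"
  and i: "i < k" "i' < k"
 shows "\<bar>ch k N al H (qs, C, K) i i' - cov n k (CV N C v K) al i i'\<bar> <= (real N)^2*ga"
proof -
 have "(\<Sum>j<n. (\<Sum>p<N. C i p * v p j)*(\<Sum>q<N. C i' q * v q j)) = (\<Sum>p<N. \<Sum>q<N. C i p*C i' q*dot {..<n} (v p) (v q))"
 proof -
  have A: "(\<Sum>j<n. v p j*(\<Sum>q<N. C i' q * v q j)) = (\<Sum>q<N. C i' q*dot {..<n} (v p) (v q))" for p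
   using sum_combine[of "C i'" v "{..<N}" "v p" "{..<n}"] by (simp add: dot_def mult.commute)
  have "(\<Sum>j<n. (\<Sum>p<N. C i p * v p j)*(\<Sum>q<N. C i' q * v q j)) = (\<Sum>p<N. C i p*(\<Sum>q<N. C i' q*dot {..<n} (v p) (v q)))"
   unfolding A[symmetric] by (rule sum_combine)
  then show ?thesis by (simp only: sum_distrib_left mult.assoc)
 qed
 then have "ch k N al H (qs, C, K) i i' - cov n k (CV N C v K) al i i' = (\<Sum>p<N. \<Sum>q<N. C i p*C i' q*(H p q - dot {..<n} (v p) (v q)))"
  by (simp add: ch_def cov_def CV_def sum.Plus right_diff_distrib sum_subtractf)
 also have "\<bar>...\<bar> <= (\<Sum>p<N. \<Sum>q<N. 1*1*ga)"
 proof (rule order_trans[OF sum_abs sum_mono])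
  fix p assume p: "p \<in> {..<N}"
  have "\<bar>\<Sum>q<N. C i p*C i' q*(H p q - dot {..<n} (v p) (v q))\<bar> <= (\<Sum>q<N. \<bar>C i p*C i' q*(H p q - dot {..<n} (v p) (v q))\<bar>)"
   by (rule sum_abs)
  also have "... <= (\<Sum>q<N. 1*1*ga)"
   unfolding abs_mult using C H i p by (intro sum_mono mult_mono) auto
  finally show "\<bar>\<Sum>q<N. C i p*C i' q*(H p q - dot {..<n} (v p) (v q))\<bar> <= (\<Sum>q<N. 1*1*ga)" .
 qed
 finally show ?thesis by (simp add: power2_eq_square)
qed

text \<open>The unit of covariance error is \<open>rh\<close>. A rounded good candidate deviates by
  at most \<open>3*rh\<close>, estimation adds at most \<open>3*rh\<close>, so it passes the test at
  \<open>6*rh\<close>; whatever passes has true deviation at most \<open>9*rh\<close>. The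
  assumption \<open>conc\<close> is the union bound, \<open>up\<close> the budget for overestimation
  and \<open>lo\<close> the one for underestimation.\<close>

locale alg_params =
 fixes n k N T m L R :: nat and s t c ka um be rh ze et dl ep1 e :: real and F :: "(rvec => real) set"
 assumes kn: "k <= n" and s: "0 <= s" and t: "0 < t" and c: "c = exp (- t/2)"
  and pos: "0 < N" "0 < T" "0 < m" "0 < L" "0 < R" and L2: "2*L <= N" and ka: "0 < ka" "ka^2 <= 1/2"
  and um: "0 < um" "0 <= be" "um+be <= 1 - c^2"
  and rh: "(real N+real k)/real R <= rh" "rh <= 1" "real k*(9*rh) <= be"
  and ze: "0 <= ze" "2*(12*(real N*(4 / ka^2/real T)))+8 * ka^2 <= ze^2"
  and et: "0 < et" "(real N)^2*(et+(2+ze)*ze) <= 3*rh"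
  and F: "finite F" "F \<subseteq> Collect (smo {..<k} s)" "!!qs. smo {..<k} s qs ==> EX qs':F. (LINT x|GI {..<k}. (qs x - qs' x)^2) <= ep1^2"
  and ep1: "0 <= ep1" and dl: "0 < dl"
  and conc: "(real (card F)*(2*real R+1)^(k*N + k * k)+(real N)^2)*(2*exp (- (real m*et^2/(2*((2 / ka)^2)^2)))) <= 1/6"
  and up: "2 / sqrt um * sqrt (real k*(be+9*rh))+(et+2 / sqrt um*(sqrt k*(real N*ze))) <= e"
  and lo: "(s * sqrt t+dl+c^2/(1 - c^2) * sqrt (real k/real L+real k * sqrt (12*(1/real N)))+ep1+2 / sqrt um * sqrt (real k*be)+2 / sqrt um*(sqrt k*rh))
   + (et+2 / sqrt um*(sqrt k*(real N*ze))) <= e"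
begin

text \<open>The blocks serve three purposes: the first \<open>N\<close> are base points of
  gradients, those in \<open>J\<close> are averaging points shared by all features, and those in
  \<open>Kx\<close> are test points for empirical correlations.\<close>

definition "J = {N..<N+T}"
definition "Kx = {N+T..<N+T+m}"
abbreviation "I == {..<N+T+m}"
abbreviation "P == PiM I (%_. GI {..<n})"
definition "TH = F \<times> ({..<k} \<rightarrow>\<^sub>E {..<N} \<rightarrow>\<^sub>E gr R) \<times> ({..<k} \<rightarrow>\<^sub>E {..<k} \<rightarrow>\<^sub>E gr R)"
definition "ft f W p = lh n c ka f J (W p) W"
definition "sc3 f W tt x = cand3 k N um tt (%p. ft f W p x)*f x"
definition "av g = (\<Sum>j\<in>Kx. g j)/real (card Kx)" for g :: "nat => real"
definition "out U y = est k N (um+be) (6*rh) TH (%tt. av (%j. cand3 k N um tt (%p. U p j)*y j)) (%p q. av (%j. U p j*U q j))"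
definition "ferr f W = (\<Sum>p<N. (LINT x|GI {..<n}. (ft f W p x - md n c ka f (W p) x)^2))"

text \<open>The four requirements concern the second moment matrix of the gradients, the features,
  the values of all candidates, and the Gram matrix of the features.\<close>

definition "good f W \<longleftrightarrow> disc n N c f W <= 12*(1/real N) \<and> ferr f W <= 12*(real N*(4 / ka^2/real T)) \<and>
 (ALL tt:TH. \<bar>av (%j. sc3 f W tt (W j)) - (LINT x|GI {..<n}. sc3 f W tt x)\<bar> <= et) \<and>
 (ALL p<N. ALL q<N. \<bar>av (%j. ft f W p (W j)*ft f W q (W j)) - (LINT x|GI {..<n}. ft f W p x*ft f W q x)\<bar> <= et)"

lemma THD: "tt \<in> TH ==> EX qs C K. tt = (qs, C, K) \<and> qs \<in> F \<and> smo {..<k} s qs \<and> bdd (GI {..<k}) 1 qs \<and> (ALL i<k. ALL p<N. \<bar>C i p\<bar> <= 1)"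
proof -
 assume "tt \<in> TH"
 then obtain qs C K where h: "tt = (qs, C, K)" "qs \<in> F" "C \<in> {..<k} \<rightarrow>\<^sub>E {..<N} \<rightarrow>\<^sub>E gr R" unfolding TH_def by blast
 have "\<bar>C i p\<bar> <= 1" if "i < k" "p < N" for i p using PiE_mem[OF PiE_mem[OF h(3)]] that by (intro gr_le[of _ R]) auto
 then show ?thesis using h F(2) by (auto simp: smo_def)
qed

lemma finite_TH: "finite TH"
 unfolding TH_def using F(1) by (intro finite_cartesian_product finite_PiE) auto

lemma card_TH: "real (card TH) <= real (card F)*(2*real R+1)^(k*N + k * k)"
proof -
 have "card ({..<k} \<rightarrow>\<^sub>E {..<N'} \<rightarrow>\<^sub>E gr R) = card (gr R)^(k*N')" for N'
  by (simp add: card_PiE mult.commute flip: power_mult)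
 then have "card TH = card F*card (gr R)^(k*N + k * k)" by (simp add: TH_def card_cartesian_product power_add)
 moreover have "real (card (gr R)) <= 2*real R+1" using card_gr[of R] by linarith
 then have "real (card (gr R))^(k*N + k * k) <= (2*real R+1)^(k*N + k * k)" by (rule power_mono) simp
 ultimately show ?thesis by (simp add: mult_left_mono)
qed

text \<open>Entirely deterministic. \<open>cand_complete\<close> provides an accepted candidate of
  nearly optimal value, and \<open>cand_sound\<close> caps every accepted one; replacing exact
  features by estimated ones is absorbed by Lipschitz continuity.\<close>

lemma good_accurate:
 assumes f: "bdd (GI {..<n}) 1 f" and W: "W \<in> space P" and g: "good f W"
 shows "\<bar>out (%p j. ft f W p (W j)) (%j. f (W j)) - junta_corr n k s f\<bar> <= e"
proof -
 let ?v = "%p. gz n c f (W p)" let ?H = "%p q. av (%j. ft f W p (W j)*ft f W q (W j))"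
 let ?S = "%tt. av (%j. sc3 f W tt (W j))" and ?E = "%tt. (LINT x|GI {..<n}. cand3 k N um tt (%p. dot {..<n} (?v p) x)*f x)"
 define xi where "xi = et+2 / sqrt um*(sqrt k*(real N*ze))"
 have Wi: "W i \<in> space (GI {..<n})" if "i < N+T+m" for i using W that by (auto simp: space_PiM)
 have Wp: "W p \<in> space (GI {..<n})" if "p < N" for p using Wi that by simp
 have WJ: "W j \<in> space (GI {..<n})" if "j \<in> J" for j using Wi that by (simp add: J_def)
 have lb: "bdd (GI {..<n}) (2 / ka) (ft f W p)" if "p < N" for p
  unfolding ft_def using Wp[OF that] WJ by (intro lh_bdd[OF f ka(1)] measurable_const) simp_all
 have err: "(LINT x|GI {..<n}. (ft f W p x - dot {..<n} (?v p) x)^2) <= ze^2" if p: "p < N" for p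
 proof -
  have "(LINT x|GI {..<n}. (ft f W p x - md n c ka f (W p) x)^2) <= ferr f W"
   unfolding ferr_def using p by (intro member_le_sum) auto
  also have "... <= 12*(real N*(4 / ka^2/real T))" using g by (simp add: good_def)
  finally have 1: "(LINT x|GI {..<n}. (ft f W p x - md n c ka f (W p) x)^2) <= 12*(real N*(4 / ka^2/real T))" .
  have "(LINT x|GI {..<n}. (ft f W p x - dot {..<n} (?v p) x)^2) <= 2*(LINT x|GI {..<n}. (ft f W p x - md n c ka f (W p) x)^2)+8 * ka^2"
   unfolding ft_def by (rule feature_error[OF f ka(1) Wp[OF p] WJ ka(2)])
  then show ?thesis using 1 ze(2) by linarith
 qed
 have v1: "dot {..<n} (?v p) (?v p) <= 1" if "p < N" for p
  using gz_norm[OF f Wp[OF that], of c] by (simp add: dot_def power2_eq_square)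
 have H: "\<bar>?H p q - dot {..<n} (?v p) (?v q)\<bar> <= et+(2+ze)*ze" if "p < N" "q < N" for p q
 proof -
  have "\<bar>(LINT x|GI {..<n}. ft f W p x*ft f W q x) - dot {..<n} (?v p) (?v q)\<bar> <= (2+ze)*ze"
   by (rule second_moment_close[OF lb[OF that(1)] lb[OF that(2)] v1[OF that(1)] v1[OF that(2)] ze(1) err[OF that(1)] err[OF that(2)]])
  moreover have "\<bar>?H p q - (LINT x|GI {..<n}. ft f W p x*ft f W q x)\<bar> <= et" using g that by (simp add: good_def)
  ultimately show ?thesis by linarith
 qed
 have close: "\<bar>ch k N (um+be) ?H (qs, C, K) i i' - cov n k (CV N C ?v K) (um+be) i i'\<bar> <= 3*rh"
  if "(qs, C, K) \<in> TH" "i < k" "i' < k" for qs C K i i'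
 proof -
  have C: "!!i p. i < k ==> p < N ==> \<bar>C i p\<bar> <= 1" using THD[OF that(1)] by auto
  show ?thesis using ch_close[where H = ?H and v = ?v, OF C H that(2,3)] et(2) by (rule order_trans)
 qed
 have val: "\<bar>?S (qs, C, K) - ?E (qs, C, K)\<bar> <= xi" if th: "(qs, C, K) \<in> TH" for qs C K
 proof -
  have C: "!!i p. i < k ==> p < N ==> \<bar>C i p\<bar> <= 1" and qs: "bdd (GI {..<k}) 1 qs" using THD[OF th] by auto
  have "\<bar>(LINT x|GI {..<n}. sc3 f W (qs, C, K) x) - ?E (qs, C, K)\<bar> <= 2 / sqrt um*(sqrt k*(real N*ze))"
   unfolding sc3_def cand3_def prod.case by (rule value_close[OF qs um(1) C f lb ze(1) err])
  moreover have "\<bar>?S (qs, C, K) - (LINT x|GI {..<n}. sc3 f W (qs, C, K) x)\<bar> <= et" using g th by (simp add: good_def)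
  ultimately show ?thesis unfolding xi_def by linarith
 qed
 have dW: "disc n N c f W <= 12*(1/real N)" using g by (simp add: good_def)
 let ?X = "s * sqrt t+dl+c^2/(1 - c^2) * sqrt (real k/real L+real k * sqrt (12*(1/real N)))+ep1+2 / sqrt um * sqrt (real k*be)+2 / sqrt um*(sqrt k*rh)"
 obtain qs C K where m: "qs \<in> F" "C \<in> {..<k} \<rightarrow>\<^sub>E {..<N} \<rightarrow>\<^sub>E gr R" "K \<in> {..<k} \<rightarrow>\<^sub>E {..<k} \<rightarrow>\<^sub>E gr R"
  and cv: "ALL i<k. ALL i'<k. \<bar>cov n k (CV N C ?v K) (um+be) i i'\<bar> <= 3*rh"
  and lw: "junta_corr n k s f <= (LINT x|GI {..<n}. cand k N um qs C K (%p. dot {..<n} (?v p) x)*f x)+?X"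
  using cand_complete[OF f kn s dl t c Wp pos(4) L2 dW F(2,3) ep1 um pos(5) rh(1,2)] by blast
 have th: "(qs, C, K) \<in> TH" using m by (simp add: TH_def)
 have "?X+xi <= e" unfolding xi_def by (rule lo)
 then have lw: "junta_corr n k s f <= ?E (qs, C, K)+(e - xi)" using lw unfolding cand3_def prod.case by linarith
 have "\<bar>est k N (um+be) (6*rh) TH ?S ?H - junta_corr n k s f\<bar> <= e"
  unfolding est_def
 proof (rule Max_selection[OF finite_TH th])
  show "ALL i<k. ALL i'<k. \<bar>ch k N (um+be) ?H (qs, C, K) i i'\<bar> <= 6*rh" using close[OF th] cv by fastforce
  show "junta_corr n k s f <= ?S (qs, C, K)+e" using lw val[OF th] by linarith
  have "\<bar>sc3 f W (qs, C, K) (W j)\<bar> <= 1" if "j \<in> Kx" for j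
  proof -
   have "W j \<in> space (GI {..<n})" using that Wi by (simp add: Kx_def)
   then show ?thesis using bddD(2)[OF bdd_mult1[OF cand_compose[of k qs N "ft f W"] f]] bddD(1)[OF lb] THD[OF th] unfolding sc3_def cand3_def by auto
  qed
  then have "\<bar>\<Sum>j\<in>Kx. sc3 f W (qs, C, K) (W j)\<bar> <= (\<Sum>j\<in>Kx. 1)" by (intro order_trans[OF sum_abs sum_mono])
  then have "\<bar>?S (qs, C, K)\<bar> <= 1" using pos(3) by (simp add: av_def Kx_def abs_divide)
  then show "- 1 <= ?S (qs, C, K)" by linarith
 next
  fix tt assume tt: "tt \<in> TH" and va: "ALL i<k. ALL i'<k. \<bar>ch k N (um+be) ?H tt i i'\<bar> <= 6*rh"
  obtain qs C K where e: "tt = (qs, C, K)" and qs: "smo {..<k} s qs" using THD[OF tt] by auto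
  have "(0::real) <= (real N+real k)/real R" by simp
  then have rh0: "0 <= 9*rh" using rh(1) by linarith
  have cv: "\<bar>cov n k (CV N C ?v K) (um+be) i i'\<bar> <= 9*rh" if "i < k" "i' < k" for i i'
   using close[OF tt[unfolded e] that] va that unfolding e by fastforce
  have "?E tt <= junta_corr n k s f+2 / sqrt um * sqrt (real k*(be+9*rh))"
   unfolding e cand3_def prod.case by (rule cand_sound[OF qs f kn um(1) rh0 rh(3) cv])
  then show "?S tt <= junta_corr n k s f+e" using val[OF tt[unfolded e]] up unfolding e xi_def by linarith
 qed
 then show ?thesis by (simp add: out_def sc3_def)
qed

text \<open>The failure probability \<open>1/3\<close> is spent as \<open>1/12\<close> for each
  moment event and \<open>1/6\<close> for all empirical averages together.\<close>

lemma good_event: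
 assumes f: "bdd (GI {..<n}) 1 f"
 shows "EX S:sets P. measure P S >= 2/3 \<and> (ALL W:S. W \<in> space P \<and> good f W)"
proof -
 let ?G = "GI {..<n}" and ?A = "{..<N+T}"
 have P: "prob_space (PiM A (%_. ?G))" for A by (intro prob_space_PiM prob_GI)
 have J: "finite J" "J ~= {}" "J \<subseteq> I" "J \<subseteq> ?A" "card J = T" using pos by (auto simp: J_def)
 have Kx: "?A \<inter> Kx = {}" "finite ?A" "finite Kx" "?A \<subseteq> I" "Kx \<subseteq> I" "Kx ~= {}" "card Kx = m" using pos by (auto simp: Kx_def)
 define B1 where "B1 = {W \<in> space P. 12*(1/real N) <= disc n N c f W}"
 define B2 where "B2 = {W \<in> space P. 12*(real N*(4 / ka^2/real T)) <= ferr f W}"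
 have B1: "B1 \<in> sets P" "measure P B1 <= 1/12"
 proof -
  let ?r = "%W. restrict W {..<N}" let ?Q = "PiM {..<N} (%_. ?G)"
  interpret PP: product_prob_space "%_. ?G" I by (intro product_prob_spaceI prob_GI)
  have r: "?r \<in> measurable P ?Q" by (intro measurable_restrict_subset) auto
  have d: "disc n N c f W = disc n N c f (?r W)" for W by (simp add: disc_def)
  have l: "distr P ?Q ?r = ?Q" by (intro PP.distr_PiM_restrict_finite) auto
  have i: "integrable ?Q (disc n N c f)" by (rule disc_expectation(2)[OF f pos(1)])
  have "integrable P (%W. disc n N c f (?r W))" using integrable_distr[OF r, of "disc n N c f"] i l by simp
  then have i': "integrable P (disc n N c f)" by (subst d[abs_def])
  have "(LINT W|P. disc n N c f W) = (LINT Z|?Q. disc n N c f Z)"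
   using integral_distr[OF r borel_measurable_integrable[OF i]] l by (simp flip: d)
  also have "... <= 1/real N" by (rule disc_expectation(1)[OF f pos(1)])
  finally have E: "(LINT W|P. disc n N c f W) <= 1/real N" .
  have nn: "0 <= disc n N c f W" for W by (simp add: disc_def sum_nonneg)
  show "B1 \<in> sets P" "measure P B1 <= 1/12"
   unfolding B1_def using pos(1) by (intro markov_bdd[OF P i' nn E], simp)+
 qed
 have B2: "B2 \<in> sets P" "measure P B2 <= 1/12"
 proof -
  have p: "p \<in> I" "p \<notin> J" if "p < N" for p using that by (auto simp: J_def)
  note fv = feature_variance_PiM[OF f ka(1) J(1-3) p]
  have i: "integrable P (%W. (LINT x|?G. (ft f W p x - md n c ka f (W p) x)^2))" if "p < N" for p
   unfolding ft_def by (rule prob_space.bdd_integrable[OF P fv(2)[OF that that]])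
  have i': "integrable P (ferr f)" unfolding ferr_def[abs_def] using i by (intro Bochner_Integration.integrable_sum) auto
  have "(LINT W|P. ferr f W) = (\<Sum>p<N. (LINT W|P. LINT x|?G. (ft f W p x - md n c ka f (W p) x)^2))"
   unfolding ferr_def by (rule Bochner_Integration.integral_sum) (simp add: i)
  also have "... <= (\<Sum>p<N. 4 / ka^2/real T)"
  proof (rule sum_mono)
   fix p assume "p \<in> {..<N}"
   then have "p < N" by simp
   from fv(1)[OF this this] show "(LINT W|P. LINT x|?G. (ft f W p x - md n c ka f (W p) x)^2) <= 4 / ka^2/real T"
    by (simp only: ft_def J(5))
  qed
  also have "... = real N*(4 / ka^2/real T)" by simp
  finally have E: "(LINT W|P. ferr f W) <= real N*(4 / ka^2/real T)" .
  have nn: "0 <= ferr f W" for W by (simp add: ferr_def sum_nonneg)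
  show "B2 \<in> sets P" "measure P B2 <= 1/12"
   unfolding B2_def using pos ka(1) by (intro markov_bdd[OF P i' nn E], simp)+
 qed
 define bad where "bad = (%g. {W \<in> space P. \<bar>(\<Sum>j\<in>Kx. g (restrict W ?A) (W j))/real (card Kx) - (LINT x|?G. g (restrict W ?A) x)\<bar> >= et})"
 define q where "q = 2*exp (- (real m*et^2/(2*((2 / ka)^2)^2)))"
 \<comment> \<open>One bound \<open>(2 / ka)^2\<close> then serves both the products of two features
   and the candidates, which are bounded by one.\<close>
 have k2: "1 <= (2 / ka)^2"
 proof -
  have "ka^2 <= 4" using ka(2) by simp
  then show ?thesis using ka(1) by (simp add: power_divide)
 qed
 have badI: "bad g \<in> sets P" "measure P (bad g) <= q" if "bdd (PiM ?A (%_. ?G) >< ?G) ((2 / ka)^2) (%(a, x). g a x)" for g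
 proof -
  have "0 < (2 / ka)^2" using k2 by linarith
  note h = hoeffding_param[OF prob_GI Kx(1-6) that this less_imp_le[OF et(1)]]
  show "bad g \<in> sets P" unfolding bad_def by (rule h(1))
  show "measure P (bad g) <= q" using h(2) by (simp only: bad_def q_def Kx(7))
 qed
 have ftb: "bdd (PiM ?A (%_. ?G) >< ?G) (2 / ka) (%r. ft f (fst r) p (snd r))" if "p < N" for p
  unfolding ft_def using that J(4)
  by (intro lh_bdd[OF f ka(1)] measurable_snd measurable_compose[OF measurable_fst measurable_component_singleton]) auto
 have g1: "bdd (PiM ?A (%_. ?G) >< ?G) ((2 / ka)^2) (%(a, x). sc3 f a tt x)" if th: "tt \<in> TH" for tt
 proof -
  obtain qs C K where e: "tt = (qs, C, K)" and qs: "bdd (GI {..<k}) 1 qs" using THD[OF th] by auto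
  have "bdd (PiM ?A (%_. ?G) >< ?G) 1 (%r. cand k N um qs C K (%p. ft f (fst r) p (snd r))*f (snd r))"
   by (intro bdd_mult1 cand_compose[OF qs] bddD(1)[OF ftb] bdd_compose[OF f measurable_snd])
  then have "bdd (PiM ?A (%_. ?G) >< ?G) 1 (%(a, x). sc3 f a tt x)" by (simp add: sc3_def cand3_def e split_beta')
  then show ?thesis by (rule bdd_mono[OF _ k2])
 qed
 have g2: "bdd (PiM ?A (%_. ?G) >< ?G) ((2 / ka)^2) (%(a, x). ft f a p x*ft f a p' x)" if "p < N" "p' < N" for p p'
  using bdd_mult[OF ftb[OF that(1)] ftb[OF that(2)]] by (simp add: split_beta' power2_eq_square)
 define B3 where "B3 = (\<Union>tt\<in>TH. bad (%a x. sc3 f a tt x))"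
 define B4 where "B4 = (\<Union>u\<in>{..<N} \<times> {..<N}. bad (%a x. ft f a (fst u) x*ft f a (snd u) x))"
 have un: "measure P (\<Union>(b ` X)) <= real (card X)*q" if "finite X" "!!x. x \<in> X ==> b x \<in> sets P \<and> measure P (b x) <= q" for b and X :: "'z set"
 proof -
  have "measure P (\<Union>(b ` X)) <= (\<Sum>x\<in>X. measure P (b x))"
   using that by (intro finite_measure.finite_measure_subadditive_finite prob_space.finite_measure[OF P]) auto
  also have "... <= (\<Sum>x\<in>X. q)" using that by (intro sum_mono) auto
  finally show ?thesis by simp
 qed
 have B3: "B3 \<in> sets P" "measure P B3 <= real (card TH)*q"
  unfolding B3_def using badI[OF g1] finite_TH by (auto intro!: un sets.finite_UN)
 have B4: "B4 \<in> sets P" "measure P B4 <= (real N)^2*q"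
  unfolding B4_def using badI[OF g2] un[of "{..<N} \<times> {..<N}" "%u. bad (%a x. ft f a (fst u) x*ft f a (snd u) x)"]
  by (auto intro!: sets.finite_UN simp: card_cartesian_product power2_eq_square)
 have "real (card TH)*q+(real N)^2*q <= 1/6"
 proof -
  have "0 <= q" by (simp add: q_def)
  then have "(real (card TH)+(real N)^2)*q <= (real (card F)*(2*real R+1)^(k*N + k * k)+(real N)^2)*q"
   using card_TH by (intro mult_right_mono) auto
  also have "... <= 1/6" unfolding q_def by (rule conc)
  finally show ?thesis by (simp only: distrib_right)
 qed
 moreover have "measure P (B1 \<union> B2 \<union> (B3 \<union> B4)) <= (measure P B1+measure P B2)+(measure P B3+measure P B4)"
  using B1 B2 B3 B4 by (intro order_trans[OF measure_Un_le] add_mono order_refl measure_Un_le) auto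
 ultimately have b: "measure P (B1 \<union> B2 \<union> (B3 \<union> B4)) <= 1/3" using B1 B2 B3 B4 by linarith
 let ?S = "space P - (B1 \<union> B2 \<union> (B3 \<union> B4))"
 have Bs: "B1 \<union> B2 \<union> (B3 \<union> B4) \<in> sets P" using B1 B2 B3 B4 by auto
 have "measure P ?S >= 2/3" using prob_space.prob_compl[OF P Bs] b by simp
 moreover have "good f W" if W: "W \<in> ?S" for W
 proof -
  have r: "ft f (restrict W ?A) p = ft f W p" if "p < N" for p
   using that J(4) by (auto simp: ft_def lh_def fun_eq_iff intro!: arg_cong2[where f = "(/)"] sum.cong)
  have cr: "sc3 f (restrict W ?A) tt = sc3 f W tt" for tt
  proof
   fix x
   have "cand3 k N um tt u = cand3 k N um tt (restrict u {..<N})" for u by (simp add: cand3_def cand_restrict split: prod.splits)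
   moreover have "restrict (%p. ft f (restrict W ?A) p x) {..<N} = restrict (%p. ft f W p x) {..<N}" using r by (auto simp: fun_eq_iff)
   ultimately show "sc3 f (restrict W ?A) tt x = sc3 f W tt x" unfolding sc3_def by metis
  qed
  have "\<bar>av (%j. sc3 f W tt (W j)) - (LINT x|?G. sc3 f W tt x)\<bar> < et" if "tt \<in> TH" for tt
   using W that unfolding B3_def bad_def av_def by (auto simp: not_le cr)
  moreover have "\<bar>av (%j. ft f W p (W j)*ft f W p' (W j)) - (LINT x|?G. ft f W p x*ft f W p' x)\<bar> < et" if "p < N" "p' < N" for p p'
  proof -
   have "W \<notin> bad (%a x. ft f a p x*ft f a p' x)" using W that unfolding B4_def by force
   then show ?thesis using W that by (simp add: bad_def av_def r not_le)
  qed
  moreover have "\<not> 12*(1/real N) <= disc n N c f W" "\<not> 12*(real N*(4 / ka^2/real T)) <= ferr f W"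
   using W unfolding B1_def B2_def by blast+
  ultimately show ?thesis unfolding good_def by (meson less_imp_le not_le)
 qed
 ultimately show ?thesis using Bs by (intro bexI[of _ ?S]) auto
qed

end

section \<open>The query points and the resulting algorithm\<close>

context alg_params
begin

text \<open>A query is indexed by a test point, a base point, an averaging point and a selector:
  \<open>0\<close> asks for the value at the test point, \<open>1\<close> and \<open>2\<close> for
  the two points of a difference. The repetition for selector \<open>0\<close> only keeps the index
  set a product.\<close>

definition "S = Kx \<times> {..<N} \<times> J \<times> {..<3::nat}"
definition "Q u om = (case u of (j, p, l, b) => if b = 0 then blk n j om
 else if b = 1 then mix {..<n} c (sqrt (1 - c^2)) (blk n p om) (mix {..<n} ka (sqrt (1 - ka^2)) (blk n j om) (blk n l om))
 else mix {..<n} c (sqrt (1 - c^2)) (blk n p om) (blk n l om))"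
definition "UU' a p j = (\<Sum>l\<in>J. (a (j, p, l, 1) - a (j, p, l, 2)) / ka)/real (card J)"
 for a :: "nat \<times> nat \<times> nat \<times> nat => real"
text \<open>The value at test point \<open>j\<close> is read from one of its many copies; the
  indices \<open>0\<close> and \<open>N\<close> are valid because \<open>N\<close> and
  \<open>T\<close> are positive.\<close>

definition "EE a = out (UU' a) (%j. a (j, 0, N, 0))"

lemma cand3_restrict: "cand3 k N um tt (restrict u {..<N}) = cand3 k N um tt u"
 by (simp add: cand3_def cand_restrict split: prod.splits)

lemma out_cong:
 assumes U: "!!p j. p < N ==> j \<in> Kx ==> U p j = U' p j" and y: "!!j. j \<in> Kx ==> y j = y' j"
 shows "out U y = out U' y'"
proof -
 have "cand3 k N um tt (%p. U p j) = cand3 k N um tt (%p. U' p j)" if "j \<in> Kx" for tt j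
  using U that by (subst (1 2) cand3_restrict[symmetric]) (simp cong: restrict_cong)
 then have "av (%j. cand3 k N um tt (%p. U p j)*y j) = av (%j. cand3 k N um tt (%p. U' p j)*y' j)" for tt
  using y by (simp add: av_def)
 moreover have "ch k N (um+be) (%p q. av (%j. U p j*U q j)) = ch k N (um+be) (%p q. av (%j. U' p j*U' q j))"
  using U by (auto simp: ch_def av_def fun_eq_iff split: prod.splits)
 ultimately show ?thesis by (simp add: out_def est_def)
qed

lemma EE_measurable: "EE \<in> borel_measurable (PiM S (%_. borel))"
proof -
 let ?M = "PiM S (%_. borel :: real measure)"
 have U: "(%a. UU' a p j) \<in> borel_measurable ?M" if "p < N" "j \<in> Kx" for p j
  unfolding UU'_def using that
  by (intro borel_measurable_divide borel_measurable_sum borel_measurable_diff measurable_component_singleton borel_measurable_const) (auto simp: S_def)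
 have Y: "(%a. a (j, 0, N, 0)) \<in> borel_measurable ?M" if "j \<in> Kx" for j
  using that pos by (intro measurable_component_singleton) (auto simp: S_def J_def)
 have "(%a. cand3 k N um tt (%p. UU' a p j)) \<in> borel_measurable ?M" if th: "tt \<in> TH" and j: "j \<in> Kx" for tt j
 proof -
  obtain qs C K where e: "tt = (qs, C, K)" and qs: "bdd (GI {..<k}) 1 qs" using THD[OF th] by auto
  show ?thesis unfolding e cand3_def prod.case by (rule bddD(1)[OF cand_compose[OF qs U[OF _ j]]])
 qed
 then have s: "(%a. av (%j. cand3 k N um tt (%p. UU' a p j)*a (j, 0, N, 0))) \<in> borel_measurable ?M" if "tt \<in> TH" for tt
  unfolding av_def using that Y by (intro borel_measurable_divide borel_measurable_sum borel_measurable_times borel_measurable_const) auto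
 have h: "(%a. ch k N (um+be) (%p q. av (%j. UU' a p j*UU' a q j)) (qs, C, K) i i') \<in> borel_measurable ?M" for qs C K i i'
  unfolding ch_def av_def prod.case using U
  by (intro borel_measurable_add borel_measurable_divide borel_measurable_sum borel_measurable_times borel_measurable_const) auto
 have "(%a. if ALL i<k. ALL i'<k. \<bar>ch k N (um+be) (%p q. av (%j. UU' a p j*UU' a q j)) tt i i'\<bar> <= 6*rh
   then av (%j. cand3 k N um tt (%p. UU' a p j)*a (j, 0, N, 0)) else - 2) \<in> borel_measurable ?M" if th: "tt \<in> TH" for tt
 proof -
  obtain qs C K where e: "tt = (qs, C, K)" by (cases tt) auto
  note [measurable] = h[of qs C K, folded e] s[OF th]
  have "{a \<in> space ?M. ALL i:{..<k}. ALL i':{..<k}. \<bar>ch k N (um+be) (%p q. av (%j. UU' a p j*UU' a q j)) tt i i'\<bar> <= 6*rh} \<in> sets ?M"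
   by measurable
  then show ?thesis using s[OF th] by (intro measurable_If) (auto simp: Ball_def)
 qed
 then show ?thesis unfolding EE_def[abs_def] out_def est_def by (rule borel_measurable_Max[OF finite_TH])
qed

lemma Q_measurable: "u \<in> S ==> Q u \<in> measurable random_source (GI {..<n})"
proof -
 note blk_measurable[measurable]
 show "Q u \<in> measurable random_source (GI {..<n})" unfolding Q_def by (cases u) measurable
qed

lemma EE_eval:
 assumes W: "W = (\<lambda>j\<in>I. blk n j om)"
 shows "EE (\<lambda>u\<in>S. f (Q u om)) = out (%p j. ft f W p (W j)) (%j. f (W j))"
 unfolding EE_def
proof (rule out_cong)
 fix j assume j: "j \<in> Kx"
 have Wj: "W i = blk n i om" if "i < N+T+m" for i using that by (simp add: W)
 have jl: "j < N+T+m" using j by (simp add: Kx_def)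
 show "(\<lambda>u\<in>S. f (Q u om)) (j, 0, N, 0) = f (W j)" using j jl pos by (simp add: S_def J_def Q_def Wj)
 fix p assume p: "p < N"
 have "((\<lambda>u\<in>S. f (Q u om)) (j, p, l, 1) - (\<lambda>u\<in>S. f (Q u om)) (j, p, l, 2)) / ka = dif n c ka f (W p) (W j) (W l)" if "l \<in> J" for l
  using that j jl p by (simp add: S_def Q_def dif_def Wj J_def)
 then show "UU' (\<lambda>u\<in>S. f (Q u om)) p j = ft f W p (W j)" by (simp add: UU'_def ft_def lh_def)
qed

theorem algorithm:
 "EX A. num_queries A = m*(N*(T*3)) \<and> randomized_query_alg n A \<and>
  (ALL f. bounded_fun n f --> \<P>(om in random_source. \<bar>run_alg A f om - junta_corr n k s f\<bar> <= e) >= 2/3)"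
proof -
 have fin: "finite S" by (simp add: S_def Kx_def J_def)
 have card: "card S = m*(N*(T*3))" by (simp add: S_def Kx_def J_def card_cartesian_product)
 obtain A where A: "num_queries A = card S" "randomized_query_alg n A" and run: "!!f om. run_alg A f om = EE (\<lambda>u\<in>S. f (Q u om))"
  using nonadaptive_alg[where Q = Q, OF fin Q_measurable EE_measurable] by blast
 interpret prob_space random_source unfolding random_source_def by (rule prob_space_PiM[OF prob_space_std_gaussian])
 have "\<P>(om in random_source. \<bar>run_alg A f om - junta_corr n k s f\<bar> <= e) >= 2/3" if bf: "bounded_fun n f" for f
 proof -
  have f: "bdd (GI {..<n}) 1 f" using bf by (simp add: bounded_fun_bdd)
  let ?B = "%om. \<lambda>j\<in>I. blk n j om"
  obtain X where X: "X \<in> sets P" "measure P X >= 2/3" "ALL W:X. W \<in> space P \<and> good f W" using good_event[OF f] by blast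
  have B: "?B \<in> measurable random_source P" by (intro measurable_restrict blk_measurable)
  have law: "distr random_source P ?B = P" using pos by (intro blocks_law) auto
  have m: "(%om. run_alg A f om) \<in> borel_measurable random_source"
   unfolding run by (intro measurable_compose[OF _ EE_measurable] measurable_restrict measurable_compose[OF Q_measurable bddD(1)[OF f]])
  have "2/3 <= prob (?B -` X \<inter> space random_source)" using X(2) measure_distr[OF B X(1)] law by simp
  also have "... <= \<P>(om in random_source. \<bar>run_alg A f om - junta_corr n k s f\<bar> <= e)"
  proof (rule finite_measure_mono)
   show "{om \<in> space random_source. \<bar>run_alg A f om - junta_corr n k s f\<bar> <= e} \<in> events" using m by measurable
   show "?B -` X \<inter> space random_source \<subseteq> {om \<in> space random_source. \<bar>run_alg A f om - junta_corr n k s f\<bar> <= e}"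
   proof
    fix om assume "om \<in> ?B -` X \<inter> space random_source"
    then have om: "om \<in> space random_source" and W: "?B om \<in> space P" "good f (?B om)" using X(3) by blast+
    have "\<bar>run_alg A f om - junta_corr n k s f\<bar> <= e"
     unfolding run EE_eval[OF refl] by (rule good_accurate[OF f W])
    then show "om \<in> {om \<in> space random_source. \<bar>run_alg A f om - junta_corr n k s f\<bar> <= e}" by (intro CollectI conjI om)
   qed
  qed
  finally show ?thesis .
 qed
 then show ?thesis using A unfolding card by blast
qed

end

section \<open>Choice of parameters\<close>

text \<open>
  For \<open>K = max 2 k\<close> and \<open>x = max 1 s / ep\<close>: \<open>pL\<close> Landweber steps, \<open>pN\<close> sampled gradients, \<open>pR\<close> grid points per unit
  length, \<open>pT\<close> points per gradient estimate, \<open>pd\<close> and \<open>pM\<close> the degree and sample size behind the net, \<open>pm\<close> samples;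
  \<open>prh\<close> and \<open>pze\<close> are the reciprocals of \<open>rh\<close> and \<open>ze\<close>.
\<close>

definition pL :: "real => real => nat" where "pL K x = nat \<lceil>10^7*K*x^10\<rceil>"
definition pN :: "real => real => nat" where "pN K x = 12*(pL K x)^2"
definition prh :: "real => real => real" where "prh K x = 9*10^6*K^2*x^6"
definition pR :: "real => real => nat" where "pR K x = nat \<lceil>(real (pN K x)+K)*prh K x\<rceil>"
definition pze :: "real => real => real" where "pze K x = 3*(real (pN K x))^2*prh K x"
definition pT :: "real => real => nat" where "pT K x = nat \<lceil>3072*real (pN K x)*pze K x^4\<rceil>"
definition pd :: "real => nat" where "pd x = nat \<lceil>10240000*x^6\<rceil>"
definition pV :: "real => real => real" where "pV K x = 2*(2*K)^(2*(Suc (pd x))^2)"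
definition pM :: "real => real => nat" where "pM K x = nat \<lceil>3200*x^2*pV K x\<rceil>"
definition pX :: "real => real => real" where "pX K x = 5+real (pM K x)+2*real (pR K x)*(K*real (pN K x)+K^2)+2*real (pN K x)"
definition pm :: "real => real => nat" where "pm K x = nat \<lceil>8192*pX K x*pze K x^6\<rceil>"

lemma nat_ceiling_ge: "y <= real (nat \<lceil>y\<rceil>)" by linarith

text \<open>The correlation \<open>sqrt (1/(2*K))\<close> balances two effects: Bernoulli's
  inequality bounds the \<open>k\<close>-th power of \<open>1/(1 - 1/(2*K))\<close> by
  \<open>2\<close>, while \<open>1/?ka <= 2*K\<close> limits each of the \<open>Suc d\<close>
  factors of the coefficient bound to \<open>(2*K)^Suc d\<close>.\<close>

lemma Vq_le:
 assumes K: "2 <= K" "real k <= K"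
 shows "Vq (sqrt (1/(2*K))) (Suc d) k <= 2*(2*K)^(2*(Suc d)^2)"
proof -
 let ?ka = "sqrt (1/(2*K))"
 have k2: "?ka^2 = 1/(2*K)" using K by simp
 have i: "0 <= 1/?ka" "1/?ka <= 2*K"
 proof -
  have "1/?ka = sqrt (2*K)" by (simp add: real_sqrt_divide)
  also have "... <= sqrt ((2*K)^2)" using K self_le_power[of "2*K" 2] by (intro real_sqrt_le_mono) auto
  also have "... = 2*K" using K real_sqrt_abs[of "2*K"] by linarith
  finally show "1/?ka <= 2*K" .
 qed (use K in simp)
 have "(\<Prod>i<Suc d. 1+(1/?ka)^i) <= (\<Prod>i<Suc d. (2*K)^Suc d)"
 proof (rule prod_mono)
  fix i assume "i \<in> {..<Suc d}"
  then have "(1/?ka)^i <= (2*K)^d" using i K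
   by (intro order_trans[OF power_mono[of "1/?ka" "2*K" i]] power_increasing) auto
  moreover have "1 <= (2*K)^d" by (rule one_le_power) (use K in simp)
  moreover have "2*(2*K)^d <= (2*K)*(2*K)^d" using K by (intro mult_right_mono) auto
  ultimately show "0 <= 1+(1/?ka)^i \<and> 1+(1/?ka)^i <= (2*K)^Suc d" using zero_le_power[OF i(1), of i] unfolding power_Suc by (intro conjI) linarith+
 qed
 also have "... = (2*K)^(Suc d)\<^sup>2" by (simp only: prod_constant card_lessThan power_mult[symmetric] power2_eq_square)
 finally have "(\<Prod>i<Suc d. 1+(1/?ka)^i)^2 <= ((2*K)^(Suc d)\<^sup>2)^2"
  using i(1) by (intro power_mono prod_nonneg) (auto intro: add_nonneg_nonneg)
 also have "... = (2*K)^(2*(Suc d)^2)" by (simp only: power_mult[symmetric] mult.commute)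
 finally have 1: "(\<Prod>i<Suc d. 1+(1/?ka)^i)^2 <= (2*K)^(2*(Suc d)^2)" .
 have "1/2 <= 1+real k * - (1/(2*K))" using K by (simp add: field_simps)
 also have "... <= (1 + - (1/(2*K))) ^ k" using K by (intro Bernoulli_inequality) (simp add: field_simps)
 finally have b: "1/2 <= (1 - 1/(2*K)) ^ k" by simp
 then have 2: "(1/(1 - 1/(2*K))) ^ k <= 2" using le_imp_inverse_le[OF b] by (simp add: power_divide inverse_eq_divide)
 have "1/(2*K) < 1" using K by simp
 then show ?thesis unfolding Vq_def k2 using mult_mono[OF 1 2] K by (simp add: mult.commute)
qed

lemma exp_minus_le:
 fixes t :: real
 assumes "0 <= t" "t <= 1"
 shows "t/2 <= 1 - exp (- t)"
proof -
 have "t*t <= t*1" using assms by (intro mult_left_mono) auto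
 then have "1 <= (1 - t/2)*(1+t)" by (simp add: algebra_simps)
 also have "... <= (1 - t/2)*exp t" using assms by (intro mult_left_mono exp_ge_add_one_self) auto
 finally have "exp (- t)*1 <= exp (- t)*((1 - t/2)*exp t)" by (intro mult_left_mono) auto
 also have "... = 1 - t/2" by (simp add: exp_minus)
 finally show ?thesis by simp
qed

text \<open>All counts are turned into exponentials by \<open>2 <= exp 1\<close>,
  \<open>1+2*R <= exp (2*R)\<close> and \<open>N <= exp N\<close>. The \<open>5\<close> in the
  exponent consists of \<open>1\<close> from the factor \<open>2\<close> in front of
  \<open>2^M\<close> and \<open>4\<close> from the final constant
  \<open>24 <= exp 4\<close>.\<close>

lemma concentration_arith:
 fixes R N M m p :: nat and X q :: real
 assumes F: "real F <= 2*2^M" and p: "real p <= p'" and X: "5+real M+2*real R*p'+2*real N <= q"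
 shows "(real F*(2*real R+1)^p+(real N)^2)*(2*exp (- q)) <= 1/6"
proof -
 have e: "1+y <= exp y" for y :: real by (rule exp_ge_add_one_self)
 have e1: "(2::real) <= exp 1" "(12::real) <= exp 4"
 proof -
  show "(2::real) <= exp 1" using e[of 1] by simp
  then have "(2::real)^4 <= exp 1^4" by (intro power_mono) auto
  then show "(12::real) <= exp 4" by (simp flip: exp_of_nat_mult)
 qed
 have "real F <= exp 1*exp 1^M" using F mult_mono[OF e1(1) power_mono[OF e1(1), of M]] by simp
 moreover have "(2*real R+1)^p <= exp (2*real R)^p" using e[of "2*real R"] by (intro power_mono) linarith+
 ultimately have "real F*(2*real R+1)^p <= (exp 1*exp 1^M)*exp (2*real R)^p" by (intro mult_mono) auto
 also have "... = exp (1+real M+2*real R*real p)" by (simp add: exp_add mult.commute flip: exp_of_nat_mult)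
 also have "... <= exp (1+real M+2*real R*p'+2*real N)" using p by (auto intro!: add_increasing2 mult_left_mono)
 finally have 1: "real F*(2*real R+1)^p <= exp (1+real M+2*real R*p'+2*real N)" .
 have "real N <= exp (real N)" using e[of "real N"] by linarith
 then have "(real N)^2 <= (exp (real N))^2" by (intro power_mono) auto
 also have "... = exp (2*real N)" by (simp add: power2_eq_square flip: exp_add)
 also have "... <= exp (1+real M+2*real R*p'+2*real N)" using p by (auto intro!: add_nonneg_nonneg mult_nonneg_nonneg)
 finally have "(real F*(2*real R+1)^p+(real N)^2)*12 <= (2*exp (1+real M+2*real R*p'+2*real N))*12" using 1 by simp
 also have "... = 24*exp (1+real M+2*real R*p'+2*real N)" by simp
 also have "... <= exp q"
 proof -
  have e27: "24 <= exp (4 :: real)"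
  proof -
   have "(1+4/3 :: real)^3 <= exp (4/3)^3" using e[of "4/3"] by (intro power_mono) auto
   have "exp (4 :: real) = exp 2*exp 2" by (simp flip: exp_add)
   moreover have "(5 :: real) <= exp 2" using exp_lower_Taylor_quadratic[of "2 :: real"] by simp
   ultimately show ?thesis using mult_mono[of 5 "exp 2 :: real" 5 "exp 2"] by simp
  qed
  have "24*exp (1+real M+2*real R*p'+2*real N) <= exp 4*exp (1+real M+2*real R*p'+2*real N)"
   using e27 by (intro mult_right_mono) auto
  also have "... = exp (5+real M+2*real R*p'+2*real N)" by (simp flip: exp_add)
  also have "... <= exp q" using X by simp
  finally show ?thesis .
 qed
 finally have "(real F*(2*real R+1)^p+(real N)^2)*12*exp (- q) <= exp q*exp (- q)" by (intro mult_right_mono) auto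
 also have "... = 1" by (simp flip: exp_add)
 finally show ?thesis by (simp add: algebra_simps)
qed

text \<open>Each source of error receives at most \<open>y/10\<close>, where \<open>y = 1/x\<close>
  is at most the accuracy. The estimation term takes two such shares and at most eight shares occur,
  so the total stays below \<open>y\<close>.\<close>

lemma params_exist:
 fixes x K s e :: real and n k :: nat
 assumes x: "1 <= x" and K: "K = max 2 (real k)" and kn: "k <= n" and s: "0 <= s" "s <= x" and e: "1/x <= e"
 shows "EX t c ka um be rh ze et dl ep1 F. alg_params n k (pN K x) (pT K x) (pm K x) (pL K x) (pR K x) s t c ka um be rh ze et dl ep1 e F"
proof -
 have K2: "2 <= K" and kK: "real k <= K" using K by auto
 define y where "y = 1/x"
 have y: "0 < y" "y <= 1" and xy: "x = 1/y" using x by (auto simp: y_def)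
 have yp: "y^a <= 1" "y^b <= y^a" if "a <= b" for a b using y that by (auto intro: power_le_one power_decreasing)
 let ?N = "real (pN K x)" let ?L = "real (pL K x)"
 have L: "10^7*K/y^10 <= ?L" using nat_ceiling_ge[of "10^7*K*x^10"] by (simp add: pL_def xy power_divide)
 have L1: "1 <= ?L"
 proof -
  have "1 <= 10^7*K/y^10" using K2 y yp(1)[of 10 10] by (simp add: field_simps)
  then show ?thesis using L by linarith
 qed
 have N: "?N = 12*?L^2" by (simp add: pN_def)
 have "?L*1 <= ?L*?L" using L1 by (intro mult_left_mono) auto
 then have N1: "1 <= ?N" "2*?L <= ?N" and N0: "0 < ?N" using L1 unfolding N power2_eq_square by linarith+
 \<comment> \<open>Makes \<open>sqrt t = y^2/10\<close>, so that \<open>s <= 1/y\<close> bounds the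
   damping loss by \<open>y/10\<close>.\<close>
 define t where "t = y^4/100"
 have t: "0 < t" "t <= 1" using y yp(1)[of 4 4] by (auto simp: t_def)
 have st: "sqrt t = y^2/10" unfolding t_def by (rule real_sqrt_unique) (auto simp: power_divide simp flip: power_mult)
 define c where "c = exp (- t/2)"
 have c2: "c^2 = exp (- t)" by (simp add: c_def power2_eq_square flip: exp_add)
 have c1: "t/2 <= 1 - c^2" unfolding c2 using t by (intro exp_minus_le) auto
 \<comment> \<open>Half of the guaranteed gap \<open>t/2 <= 1 - c^2\<close>; the rest accommodates
   \<open>be\<close>.\<close>
 define um where "um = t/4"
 have sm: "2 / sqrt um = 40/y^2" using y by (simp add: um_def real_sqrt_divide st)
 \<comment> \<open>The Lipschitz constant is \<open>40/y^2\<close>, so errors under the square root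
   may be of order \<open>y^6\<close>; dividing by \<open>K\<close> compensates the trace of a
   \<open>k\<close> by \<open>k\<close> matrix. \<open>rh\<close> is then fixed by
   \<open>K*(9*rh) = be\<close>.\<close>
 define be where "be = y^6/(10^6*K)"
 define rh where "rh = 1/prh K x"
 have rh: "rh = y^6/(9*10^6*K^2)" by (simp add: rh_def prh_def xy power_divide)
 have rh0: "0 < rh" using y K2 by (simp add: rh)
 have be0: "0 < be" using y K2 by (simp add: be_def)
 have k9: "K*(9*rh) = be" using K2 by (simp add: rh be_def power2_eq_square)
 have k9': "real k*(9*rh) <= be" unfolding k9[symmetric] using kK rh0 by (intro mult_right_mono) auto
 have Kb: "K*be = y^6/10^6" using K2 by (simp add: be_def)
 have kb: "sqrt (real k*(be+9*rh)) <= y^3/400"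
 proof (rule real_le_lsqrt)
  have "real k*(be+9*rh) <= K*be+be" using mult_right_mono[OF kK less_imp_le[OF be0]] k9' by (simp add: distrib_left)
  moreover have "be <= K*be" using K2 be0 by simp
  ultimately have "real k*(be+9*rh) <= 2*(y^6/10^6)" using Kb by linarith
  also have "... <= (y^3/400)^2" using y by (simp add: power_divide flip: power_mult)
  finally show "real k*(be+9*rh) <= (y^3/400)^2" .
 qed (use be0 rh0 y in auto)
 have S: "40/y^2*z <= y/10" if "z <= y^3/400" for z
 proof -
  have "40/y^2*z <= 40/y^2*(y^3/400)" using that y by (intro mult_left_mono) auto
  also have "... = y/10" using y by (simp add: power2_eq_square power3_eq_cube)
  finally show ?thesis .
 qed
 have up1: "2 / sqrt um * sqrt (real k*(be+9*rh)) <= y/10" unfolding sm by (rule S[OF kb])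
 have up2: "2 / sqrt um * sqrt (real k*be) <= y/10"
  unfolding sm using rh0 by (intro S order_trans[OF _ kb] real_sqrt_le_mono mult_left_mono) auto
 have krh: "sqrt (real k)*rh <= y^3/400"
 proof -
  have "sqrt (real k) <= sqrt (K^2)" using kK K2 self_le_power[of K 2] by (intro real_sqrt_le_mono) auto
  then have "sqrt (real k)*rh <= K*rh" using K2 rh0 by (intro mult_right_mono) auto
  also have "... <= K*be"
  proof -
   have "0 <= K*rh" "be <= K*be" using K2 rh0 be0 by simp_all
   then show ?thesis using k9 by linarith
  qed
  also have "... <= y^3/400" unfolding Kb using yp(2)[of 3 6] y by (intro frac_le) auto
  finally show ?thesis .
 qed
 have rhy: "rh <= y/10"
 proof -
  have "9*rh <= K*(9*rh)" using K2 rh0 by simp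
  also have "... <= K*be" unfolding k9 using K2 be0 by simp
  finally show ?thesis unfolding Kb using yp(2)[of 1 6] y by simp
 qed
 have pz: "pze K x = 3*?N^2/rh" by (simp add: pze_def rh_def)
 \<comment> \<open>With these choices \<open>et = 3*ze\<close>, so
   \<open>?N^2*(et+3*ze) = 2*rh\<close>. The bias \<open>8 * ka^2\<close> takes half of
   \<open>ze^2\<close>, and the number of averaging points makes the sampling error fit into the
   other half.\<close>
 define ze where "ze = 1/pze K x"
 define et where "et = rh/?N^2"
 define ka where "ka = ze/4"
 have NN: "1 <= ?N^2" "?N <= ?N^2" using N1 by (auto intro: self_le_power one_le_power)
 have ze: "ze = rh/(3*?N^2)" by (simp add: ze_def pz)
 have ze0: "0 < ze" using rh0 N0 by (simp add: ze)
 have zerh: "?N*ze <= rh"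
 proof -
  have "?N*rh <= 3*?N^2*rh" using NN rh0 by (intro mult_right_mono) linarith+
  then show ?thesis unfolding ze times_divide_eq_right using NN by (subst pos_divide_le_eq) (linarith, simp add: mult.commute)
 qed
 have "1*ze <= ?N*ze" using N1 ze0 by (intro mult_right_mono) auto
 then have ze1: "ze <= 1" using zerh rhy y by linarith
 have etrh: "0 < et" "et <= rh" using rh0 N0 NN(1) divide_left_mono[of 1 "?N^2" rh] by (auto simp: et_def)
 have up3: "et+2 / sqrt um*(sqrt k*(?N*ze)) <= y/10+y/10"
  unfolding sm using zerh etrh rhy by (intro add_mono S order_trans[OF _ krh] mult_left_mono) auto
 have up4: "2 / sqrt um*(sqrt k*rh) <= y/10" unfolding sm by (rule S[OF krh])
 have path: "c^2/(1 - c^2) * sqrt (real k/?L+real k * sqrt (12*(1/?N))) <= y/10"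
 proof -
  \<comment> \<open>The choice of \<open>pN\<close> makes the sampling term equal to the iteration
    term \<open>real k/?L\<close>.\<close>
  have "12*(1/?N) = (1/?L)^2" by (simp add: N power_divide)
  then have e: "real k/?L+real k * sqrt (12*(1/?N)) = 2*(real k/?L)" using L1 by simp
  have "real k/?L <= K/(10^7*K/y^10)" using L kK K2 y by (intro frac_le) auto
  also have "... = y^10/10^7" using K2 by simp
  also have "... <= y^10/8000000" using y by (intro divide_left_mono) auto
  finally have "2*(real k/?L) <= y^10/4000000" by (simp add: mult.commute)
  also have "... = (y^5/2000)^2" by (simp add: power_divide flip: power_mult)
  finally have "2*(real k/?L) <= (y^5/2000)^2" .
  then have 1: "sqrt (2*(real k/?L)) <= y^5/2000" using y by (intro real_le_lsqrt) auto
  have "c^2/(1 - c^2) <= 1/(t/2)" using c1 t by (intro frac_le) (auto simp: c2)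
  also have "... = 200/y^4" by (simp add: t_def)
  finally have "c^2/(1 - c^2) * sqrt (2*(real k/?L)) <= 200/y^4*(y^5/2000)"
   using 1 y by (intro mult_mono) auto
  also have "... = y/10" using y by (simp add: power_eq_if)
  finally show ?thesis unfolding e .
 qed
 have s1: "s * sqrt t <= y/10"
 proof -
  have "s * sqrt t <= 1/y*(y^2/10)" unfolding st using s xy by (intro mult_right_mono) auto
  also have "... = y/10" using y by (simp add: power2_eq_square)
  finally show ?thesis .
 qed
 have ye: "y <= e" using e by (simp add: y_def)
 define ep1 where "ep1 = y/10"
 \<comment> \<open>This correlation belongs to the kernel behind the net and is unrelated to the
   \<open>ka\<close> of the features.\<close>
 let ?ka = "sqrt (1/(2*K))"
 have Mx: "3200*x^2*pV K x <= real (pM K x)" unfolding pM_def by (rule nat_ceiling_ge)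
 have dx: "10240000*x^6 <= real (pd x)" unfolding pd_def by (rule nat_ceiling_ge)
 have pV: "1 <= pV K x" "Vq ?ka (Suc (pd x)) k <= pV K x"
 proof -
  have "1 <= (2*K)^(2*(Suc (pd x))^2)" using K2 by (intro one_le_power) auto
  then show "1 <= pV K x" unfolding pV_def by linarith
  show "Vq ?ka (Suc (pd x)) k <= pV K x" unfolding pV_def by (rule Vq_le[OF K2 kK])
 qed
 have x2: "1 <= x^2" "1 <= x^6" using x by auto
 have d0: "0 < pd x" using dx x2 by (cases "pd x") auto
 have M0: "0 < pM K x"
 proof -
  have "1*1 <= 3200*x^2*pV K x" using x2 pV by (intro mult_mono) auto
  then show ?thesis using Mx by (cases "pM K x") auto
 qed
 obtain F where F: "finite F" "F \<subseteq> Collect (smo {..<k} s)" "card F <= 2*2^pM K x"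
  and net: "!!qs. smo {..<k} s qs ==> EX qs':F. (LINT u|GI {..<k}. (qs u - qs' u)^2) <= 16 * s / sqrt (pd x)+16*(Vq ?ka (Suc (pd x)) (card {..<k})/real (pM K x))"
  using smooth_net[of "{..<k}" ?ka "pM K x" "pd x" s] K2 M0 d0 s(1) by auto
 have "16 * s / sqrt (pd x)+16*(Vq ?ka (Suc (pd x)) (card {..<k})/real (pM K x)) <= ep1^2"
 proof -
  have "(3200*x^3)^2 <= real (pd x)" using dx by (simp add: power_mult_distrib flip: power_mult)
  then have "3200*x^3 <= sqrt (pd x)" by (rule real_le_rsqrt)
  then have "16 * s / sqrt (pd x) <= 16*x/(3200*x^3)" using s x by (intro frac_le) auto
  also have "... = y^2/200" using y by (simp add: xy power_divide power2_eq_square power3_eq_cube)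
  finally have 1: "16 * s / sqrt (pd x) <= y^2/200" .
  have "Vq ?ka (Suc (pd x)) k/real (pM K x) <= pV K x/(3200*x^2*pV K x)"
   using Mx pV by (intro frac_le mult_pos_pos) (use x2 in linarith)+
  also have "... = y^2/3200" using pV by (simp add: xy power_divide)
  finally have 2: "Vq ?ka (Suc (pd x)) k/real (pM K x) <= y^2/3200" .
  have "ep1^2 = y^2/100" by (simp add: ep1_def power_divide)
  then show ?thesis using 1 2 unfolding card_lessThan by linarith
 qed
 then have net': "EX qs':F. (LINT u|GI {..<k}. (qs u - qs' u)^2) <= ep1^2" if "smo {..<k} s qs" for qs
  using net[OF that] by (meson order_trans)
 have pos: "0 < pN K x" "0 < pL K x" using N1 L1 by (auto intro: gr0I)
 have NR: "(?N+K)/rh <= real (pR K x)" using nat_ceiling_ge[of "(?N+K)*prh K x"] by (simp add: pR_def rh_def)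
 have R0: "0 < real (pR K x)" using NR N1 K2 rh0 by (smt (verit) divide_pos_pos)
 have NR': "(?N+real k)/real (pR K x) <= rh"
 proof -
  have "?N+real k <= rh*((?N+K)/rh)" using kK rh0 by simp
  also have "... <= rh*real (pR K x)" using NR rh0 by (intro mult_left_mono) auto
  finally show ?thesis using R0 by (simp add: field_simps)
 qed
 have T: "3072*?N/ze^4 <= real (pT K x)" using nat_ceiling_ge[of "3072*?N*pze K x^4"] by (simp add: pT_def ze_def power_divide)
 have T0: "0 < real (pT K x)" using T N1 ze0 by (smt (verit) divide_pos_pos zero_less_power)
 have zz: "2*(12*(?N*(4 / ka^2/real (pT K x))))+8 * ka^2 <= ze^2"
 proof -
  have "2*(12*(?N*(4 / ka^2/real (pT K x)))) = (1536*?N/ze^2)/real (pT K x)"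
   by (simp add: ka_def power_divide)
  also have "... <= (1536*?N/ze^2)/(3072*?N/ze^4)" by (intro divide_left_mono T mult_pos_pos T0) (use N0 ze0 in auto)
  also have "... = ze^2/2" using N1 ze0 by (simp add: power2_eq_square power4_eq_xxxx)
  finally show ?thesis by (simp add: ka_def power_divide)
 qed
 have ee: "?N^2*(et+(2+ze)*ze) <= 3*rh"
 proof -
  have "?N^2*(et+(2+ze)*ze) <= ?N^2*(et+3*ze)" using ze0 ze1 by (intro mult_left_mono add_mono mult_right_mono) auto
  also have "... = 2*rh" using N0 by (simp add: et_def ze distrib_left)
  finally show ?thesis using rh0 by linarith
 qed
 have mx: "8192*pX K x/ze^6 <= real (pm K x)" using nat_ceiling_ge[of "8192*pX K x*pze K x^6"] by (simp add: pm_def ze_def power_divide)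
 have X0: "5 <= pX K x" using K2 by (auto simp: pX_def intro!: add_nonneg_nonneg mult_nonneg_nonneg)
 have m0: "0 < real (pm K x)" using mx X0 ze0 by (smt (verit) divide_pos_pos zero_less_power)
 have qX: "pX K x <= real (pm K x)*et^2/(2*((2 / ka)^2)^2)"
 proof -
  have etze: "et = 3*ze" by (simp add: et_def ze)
  have "pX K x <= 9*pX K x" using X0 by simp
  also have "... = (8192*pX K x/ze^6)*(9*ze^6/8192)" using ze0 by simp
  also have "... <= real (pm K x)*(9*ze^6/8192)" using mx ze0 by (intro mult_right_mono) auto
  also have "... = real (pm K x)*et^2/(2*((2 / ka)^2)^2)"
  proof -
   have "((2 / ka)^2)^2 = 4096/ze^4" by (simp add: ka_def power_divide flip: power_mult)
   moreover have "ze^6 = ze^2*ze^4" by (simp flip: power_add)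
   ultimately show ?thesis by (simp add: etze power_mult_distrib)
  qed
  finally show ?thesis .
 qed
 have pk: "real (k*pN K x + k * k) <= K*?N+K^2"
  using kK K2 by (auto simp: power2_eq_square intro!: add_mono mult_mono)
 have conc: "(real (card F)*(2*real (pR K x)+1)^(k*pN K x + k * k)+?N^2)*(2*exp (- (real (pm K x)*et^2/(2*((2 / ka)^2)^2)))) <= 1/6"
 proof (rule concentration_arith[OF _ pk])
  show "real (card F) <= 2*2^pM K x" using of_nat_mono[OF F(3), where 'a = real] by simp
  show "5+real (pM K x)+2*real (pR K x)*(K*?N+K^2)+2*?N <= real (pm K x)*et^2/(2*((2 / ka)^2)^2)"
   using qX unfolding pX_def .
 qed
 have umbe: "um+be <= 1 - c^2"
 proof -
  have "be <= K*be" using K2 be0 by simp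
  also have "... <= y^4/400" unfolding Kb using yp(2)[of 4 6] y by (intro frac_le) auto
  finally show ?thesis using c1 by (simp add: um_def t_def)
 qed
 have k2: "ka^2 <= 1/2" using ze0 ze1 power_le_one[of ze 2] by (simp add: ka_def power_divide)
 have LN: "2*pL K x <= pN K x" using N1(2) by (metis of_nat_le_iff of_nat_mult of_nat_numeral)
 have p: "0 < pT K x" "0 < pm K x" "0 < pR K x" "0 < ka" "0 < um" "0 <= be" "rh <= 1" "0 <= ze" "0 <= ep1" "0 < y/10"
  using T0 m0 R0 ze0 t(1) be0 rhy y by (auto simp: ka_def um_def ep1_def)
 have UP: "2 / sqrt um * sqrt (real k*(be+9*rh))+(et+2 / sqrt um*(sqrt k*(?N*ze))) <= e"
  using up1 up3 ye y(1) by linarith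
 have LO: "(s * sqrt t+y/10+c^2/(1 - c^2) * sqrt (real k/?L+real k * sqrt (12*(1/?N)))+ep1+2 / sqrt um * sqrt (real k*be)+2 / sqrt um*(sqrt k*rh))
   + (et+2 / sqrt um*(sqrt k*(?N*ze))) <= e"
  using s1 path up2 up4 up3 ye y(1) unfolding ep1_def by linarith
 have "alg_params n k (pN K x) (pT K x) (pm K x) (pL K x) (pR K x) s t c ka um be rh ze et (y/10) ep1 e F"
  by (intro alg_params.intro kn s(1) t(1) c_def pos p LN k2 umbe NR' k9' zz etrh(1) ee F(1,2) net' conc UP LO)
 then show ?thesis by blast
qed

section \<open>Growth of the number of queries\<close>

text \<open>The class of bounds \<open>K\<close> to a polynomial in \<open>x\<close>. Both the
  function and the exponent are required to be nonnegative, so that sums and products stay in the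
  class; a factor \<open>2\<close> is absorbed since \<open>K >= 2\<close>.\<close>

definition kp :: "(real => real => real) => bool" where
 "kp F \<longleftrightarrow> (EX p :: real poly. ALL K>=2. ALL x>=1. 0 <= F K x \<and> 0 <= poly p x \<and> F K x <= K powr poly p x)"

lemma kp_mono: "kp F ==> (!!K x. 2 <= K ==> 1 <= x ==> 0 <= H K x \<and> H K x <= F K x) ==> kp H"
 unfolding kp_def by (meson order_trans)

lemma nat_le_powr: "2 <= K ==> real n <= K powr real n" for K :: real
proof -
 assume K: "2 <= K"
 have "real n <= 2^n" using of_nat_less_two_power[of n, where 'a = real] by simp
 also have "... <= K^n" using K by (intro power_mono) auto
 finally show "real n <= K powr real n" using K by (simp add: powr_realpow)
qed

lemma kp_const: "0 <= a ==> kp (%_ _. a)"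
proof -
 assume a: "0 <= a"
 obtain m where "a <= real m" using real_arch_simple by blast
 then show ?thesis
  unfolding kp_def using a by (intro exI[of _ "[:real m:]"]) (auto intro: order_trans[OF _ nat_le_powr])
qed

lemma kp_base: "kp (%K _. K)"
 unfolding kp_def by (rule exI[of _ 1]) auto

lemma kp_x: "kp (%_ x. x)"
 unfolding kp_def
proof (rule exI[of _ "[:1, 1:]"], intro allI impI conjI)
 fix K x :: real assume K: "2 <= K" and x: "1 <= x"
 have "x <= K powr real (nat \<lceil>x\<rceil>)" by (rule order_trans[OF nat_ceiling_ge nat_le_powr[OF K]])
 also have "... <= K powr (1+x)" using K x by (intro powr_mono) linarith+
 finally show "x <= K powr poly [:1, 1:] x" by simp
qed auto

lemma kp_mult: "kp F ==> kp H ==> kp (%K x. F K x*H K x)"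
proof -
 assume "kp F" "kp H"
 then obtain p q where p: "ALL K>=2. ALL x>=1. 0 <= F K x \<and> 0 <= poly p x \<and> F K x <= K powr poly p x"
  and q: "ALL K>=2. ALL x>=1. 0 <= H K x \<and> 0 <= poly q x \<and> H K x <= K powr poly q x" unfolding kp_def by blast
 show ?thesis unfolding kp_def
 proof (rule exI[of _ "p+q"], intro allI impI conjI)
  fix K x :: real assume h: "2 <= K" "1 <= x"
  then show "F K x*H K x <= K powr poly (p+q) x" using p q by (auto simp: powr_add intro: mult_mono)
  show "0 <= F K x*H K x" "0 <= poly (p+q) x" using h p q by auto
 qed
qed

lemma kp_add: "kp F ==> kp H ==> kp (%K x. F K x+H K x)"
proof -
 assume "kp F" "kp H"
 then obtain p q where p: "ALL K>=2. ALL x>=1. 0 <= F K x \<and> 0 <= poly p x \<and> F K x <= K powr poly p x"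
  and q: "ALL K>=2. ALL x>=1. 0 <= H K x \<and> 0 <= poly q x \<and> H K x <= K powr poly q x" unfolding kp_def by blast
 show ?thesis unfolding kp_def
 proof (rule exI[of _ "1+p+q"], intro allI impI conjI)
  fix K x :: real assume h: "2 <= K" "1 <= x"
  have "K powr poly p x <= K powr (poly p x+poly q x)" "K powr poly q x <= K powr (poly p x+poly q x)"
   using h p q by (auto intro!: powr_mono)
  then have "F K x+H K x <= 2*K powr (poly p x+poly q x)" using h p q by (smt (verit))
  also have "... <= K*K powr (poly p x+poly q x)" using h by (intro mult_right_mono) auto
  also have "... = K powr poly (1+p+q) x" using h by (simp add: powr_add)
  finally show "F K x+H K x <= K powr poly (1+p+q) x" .
  show "0 <= F K x+H K x" "0 <= poly (1+p+q) x" using h p q by (auto intro!: add_nonneg_nonneg)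
 qed
qed

lemma kp_power: "kp F ==> kp (%K x. F K x^m)"
 by (induction m) (auto intro: kp_mult kp_const[of 1])

lemma kp_ceiling:
 assumes F: "kp F"
 shows "kp (%K x. real (nat \<lceil>F K x\<rceil>))"
proof (rule kp_mono[OF kp_add[OF F kp_const[of 1]]])
 fix K x :: real assume "2 <= K" "1 <= x"
 then have "0 <= F K x" using F unfolding kp_def by blast
 then show "0 <= real (nat \<lceil>F K x\<rceil>) \<and> real (nat \<lceil>F K x\<rceil>) <= F K x+1" by linarith
qed simp

text \<open>The only parameter with \<open>x\<close> in an exponent. Here \<open>2*K <= K^2\<close>
  turns the base into \<open>K\<close>, and the degree \<open>pd x\<close> is polynomial in
  \<open>x\<close>.\<close>

lemma kp_pV: "kp pV"
 unfolding kp_def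
proof (rule exI[of _ "[:1:] + [:4:] * ([:2:] + monom 10240000 6)^2"], intro allI impI conjI)
 fix K x :: real assume K: "2 <= K" and x: "1 <= x"
 let ?j = "2*(Suc (pd x))^2"
 have "(2*K)^?j <= (K^2)^?j" using K by (intro power_mono) (auto simp: power2_eq_square)
 then have "pV K x <= K*(K^2)^?j" unfolding pV_def using K by (intro mult_mono) auto
 also have "... = K powr real (1+2*?j)" using K by (subst powr_realpow) (auto simp flip: power_mult)
 also have "... <= K powr (1+4*(2+10240000*x^6)^2)"
 proof (rule powr_mono)
  have "real (Suc (pd x)) <= 2+10240000*x^6" using x zero_le_power[of x 6] unfolding pd_def by linarith
  then have "(real (Suc (pd x)))^2 <= (2+10240000*x^6)^2" by (rule power_mono) simp
  then show "real (1+2*?j) <= 1+4*(2+10240000*x^6)^2" by simp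
 qed (use K in simp)
 finally show "pV K x <= K powr poly ([:1:] + [:4:] * ([:2:] + monom 10240000 6)^2) x" by (simp add: poly_monom)
 show "0 <= pV K x" using K by (simp add: pV_def)
qed (simp add: poly_monom)

text \<open>The size of the net, exponential in \<open>pM\<close>, does not occur: the sample size
  \<open>pm\<close> contains only its logarithm.\<close>

lemma kp_queries: "kp (%K x. real (pm K x*(pN K x*(pT K x*3))))"
proof -
 note i = kp_mult kp_add kp_power kp_ceiling kp_const kp_base kp_x
 have L: "kp (%K x. real (pL K x))" unfolding pL_def by (intro i) auto
 have N: "kp (%K x. real (pN K x))" unfolding pN_def of_nat_mult of_nat_power by (intro i L) auto
 have r: "kp prh" unfolding prh_def[abs_def] by (intro i) auto
 have R: "kp (%K x. real (pR K x))" unfolding pR_def by (intro i N r)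
 have z: "kp pze" unfolding pze_def[abs_def] by (intro i N r) auto
 have T: "kp (%K x. real (pT K x))" unfolding pT_def by (intro i N z) auto
 have M: "kp (%K x. real (pM K x))" unfolding pM_def by (intro i kp_pV) auto
 have X: "kp pX" unfolding pX_def[abs_def] by (intro i N R M) auto
 have m: "kp (%K x. real (pm K x))" unfolding pm_def by (intro i X z) auto
 show ?thesis unfolding of_nat_mult by (intro i m N T) auto
qed

section \<open>Assembly for all accuracies\<close>

text \<open>Makes the output zero correct for accuracies of at least one. The lower bound uses that
  some lifted profile exists, the upper one that the supremum is nearly attained by a value of
  \<open>VV\<close>.\<close>

lemma junta_corr_bounds:
 assumes f: "bdd (GI {..<n}) 1 f" and kn: "k <= n" and s: "0 <= s"
 shows "\<bar>junta_corr n k s f\<bar> <= 1"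
proof -
 have VV: "\<bar>VV k n qs f A\<bar> <= 1" if "smo {..<k} s qs" for qs A
  unfolding VV_def using that by (intro GI.bdd_integral_le bdd_mult1 bdd_lf bdd_pr f) (simp add: smo_def)
 have "junta_corr n k s f <= 1+d" if d: "0 < d" for d :: real
 proof -
  define t where "t = (d/(2*(s+1)))^2"
  have t: "0 < t" "s * sqrt t <= d/2"
  proof -
   have "s*(d/(2*(s+1))) <= d/2"
    unfolding times_divide_eq_right by (subst pos_divide_le_eq) (use s d in \<open>auto simp: algebra_simps\<close>)
   then show "0 < t" "s * sqrt t <= d/2" using s d by (auto simp: t_def)
  qed
  from junta_corr_frame[OF f kn s _ t(1), of "d/2"] d obtain qs A where "smo {..<k} s qs" "junta_corr n k s f <= VV k n qs f A + s * sqrt t+d/2" by auto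
  then show ?thesis using VV[of qs A] t(2) by linarith
 qed
 then have "junta_corr n k s f <= 1" by (rule field_le_epsilon)
 moreover obtain qs A where "smo {..<k} s qs" "orth k (JJ n k) A" using junta_corr_frame[OF f kn s, of 1 1] by auto
 then have "- 1 <= junta_corr n k s f" using VV[of qs A] VV_le_junta_corr[OF f _ _ kn, of s qs A] by linarith
 ultimately show ?thesis by linarith
qed

theorem theorem3:
  "\<exists>(A :: nat \<Rightarrow> real \<Rightarrow> nat \<Rightarrow> real \<Rightarrow> query_alg) (p :: real poly).
     \<forall>(n::nat) (\<epsilon>::real) (k::nat) (s::real). \<epsilon> > 0 \<longrightarrow> k \<le> n \<longrightarrow> s \<ge> 0 \<longrightarrow>
       randomized_query_alg n (A n \<epsilon> k s) \<and>
       real (num_queries (A n \<epsilon> k s)) \<le> real (max 2 k) powr poly p (max 1 s / \<epsilon>) \<and>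
       (\<forall>f. bounded_fun n f \<longrightarrow>
          \<P>(\<omega> in random_source. \<bar>run_alg (A n \<epsilon> k s) f \<omega> - junta_corr n k s f\<bar> \<le> \<epsilon>) \<ge> 2 / 3)"
proof -
 \<comment> \<open>The polynomial is fixed before the dimension, accuracy, arity and smoothness; the
   algorithm is chosen pointwise afterwards.\<close>
 obtain p :: "real poly" where p: "!!K x. 2 <= K ==> 1 <= x ==> real (pm K x*(pN K x*(pT K x*3))) <= K powr poly p x"
  using kp_queries unfolding kp_def by blast
 define Ok where "Ok = (%n ep k s A. randomized_query_alg n A \<and>
    real (num_queries A) <= real (max 2 k) powr poly p (max 1 s/ep) \<and>
    (ALL f. bounded_fun n f --> \<P>(om in random_source. \<bar>run_alg A f om - junta_corr n k s f\<bar> <= ep) >= 2/3))"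
 have "EX A. Ok n ep k s A" if e: "0 < ep" and kn: "k <= n" and s: "0 <= s" for n k :: nat and ep s :: real
 proof (cases "1 <= ep")
  \<comment> \<open>No query is made here, so the bound on the number of queries is trivial.\<close>
  case True
  have "(%_. 0 :: real) \<in> borel_measurable (PiM ({} :: nat set) (%_. borel))" by simp
  from nonadaptive_alg[where Q = "%_ _. undefined" and n = n, OF finite.emptyI _ this] obtain A
   where A: "num_queries A = 0" "randomized_query_alg n A" "!!f om. run_alg A f om = 0" by auto
  interpret prob_space random_source unfolding random_source_def by (rule prob_space_PiM[OF prob_space_std_gaussian])
  have "\<P>(om in random_source. \<bar>run_alg A f om - junta_corr n k s f\<bar> <= ep) >= 2/3" if "bounded_fun n f" for f
  proof -
   have "\<bar>junta_corr n k s f\<bar> <= ep" using junta_corr_bounds[of n f k s] that kn s True by (simp add: bounded_fun_bdd)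
   then show ?thesis by (simp add: A(3) prob_space)
  qed
  then show ?thesis using A by (auto simp: Ok_def)
 next
  case False
  let ?x = "max 1 s/ep" and ?K = "max 2 (real k)"
  have x: "1 <= ?x" "s <= ?x" "1/?x <= ep"
  proof -
   have "max 1 s*1 <= max 1 s*(1/ep)" using e False by (intro mult_left_mono) (auto simp: field_simps)
   then show "1 <= ?x" "s <= ?x" by auto
   have "ep/max 1 s <= ep/1" using e by (intro divide_left_mono) auto
   then show "1/?x <= ep" by simp
  qed
  obtain t c ka um be rh ze et dl ep1 F where "alg_params n k (pN ?K ?x) (pT ?K ?x) (pm ?K ?x) (pL ?K ?x) (pR ?K ?x) s t c ka um be rh ze et dl ep1 ep F"
   using params_exist[OF x(1) refl kn s x(2,3)] by blast
  from alg_params.algorithm[OF this] obtain A where A: "num_queries A = pm ?K ?x*(pN ?K ?x*(pT ?K ?x*3))" "randomized_query_alg n A"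
   "ALL f. bounded_fun n f --> \<P>(om in random_source. \<bar>run_alg A f om - junta_corr n k s f\<bar> <= ep) >= 2/3" by blast
  have "real (num_queries A) <= ?K powr poly p ?x" unfolding A(1) by (rule p) (use x in auto)
  moreover have "real (max 2 k) = ?K" by simp
  ultimately show ?thesis using A(2,3) unfolding Ok_def by auto
 qed
 then have "ALL n ep k s. EX A. ep > 0 --> k <= n --> s >= 0 --> Ok n ep k s A" by blast
 then obtain A where "ALL n ep k s. ep > 0 --> k <= n --> s >= 0 --> Ok n ep k s (A n ep k s)" by metis
 then show ?thesis unfolding Ok_def by blast
qed

end
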